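(* Let $k$ be a field of characteristic zero, $A$ an associative unital $k$-algebra, $V$ a $k$-vector space of finite dimension $d\ge1$, and $\pi:R\to A$ an almost free resolution of $A$ in $\mathrm{DGA}_k^+$. Let $f_n:A^{\otimes n}\to R_{n-1}$ ($n\ge1$) be linear maps satisfying $$\pi f_1=\mathrm{Id}_A,\qquad f_1(1)=1,\qquad f_n(a_1,\dots,a_n)=0\ \text{ for } n\ge2 \text{ whenever some } a_i=1,$$ $$d_Rf_n=\sum_{i=1}^{n-1}(-1)^{i-1}f_{n-1}\bigl(\mathrm{Id}_A^{\otimes(i-1)}\otimes m_A\otimes\mathrm{Id}_A^{\otimes(n-1-i)}\bigr)+\sum_{i=1}^{n-1}(-1)^i\,m_R(f_i\otimes f_{n-i}),\qquad n\ge2,$$ where $m_A,m_R$ are the multiplication maps. Then the trace maps $\mathrm{Tr}_V(A)_n:\mathrm{HC}_n(A)\to\mathrm H_n(A,V)$, $n\ge0$, are induced by the morphism of complexes $T:\mathrm{CC}(A)\to R_V$ whose $n$-th graded component $T_n:A^{\otimes(n+1)}/\mathrm{Im}(1-t_n)\to(R_V)_n$ is given by $$T_n(a_1,a_2,\dots,a_{n+1})=\sum_{i=1}^d\ \sum_{j\in\mathbb Z_{n+1}}(-1)^{nj}\,f_{n+1}(a_{1+j},a_{2+j},\dots,a_{n+1+j})_{ii},$$ where indices of the $a$'s are read modulo $n+1$.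
   Context: Differentials have degree $-1$; $\otimes=\otimes_k$. $\mathrm{DGA}_k^+$ is the category of non-negatively graded unital DG $k$-algebras. An almost free resolution $\pi:R\to A$ is a surjective quasi-isomorphism with $R\in\mathrm{DGA}_k^+$ whose underlying graded algebra is free (a tensor algebra). A family $(f_n)$ as in the claim always exists (it is a strictly unital $A_\infty$-quasi-isomorphism $A\to R$ inverse to $\pi$ on homology). Matrix elements: for a DG algebra $R$ let $\sqrt[V]R$ be the graded centralizer of $\mathrm{End}\,V$ in the free product $\mathrm{End}\,V*_kR$, and $R_V$ its quotient by the ideal generated by graded commutators; $R_V$ is the commutative DG algebra with $\mathrm{Hom}(R_V,C)\cong\mathrm{Hom}(R,\mathrm{End}\,V\otimes C)$ for all commutative DG algebras $C$. Let $\pi_V:R\to\mathrm{End}\,V\otimes R_V$ be the universal representation, fix a basis of $V$ with matrix units $e_{ij}$, and write $\pi_V(r)=\sum_{i,j}e_{ij}\otimes r_{ij}$; these are the elements $r_{ij}\in R_V$. Put $\mathrm H_n(A,V):=\mathrm H_n(R_V)$ (independent of $R$); $\mathrm H_0(A,V)=A_V$. Connes' complex: $\mathrm{CC}_n(A)=A^{\otimes(n+1)}/\mathrm{Im}(\mathrm{Id}-t_n)$, $t_n(a_0,\dots,a_n)=(-1)^n(a_n,a_0,\dots,a_{n-1})$, with differential induced by the Hochschild differential; $\mathrm{HC}_n(A)$ is its homology, and the reduced cyclic homology $\overline{\mathrm{HC}}_n(A)$ is the homology of $\mathrm{CC}(A)/\mathrm{CC}(k)$. Trace maps: write $R_\natural=R/[R,R]$.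 The map $r\mapsto\sum_ir_{ii}$ is a morphism of complexes $R\to R_V$ killing $[R,R]$, hence it induces $R_\natural/k\to R_V/k$. For $n\ge1$, $\mathrm{Tr}_V(A)_n$ is the composite $$\mathrm{HC}_n(A)\to\overline{\mathrm{HC}}_n(A)\cong\mathrm H_n(R_\natural/k)\to\mathrm H_n(R_V/k)\cong\mathrm H_n(R_V)=\mathrm H_n(A,V)$$ (and it is $0$ if $R_V$ is acyclic). Here $\overline{\mathrm{HC}}_n(A)\cong\mathrm H_n(R_\natural/k)$ is the canonical Feigin–Tsygan isomorphism, obtained as follows: let $R\langle x\rangle$, $A\langle x\rangle$ be the DG algebras got by freely adjoining $x$ of degree $1$ with $dx=1$; then $A\langle x\rangle_\natural/A_\natural\cong\mathrm{CC}(A)[1]$ via $a_1x\,a_2x\cdots a_nx\leftrightarrow a_1\otimes\cdots\otimes a_n$, the map $R\langle x\rangle_\natural/R_\natural\to A\langle x\rangle_\natural/A_\natural$ induced by $\pi$ is a quasi-isomorphism, and the connecting homomorphism of $0\to R_\natural\to R\langle x\rangle_\natural\to R\langle x\rangle_\natural/R_\natural\to0$ gives $\mathrm{HC}_n(A)\to\mathrm H_n(R_\natural)\to\mathrm H_n(R_\natural/k)$, which factors through an isomorphism from $\overline{\mathrm{HC}}_n(A)$; the overall sign in each degree, which depends only on suspension conventions, is normalized suitably. For $n=0$, $\mathrm{Tr}_V(A)_0:A/[A,A]\to A_V$ is the usual trace $a\mapsto\sum_ia_{ii}$. *)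

theory Defs
  imports Complex_Main "HOL-Library.Poly_Mapping"
begin

section \<open>Free algebras\<close>

text \<open>The free monoid on a type of letters, written additively, so that its monoid algebra
  (finitely supported functions with the convolution product) is the free algebra on the letters.\<close>

datatype 'x word = Word (letters: "'x list")

instantiation word :: (type) monoid_add
begin

definition zero_word :: "'a word" where "0 = Word []"

definition plus_word :: "'a word \<Rightarrow> 'a word \<Rightarrow> 'a word"
  where "u + v = Word (letters u @ letters v)"

instance
  by standard (simp_all add: zero_word_def plus_word_def)

end

type_synonym ('x, 'k) free_alg = "'x word \<Rightarrow>\<^sub>0 'k"

definition smul :: "'k::field \<Rightarrow> ('x, 'k) free_alg \<Rightarrow> ('x, 'k) free_alg"
  where "smul c p = Poly_Mapping.map ((*) c) p"

definition mon :: "'x list \<Rightarrow> ('x, 'k::field) free_alg"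
  where "mon w = Poly_Mapping.single (Word w) 1"

definition gen :: "'x \<Rightarrow> ('x, 'k::field) free_alg"
  where "gen x = mon [x]"

text \<open>Linear extension of a map given on words, with values in a space with scaling \<open>sc\<close>.\<close>

definition lin :: "('k \<Rightarrow> 'b \<Rightarrow> 'b) \<Rightarrow> ('x list \<Rightarrow> 'b) \<Rightarrow> ('x, 'k::field) free_alg \<Rightarrow> 'b::ab_group_add"
  where "lin sc g p = (\<Sum>w\<in>Poly_Mapping.keys p. sc (Poly_Mapping.lookup p w) (g (letters w)))"

lemma lookup_smul: "Poly_Mapping.lookup (smul c p) w = c * Poly_Mapping.lookup p w"
  by (simp add: smul_def Poly_Mapping.map.rep_eq when_def)

lemma vector_space_smul: "vector_space (smul :: 'k::field \<Rightarrow> ('x, 'k) free_alg \<Rightarrow> _)"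
  by standard (auto intro!: poly_mapping_eqI simp: lookup_smul lookup_add algebra_simps)

lemma mon_mult: "mon u * mon v = mon (u @ v)"
  by (simp add: mon_def mult_single plus_word_def)

lemma mon_Nil: "mon [] = 1"
  by (simp add: mon_def zero_word_def[symmetric])


section \<open>Complexes as subquotients and their homology\<close>

text \<open>A complex is presented inside one ambient vector space: in degree \<open>n\<close> it is the quotient
  \<open>cx_part K n / cx_rel K n\<close> of two subspaces, and \<open>cx_diff\<close> induces the differential of degree
  \<open>-1\<close>. A homology class is a coset of the space of boundaries, which contains \<open>cx_rel K n\<close>.\<close>

record ('k, 'm) cplx =
  cx_scale :: "'k \<Rightarrow> 'm \<Rightarrow> 'm"
  cx_part :: "nat \<Rightarrow> 'm set"
  cx_rel :: "nat \<Rightarrow> 'm set"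
  cx_diff :: "'m \<Rightarrow> 'm"

definition cycles :: "('k, 'm) cplx \<Rightarrow> nat \<Rightarrow> 'm set"
  where "cycles K n = {z \<in> cx_part K n. n = 0 \<or> cx_diff K z \<in> cx_rel K (n - 1)}"

definition boundaries :: "('k, 'm::ab_group_add) cplx \<Rightarrow> nat \<Rightarrow> 'm set"
  where "boundaries K n = {cx_diff K y + u |y u. y \<in> cx_part K (n + 1) \<and> u \<in> cx_rel K n}"

definition homology :: "('k, 'm::ab_group_add) cplx \<Rightarrow> nat \<Rightarrow> 'm set set"
  where "homology K n = (\<lambda>z. (+) z ` boundaries K n) ` cycles K n"

definition acyclic_cplx :: "('k, 'm::ab_group_add) cplx \<Rightarrow> bool"
  where "acyclic_cplx K \<longleftrightarrow> (\<forall>n. homology K n = {boundaries K n})"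

text \<open>The class in the \<open>n\<close>-th homology of \<open>L\<close> of the images under \<open>g\<close> of the cycles in \<open>c\<close>.\<close>

definition induced :: "('k, 'm::ab_group_add) cplx \<Rightarrow> ('l \<Rightarrow> 'm) \<Rightarrow> nat \<Rightarrow> 'l set \<Rightarrow> 'm set"
  where "induced L g n c = {g z + b |z b. z \<in> c \<and> b \<in> boundaries L n}"

definition cplx_morphism ::
    "('k::field, 'l::ab_group_add) cplx \<Rightarrow> ('k, 'm::ab_group_add) cplx \<Rightarrow> (nat \<Rightarrow> 'l \<Rightarrow> 'm) \<Rightarrow> bool"
  where "cplx_morphism K L g \<longleftrightarrow>
    (\<forall>n. Vector_Spaces.linear (cx_scale K) (cx_scale L) (g n) \<and>
         g n ` cx_part K n \<subseteq> cx_part L n \<and>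
         g n ` cx_rel K n \<subseteq> cx_rel L n \<and>
         (\<forall>z \<in> cx_part K (n + 1). g n (cx_diff K z) - cx_diff L (g (n + 1) z) \<in> cx_rel L n))"

definition quasi_iso ::
    "('k, 'l::ab_group_add) cplx \<Rightarrow> ('k, 'm::ab_group_add) cplx \<Rightarrow> (nat \<Rightarrow> 'l \<Rightarrow> 'm) \<Rightarrow> bool"
  where "quasi_iso K L g \<longleftrightarrow>
    (\<forall>n. bij_betw (induced L (g n) n) (homology K n) (homology L n))"


section \<open>DG algebras\<close>

locale k_algebra = vector_space sc
  for sc :: "'k::field \<Rightarrow> 'a::{ring, monoid_mult} \<Rightarrow> 'a" +
  assumes scale_mult_left: "sc c x * y = sc c (x * y)"
    and scale_mult_right: "x * sc c y = sc c (x * y)"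

text \<open>The additive group and the multiplication of a DG algebra come from its type.\<close>

record ('k, 'r) dga =
  dg_scale :: "'k \<Rightarrow> 'r \<Rightarrow> 'r"
  dg_part :: "nat \<Rightarrow> 'r set"
  dg_diff :: "'r \<Rightarrow> 'r"

definition is_dga :: "('k::field, 'r::{ring, monoid_mult}) dga \<Rightarrow> bool"
  where "is_dga R \<longleftrightarrow>
    k_algebra (dg_scale R) \<and>
    (\<forall>n. module.subspace (dg_scale R) (dg_part R n)) \<and>
    (\<forall>x. \<exists>!c. (\<forall>n. c n \<in> dg_part R n) \<and> finite {n. c n \<noteq> 0} \<and> x = (\<Sum>n | c n \<noteq> 0. c n)) \<and>
    1 \<in> dg_part R 0 \<and>
    (\<forall>m n. \<forall>x \<in> dg_part R m. \<forall>y \<in> dg_part R n. x * y \<in> dg_part R (m + n)) \<and>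
    Vector_Spaces.linear (dg_scale R) (dg_scale R) (dg_diff R) \<and>
    (\<forall>x \<in> dg_part R 0. dg_diff R x = 0) \<and>
    (\<forall>n. \<forall>x \<in> dg_part R (n + 1). dg_diff R x \<in> dg_part R n) \<and>
    (\<forall>x. dg_diff R (dg_diff R x) = 0) \<and>
    (\<forall>m. \<forall>x \<in> dg_part R m. \<forall>y.
       dg_diff R (x * y) = dg_diff R x * y + dg_scale R ((-1) ^ m) (x * dg_diff R y))"

text \<open>An ordinary algebra, placed in degree \<open>0\<close>.\<close>

definition deg0 :: "('k \<Rightarrow> 'a \<Rightarrow> 'a) \<Rightarrow> ('k, 'a::zero) dga"
  where "deg0 sc = \<lparr>dg_scale = sc, dg_part = (\<lambda>n. if n = 0 then UNIV else {0}), dg_diff = (\<lambda>_. 0)\<rparr>"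

definition dga_cplx :: "('k, 'r::zero) dga \<Rightarrow> ('k, 'r) cplx"
  where "dga_cplx R =
    \<lparr>cx_scale = dg_scale R, cx_part = dg_part R, cx_rel = (\<lambda>_. {0}), cx_diff = dg_diff R\<rparr>"

definition dga_hom ::
    "('k::field, 'r::{ring, monoid_mult}) dga \<Rightarrow> ('k, 's::{ring, monoid_mult}) dga \<Rightarrow> ('r \<Rightarrow> 's) \<Rightarrow> bool"
  where "dga_hom R S h \<longleftrightarrow>
    Vector_Spaces.linear (dg_scale R) (dg_scale S) h \<and> h 1 = 1 \<and> (\<forall>x y. h (x * y) = h x * h y) \<and>
    (\<forall>n. h ` dg_part R n \<subseteq> dg_part S n) \<and> (\<forall>x. h (dg_diff R x) = dg_diff S (h x))"

text \<open>The underlying graded algebra is the tensor algebra of the graded vector space with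
  homogeneous basis \<open>X\<close>: evaluation is an isomorphism from the free algebra on \<open>X\<close>.\<close>

definition graded_free :: "('k::field, 'r::{ring, monoid_mult}) dga \<Rightarrow> bool"
  where "graded_free R \<longleftrightarrow>
    (\<exists>X \<subseteq> (\<Union>n. dg_part R n).
       bij_betw (lin (dg_scale R) prod_list)
         {p. \<forall>w \<in> Poly_Mapping.keys p. set (letters w) \<subseteq> X} UNIV)"

definition almost_free_resolution ::
    "('k::field, 'r::{ring, monoid_mult}) dga \<Rightarrow> ('k \<Rightarrow> 'a \<Rightarrow> 'a) \<Rightarrow> ('r \<Rightarrow> 'a::{ring, monoid_mult}) \<Rightarrow> bool"
  where "almost_free_resolution R scA \<pi> \<longleftrightarrow>
    is_dga R \<and> graded_free R \<and> dga_hom R (deg0 scA) \<pi> \<and> surj \<pi> \<and>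
    quasi_iso (dga_cplx R) (dga_cplx (deg0 scA)) (\<lambda>_. \<pi>)"

definition graded_commutators ::
    "('k::field \<Rightarrow> 'r \<Rightarrow> 'r) \<Rightarrow> (nat \<Rightarrow> 'r set) \<Rightarrow> 'r::ring set"
  where "graded_commutators sc P =
    {u * v - sc ((-1) ^ (p * q)) (v * u) |p q u v. u \<in> P p \<and> v \<in> P q}"

text \<open>The complexes \<open>R\<^sub>\<natural> = R/[R,R]\<close> and \<open>R\<^sub>\<natural>/k\<close>.\<close>

definition nat_cplx :: "('k::field, 'r::{ring, monoid_mult}) dga \<Rightarrow> ('k, 'r) cplx"
  where "nat_cplx R =
    \<lparr>cx_scale = dg_scale R, cx_part = dg_part R,
     cx_rel = (\<lambda>n. module.span (dg_scale R) (graded_commutators (dg_scale R) (dg_part R)) \<inter> dg_part R n),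
     cx_diff = dg_diff R\<rparr>"

definition nat_mod_k_cplx :: "('k::field, 'r::{ring, monoid_mult}) dga \<Rightarrow> ('k, 'r) cplx"
  where "nat_mod_k_cplx R = nat_cplx R
    \<lparr>cx_rel := \<lambda>n. module.span (dg_scale R)
       (insert 1 (graded_commutators (dg_scale R) (dg_part R))) \<inter> dg_part R n\<rparr>"


section \<open>Free products with a DG algebra\<close>

text \<open>A free product of a DG algebra \<open>R\<close> with another algebra is presented by generators and
  relations. The generators are letters \<open>Ext y\<close> of the other factor, all of one degree \<open>e\<close> and
  with the same differential \<open>\<delta>\<close>, and one letter \<open>Elt n r\<close> for every \<open>r\<close> in the degree \<open>n\<close> part of \<open>R\<close>.\<close>

datatype ('y, 'r) letter = Ext 'y | Elt nat 'r

type_synonym ('y, 'r, 'k) fp = "(('y, 'r) letter, 'k) free_alg"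

fun letter_deg :: "nat \<Rightarrow> ('y, 'r) letter \<Rightarrow> nat" where
  "letter_deg e (Ext y) = e"
| "letter_deg e (Elt n r) = n"

fun letter_diff :: "('y, 'r, 'k) fp \<Rightarrow> ('k::field, 'r) dga \<Rightarrow> ('y, 'r) letter \<Rightarrow> ('y, 'r, 'k) fp" where
  "letter_diff \<delta> R (Ext y) = \<delta>"
| "letter_diff \<delta> R (Elt 0 r) = 0"
| "letter_diff \<delta> R (Elt (Suc n) r) = gen (Elt n (dg_diff R r))"

fun word_diff :: "nat \<Rightarrow> ('y, 'r, 'k) fp \<Rightarrow> ('k::field, 'r) dga \<Rightarrow> ('y, 'r) letter list \<Rightarrow> ('y, 'r, 'k) fp" where
  "word_diff e \<delta> R [] = 0"
| "word_diff e \<delta> R (l # w) =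
     letter_diff \<delta> R l * mon w + smul ((-1) ^ letter_deg e l) (gen l * word_diff e \<delta> R w)"

definition fp_letters :: "'y set \<Rightarrow> ('k, 'r) dga \<Rightarrow> ('y, 'r) letter set"
  where "fp_letters Y R = Ext ` Y \<union> {Elt n r |n r. r \<in> dg_part R n}"

definition fp_part :: "'y set \<Rightarrow> nat \<Rightarrow> ('k::field, 'r) dga \<Rightarrow> nat \<Rightarrow> ('y, 'r, 'k) fp set"
  where "fp_part Y e R n =
    module.span smul {mon w |w. set w \<subseteq> fp_letters Y R \<and> sum_list (map (letter_deg e) w) = n}"

text \<open>The relations making \<open>r \<mapsto> Elt n r\<close> a morphism of graded algebras.\<close>

definition elt_relations :: "('k::field, 'r::{ring, monoid_mult}) dga \<Rightarrow> ('y, 'r, 'k) fp set"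
  where "elt_relations R =
    {gen (Elt n (r + s)) - gen (Elt n r) - gen (Elt n s) |n r s. r \<in> dg_part R n \<and> s \<in> dg_part R n} \<union>
    {gen (Elt n (dg_scale R c r)) - smul c (gen (Elt n r)) |n c r. r \<in> dg_part R n} \<union>
    {gen (Elt (m + n) (r * s)) - gen (Elt m r) * gen (Elt n s) |m n r s. r \<in> dg_part R m \<and> s \<in> dg_part R n} \<union>
    {gen (Elt 0 1) - 1}"

definition fp_ideal :: "'y set \<Rightarrow> ('k::field, 'r) dga \<Rightarrow> ('y, 'r, 'k) fp set \<Rightarrow> ('y, 'r, 'k) fp set"
  where "fp_ideal Y R S = module.span smul
    {mon u * s * mon v |u s v. set u \<subseteq> fp_letters Y R \<and> s \<in> S \<and> set v \<subseteq> fp_letters Y R}"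

text \<open>The map of free products induced by a morphism of DG algebras.\<close>

definition fp_map :: "('r \<Rightarrow> 's) \<Rightarrow> ('y, 'r, 'k::field) fp \<Rightarrow> ('y, 's, 'k) fp"
  where "fp_map h = lin smul (\<lambda>w. mon (map (map_letter id h) w))"


section \<open>Adjoining \<open>x\<close> of degree \<open>1\<close> with \<open>dx = 1\<close>\<close>

definition adj_part :: "('k::field, 'r) dga \<Rightarrow> nat \<Rightarrow> (unit, 'r, 'k) fp set"
  where "adj_part R = fp_part {()} 1 R"

definition adj_diff :: "('k::field, 'r) dga \<Rightarrow> (unit, 'r, 'k) fp \<Rightarrow> (unit, 'r, 'k) fp"
  where "adj_diff R = lin smul (word_diff 1 1 R)"

definition adj_nat_relations :: "('k::field, 'r::{ring, monoid_mult}) dga \<Rightarrow> (unit, 'r, 'k) fp set"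
  where "adj_nat_relations R =
    fp_ideal {()} R (elt_relations R) \<union> graded_commutators smul (adj_part R)"

text \<open>The complexes \<open>R\<langle>x\<rangle>\<^sub>\<natural>\<close> and \<open>R\<langle>x\<rangle>\<^sub>\<natural>/R\<^sub>\<natural>\<close>.\<close>

definition adj_nat_cplx :: "('k::field, 'r::{ring, monoid_mult}) dga \<Rightarrow> ('k, (unit, 'r, 'k) fp) cplx"
  where "adj_nat_cplx R =
    \<lparr>cx_scale = smul, cx_part = adj_part R,
     cx_rel = (\<lambda>n. module.span smul (adj_nat_relations R) \<inter> adj_part R n),
     cx_diff = adj_diff R\<rparr>"

definition adj_nat_quot_cplx :: "('k::field, 'r::{ring, monoid_mult}) dga \<Rightarrow> ('k, (unit, 'r, 'k) fp) cplx"
  where "adj_nat_quot_cplx R = adj_nat_cplx R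
    \<lparr>cx_rel := \<lambda>n. module.span smul
       (adj_nat_relations R \<union> {gen (Elt m r) |m r. r \<in> dg_part R m}) \<inter> adj_part R n\<rparr>"

text \<open>The connecting homomorphism \<open>H\<^sub>n\<^sub>+\<^sub>1(R\<langle>x\<rangle>\<^sub>\<natural>/R\<^sub>\<natural>) \<rightarrow> H\<^sub>n(R\<^sub>\<natural>)\<close> of the exact sequence
  \<open>0 \<rightarrow> R\<^sub>\<natural> \<rightarrow> R\<langle>x\<rangle>\<^sub>\<natural> \<rightarrow> R\<langle>x\<rangle>\<^sub>\<natural>/R\<^sub>\<natural> \<rightarrow> 0\<close>: lift to \<open>R\<langle>x\<rangle>\<^sub>\<natural>\<close>, differentiate, and pull back to \<open>R\<^sub>\<natural>\<close>.\<close>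

definition connecting :: "('k::field, 'r::{ring, monoid_mult}) dga \<Rightarrow> nat \<Rightarrow> (unit, 'r, 'k) fp set \<Rightarrow> 'r set"
  where "connecting R n c =
    {r \<in> dg_part R n. \<exists>w \<in> c. adj_diff R w - gen (Elt n r) \<in> cx_rel (adj_nat_cplx R) n}"


section \<open>Cyclic homology\<close>

text \<open>\<open>A\<^sup>\<otimes>\<^sup>n\<close> is the span of the words of length \<open>n\<close> in the elements of \<open>A\<close>, modulo multilinearity.\<close>

definition multilinearity :: "('k::field \<Rightarrow> 'a \<Rightarrow> 'a) \<Rightarrow> nat \<Rightarrow> ('a::ring, 'k) free_alg set"
  where "multilinearity sc n =
    {mon (u @ [a + b] @ v) - mon (u @ [a] @ v) - mon (u @ [b] @ v) |u v a b.
       length u + 1 + length v = n} \<union>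
    {mon (u @ [sc c a] @ v) - smul c (mon (u @ [a] @ v)) |u v c a.
       length u + 1 + length v = n}"

text \<open>\<open>contract i\<close> multiplies the entries with (zero-based) positions \<open>i\<close> and \<open>i + 1\<close>.\<close>

definition contract :: "nat \<Rightarrow> 'a::times list \<Rightarrow> 'a list"
  where "contract i w = take i w @ [w ! i * w ! (i + 1)] @ drop (i + 2) w"

definition hochschild_word :: "'a::ring list \<Rightarrow> ('a, 'k::field) free_alg"
  where "hochschild_word w = (let n = length w - 1 in
    if n = 0 then 0
    else (\<Sum>i<n. smul ((-1) ^ i) (mon (contract i w))) +
         smul ((-1) ^ n) (mon ((last w * hd w) # butlast (tl w))))"

definition cyclic_relations :: "nat \<Rightarrow> ('a::ring, 'k::field) free_alg set"
  where "cyclic_relations n =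
    {mon w - smul ((-1) ^ n) (mon (last w # butlast w)) |w. length w = n + 1}"

definition connes_cplx :: "('k::field \<Rightarrow> 'a \<Rightarrow> 'a) \<Rightarrow> ('k, ('a::ring, 'k) free_alg) cplx"
  where "connes_cplx sc =
    \<lparr>cx_scale = smul,
     cx_part = (\<lambda>n. module.span smul {mon w |w. length w = n + 1}),
     cx_rel = (\<lambda>n. module.span smul (multilinearity sc (n + 1) \<union> cyclic_relations n)),
     cx_diff = lin smul hochschild_word\<rparr>"

text \<open>\<open>CC(A)/CC(k)\<close>; the image of \<open>CC\<^sub>n(k)\<close> is spanned by \<open>1 \<otimes> \<dots> \<otimes> 1\<close>.\<close>

definition reduced_connes_cplx ::
    "('k::field \<Rightarrow> 'a \<Rightarrow> 'a) \<Rightarrow> ('k, ('a::{ring, monoid_mult}, 'k) free_alg) cplx"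
  where "reduced_connes_cplx sc = connes_cplx sc
    \<lparr>cx_rel := \<lambda>n. module.span smul
       (multilinearity sc (n + 1) \<union> cyclic_relations n \<union> {mon (replicate (n + 1) 1)})\<rparr>"

definition HC :: "('k::field \<Rightarrow> 'a \<Rightarrow> 'a) \<Rightarrow> nat \<Rightarrow> ('a::ring, 'k) free_alg set set"
  where "HC sc n = homology (connes_cplx sc) n"

definition to_reduced_HC ::
    "('k::field \<Rightarrow> 'a \<Rightarrow> 'a) \<Rightarrow> nat \<Rightarrow> ('a::{ring, monoid_mult}, 'k) free_alg set \<Rightarrow> ('a, 'k) free_alg set"
  where "to_reduced_HC sc n = induced (reduced_connes_cplx sc) id n"


section \<open>The Feigin--Tsygan map\<close>

text \<open>\<open>a\<^sub>1 \<otimes> \<dots> \<otimes> a\<^sub>n \<mapsto> a\<^sub>1x \<dots> a\<^sub>nx\<close>, inducing \<open>CC(A)[1] \<rightarrow> A\<langle>x\<rangle>\<^sub>\<natural>/A\<^sub>\<natural>\<close>.\<close>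

definition x_word :: "('a, 'k::field) free_alg \<Rightarrow> (unit, 'a, 'k) fp"
  where "x_word = lin smul (\<lambda>w. mon (concat (map (\<lambda>a. [Elt 0 a, Ext ()]) w)))"

text \<open>The composite
  \<open>HC\<^sub>n(A) \<rightarrow> H\<^sub>n\<^sub>+\<^sub>1(A\<langle>x\<rangle>\<^sub>\<natural>/A\<^sub>\<natural>) \<rightarrow> H\<^sub>n\<^sub>+\<^sub>1(R\<langle>x\<rangle>\<^sub>\<natural>/R\<^sub>\<natural>) \<rightarrow> H\<^sub>n(R\<^sub>\<natural>) \<rightarrow> H\<^sub>n(R\<^sub>\<natural>/k)\<close>,
  whose second arrow is inverse to the isomorphism induced by \<open>\<pi>\<close>. The isomorphism
  \<open>CC(A)[1] \<cong> A\<langle>x\<rangle>\<^sub>\<natural>/A\<^sub>\<natural>\<close> is normalised by the sign \<open>(-1)\<^sup>n\<close> on \<open>CC\<^sub>n(A)\<close>, i.e. the suspended complex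
  carries the differential \<open>-b\<close>; with \<open>d(rx) = (dr)x + (-1)\<^sup>|\<^sup>r\<^sup>| r\<close> this is the sign making the map
  in degree \<open>n\<close> send the class of a cycle to the part of its lift linear in \<open>x\<close>, with \<open>x\<close> dropped.\<close>

definition cyclic_to_nat ::
    "('k::field, 'r::{ring, monoid_mult}) dga \<Rightarrow> ('k \<Rightarrow> 'a \<Rightarrow> 'a) \<Rightarrow> ('r \<Rightarrow> 'a) \<Rightarrow> nat \<Rightarrow>
     ('a::{ring, monoid_mult}, 'k) free_alg set \<Rightarrow> 'r set"
  where "cyclic_to_nat R scA \<pi> n c =
    (let A = deg0 scA;
         cA = induced (adj_nat_quot_cplx A) (\<lambda>z. smul ((-1) ^ n) (x_word z)) (n + 1) c;
         cR = inv_into (homology (adj_nat_quot_cplx R) (n + 1))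
                (induced (adj_nat_quot_cplx A) (fp_map \<pi>) (n + 1)) cA
     in induced (nat_mod_k_cplx R) id n (connecting R n cR))"

text \<open>The Feigin--Tsygan isomorphism is a factorisation of \<^const>\<open>cyclic_to_nat\<close> through reduced
  cyclic homology. That determines it on the image of \<open>HC\<^sub>n(A)\<close> in reduced cyclic homology, which
  is where trace maps need it and where the following definition is meaningful.\<close>

definition feigin_tsygan ::
    "('k::field, 'r::{ring, monoid_mult}) dga \<Rightarrow> ('k \<Rightarrow> 'a \<Rightarrow> 'a) \<Rightarrow> ('r \<Rightarrow> 'a) \<Rightarrow> nat \<Rightarrow>
     ('a::{ring, monoid_mult}, 'k) free_alg set \<Rightarrow> 'r set"
  where "feigin_tsygan R scA \<pi> n c' =
    (\<Union>c \<in> {c \<in> HC scA n. to_reduced_HC scA n c = c'}. cyclic_to_nat R scA \<pi> n c)"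


section \<open>Matrix elements and the algebra \<open>R\<^sub>V\<close>\<close>

definition is_basis_list :: "('k::field \<Rightarrow> 'v \<Rightarrow> 'v) \<Rightarrow> 'v::ab_group_add list \<Rightarrow> bool"
  where "is_basis_list scV bs \<longleftrightarrow> distinct bs \<and>
    \<not> module.dependent scV (set bs) \<and> module.span scV (set bs) = UNIV"

text \<open>The matrix unit \<open>e\<^sub>i\<^sub>j\<close>: it sends the \<open>j\<close>-th basis vector to the \<open>i\<close>-th and kills the others.\<close>

definition matrix_unit :: "('k::field \<Rightarrow> 'v \<Rightarrow> 'v) \<Rightarrow> 'v::ab_group_add list \<Rightarrow> nat \<Rightarrow> nat \<Rightarrow> 'v \<Rightarrow> 'v"
  where "matrix_unit scV bs i j v = scV (module.representation scV (set bs) v (bs ! j)) (bs ! i)"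

definition End :: "('k::field \<Rightarrow> 'v \<Rightarrow> 'v) \<Rightarrow> ('v::ab_group_add \<Rightarrow> 'v) set"
  where "End scV = {\<phi>. Vector_Spaces.linear scV scV \<phi>}"

definition end_relations :: "('k::field \<Rightarrow> 'v \<Rightarrow> 'v) \<Rightarrow> ('v::ab_group_add \<Rightarrow> 'v, 'r, 'k) fp set"
  where "end_relations scV =
    {gen (Ext (\<lambda>v. \<phi> v + \<psi> v)) - gen (Ext \<phi>) - gen (Ext \<psi>) |\<phi> \<psi>. \<phi> \<in> End scV \<and> \<psi> \<in> End scV} \<union>
    {gen (Ext (\<lambda>v. scV c (\<phi> v))) - smul c (gen (Ext \<phi>)) |c \<phi>. \<phi> \<in> End scV} \<union>
    {gen (Ext (\<phi> \<circ> \<psi>)) - gen (Ext \<phi>) * gen (Ext \<psi>) |\<phi> \<psi>. \<phi> \<in> End scV \<and> \<psi> \<in> End scV} \<union>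
    {gen (Ext id) - 1}"

text \<open>The ideal defining \<open>End V *\<^sub>k R\<close> inside the free algebra on the letters.\<close>

definition end_ideal ::
    "('k::field \<Rightarrow> 'v \<Rightarrow> 'v) \<Rightarrow> ('k, 'r::{ring, monoid_mult}) dga \<Rightarrow> ('v::ab_group_add \<Rightarrow> 'v, 'r, 'k) fp set"
  where "end_ideal scV R = fp_ideal (End scV) R (end_relations scV \<union> elt_relations R)"

text \<open>Degree \<open>n\<close> part of the (preimage in the free algebra of the) graded centralizer of \<open>End V\<close>
  in \<open>End V *\<^sub>k R\<close>; no signs occur because \<open>End V\<close> has degree \<open>0\<close>.\<close>

definition centralizer ::
    "('k::field \<Rightarrow> 'v \<Rightarrow> 'v) \<Rightarrow> ('k, 'r::{ring, monoid_mult}) dga \<Rightarrow> nat \<Rightarrow>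
     ('v::ab_group_add \<Rightarrow> 'v, 'r, 'k) fp set"
  where "centralizer scV R n =
    {u \<in> fp_part (End scV) 0 R n. \<forall>\<phi> \<in> End scV. gen (Ext \<phi>) * u - u * gen (Ext \<phi>) \<in> end_ideal scV R}"

definition rep_relations ::
    "('k::field \<Rightarrow> 'v \<Rightarrow> 'v) \<Rightarrow> ('k, 'r::{ring, monoid_mult}) dga \<Rightarrow> ('v::ab_group_add \<Rightarrow> 'v, 'r, 'k) fp set"
  where "rep_relations scV R = end_ideal scV R \<union>
    {u * s * v |p q u s v. u \<in> centralizer scV R p \<and>
       s \<in> graded_commutators smul (centralizer scV R) \<and> v \<in> centralizer scV R q}"

text \<open>\<open>R\<^sub>V\<close> and \<open>R\<^sub>V/k\<close>.\<close>

definition rep_cplx ::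
    "('k::field \<Rightarrow> 'v \<Rightarrow> 'v) \<Rightarrow> ('k, 'r::{ring, monoid_mult}) dga \<Rightarrow>
     ('k, ('v::ab_group_add \<Rightarrow> 'v, 'r, 'k) fp) cplx"
  where "rep_cplx scV R =
    \<lparr>cx_scale = smul, cx_part = centralizer scV R,
     cx_rel = (\<lambda>n. module.span smul (rep_relations scV R) \<inter> centralizer scV R n),
     cx_diff = lin smul (word_diff 0 0 R)\<rparr>"

definition rep_mod_k_cplx ::
    "('k::field \<Rightarrow> 'v \<Rightarrow> 'v) \<Rightarrow> ('k, 'r::{ring, monoid_mult}) dga \<Rightarrow>
     ('k, ('v::ab_group_add \<Rightarrow> 'v, 'r, 'k) fp) cplx"
  where "rep_mod_k_cplx scV R = rep_cplx scV R
    \<lparr>cx_rel := \<lambda>n. module.span smul (insert 1 (rep_relations scV R)) \<inter> centralizer scV R n\<rparr>"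

text \<open>For \<open>r\<close> of degree \<open>n\<close>, \<open>r\<^sub>i\<^sub>j = \<Sum>\<^sub>l e\<^sub>l\<^sub>i r e\<^sub>j\<^sub>l\<close>. These elements centralize \<open>End V\<close> and satisfy
  \<open>r = \<Sum>\<^sub>i\<^sub>j e\<^sub>i\<^sub>j r\<^sub>i\<^sub>j\<close> in \<open>End V *\<^sub>k R\<close>, i.e. they are the components of the image of \<open>r\<close> under
  \<open>R \<rightarrow> End V *\<^sub>k R \<cong> End V \<otimes> \<surd>R\<close>, and so of the universal representation.\<close>

definition mat_elt ::
    "('k::field \<Rightarrow> 'v \<Rightarrow> 'v) \<Rightarrow> 'v list \<Rightarrow> nat \<Rightarrow> 'r \<Rightarrow> nat \<Rightarrow> nat \<Rightarrow> ('v::ab_group_add \<Rightarrow> 'v, 'r, 'k) fp"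
  where "mat_elt scV bs n r i j =
    (\<Sum>l<length bs. gen (Ext (matrix_unit scV bs l i)) * gen (Elt n r) * gen (Ext (matrix_unit scV bs j l)))"

definition mat_trace ::
    "('k::field \<Rightarrow> 'v \<Rightarrow> 'v) \<Rightarrow> 'v list \<Rightarrow> nat \<Rightarrow> 'r \<Rightarrow> ('v::ab_group_add \<Rightarrow> 'v, 'r, 'k) fp"
  where "mat_trace scV bs n r = (\<Sum>i<length bs. mat_elt scV bs n r i i)"


section \<open>Trace maps\<close>

text \<open>In degree \<open>0\<close> the map is \<open>A/[A,A] \<rightarrow> A\<^sub>V\<close>, \<open>a \<mapsto> \<Sum>\<^sub>i a\<^sub>i\<^sub>i\<close>, followed by the inverse of the
  isomorphism \<open>H\<^sub>0(R\<^sub>V) \<rightarrow> A\<^sub>V\<close> induced by \<open>\<pi>\<close>.\<close>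

definition trace_map ::
    "('k::field, 'r::{ring, monoid_mult}) dga \<Rightarrow> ('k \<Rightarrow> 'a \<Rightarrow> 'a) \<Rightarrow> ('r \<Rightarrow> 'a) \<Rightarrow>
     ('k \<Rightarrow> 'v \<Rightarrow> 'v) \<Rightarrow> 'v list \<Rightarrow> nat \<Rightarrow> ('a::{ring, monoid_mult}, 'k) free_alg set \<Rightarrow>
     ('v::ab_group_add \<Rightarrow> 'v, 'r, 'k) fp set"
  where "trace_map R scA \<pi> scV bs n c =
    (if n = 0 then
       inv_into (homology (rep_cplx scV R) 0) (induced (rep_cplx scV (deg0 scA)) (fp_map \<pi>) 0)
         (induced (rep_cplx scV (deg0 scA)) (lin smul (\<lambda>w. mat_trace scV bs 0 (hd w))) 0 c)
     else if acyclic_cplx (rep_cplx scV R) then boundaries (rep_cplx scV R) n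
     else
       inv_into (homology (rep_cplx scV R) n) (induced (rep_mod_k_cplx scV R) id n)
         (induced (rep_mod_k_cplx scV R) (mat_trace scV bs n) n
           (feigin_tsygan R scA \<pi> n (to_reduced_HC scA n c))))"

text \<open>Linear maps \<open>f\<^sub>n : A\<^sup>\<otimes>\<^sup>n \<rightarrow> R\<^sub>n\<^sub>-\<^sub>1\<close>, \<open>n \<ge> 1\<close>, are given as one function on lists, multilinear in
  the entries, whose restriction to lists of length \<open>n\<close> is \<open>f\<^sub>n\<close>.\<close>

definition multilinear_family ::
    "('k::field, 'r::{ring, monoid_mult}) dga \<Rightarrow> ('k \<Rightarrow> 'a \<Rightarrow> 'a) \<Rightarrow> ('a::ring list \<Rightarrow> 'r) \<Rightarrow> bool"
  where "multilinear_family R scA f \<longleftrightarrow>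
    (\<forall>w. w \<noteq> [] \<longrightarrow> f w \<in> dg_part R (length w - 1)) \<and>
    (\<forall>u v. Vector_Spaces.linear scA (dg_scale R) (\<lambda>a. f (u @ [a] @ v)))"

definition T_map ::
    "('k::field \<Rightarrow> 'v \<Rightarrow> 'v) \<Rightarrow> 'v list \<Rightarrow> ('a list \<Rightarrow> 'r) \<Rightarrow> nat \<Rightarrow> ('a, 'k) free_alg \<Rightarrow>
     ('v::ab_group_add \<Rightarrow> 'v, 'r, 'k) fp"
  where "T_map scV bs f n = lin smul (\<lambda>w.
    \<Sum>i<length bs. \<Sum>j<n + 1. smul ((-1) ^ (n * j)) (mat_elt scV bs n (f (rotate j w)) i i))"

end

theory Submission
  imports Defs
begin

text \<open>For a word \<open>a\<^sub>1 \<dots> a\<^sub>n\<^sub>+\<^sub>1\<close> let \<open>t(a\<^sub>1, \<dots>, a\<^sub>n\<^sub>+\<^sub>1) \<in> R\<close> be the signed sum of the values of \<open>f\<close> on its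
  rotations. Then \<open>T\<close> is \<open>t\<close> followed by the trace \<open>r \<mapsto> \<Sum>\<^sub>i r\<^sub>i\<^sub>i\<close>, so everything is about \<open>t\<close>.

  The equation for \<open>d f\<close> is the equation \<open>d f = f b' + f * f\<close> of a twisting cochain, where \<open>b'\<close> is the
  differential of the bar construction and \<open>*\<close> the convolution over all cuts of a word into two
  pieces (up to Koszul signs). A cyclic sum has the graded trace property (\<open>cyc_conv_swap\<close>), so it
  kills \<open>f * f\<close> modulo commutators, and it turns \<open>b'\<close> into the Hochschild differential \<open>b\<close> (\<open>cyc_bar\<close>). Hence
  \<open>t\<close> is a morphism from Connes' complex to \<open>R/[R,R]\<close>. As the trace kills commutators
  (\<open>mat_trace_comm\<close>), \<open>T\<close> is a morphism of complexes (\<open>T_morphism\<close>).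

  To compare \<open>t\<close> with the Feigin--Tsygan map, put \<open>g = f x\<close> in \<open>R\<langle>x\<rangle>\<close>. Since \<open>d x = 1\<close>, the twisting
  equation gives \<open>d g - g b' = -f (1 - g)\<close> up to signs, so that for the logarithm
  \<open>L = - tr log (1 - g) = \<Sum>\<^sub>p tr (g\<^sup>p)/p\<close>, where \<open>tr\<close> is the cyclic sum, the terms of \<open>d L - L b\<close> telescope modulo
  commutators, and all that remains is \<open>\<plusminus> t\<close> (\<open>adj_diff_log_cyc\<close>). The sum is finite because each factor \<open>g\<close>
  uses up a letter. Under \<open>\<pi>\<close> only \<open>f\<^sub>1\<close> survives, hence only the top power of \<open>g\<close>, and \<open>L\<close> becomes
  the word \<open>a\<^sub>1x \<dots> a\<^sub>n\<^sub>+\<^sub>1x\<close> (\<open>apush_LogC\<close>): its \<open>n + 1\<close> rotations agree modulo commutators and cancel the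
  coefficient \<open>1/(n + 1)\<close>. So \<open>L\<close> carries a cycle of Connes' complex to a lift to \<open>R\<langle>x\<rangle>\<close> of the corresponding
  class in \<open>A\<langle>x\<rangle>\<close>, and its differential, which is the connecting homomorphism applied to
  that class, is \<open>t\<close> (\<open>cyclic_to_nat_eq\<close>).

  The trace maps are defined through inverses of three maps on homology. To evaluate an inverse at
  an element known to be an image, injectivity is enough.

  \<^item> \<open>R\<langle>x\<rangle>\<^sub>\<natural>/R\<^sub>\<natural> \<rightarrow> A\<langle>x\<rangle>\<^sub>\<natural>/A\<^sub>\<natural>\<close> (\<open>adj_nat_quot_injective\<close>). With \<open>\<sigma> = f\<^sub>1 \<circ> \<pi>\<close> there is a homotopy \<open>h\<close> on \<open>R\<close> with
  \<open>d h + h d = 1 - \<sigma>\<close> and \<open>\<pi> h = 0\<close>. Its extension to cyclic words as a derivation is a homotopy whose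
  commutator with the part of \<open>d\<close> preserving the number of letters \<open>x\<close> multiplies a word by the
  number of its factors in the kernel of \<open>\<sigma>\<close>. In characteristic zero this number can be divided by, and
  an induction on the number of letters \<open>x\<close> and on the number of such factors removes a cycle
  with trivial image.

  \<^item> \<open>H\<^sub>0(R\<^sub>V) \<rightarrow> A\<^sub>V\<close> (\<open>degree_zero_injective\<close>). The map \<open>a \<mapsto> f\<^sub>1(a)\<close> lifts relations of \<open>A\<^sub>V\<close> to relations of
  \<open>R\<^sub>V\<close> up to boundaries, because \<open>f\<^sub>1(a b) - f\<^sub>1(a) f\<^sub>1(b) = d f\<^sub>2(a, b)\<close>.

  \<^item> \<open>H\<^sub>n(R\<^sub>V) \<rightarrow> H\<^sub>n(R\<^sub>V/k)\<close> for \<open>n \<ge> 1\<close> (\<open>RVk_inj\<close>). The constants have degree \<open>0\<close>.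

  All quotients are presented by representatives in free algebras. An identity in a quotient is
  stated as membership of a difference in the space of relations and is checked on words.\<close>


section \<open>Linear maps on free algebras\<close>

interpretation fa: vector_space "smul :: 'k::field \<Rightarrow> ('x, 'k) free_alg \<Rightarrow> ('x, 'k) free_alg"
  by (rule vector_space_smul)

lemma
  assumes "Vector_Spaces.linear s1 s2 F"
  shows linear_add: "F (x + y) = F x + F y"
    and linear_scale: "F (s1 c x) = s2 c (F x)"
    and linear_0: "F 0 = 0"
    and linear_diff: "F (x - y) = F x - F y"
    and linear_neg: "F (- x) = - F x"
    and linear_sum: "F (sum g S) = (\<Sum>a\<in>S. F (g a))"
    and linear_vs1: "vector_space s1"
    and linear_vs2: "vector_space s2"
proof -
  interpret F: Vector_Spaces.linear s1 s2 F by fact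
  show "F (x + y) = F x + F y" "F (s1 c x) = s2 c (F x)" "F 0 = 0" "F (x - y) = F x - F y"
    "F (- x) = - F x" "F (sum g S) = (\<Sum>a\<in>S. F (g a))"
    by (simp_all add: F.add F.scale F.zero F.diff F.neg F.sum)
  show "vector_space s1" "vector_space s2" by unfold_locales
qed

lemma linearI:
  assumes "vector_space s1" "vector_space s2"
    and "\<And>x y. F (x + y) = F x + F y" "\<And>c x. F (s1 c x) = s2 c (F x)"
  shows "Vector_Spaces.linear s1 s2 F"
proof -
  interpret v1: vector_space s1 by fact
  interpret v2: vector_space s2 by fact
  show ?thesis by unfold_locales (use assms(3,4) in auto)
qed

lemma linear_comp:
  assumes "Vector_Spaces.linear s1 s2 F" "Vector_Spaces.linear s2 s3 G"
  shows "Vector_Spaces.linear s1 s3 (\<lambda>x. G (F x))"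
  by (rule linearI)
    (use assms in \<open>auto simp: linear_add linear_scale dest: linear_vs1 linear_vs2\<close>)

lemma linear_addI:
  assumes "Vector_Spaces.linear s1 s2 F" "Vector_Spaces.linear s1 s2 G"
  shows "Vector_Spaces.linear s1 s2 (\<lambda>x. F x + G x)"
proof -
  interpret v: vector_space s2 using assms(1) by (rule linear_vs2)
  show ?thesis
    by (rule linearI) (use assms in \<open>auto simp: linear_add linear_scale v.scale_right_distrib
      algebra_simps dest: linear_vs1 linear_vs2\<close>)
qed

lemma linear_scaleI:
  assumes "Vector_Spaces.linear s1 s2 F"
  shows "Vector_Spaces.linear s1 s2 (\<lambda>x. s2 c (F x))"
proof -
  interpret v: vector_space s2 using assms(1) by (rule linear_vs2)
  show ?thesis
    by (rule linearI) (use assms in \<open>auto simp: linear_add linear_scale v.scale_right_distrib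
      algebra_simps dest: linear_vs1 linear_vs2\<close>)
qed

lemma linear_diffI:
  assumes "Vector_Spaces.linear s1 s2 F" "Vector_Spaces.linear s1 s2 G"
  shows "Vector_Spaces.linear s1 s2 (\<lambda>x. F x - G x)"
proof -
  interpret v: vector_space s2 using assms(1) by (rule linear_vs2)
  show ?thesis
    by (rule linearI) (use assms in \<open>auto simp: linear_add linear_scale v.scale_right_diff_distrib
      algebra_simps dest: linear_vs1 linear_vs2\<close>)
qed

lemma linear_sumI:
  assumes "vector_space s1" "vector_space s2" "\<And>i. i \<in> I \<Longrightarrow> Vector_Spaces.linear s1 s2 (F i)"
  shows "Vector_Spaces.linear s1 s2 (\<lambda>x. \<Sum>i\<in>I. F i x)"
proof -
  interpret v: vector_space s2 by fact
  show ?thesis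
    by (rule linearI) (use assms in \<open>auto simp: linear_add[OF assms(3)] linear_scale[OF assms(3)]
        sum.distrib v.scale_sum_right cong: sum.cong\<close>)
qed

lemma linear_idI: "vector_space s \<Longrightarrow> Vector_Spaces.linear s s (\<lambda>x. x)"
  by (rule linearI) auto

text \<open>With \<open>K\<close> a space of relations: a linear map respects relations as soon as it does so on
  generators. Nearly every verification below has this form.\<close>

lemma linear_span_into:
  assumes F: "Vector_Spaces.linear s1 s2 F" and K: "module.subspace s2 K"
    and gen: "\<And>x. x \<in> S \<Longrightarrow> F x \<in> K" and x: "x \<in> module.span s1 S"
  shows "F x \<in> K"
proof -
  interpret F: Vector_Spaces.linear s1 s2 F by (rule F)
  from x show ?thesis
  proof (induction rule: F.vs1.span_induct_alt)
    case base then show ?case using K by (simp add: F.zero F.vs2.subspace_0)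
  next
    case (step c x y) then show ?case
      using K gen by (simp add: F.add F.scale F.vs2.subspace_add F.vs2.subspace_scale)
  qed
qed

lemma lin_superset:
  assumes "vector_space sc" "finite S" "Poly_Mapping.keys p \<subseteq> S"
  shows "lin sc g p = (\<Sum>w\<in>S. sc (Poly_Mapping.lookup p w) (g (letters w)))"
proof -
  interpret vector_space sc by fact
  show ?thesis unfolding lin_def
    using assms(2,3) by (intro sum.mono_neutral_left) (auto simp: in_keys_iff)
qed

lemma linear_lin:
  fixes g :: "'x list \<Rightarrow> 'b::ab_group_add" and sc :: "'k::field \<Rightarrow> 'b \<Rightarrow> 'b"
  assumes "vector_space sc"
  shows "Vector_Spaces.linear smul sc (lin sc g)"
proof -
  interpret vector_space sc by fact
  show ?thesis
  proof (rule linearI[OF vector_space_smul assms])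
    fix p q :: "('x, 'k) free_alg"
    let ?S = "Poly_Mapping.keys p \<union> Poly_Mapping.keys q"
    have "lin sc g (p + q) = (\<Sum>w\<in>?S. sc (Poly_Mapping.lookup (p + q) w) (g (letters w)))"
      by (intro lin_superset assms) (use Poly_Mapping.keys_add[of p q] in auto)
    also have "\<dots> = lin sc g p + lin sc g q"
      by (simp add: lin_superset[OF assms, of ?S] lookup_add scale_left_distrib sum.distrib)
    finally show "lin sc g (p + q) = lin sc g p + lin sc g q" .
  next
    fix c and p :: "('x, 'k) free_alg"
    have "lin sc g (smul c p)
        = (\<Sum>w\<in>Poly_Mapping.keys p. sc (Poly_Mapping.lookup (smul c p) w) (g (letters w)))"
      by (intro lin_superset assms) (auto simp: in_keys_iff lookup_smul)
    also have "\<dots> = sc c (lin sc g p)"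
      by (simp add: lookup_smul lin_def scale_sum_right)
    finally show "lin sc g (smul c p) = sc c (lin sc g p)" .
  qed
qed

lemma linear_lin_smul [intro, simp]: "Vector_Spaces.linear smul smul (lin smul g)"
  by (rule linear_lin[OF vector_space_smul])

lemma lin_mon:
  assumes "vector_space sc"
  shows "lin sc g (mon w) = g w"
proof -
  interpret vector_space sc by fact
  show ?thesis by (simp add: lin_def mon_def)
qed

lemma lin_smul_mon [simp]: "lin smul g (mon w) = g w"
  by (rule lin_mon[OF vector_space_smul])

lemma free_alg_expand:
  "p = (\<Sum>w\<in>Poly_Mapping.keys p. smul (Poly_Mapping.lookup p w) (mon (letters w)))"
proof (rule poly_mapping_eqI)
  fix v
  have "(\<Sum>w\<in>Poly_Mapping.keys p. Poly_Mapping.lookup p w * Poly_Mapping.lookup (mon (letters w)) v)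
      = (\<Sum>w\<in>Poly_Mapping.keys p. if w = v then Poly_Mapping.lookup p v else 0)"
    by (rule sum.cong) (auto simp: mon_def lookup_single)
  then show "Poly_Mapping.lookup p v = Poly_Mapping.lookup
      (\<Sum>w\<in>Poly_Mapping.keys p. smul (Poly_Mapping.lookup p w) (mon (letters w))) v"
    by (simp add: lookup_sum lookup_smul in_keys_iff)
qed

lemma span_mon: "module.span smul (range mon) = (UNIV :: ('x, 'k::field) free_alg set)"
proof -
  have "p \<in> fa.span (range mon)" for p :: "('x, 'k) free_alg"
    by (subst free_alg_expand) (intro fa.span_sum fa.span_scale fa.span_base rangeI)
  then show ?thesis by auto
qed

lemma linear_mon_into:
  assumes F: "Vector_Spaces.linear smul sc F" and K: "module.subspace sc K"
    and "\<And>w. F (mon w) \<in> K"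
  shows "F x \<in> K"
proof (rule linear_span_into[OF F K])
  show "x \<in> fa.span (range mon)" by (simp add: span_mon)
qed (use assms(3) in auto)

lemma linear_eq_on_mon:
  assumes F: "Vector_Spaces.linear smul sc F" and G: "Vector_Spaces.linear smul sc G"
    and eq: "\<And>w. F (mon w) = G (mon w)"
  shows "F x = G x"
proof -
  interpret v: vector_space sc using F by (rule linear_vs2)
  have "F x - G x \<in> {0}"
    by (rule linear_mon_into[OF linear_diffI[OF F G]]) (auto simp: eq)
  then show ?thesis by simp
qed

lemma smul_conv_mult: "smul c p = Poly_Mapping.single 0 c * p"
  by (simp add: smul_def mult_map_scale_conv_mult)

lemma smul_mult_left [simp]: "smul c p * q = smul c (p * q)"
  by (simp add: smul_conv_mult mult.assoc)

lemma linear_mult_left: "Vector_Spaces.linear smul smul (\<lambda>p. p * q)"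
  by (rule linearI) (auto intro: vector_space_smul simp: algebra_simps)

lemma smul_mult_right [simp]:
  fixes p q :: "('x, 'k::field) free_alg"
  shows "p * smul c q = smul c (p * q)"
proof -
  have lin: "Vector_Spaces.linear smul smul (\<lambda>q :: ('x, 'k) free_alg. Poly_Mapping.single 0 c * q)"
    unfolding smul_conv_mult[symmetric]
    by (rule linear_scaleI[OF linear_idI[OF vector_space_smul]])
  have "p * Poly_Mapping.single 0 c = Poly_Mapping.single 0 c * p"
  proof (rule linear_eq_on_mon[where x = p and F = "\<lambda>p. p * Poly_Mapping.single 0 c"
        and G = "\<lambda>p. Poly_Mapping.single 0 c * p"])
    show "Vector_Spaces.linear smul smul (\<lambda>p :: ('x, 'k) free_alg. p * Poly_Mapping.single 0 c)"
      by (rule linear_mult_left)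
    show "Vector_Spaces.linear smul smul (\<lambda>p :: ('x, 'k) free_alg. Poly_Mapping.single 0 c * p)"
      by (rule lin)
  qed (simp add: mon_def mult_single)
  then show ?thesis by (simp add: smul_conv_mult mult.assoc[symmetric])
qed

lemma linear_mult_right: "Vector_Spaces.linear smul smul (\<lambda>q. p * q)"
  by (rule linearI) (auto intro: vector_space_smul simp: algebra_simps)

lemma linear_smulI: "Vector_Spaces.linear smul smul (\<lambda>p. smul c p)"
  by (rule linear_scaleI[OF linear_idI[OF vector_space_smul]])

lemma bilinear_eq_on_mon:
  assumes "\<And>q. Vector_Spaces.linear smul sc (\<lambda>p. F p q)" "\<And>p. Vector_Spaces.linear smul sc (F p)"
    and "\<And>q. Vector_Spaces.linear smul sc (\<lambda>p. G p q)" "\<And>p. Vector_Spaces.linear smul sc (G p)"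
    and "\<And>u v. F (mon u) (mon v) = G (mon u) (mon v)"
  shows "F p q = G p q"
proof -
  have "F (mon u) q = G (mon u) q" for u
    by (rule linear_eq_on_mon[OF assms(2) assms(4)]) (rule assms(5))
  then show ?thesis
    by (rule linear_eq_on_mon[OF assms(1) assms(3)])
qed

lemma bilinear_into:
  assumes F1: "\<And>q. Vector_Spaces.linear s1 s2 (\<lambda>p. F p q)" and F2: "\<And>p. Vector_Spaces.linear s1' s2 (F p)"
    and K: "module.subspace s2 K" and "\<And>x y. x \<in> S \<Longrightarrow> y \<in> T \<Longrightarrow> F x y \<in> K"
    and "x \<in> module.span s1 S" "y \<in> module.span s1' T"
  shows "F x y \<in> K"
proof (rule linear_span_into[OF F1 K _ assms(5)])
  fix x assume "x \<in> S"
  then show "F x y \<in> K"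
    by (intro linear_span_into[OF F2 K _ assms(6)] assms(4))
qed

lemma gen_mult_mon: "gen l * mon w = mon (l # w)"
  by (simp add: gen_def mon_mult)

lemma mon_Cons: "mon (l # w) = gen l * mon w"
  by (simp add: gen_mult_mon)

lemma mon_append: "mon (u @ v) = mon u * mon v"
  by (simp add: mon_mult)

lemma neg_one_power_cong: "even (a + b) \<Longrightarrow> (-1 :: 'k::field) ^ a = (-1) ^ b"
  by (auto simp: minus_one_power_iff)

lemma neg_one_power_square [simp]: "(-1 :: 'k::field) ^ a * (-1) ^ a = 1"
  by (auto simp: minus_one_power_iff)

text \<open>Identities in a quotient are stated as memberships of differences, and the following lemmas take
  the place of equational reasoning.\<close>

lemma (in module) cong_trans:
  "subspace K \<Longrightarrow> x - y \<in> K \<Longrightarrow> y - z \<in> K \<Longrightarrow> x - z \<in> K"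
  using subspace_add[of K "x - y" "y - z"] by simp

lemma (in module) cong_sym:
  "subspace K \<Longrightarrow> x - y \<in> K \<Longrightarrow> y - x \<in> K"
  using subspace_neg[of K "x - y"] by simp

lemma (in module) cong_add:
  "subspace K \<Longrightarrow> x - y \<in> K \<Longrightarrow> x' - y' \<in> K \<Longrightarrow> (x + x') - (y + y') \<in> K"
  using subspace_add[of K "x - y" "x' - y'"] by (simp add: algebra_simps)

lemma (in module) cong_diff:
  "subspace K \<Longrightarrow> x - y \<in> K \<Longrightarrow> x' - y' \<in> K \<Longrightarrow> (x - x') - (y - y') \<in> K"
  using subspace_diff[of K "x - y" "x' - y'"] by (simp add: algebra_simps)

lemma (in module) cong_scale:
  "subspace K \<Longrightarrow> x - y \<in> K \<Longrightarrow> c *s x - c *s y \<in> K"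
  using subspace_scale[of K "x - y" c] by (simp add: scale_right_diff_distrib)

lemma (in module) cong_sum:
  assumes "subspace K" "\<And>i. i \<in> I \<Longrightarrow> f i - g i \<in> K"
  shows "sum f I - sum g I \<in> K"
  using subspace_sum[of K I "\<lambda>i. f i - g i"] assms by (simp add: sum_subtractf)

lemma (in module) cong_mem:
  "subspace K \<Longrightarrow> x - y \<in> K \<Longrightarrow> x \<in> K \<longleftrightarrow> y \<in> K"
  by (metis cong_sym diff_add_cancel subspace_add)


section \<open>Free products presented by letters\<close>

abbreviation word_deg :: "nat \<Rightarrow> ('y, 'r) letter list \<Rightarrow> nat"
  where "word_deg e w \<equiv> sum_list (map (letter_deg e) w)"

abbreviation fp_diff :: "nat \<Rightarrow> ('y, 'r, 'k) fp \<Rightarrow> ('k::field, 'r) dga \<Rightarrow> ('y, 'r, 'k) fp \<Rightarrow> ('y, 'r, 'k) fp"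
  where "fp_diff e \<delta> R \<equiv> lin smul (word_diff e \<delta> R)"

definition elt :: "nat \<Rightarrow> 'r \<Rightarrow> ('y, 'r, 'k::field) fp"
  where "elt n r = gen (Elt n r)"

text \<open>The Koszul sign that a derivation of odd degree picks up when it passes an element.\<close>

definition hat :: "nat \<Rightarrow> ('y, 'r, 'k::field) fp \<Rightarrow> ('y, 'r, 'k) fp"
  where "hat e = lin smul (\<lambda>w. smul ((-1) ^ word_deg e w) (mon w))"

text \<open>A letter \<open>Elt n r\<close> with \<open>r\<close> outside the degree \<open>n\<close> part of the algebra is junk about which the relations
  say nothing, and the ideals are not closed under multiplication by it. Factors multiplied into an
  ideal therefore have to lie in this span.\<close>

definition adm :: "'y set \<Rightarrow> ('k::field, 'r) dga \<Rightarrow> ('y, 'r, 'k) fp set"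
  where "adm Y R = module.span smul {mon w |w. set w \<subseteq> fp_letters Y R}"

lemma elt_relations_cases:
  assumes "s \<in> elt_relations R"
  obtains (add) n r r' where "s = elt n (r + r') - elt n r - elt n r'" "r \<in> dg_part R n" "r' \<in> dg_part R n"
    | (scale) n c r where "s = elt n (dg_scale R c r) - smul c (elt n r)" "r \<in> dg_part R n"
    | (mult) m n r r' where "s = elt (m + n) (r * r') - elt m r * elt n r'" "r \<in> dg_part R m" "r' \<in> dg_part R n"
    | (one) "s = elt 0 1 - 1"
  using assms unfolding elt_relations_def elt_def[symmetric]
  by (elim UnE CollectE exE conjE insertE emptyE) (rule that; assumption)+

lemma elt_relations_addI:
  "r \<in> dg_part R n \<Longrightarrow> s \<in> dg_part R n \<Longrightarrow> elt n (r + s) - elt n r - elt n s \<in> elt_relations R"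
  unfolding elt_relations_def elt_def by (rule UnI1, rule UnI1, rule UnI1) blast

lemma elt_relations_scaleI:
  "r \<in> dg_part R n \<Longrightarrow> elt n (dg_scale R c r) - smul c (elt n r) \<in> elt_relations R"
  unfolding elt_relations_def elt_def by (rule UnI1, rule UnI1, rule UnI2) blast

lemma elt_relations_multI:
  "r \<in> dg_part R m \<Longrightarrow> s \<in> dg_part R n \<Longrightarrow> elt (m + n) (r * s) - elt m r * elt n s \<in> elt_relations R"
  unfolding elt_relations_def elt_def by (rule UnI1, rule UnI2) blast

lemma elt_relations_oneI: "elt 0 1 - 1 \<in> elt_relations R"
  unfolding elt_relations_def elt_def by (rule UnI2) blast

lemma linear_hat [intro, simp]: "Vector_Spaces.linear smul smul (hat e)"
  by (simp add: hat_def)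

lemma hat_mon [simp]: "hat e (mon w) = smul ((-1) ^ word_deg e w) (mon w)"
  by (simp add: hat_def)

lemma hat_mult: "hat e (p * q) = hat e p * hat e q"
  by (rule bilinear_eq_on_mon[where F = "\<lambda>p q. hat e (p * q)" and G = "\<lambda>p q. hat e p * hat e q"])
    (auto intro: linear_comp[OF linear_mult_left] linear_comp[OF linear_mult_right]
      linear_comp[OF linear_hat linear_mult_left] linear_comp[OF linear_hat linear_mult_right]
      simp: mon_mult power_add)

lemma word_diff_append:
  "word_diff e \<delta> R (u @ v) = word_diff e \<delta> R u * mon v
    + smul ((-1) ^ word_deg e u) (mon u * word_diff e \<delta> R v)"
proof (induction u)
  case Nil then show ?case by (simp add: mon_Nil)
next
  case (Cons l u)
  then show ?case
    by (simp add: algebra_simps mon_Cons mon_append fa.scale_right_distrib power_add mult.assoc)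
qed

lemma fp_diff_mult:
  "fp_diff e \<delta> R (p * q) = fp_diff e \<delta> R p * q + hat e p * fp_diff e \<delta> R q"
proof (rule bilinear_eq_on_mon[where F = "\<lambda>p q. fp_diff e \<delta> R (p * q)"
      and G = "\<lambda>p q. fp_diff e \<delta> R p * q + hat e p * fp_diff e \<delta> R q"])
qed (auto intro!: linear_addI linear_comp[OF linear_mult_left] linear_comp[OF linear_mult_right]
      linear_comp[OF linear_hat linear_mult_left] linear_comp[OF _ linear_mult_left]
      linear_mult_right linear_idI[OF vector_space_smul] linear_comp[OF linear_lin_smul linear_mult_right]
      simp: mon_mult word_diff_append)

lemma subspace_fp_part [intro, simp]: "fa.subspace (fp_part Y e R n)"
  by (simp add: fp_part_def)

lemma subspace_adm [intro, simp]: "fa.subspace (adm Y R)"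
  by (simp add: adm_def)

lemma subspace_fp_ideal [intro, simp]: "fa.subspace (fp_ideal Y R S)"
  by (simp add: fp_ideal_def)

lemma mon_fp_part: "set w \<subseteq> fp_letters Y R \<Longrightarrow> word_deg e w = n \<Longrightarrow> mon w \<in> fp_part Y e R n"
  unfolding fp_part_def by (rule fa.span_base) auto

lemma mon_adm: "set w \<subseteq> fp_letters Y R \<Longrightarrow> mon w \<in> adm Y R"
  unfolding adm_def by (rule fa.span_base) auto

lemma fp_part_adm: "x \<in> fp_part Y e R n \<Longrightarrow> x \<in> adm Y R"
  unfolding fp_part_def adm_def by (rule subsetD[OF fa.span_mono]) auto

lemma fp_part_mult:
  assumes "x \<in> fp_part Y e R m" "y \<in> fp_part Y e R n"
  shows "x * y \<in> fp_part Y e R (m + n)"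
  by (rule bilinear_into[OF linear_mult_left linear_mult_right _ _
        assms[unfolded fp_part_def]])
    (auto simp: mon_mult intro!: mon_fp_part, blast+)

lemma adm_mult:
  assumes "x \<in> adm Y R" "y \<in> adm Y R"
  shows "x * y \<in> adm Y R"
  by (rule bilinear_into[OF linear_mult_left linear_mult_right _ _ assms[unfolded adm_def]])
    (auto simp: mon_mult intro!: mon_adm, blast+)

lemma one_fp_part [intro, simp]: "1 \<in> fp_part Y e R 0"
  unfolding mon_Nil[symmetric] by (rule mon_fp_part) auto

lemma one_adm [intro, simp]: "1 \<in> adm Y R"
  by (rule fp_part_adm) (rule one_fp_part)

lemma elt_fp_part: "r \<in> dg_part R n \<Longrightarrow> elt n r \<in> fp_part Y e R n"
  unfolding elt_def gen_def by (rule mon_fp_part) (auto simp: fp_letters_def)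

lemma ext_fp_part: "y \<in> Y \<Longrightarrow> gen (Ext y) \<in> fp_part Y e R e"
  unfolding gen_def by (rule mon_fp_part) (auto simp: fp_letters_def)

lemma gen_fp_part: "l \<in> fp_letters Y R \<Longrightarrow> gen l \<in> fp_part Y e R (letter_deg e l)"
  unfolding gen_def by (rule mon_fp_part) auto

lemma hat_fp_part: "x \<in> fp_part Y e R n \<Longrightarrow> hat e x = smul ((-1) ^ n) x"
proof -
  assume x: "x \<in> fp_part Y e R n"
  have "hat e x - smul ((-1) ^ n) x \<in> {0}"
    by (rule linear_span_into[OF linear_diffI[OF linear_hat linear_smulI] _ _ x[unfolded fp_part_def]])
      auto
  then show ?thesis by simp
qed

lemma hat_adm: "x \<in> adm Y R \<Longrightarrow> hat e x \<in> adm Y R"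
  unfolding adm_def
  by (erule linear_span_into[OF linear_hat, rotated 2])
    (auto intro!: fa.span_scale mon_adm[unfolded adm_def])


subsection \<open>Two-sided ideals\<close>

lemma fp_ideal_base: "s \<in> S \<Longrightarrow> s \<in> fp_ideal Y R S"
  unfolding fp_ideal_def
  by (rule fa.span_base) (auto intro!: exI[of _ "[]"] exI[of _ s] simp: mon_Nil)

lemma fp_ideal_sandwich:
  "set u \<subseteq> fp_letters Y R \<Longrightarrow> s \<in> S \<Longrightarrow> set v \<subseteq> fp_letters Y R \<Longrightarrow> mon u * s * mon v \<in> fp_ideal Y R S"
  unfolding fp_ideal_def by (rule fa.span_base) auto

text \<open>The generators of an ideal have words on both sides, so multiplying by a word only lengthens one
  of them.\<close>

lemma fp_ideal_mult_left:
  fixes R :: "('k::field, 'r) dga" and Y :: "'y set"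
  assumes "a \<in> adm Y R" "x \<in> fp_ideal Y R S"
  shows "a * x \<in> fp_ideal Y R S"
proof (rule bilinear_into[OF linear_mult_left linear_mult_right _ _
      assms[unfolded adm_def fp_ideal_def]])
  fix a x :: "('y, 'r, 'k) fp"
  assume "a \<in> {mon w |w. set w \<subseteq> fp_letters Y R}"
    and "x \<in> {mon u * s * mon v |u s v. set u \<subseteq> fp_letters Y R \<and> s \<in> S \<and> set v \<subseteq> fp_letters Y R}"
  then obtain w u s v where eq: "a = mon w" "x = mon u * s * mon v"
    and *: "set w \<subseteq> fp_letters Y R" "set u \<subseteq> fp_letters Y R" "s \<in> S" "set v \<subseteq> fp_letters Y R"
    by auto
  have "mon (w @ u) * s * mon v \<in> fp_ideal Y R S"
    by (rule fp_ideal_sandwich) (use * in auto)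
  then show "a * x \<in> fp_ideal Y R S"
    by (simp add: eq mon_append mult.assoc)
qed simp

lemma fp_ideal_mult_right:
  fixes R :: "('k::field, 'r) dga" and Y :: "'y set"
  assumes "x \<in> fp_ideal Y R S" "a \<in> adm Y R"
  shows "x * a \<in> fp_ideal Y R S"
proof (rule bilinear_into[OF linear_mult_left linear_mult_right _ _
      assms[unfolded adm_def fp_ideal_def]])
  fix a x :: "('y, 'r, 'k) fp"
  assume "a \<in> {mon w |w. set w \<subseteq> fp_letters Y R}"
    and "x \<in> {mon u * s * mon v |u s v. set u \<subseteq> fp_letters Y R \<and> s \<in> S \<and> set v \<subseteq> fp_letters Y R}"
  then obtain w u s v where eq: "a = mon w" "x = mon u * s * mon v"
    and *: "set w \<subseteq> fp_letters Y R" "set u \<subseteq> fp_letters Y R" "s \<in> S" "set v \<subseteq> fp_letters Y R"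
    by auto
  have "mon u * s * mon (v @ w) \<in> fp_ideal Y R S"
    by (rule fp_ideal_sandwich) (use * in auto)
  then show "x * a \<in> fp_ideal Y R S"
    by (simp add: eq mon_append mult.assoc)
qed simp

lemma linear_fp_ideal_into:
  assumes F: "Vector_Spaces.linear smul sc F" and K: "module.subspace sc K"
    and gen: "\<And>u s v. set u \<subseteq> fp_letters Y R \<Longrightarrow> s \<in> S \<Longrightarrow> set v \<subseteq> fp_letters Y R \<Longrightarrow>
        F (mon u * s * mon v) \<in> K"
    and x: "x \<in> fp_ideal Y R S"
  shows "F x \<in> K"
  by (rule linear_span_into[OF F K _ x[unfolded fp_ideal_def]]) (auto intro: gen)

lemma fp_ideal_cong_mult:
  assumes "x - x' \<in> fp_ideal Y R S" "y - y' \<in> fp_ideal Y R S" "x' \<in> adm Y R" "y \<in> adm Y R"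
  shows "x * y - x' * y' \<in> fp_ideal Y R S"
proof -
  have "x * y - x' * y' = (x - x') * y + x' * (y - y')" by (simp add: algebra_simps)
  then show ?thesis
    using fa.subspace_add[OF subspace_fp_ideal fp_ideal_mult_right fp_ideal_mult_left] assms by simp
qed


section \<open>Differential graded algebras\<close>

locale dga =
  fixes R :: "('k::field, 'r::{ring, monoid_mult}) dga"
  assumes is_dga: "is_dga R"
begin

sublocale k_algebra "dg_scale R"
  using is_dga by (simp add: is_dga_def)

lemma subspace_part [intro, simp]: "subspace (dg_part R n)"
  using is_dga by (simp add: is_dga_def)

lemma one_part [intro, simp]: "1 \<in> dg_part R 0"
  using is_dga by (simp add: is_dga_def)

lemma mult_part: "x \<in> dg_part R m \<Longrightarrow> y \<in> dg_part R n \<Longrightarrow> x * y \<in> dg_part R (m + n)"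
  using is_dga by (simp add: is_dga_def)

lemma linear_diff_R [intro, simp]: "Vector_Spaces.linear (dg_scale R) (dg_scale R) (dg_diff R)"
  using is_dga by (simp add: is_dga_def)

lemma diff_part0: "x \<in> dg_part R 0 \<Longrightarrow> dg_diff R x = 0"
  using is_dga by (simp add: is_dga_def)

lemma diff_part: "x \<in> dg_part R (Suc n) \<Longrightarrow> dg_diff R x \<in> dg_part R n"
  using is_dga by (simp add: is_dga_def)

lemma diff_diff: "dg_diff R (dg_diff R x) = 0"
  using is_dga by (simp add: is_dga_def)

lemma diff_mult:
  "x \<in> dg_part R m \<Longrightarrow> dg_diff R (x * y) = dg_diff R x * y + dg_scale R ((-1) ^ m) (x * dg_diff R y)"
  using is_dga by (simp add: is_dga_def)

lemma zero_part [intro, simp]: "0 \<in> dg_part R n"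
  by (rule subspace_0) simp

subsection \<open>Relations of the letters of the algebra\<close>

text \<open>The relations of \<open>R\<close> occur in several presentations, for \<open>S\<close> the set of all their relations.\<close>

context
  fixes Y :: "'y set" and S :: "('y, 'r, 'k) fp set"
  assumes elt_S: "elt_relations R \<subseteq> S"
begin

lemma elt_add: "r \<in> dg_part R n \<Longrightarrow> s \<in> dg_part R n \<Longrightarrow> elt n (r + s) - (elt n r + elt n s) \<in> fp_ideal Y R S"
  using fp_ideal_base[OF subsetD[OF elt_S elt_relations_addI]] by (simp add: diff_diff_eq)

lemma elt_scale: "r \<in> dg_part R n \<Longrightarrow> elt n (dg_scale R c r) - smul c (elt n r) \<in> fp_ideal Y R S"
  using fp_ideal_base[OF subsetD[OF elt_S elt_relations_scaleI]] .

lemma elt_mult: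
  "r \<in> dg_part R m \<Longrightarrow> s \<in> dg_part R n \<Longrightarrow> elt (m + n) (r * s) - elt m r * elt n s \<in> fp_ideal Y R S"
  using fp_ideal_base[OF subsetD[OF elt_S elt_relations_multI]] .

lemma elt_one: "elt 0 1 - 1 \<in> fp_ideal Y R S"
  using fp_ideal_base[OF subsetD[OF elt_S elt_relations_oneI]] .

lemma elt_zero: "elt n 0 \<in> fp_ideal Y R S"
  using elt_scale[of 0 n 0] by simp

lemma elt_diff:
  assumes "r \<in> dg_part R n" "s \<in> dg_part R n"
  shows "elt n (r - s) - (elt n r - elt n s) \<in> fp_ideal Y R S"
proof -
  have "elt n ((r - s) + s) - (elt n (r - s) + elt n s) \<in> fp_ideal Y R S"
    by (rule elt_add) (use assms in \<open>auto intro: subspace_diff\<close>)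
  then have "- (elt n ((r - s) + s) - (elt n (r - s) + elt n s)) \<in> fp_ideal Y R S"
    by (rule fa.subspace_neg[OF subspace_fp_ideal])
  then show ?thesis by (simp add: algebra_simps)
qed

lemma elt_sum:
  assumes "finite A" "\<And>i. i \<in> A \<Longrightarrow> r i \<in> dg_part R n"
  shows "elt n (sum r A) - (\<Sum>i\<in>A. elt n (r i)) \<in> fp_ideal Y R S"
  using assms
proof (induction A rule: finite_induct)
  case empty
  then show ?case by (simp add: elt_zero)
next
  case (insert a A)
  have "elt n (r a + sum r A) - (elt n (r a) + elt n (sum r A)) \<in> fp_ideal Y R S"
    by (rule elt_add) (use insert.prems in \<open>auto intro: subspace_sum\<close>)
  moreover have "(elt n (r a) + elt n (sum r A)) - (elt n (r a) + (\<Sum>i\<in>A. elt n (r i))) \<in> fp_ideal Y R S"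
    using insert by simp
  ultimately show ?case
    using insert.hyps fa.cong_trans[OF subspace_fp_ideal] by (metis sum.insert)
qed

end


subsection \<open>The differential of a free product\<close>

text \<open>The common differential \<open>\<delta>\<close> of the additional letters is \<open>0\<close> for \<open>End V\<close> and \<open>1\<close> for \<open>x\<close>. For \<open>x\<close> also \<open>\<delta> = 0\<close>
  will be used, which gives the part of the differential of \<open>R\<langle>x\<rangle>\<close> that keeps the number of letters \<open>x\<close>.\<close>

context
  fixes Y :: "'y set" and e :: nat and \<delta> :: "('y, 'r, 'k) fp"
  assumes \<delta>: "\<delta> = 0 \<or> (e = 1 \<and> \<delta> = 1)"
begin

lemma fp_diff_delta: "fp_diff e \<delta> R \<delta> = 0"
  using \<delta> by (auto simp: mon_Nil[symmetric] linear_0[OF linear_lin_smul])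

lemma letter_diff_part:
  assumes "l \<in> fp_letters Y R"
  shows "letter_deg e l = 0 \<Longrightarrow> letter_diff \<delta> R l = 0"
    and "letter_deg e l = Suc n \<Longrightarrow> letter_diff \<delta> R l \<in> fp_part Y e R n"
proof -
  show "letter_deg e l = 0 \<Longrightarrow> letter_diff \<delta> R l = 0"
    using \<delta> by (cases l) auto
  assume d: "letter_deg e l = Suc n"
  show "letter_diff \<delta> R l \<in> fp_part Y e R n"
  proof (cases l)
    case (Ext y)
    then show ?thesis using d \<delta> by (auto intro: fa.subspace_0)
  next
    case (Elt m r)
    then have "m = Suc n" "r \<in> dg_part R (Suc n)" using d assms by (auto simp: fp_letters_def)
    then show ?thesis using Elt
      by (auto simp flip: elt_def intro!: elt_fp_part diff_part)
  qed
qed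

lemma word_diff_part:
  assumes "set w \<subseteq> fp_letters Y R"
  shows "(word_deg e w = 0 \<longrightarrow> word_diff e \<delta> R w = 0) \<and>
    (\<forall>n. word_deg e w = Suc n \<longrightarrow> word_diff e \<delta> R w \<in> fp_part Y e R n)"
  using assms
proof (induction w)
  case Nil
  then show ?case by simp
next
  case (Cons l w)
  then have IH0: "word_deg e w = 0 \<Longrightarrow> word_diff e \<delta> R w = 0"
    and IH: "\<And>n. word_deg e w = Suc n \<Longrightarrow> word_diff e \<delta> R w \<in> fp_part Y e R n"
    and l: "l \<in> fp_letters Y R" and w: "set w \<subseteq> fp_letters Y R" by auto
  have "word_diff e \<delta> R (l # w) \<in> fp_part Y e R n" if n: "word_deg e (l # w) = Suc n" for n
  proof -
    have "letter_diff \<delta> R l * mon w \<in> fp_part Y e R n"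
    proof (cases "letter_deg e l")
      case 0
      then show ?thesis using letter_diff_part(1)[OF l] by (simp add: fa.subspace_0)
    next
      case (Suc m)
      then have "letter_diff \<delta> R l * mon w \<in> fp_part Y e R (m + word_deg e w)"
        by (intro fp_part_mult letter_diff_part(2)[OF l] mon_fp_part w) auto
      then show ?thesis using n Suc by simp
    qed
    moreover have "gen l * word_diff e \<delta> R w \<in> fp_part Y e R n"
    proof (cases "word_deg e w")
      case 0
      then show ?thesis using IH0 by (simp add: fa.subspace_0)
    next
      case (Suc m)
      then have "gen l * word_diff e \<delta> R w \<in> fp_part Y e R (letter_deg e l + m)"
        by (intro fp_part_mult gen_fp_part l IH) auto
      then show ?thesis using n Suc by simp
    qed
    ultimately show ?thesis by (simp add: fa.subspace_add fa.subspace_scale)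
  qed
  then show ?case
    using letter_diff_part(1)[OF l] IH0 by auto
qed

lemma fp_diff_part:
  assumes "x \<in> fp_part Y e R (Suc n)"
  shows "fp_diff e \<delta> R x \<in> fp_part Y e R n"
  by (rule linear_span_into[OF linear_lin_smul _ _ assms[unfolded fp_part_def]])
    (use word_diff_part in auto)

lemma fp_diff_part0:
  assumes "x \<in> fp_part Y e R 0"
  shows "fp_diff e \<delta> R x = 0"
proof -
  have "fp_diff e \<delta> R x \<in> {0}"
    by (rule linear_span_into[OF linear_lin_smul _ _ assms[unfolded fp_part_def]])
      (use word_diff_part in auto)
  then show ?thesis by simp
qed

lemma fp_diff_adm:
  assumes "x \<in> adm Y R"
  shows "fp_diff e \<delta> R x \<in> adm Y R"
proof (rule linear_span_into[OF linear_lin_smul _ _ assms[unfolded adm_def]])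
  fix x :: "('y, 'r, 'k) fp"
  assume "x \<in> {mon w |w. set w \<subseteq> fp_letters Y R}"
  then obtain w where w: "x = mon w" "set w \<subseteq> fp_letters Y R" by auto
  show "fp_diff e \<delta> R x \<in> adm Y R"
    using word_diff_part[OF w(2)] w
    by (cases "word_deg e w") (auto intro: fp_part_adm fa.subspace_0)
qed simp

lemma fp_diff_ideal:
  assumes hom: "\<And>s. s \<in> S \<Longrightarrow> \<exists>m. s \<in> fp_part Y e R m"
    and diff: "\<And>s. s \<in> S \<Longrightarrow> fp_diff e \<delta> R s \<in> fp_ideal Y R S"
    and x: "x \<in> fp_ideal Y R S"
  shows "fp_diff e \<delta> R x \<in> fp_ideal Y R S"
proof (rule linear_fp_ideal_into[OF linear_lin_smul _ _ x])
  fix u s v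
  assume u: "set u \<subseteq> fp_letters Y R" and s: "s \<in> S" and v: "set v \<subseteq> fp_letters Y R"
  obtain m where m: "s \<in> fp_part Y e R m" using hom[OF s] by auto
  have sI: "s \<in> fp_ideal Y R S" using s by (rule fp_ideal_base)
  have us: "mon u * s \<in> fp_ideal Y R S" by (rule fp_ideal_mult_left[OF mon_adm[OF u] sI])
  have "hat e (mon u * s) = smul ((-1) ^ word_deg e u) (smul ((-1) ^ m) (mon u * s))"
    by (simp add: hat_mult hat_fp_part[OF m])
  then have 1: "hat e (mon u * s) * fp_diff e \<delta> R (mon v) \<in> fp_ideal Y R S"
    by (auto intro!: fa.subspace_scale fp_ideal_mult_right us fp_diff_adm mon_adm v
        simp del: lin_smul_mon)
  have "fp_diff e \<delta> R (mon u) * s + hat e (mon u) * fp_diff e \<delta> R s \<in> fp_ideal Y R S"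
    by (intro fa.subspace_add subspace_fp_ideal fp_ideal_mult_left fp_diff_adm mon_adm u sI
        hat_adm diff s)
  then have 2: "fp_diff e \<delta> R (mon u * s) * mon v \<in> fp_ideal Y R S"
    by (subst fp_diff_mult) (rule fp_ideal_mult_right[OF _ mon_adm[OF v]])
  show "fp_diff e \<delta> R (mon u * s * mon v) \<in> fp_ideal Y R S"
    by (subst fp_diff_mult) (rule fa.subspace_add[OF subspace_fp_ideal 2 1])
qed simp

lemma fp_diff_elt_Suc: "fp_diff e \<delta> R (elt (Suc n) r) = elt n (dg_diff R r)"
  by (simp add: elt_def gen_def mon_Nil)

lemma fp_diff_elt_0: "fp_diff e \<delta> R (elt 0 r) = 0"
  by (simp add: elt_def gen_def mon_Nil)

lemma fp_diff_ext: "fp_diff e \<delta> R (gen (Ext y)) = \<delta>"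
  by (simp add: gen_def mon_Nil)

lemma elt_relations_part: "s \<in> elt_relations R \<Longrightarrow> \<exists>m. s \<in> fp_part Y e R m"
  by (erule elt_relations_cases; intro exI)
    (auto intro!: fa.subspace_diff[of "fp_part Y e R _"] fa.subspace_scale elt_fp_part fp_part_mult
      subspace_add[of "dg_part R _"] subspace_scale mult_part)

text \<open>Only the relation for products has content: its differential is the difference between the
  Leibniz rule of \<open>R\<close> and that of the free product. The case distinctions reflect that the
  differential of a letter of degree \<open>0\<close> is \<open>0\<close>, not a letter.\<close>

lemma fp_diff_elt_relations:
  assumes S: "elt_relations R \<subseteq> S" and s: "s \<in> elt_relations R"
  shows "fp_diff e \<delta> R s \<in> fp_ideal Y R S"
proof -
  note dl = linear_diff[OF linear_lin_smul] linear_scale[OF linear_lin_smul]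
  note Rl = linear_add[OF linear_diff_R] linear_scale[OF linear_diff_R]
  from s show ?thesis
  proof (cases rule: elt_relations_cases)
    case (add n r r')
    then show ?thesis
    proof (cases n)
      case 0 then show ?thesis by (simp add: add dl fp_diff_elt_0 fa.subspace_0)
    next
      case (Suc k)
      then show ?thesis using add
        by (simp add: dl fp_diff_elt_Suc Rl)
          (use elt_add[OF S, of "dg_diff R r" k "dg_diff R r'"] in \<open>simp add: diff_part diff_diff_eq\<close>)
    qed
  next
    case (scale n c r)
    then show ?thesis
    proof (cases n)
      case 0 then show ?thesis by (simp add: scale dl fp_diff_elt_0 fa.subspace_0)
    next
      case (Suc k)
      then show ?thesis using scale
        by (simp add: dl fp_diff_elt_Suc Rl elt_scale[OF S] diff_part)
    qed
  next
    case (mult m n r r')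
    let ?D = "fp_diff e \<delta> R"
    let ?I = "fp_ideal Y R S"
    have I: "fa.subspace ?I" by simp
    have eq: "?D s = ?D (elt (m + n) (r * r')) - (?D (elt m r) * elt n r' + smul ((-1) ^ m) (elt m r * ?D (elt n r')))"
      by (simp add: mult(1) dl fp_diff_mult hat_fp_part[OF elt_fp_part[OF mult(2)]])
    show ?thesis
    proof (cases "m + n")
      case 0
      then show ?thesis by (simp add: eq fp_diff_elt_0 fa.subspace_0)
    next
      case (Suc k)
      have 1: "elt k (dg_diff R r * r') - ?D (elt m r) * elt n r' \<in> ?I" (is "?a - ?a' \<in> _")
      proof (cases m)
        case 0
        then show ?thesis using mult by (simp add: fp_diff_elt_0 diff_part0 elt_zero[OF S])
      next
        case (Suc j)
        then show ?thesis using mult \<open>m + n = Suc k\<close> elt_mult[OF S, of "dg_diff R r" j r' n]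
          by (simp add: fp_diff_elt_Suc diff_part)
      qed
      have 2: "elt k (r * dg_diff R r') - elt m r * ?D (elt n r') \<in> ?I" (is "?b - ?b' \<in> _")
      proof (cases n)
        case 0
        then show ?thesis using mult by (simp add: fp_diff_elt_0 diff_part0 elt_zero[OF S])
      next
        case (Suc j)
        then show ?thesis using mult \<open>m + n = Suc k\<close> elt_mult[OF S, of r m "dg_diff R r'" j]
          by (simp add: fp_diff_elt_Suc diff_part)
      qed
      have p1: "dg_diff R r * r' \<in> dg_part R k"
      proof (cases m)
        case 0 then show ?thesis using mult by (simp add: diff_part0)
      next
        case (Suc j)
        then show ?thesis using mult \<open>m + n = Suc k\<close> mult_part[of "dg_diff R r" j r' n]
          by (simp add: diff_part)
      qed
      have p2: "r * dg_diff R r' \<in> dg_part R k"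
      proof (cases n)
        case 0 then show ?thesis using mult by (simp add: diff_part0)
      next
        case (Suc j)
        then show ?thesis using mult \<open>m + n = Suc k\<close> mult_part[of r m "dg_diff R r'" j]
          by (simp add: diff_part)
      qed
      have "?D (elt (m + n) (r * r')) = elt k (dg_diff R r * r' + dg_scale R ((-1) ^ m) (r * dg_diff R r'))"
        by (simp add: Suc fp_diff_elt_Suc diff_mult[OF mult(2)])
      moreover have "\<dots> - (?a + elt k (dg_scale R ((-1) ^ m) (r * dg_diff R r'))) \<in> ?I"
        by (rule elt_add[OF S p1]) (use p2 in \<open>auto intro: subspace_scale\<close>)
      moreover have "(?a + elt k (dg_scale R ((-1) ^ m) (r * dg_diff R r'))) - (?a' + smul ((-1) ^ m) ?b') \<in> ?I"
        by (rule fa.cong_add[OF I 1])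
          (rule fa.cong_trans[OF I elt_scale[OF S p2] fa.cong_scale[OF I 2]])
      ultimately show ?thesis
        unfolding eq using fa.cong_trans[OF I] by presburger
    qed
  next
    case one
    then show ?thesis
      by (simp add: dl fp_diff_elt_0 mon_Nil[symmetric] fa.subspace_0)
  qed
qed

text \<open>In the Leibniz expansion of the square on a word the two mixed terms cancel, which leaves
  squares on single letters. For \<open>Elt n r\<close> that is the letter of \<open>d (d r) = 0\<close>, which lies in the ideal but
  is not \<open>0\<close> in the free algebra.\<close>

lemma fp_diff_diff:
  assumes S: "elt_relations R \<subseteq> S" and x: "x \<in> adm Y R"
  shows "fp_diff e \<delta> R (fp_diff e \<delta> R x) \<in> fp_ideal Y R S"
proof (rule linear_span_into[OF linear_comp[OF linear_lin_smul linear_lin_smul] _ _ x[unfolded adm_def]])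
  fix x :: "('y, 'r, 'k) fp"
  assume "x \<in> {mon w |w. set w \<subseteq> fp_letters Y R}"
  then obtain w where w: "x = mon w" "set w \<subseteq> fp_letters Y R" by auto
  let ?D = "fp_diff e \<delta> R"
  have "?D (word_diff e \<delta> R w) \<in> fp_ideal Y R S"
    using w(2)
  proof (induction w)
    case Nil
    then show ?case by (simp add: linear_0[OF linear_lin_smul] fa.subspace_0)
  next
    case (Cons l w)
    then have l: "l \<in> fp_letters Y R" and w: "set w \<subseteq> fp_letters Y R"
      and IH: "?D (word_diff e \<delta> R w) \<in> fp_ideal Y R S" by auto
    let ?s = "(-1 :: 'k) ^ letter_deg e l"
    have hl: "hat e (letter_diff \<delta> R l) = smul (- ?s) (letter_diff \<delta> R l)"
    proof (cases "letter_deg e l")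
      case 0
      then show ?thesis using letter_diff_part(1)[OF l] by (simp add: linear_0[OF linear_hat])
    next
      case (Suc n)
      then show ?thesis using hat_fp_part[OF letter_diff_part(2)[OF l Suc]] by simp
    qed
    have hg: "hat e (gen l) = smul ?s (gen l)"
      by (simp add: gen_def)
    have dg: "?D (gen l) = letter_diff \<delta> R l"
      by (simp add: gen_def mon_Nil)
    have ddl: "?D (letter_diff \<delta> R l) \<in> fp_ideal Y R S"
    proof (cases l)
      case (Ext y)
      then show ?thesis by (simp add: fp_diff_delta fa.subspace_0)
    next
      case (Elt n r)
      show ?thesis
      proof (cases n)
        case 0 then show ?thesis by (simp add: Elt linear_0[OF linear_lin_smul] fa.subspace_0)
      next
        case (Suc j)
        then show ?thesis
          by (cases j) (simp_all add: Elt elt_def[symmetric] fp_diff_elt_0 fp_diff_elt_Suc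
              diff_diff elt_zero[OF S] fa.subspace_0)
      qed
    qed
    have "?D (word_diff e \<delta> R (l # w)) = ?D (letter_diff \<delta> R l) * mon w
        + (smul (- ?s) (letter_diff \<delta> R l * word_diff e \<delta> R w)
        + smul ?s (letter_diff \<delta> R l * word_diff e \<delta> R w)
        + gen l * ?D (word_diff e \<delta> R w))"
      by (simp add: linear_add[OF linear_lin_smul] linear_scale[OF linear_lin_smul] fp_diff_mult hl hg dg
          fa.scale_right_distrib)
    also have "\<dots> = ?D (letter_diff \<delta> R l) * mon w + gen l * ?D (word_diff e \<delta> R w)"
      by simp
    also have "\<dots> \<in> fp_ideal Y R S"
      by (intro fa.subspace_add subspace_fp_ideal fp_ideal_mult_right fp_ideal_mult_left ddl IH
          mon_adm w fp_part_adm[OF gen_fp_part] l)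
    finally show ?case .
  qed
  then show "?D (?D x) \<in> fp_ideal Y R S" by (simp add: w)
qed simp

text \<open>The differential of \<open>[u, v]\<close> is \<open>[d u, v] \<plusminus> [u, d v]\<close>.\<close>

lemma fp_diff_commutators:
  assumes x: "x \<in> graded_commutators smul (fp_part Y e R)"
  shows "fp_diff e \<delta> R x \<in> module.span smul (graded_commutators smul (fp_part Y e R))"
proof -
  let ?D = "fp_diff e \<delta> R"
  let ?C = "module.span smul (graded_commutators smul (fp_part Y e R))"
  have comm: "u * v - smul ((-1) ^ (p * q)) (v * u) \<in> ?C"
    if "u \<in> fp_part Y e R p" "v \<in> fp_part Y e R q" for u v p q
    by (rule fa.span_base) (use that in \<open>auto simp: graded_commutators_def\<close>)
  obtain p q u v where x: "x = u * v - smul ((-1) ^ (p * q)) (v * u)"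
    and u: "u \<in> fp_part Y e R p" and v: "v \<in> fp_part Y e R q"
    using x by (auto simp: graded_commutators_def)
  have eq: "?D x = (?D u * v - smul ((-1) ^ (p * q + q)) (v * ?D u))
      + smul ((-1) ^ p) (u * ?D v - smul ((-1) ^ (p * q + p)) (?D v * u))"
    by (simp add: x linear_diff[OF linear_lin_smul] linear_scale[OF linear_lin_smul] fp_diff_mult
        hat_fp_part[OF u] hat_fp_part[OF v] fa.scale_right_distrib fa.scale_right_diff_distrib
        power_add algebra_simps)
  have 1: "?D u * v - smul ((-1) ^ (p * q + q)) (v * ?D u) \<in> ?C"
  proof (cases p)
    case 0
    then show ?thesis using u by (simp add: fp_diff_part0 fa.span_zero)
  next
    case (Suc p')
    have "(-1 :: 'k) ^ (p * q + q) = (-1) ^ (p' * q)"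
      by (rule neg_one_power_cong) (auto simp: Suc)
    then show ?thesis using comm[OF fp_diff_part v] u Suc by simp
  qed
  have 2: "u * ?D v - smul ((-1) ^ (p * q + p)) (?D v * u) \<in> ?C"
  proof (cases q)
    case 0
    then show ?thesis using v by (simp add: fp_diff_part0 fa.span_zero)
  next
    case (Suc q')
    have "(-1 :: 'k) ^ (p * q + p) = (-1) ^ (p * q')"
      by (rule neg_one_power_cong) (auto simp: Suc)
    then show ?thesis using comm[OF u fp_diff_part] v Suc by simp
  qed
  show ?thesis unfolding eq by (intro fa.span_add fa.span_scale 1 2)
qed

end

end


subsection \<open>Functoriality\<close>

lemma linear_fp_map [intro, simp]: "Vector_Spaces.linear smul smul (fp_map h)"
  by (simp add: fp_map_def)

lemma fp_map_mon [simp]: "fp_map h (mon w) = mon (map (map_letter id h) w)"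
  by (simp add: fp_map_def)

lemma fp_map_mult: "fp_map h (p * q) = fp_map h p * fp_map h q"
  by (rule bilinear_eq_on_mon[where F = "\<lambda>p q. fp_map h (p * q)" and G = "\<lambda>p q. fp_map h p * fp_map h q"])
    (auto intro: linear_comp[OF linear_mult_left] linear_comp[OF linear_mult_right]
      linear_comp[OF linear_fp_map linear_mult_left] linear_comp[OF linear_fp_map linear_mult_right]
      simp: mon_mult)

lemma fp_map_one [simp]: "fp_map h 1 = 1"
  by (simp add: mon_Nil[symmetric])

lemma fp_map_elt [simp]: "fp_map h (elt n r) = elt n (h r)"
  by (simp add: elt_def gen_def)

lemma fp_map_ext [simp]: "fp_map h (gen (Ext y)) = gen (Ext y)"
  by (simp add: gen_def)

lemma letter_deg_map_letter [simp]: "letter_deg e (map_letter g h l) = letter_deg e l"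
  by (cases l) auto

lemma word_deg_map_letter [simp]: "sum_list (map (letter_deg e \<circ> map_letter g h) w) = word_deg e w"
  by (induction w) auto

lemma map_letter_fp_letters:
  assumes "\<And>n. h ` dg_part R n \<subseteq> dg_part R' n" "set w \<subseteq> fp_letters Y R"
  shows "set (map (map_letter id h) w) \<subseteq> fp_letters Y R'"
proof -
  have "map_letter id h l \<in> fp_letters Y R'" if "l \<in> fp_letters Y R" for l
    using that image_subset_iff[THEN iffD1, OF assms(1)] by (auto simp: fp_letters_def)
  then show ?thesis using assms(2) by auto
qed

lemma fp_map_part:
  assumes "\<And>n. h ` dg_part R n \<subseteq> dg_part R' n" "x \<in> fp_part Y e R n"
  shows "fp_map h x \<in> fp_part Y e R' n"
  by (rule linear_span_into[OF linear_fp_map _ _ assms(2)[unfolded fp_part_def]])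
    (auto intro!: mon_fp_part map_letter_fp_letters[OF assms(1)] simp del: set_map)

lemma fp_map_adm:
  assumes "\<And>n. h ` dg_part R n \<subseteq> dg_part R' n" "x \<in> adm Y R"
  shows "fp_map h x \<in> adm Y R'"
  by (rule linear_span_into[OF linear_fp_map _ _ assms(2)[unfolded adm_def]])
    (auto intro!: mon_adm map_letter_fp_letters[OF assms(1)] simp del: set_map)

lemma fp_map_ideal:
  assumes part: "\<And>n. h ` dg_part R n \<subseteq> dg_part R' n"
    and S: "\<And>s. s \<in> S \<Longrightarrow> fp_map h s \<in> fp_ideal Y R' S'"
    and x: "x \<in> fp_ideal Y R S"
  shows "fp_map h x \<in> fp_ideal Y R' S'"
  by (rule linear_fp_ideal_into[OF linear_fp_map _ _ x], simp, unfold fp_map_mult)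
    (intro fp_ideal_mult_right fp_ideal_mult_left S fp_map_adm[OF part] mon_adm)

lemma fp_map_elt_relations:
  assumes h: "dga_hom R R' h" and s: "s \<in> elt_relations R"
  shows "fp_map h s \<in> elt_relations R'"
proof -
  have hl: "Vector_Spaces.linear (dg_scale R) (dg_scale R') h" and h1: "h 1 = 1"
    and hm: "\<And>x y. h (x * y) = h x * h y" and hp: "\<And>n r. r \<in> dg_part R n \<Longrightarrow> h r \<in> dg_part R' n"
    using h by (auto simp: dga_hom_def image_subset_iff)
  note fl = linear_diff[OF linear_fp_map] linear_scale[OF linear_fp_map]
  from s show ?thesis
  proof (cases rule: elt_relations_cases)
    case add
    then show ?thesis
      using elt_relations_addI[OF hp hp] by (simp add: fl linear_add[OF hl])
  next
    case scale
    then show ?thesis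
      using elt_relations_scaleI[OF hp] by (simp add: fl linear_scale[OF hl])
  next
    case mult
    then show ?thesis
      using elt_relations_multI[OF hp hp] by (simp add: fl fp_map_mult hm)
  next
    case one
    then show ?thesis
      using elt_relations_oneI by (simp add: fl h1)
  qed
qed

lemma fp_map_diff:
  fixes h :: "'r \<Rightarrow> 's" and \<delta> :: "('y, 'r, 'k::field) fp"
  assumes h: "\<And>r. h (dg_diff R r) = dg_diff R' (h r)" and \<delta>: "fp_map h \<delta> = \<delta>'"
  shows "fp_map h (fp_diff e \<delta> R x) = fp_diff e \<delta>' R' (fp_map h x)"
proof (rule linear_eq_on_mon[OF linear_comp[OF linear_lin_smul linear_fp_map] linear_comp[OF linear_fp_map linear_lin_smul]])
  fix w
  have "fp_map h (letter_diff \<delta> R l) = letter_diff \<delta>' R' (map_letter id h l)" for l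
  proof (cases l)
    case (Elt n r)
    then show ?thesis by (cases n) (simp_all add: elt_def[symmetric] h linear_0[OF linear_fp_map])
  qed (simp add: \<delta>)
  moreover have "fp_map h (gen l :: ('y, 'r, 'k) fp) = gen (map_letter id h l)" for l by (simp add: gen_def)
  ultimately have "fp_map h (word_diff e \<delta> R w) = word_diff e \<delta>' R' (map (map_letter id h) w)"
    by (induction w)
      (simp_all add: linear_0[OF linear_fp_map] linear_add[OF linear_fp_map] linear_scale[OF linear_fp_map]
        fp_map_mult)
  then show "fp_map h (fp_diff e \<delta> R (mon w)) = fp_diff e \<delta>' R' (fp_map h (mon w))" by simp
qed

lemma fp_map_commutators:
  assumes "\<And>n. h ` dg_part R n \<subseteq> dg_part R' n" "x \<in> graded_commutators smul (fp_part Y e R)"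
  shows "fp_map h x \<in> graded_commutators smul (fp_part Y e R')"
proof -
  obtain p q u v where x: "x = u * v - smul ((-1) ^ (p * q)) (v * u)"
    and u: "u \<in> fp_part Y e R p" and v: "v \<in> fp_part Y e R q"
    using assms(2) by (auto simp: graded_commutators_def)
  have "fp_map h x = fp_map h u * fp_map h v - smul ((-1) ^ (p * q)) (fp_map h v * fp_map h u)"
    by (simp add: x linear_diff[OF linear_fp_map] linear_scale[OF linear_fp_map] fp_map_mult)
  then show ?thesis
    using fp_map_part[OF assms(1) u] fp_map_part[OF assms(1) v]
    by (auto simp: graded_commutators_def)
qed


section \<open>Convolution, cyclic sums and the Hochschild differential\<close>

text \<open>Functions on words play the role of cochains on the bar construction of an algebra with values in another
  one, and this is their convolution (cup) product, over all cuts into two nonempty pieces.\<close>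

definition conv :: "('a list \<Rightarrow> ('x, 'k::field) free_alg) \<Rightarrow> ('a list \<Rightarrow> ('x, 'k) free_alg) \<Rightarrow>
    'a list \<Rightarrow> ('x, 'k) free_alg"
  where "conv \<phi> \<psi> w = (\<Sum>i=1..<length w. \<phi> (take i w) * \<psi> (drop i w))"

text \<open>The norm operator for the cyclic group action used in Connes' complex.\<close>

definition cyc :: "('a list \<Rightarrow> ('x, 'k::field) free_alg) \<Rightarrow> 'a list \<Rightarrow> ('x, 'k) free_alg"
  where "cyc \<phi> w = (\<Sum>j<length w. smul ((-1) ^ ((length w - 1) * j)) (\<phi> (rotate j w)))"

text \<open>Precomposition with the differential of the bar construction, which multiplies adjacent letters
  but not the last letter with the first.\<close>

definition bar :: "('a::times list \<Rightarrow> ('x, 'k::field) free_alg) \<Rightarrow> 'a list \<Rightarrow> ('x, 'k) free_alg"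
  where "bar \<phi> w = (\<Sum>i<length w - 1. smul ((-1) ^ i) (\<phi> (contract i w)))"

text \<open>The Koszul sign for an operator of odd degree passing a cochain of a word.\<close>

definition twist :: "('a list \<Rightarrow> ('x, 'k::field) free_alg) \<Rightarrow> 'a list \<Rightarrow> ('x, 'k) free_alg"
  where "twist \<phi> w = smul ((-1) ^ length w) (\<phi> w)"

text \<open>The exponent is off by one, \<open>cpow \<phi> p\<close> being the product of \<open>p + 1\<close> factors, because convolution over
  nonempty pieces has no unit.\<close>

primrec cpow :: "('a list \<Rightarrow> ('x, 'k::field) free_alg) \<Rightarrow> nat \<Rightarrow> 'a list \<Rightarrow> ('x, 'k) free_alg" where
  "cpow \<phi> 0 = \<phi>"
| "cpow \<phi> (Suc p) = conv (cpow \<phi> p) \<phi>"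

lemma conv_assoc: "conv (conv \<phi> \<psi>) \<chi> = conv \<phi> (conv \<psi> \<chi>)"
proof
  fix w :: "'a list"
  let ?N = "length w"
  have "conv (conv \<phi> \<psi>) \<chi> w
      = (\<Sum>i=1..<?N. \<Sum>j=1..<i. \<phi> (take j w) * \<psi> (drop j (take i w)) * \<chi> (drop i w))"
    unfolding conv_def by (auto simp: sum_distrib_right min_def intro!: sum.cong)
  also have "\<dots> = (\<Sum>(i, j)\<in>(SIGMA i:{1..<?N}. {1..<i}).
      \<phi> (take j w) * \<psi> (drop j (take i w)) * \<chi> (drop i w))"
    by (rule sum.Sigma) auto
  also have "\<dots> = (\<Sum>(j, k)\<in>(SIGMA j:{1..<?N}. {1..<?N - j}).
      \<phi> (take j w) * (\<psi> (take k (drop j w)) * \<chi> (drop k (drop j w))))"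
    by (rule sum.reindex_bij_witness[where i = "\<lambda>(j, k). (j + k, j)" and j = "\<lambda>(i, j). (j, i - j)"])
      (auto simp: mult.assoc drop_take)
  also have "\<dots> = (\<Sum>j=1..<?N. \<Sum>k=1..<?N - j.
      \<phi> (take j w) * (\<psi> (take k (drop j w)) * \<chi> (drop k (drop j w))))"
    by (rule sum.Sigma[symmetric]) auto
  also have "\<dots> = conv \<phi> (conv \<psi> \<chi>) w"
    unfolding conv_def by (auto simp: sum_distrib_left intro!: sum.cong)
  finally show "conv (conv \<phi> \<psi>) \<chi> w = conv \<phi> (conv \<psi> \<chi>) w" .
qed

lemma conv_cpow: "conv (cpow \<phi> p) (cpow \<phi> q) = cpow \<phi> (p + q + 1)"
  by (induction q) (simp_all add: conv_assoc[symmetric])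

lemma conv_cpow_left: "conv \<phi> (cpow \<phi> p) = cpow \<phi> (Suc p)"
  using conv_cpow[of \<phi> 0 p] by simp

lemma twist_conv: "twist (conv \<phi> \<psi>) = conv (twist \<phi>) (twist \<psi>)"
  by (rule ext) (auto simp: twist_def conv_def fa.scale_sum_right power_add[symmetric] intro!: sum.cong)

lemma twist_cpow: "twist (cpow \<phi> p) = cpow (twist \<phi>) p"
  by (induction p) (simp_all add: twist_conv)

text \<open>Each factor uses up at least one letter.\<close>

lemma cpow_short: "p \<ge> 1 \<Longrightarrow> length w \<le> p \<Longrightarrow> cpow \<phi> p w = 0"
proof (induction p arbitrary: w)
  case 0 then show ?case by simp
next
  case (Suc p)
  show ?case
  proof (cases p)
    case 0
    then show ?thesis using Suc.prems by (simp add: conv_def)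
  next
    case (Suc q)
    have "cpow \<phi> p (take i w) = 0" if "i \<in> {1..<length w}" for i
      by (rule Suc.IH) (use that Suc Suc.prems in auto)
    then show ?thesis unfolding cpow.simps(2) conv_def by (intro sum.neutral) auto
  qed
qed

lemma conv_add_right: "conv \<phi> (\<lambda>w. \<psi> w + \<psi>' w) w = conv \<phi> \<psi> w + conv \<phi> \<psi>' w"
  by (simp add: conv_def algebra_simps sum.distrib)

lemma conv_diff_right: "conv \<phi> (\<lambda>w. \<psi> w - \<psi>' w) w = conv \<phi> \<psi> w - conv \<phi> \<psi>' w"
  by (simp add: conv_def algebra_simps sum_subtractf)

lemma cyc_add: "cyc (\<lambda>w. \<phi> w + \<psi> w) w = cyc \<phi> w + cyc \<psi> w"
  by (simp add: cyc_def fa.scale_right_distrib sum.distrib)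

lemma cyc_diff: "cyc (\<lambda>w. \<phi> w - \<psi> w) w = cyc \<phi> w - cyc \<psi> w"
  by (simp add: cyc_def fa.scale_right_diff_distrib sum_subtractf)

lemma cyc_linear: "Vector_Spaces.linear smul smul F \<Longrightarrow> F (cyc \<phi> w) = cyc (\<lambda>v. F (\<phi> v)) w"
  by (simp add: cyc_def linear_sum linear_scale)

lemma cyc_cong_mod:
  assumes "fa.subspace K" "\<And>v. v \<noteq> [] \<Longrightarrow> length v = length w \<Longrightarrow> \<phi> v - \<psi> v \<in> K"
  shows "cyc \<phi> w - cyc \<psi> w \<in> K"
  unfolding cyc_def
  by (rule fa.cong_sum[OF assms(1)], rule fa.cong_scale[OF assms(1)], rule assms(2)) auto

lemma cyc_into:
  assumes "fa.subspace K" "\<And>v. v \<noteq> [] \<Longrightarrow> length v = length w \<Longrightarrow> \<phi> v \<in> K"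
  shows "cyc \<phi> w \<in> K"
  unfolding cyc_def
  by (rule fa.subspace_sum[OF assms(1)], rule fa.subspace_scale[OF assms(1)], rule assms(2)) auto

lemma conv_into:
  assumes "fa.subspace K"
    and "\<And>u v. u \<noteq> [] \<Longrightarrow> v \<noteq> [] \<Longrightarrow> length u + length v = length w \<Longrightarrow> \<phi> u * \<psi> v \<in> K"
  shows "conv \<phi> \<psi> w \<in> K"
  unfolding conv_def
  by (rule fa.subspace_sum[OF assms(1)], rule assms(2)) auto

lemma conv_cong_mod:
  assumes "fa.subspace K"
    and "\<And>u v. u \<noteq> [] \<Longrightarrow> v \<noteq> [] \<Longrightarrow> \<phi> u * \<psi> v - \<phi>' u * \<psi>' v \<in> K"
  shows "conv \<phi> \<psi> w - conv \<phi>' \<psi>' w \<in> K"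
  unfolding conv_def
  by (rule fa.cong_sum[OF assms(1)], rule assms(2)) auto

lemma neg_one_power_mod:
  assumes "even (M * N)"
  shows "(-1 :: 'k::field) ^ (M * (a mod N)) = (-1) ^ (M * a)"
proof (rule neg_one_power_cong)
  have "M * a = M * (a mod N) + M * N * (a div N)"
    by (metis add.commute distrib_left mult.assoc mult_div_mod_eq)
  then show "even (M * (a mod N) + M * a)" using assms by auto
qed

text \<open>The graded trace property. A cut of a rotation of \<open>w\<close> is a pair of arcs of the cyclic word, and
  exchanging the arcs is an involution on the summands that changes the sign of the rotation by the
  Koszul sign of the lengths. The cochains on the two sides may differ, since exchanging
  factors whose degree differs from the length of the word produces twists.\<close>

lemma cyc_conv_swap:
  fixes \<phi> \<psi> \<phi>' \<psi>' :: "'a list \<Rightarrow> ('x, 'k::field) free_alg"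
  assumes K: "fa.subspace K"
    and comm: "\<And>u v. u \<noteq> [] \<Longrightarrow> v \<noteq> [] \<Longrightarrow>
      \<phi> u * \<psi> v - smul ((-1) ^ (length u * length v)) (\<psi>' v * \<phi>' u) \<in> K"
  shows "cyc (conv \<phi> \<psi>) w - cyc (conv \<psi>' \<phi>') w \<in> K"
proof -
  let ?N = "length w"
  let ?A = "{..<?N} \<times> {1..<?N}"
  let ?s = "\<lambda>j. (-1 :: 'k) ^ ((?N - 1) * j)"
  have 1: "cyc (conv \<phi> \<psi>) w = (\<Sum>(j, i)\<in>?A.
      smul (?s j) (\<phi> (take i (rotate j w)) * \<psi> (drop i (rotate j w))))"
    unfolding cyc_def conv_def by (simp add: fa.scale_sum_right sum.cartesian_product)
  \<comment> \<open>The second arc, of length \<open>?N - i\<close>, becomes the first one and starts \<open>i\<close> letters later.\<close>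
  let ?f = "\<lambda>(j, i). ((j + i) mod ?N, ?N - i)"
  have mem: "?f a \<in> ?A" and inv: "?f (?f a) = a" if a: "a \<in> ?A" for a
  proof -
    obtain j i where [simp]: "a = (j, i)" and ji: "j < ?N" "1 \<le> i" "i < ?N" using a by auto
    have "((j + i) mod ?N + (?N - i)) mod ?N = (j + i + (?N - i)) mod ?N" by (rule mod_add_left_eq)
    also have "\<dots> = j" using ji by simp
    finally show "?f (?f a) = a" using ji by simp
    have "(j + i) mod ?N < ?N" by (rule mod_less_divisor) (use ji in linarith)
    then show "?f a \<in> ?A" using ji by auto
  qed
  have "cyc (conv \<psi>' \<phi>') w = (\<Sum>(j, i)\<in>?A.
      smul (?s j) (\<psi>' (take i (rotate j w)) * \<phi>' (drop i (rotate j w))))"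
    unfolding cyc_def conv_def by (simp add: fa.scale_sum_right sum.cartesian_product)
  also have "\<dots> = (\<Sum>(j, i)\<in>?A.
      smul (?s j) (smul ((-1) ^ (i * (?N - i))) (\<psi>' (drop i (rotate j w)) * \<phi>' (take i (rotate j w)))))"
  proof (rule sum.reindex_bij_witness[where i = "\<lambda>(j, i). ((j + i) mod ?N, ?N - i)"
        and j = "\<lambda>(j, i). ((j + i) mod ?N, ?N - i)"])
    fix a assume a: "a \<in> ?A"
    then obtain j i where [simp]: "a = (j, i)" and ji: "j < ?N" "1 \<le> i" "i < ?N" by auto
    show "?f (?f a) = a" "?f a \<in> ?A" using a by (rule inv, rule mem)
    let ?r = "rotate j w"
    have rot: "rotate ((j + i) mod ?N) w = drop i ?r @ take i ?r"
    proof -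
      have "rotate ((j + i) mod ?N) w = rotate i ?r"
        by (metis add.commute rotate_conv_mod rotate_rotate)
      then show ?thesis using ji by (simp add: rotate_drop_take)
    qed
    have "?s ((j + i) mod ?N) * (-1) ^ ((?N - i) * (?N - (?N - i))) = ?s j"
    proof -
      obtain m where m: "?N = m + i" "m > 0" using ji by (metis add.commute le_add_diff_inverse less_imp_le_nat zero_less_diff)
      obtain m' where m': "m = Suc m'" using m by (cases m) auto
      have "?s ((j + i) mod ?N) = ?s (j + i)"
        by (rule neg_one_power_mod) (auto simp: m m')
      then have "?s ((j + i) mod ?N) * (-1) ^ ((?N - i) * (?N - (?N - i))) = (-1) ^ ((m' + i) * (j + i) + m * i)"
        using m m' by (simp add: power_add)
      also have "\<dots> = ?s j"
        by (rule neg_one_power_cong) (auto simp: m m')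
      finally show ?thesis .
    qed
    then have s: "?s ((j + i) mod ?N) * (-1) ^ ((?N - i) * i) = ?s j"
      using ji by simp
    show "(case (case a of (j, i) \<Rightarrow> ((j + i) mod ?N, ?N - i)) of (j, i) \<Rightarrow>
          smul (?s j) (smul ((-1) ^ (i * (?N - i)))
           (\<psi>' (drop i (rotate j w)) * \<phi>' (take i (rotate j w)))))
        = (case a of (j, i) \<Rightarrow> smul (?s j) (\<psi>' (take i (rotate j w)) * \<phi>' (drop i (rotate j w))))"
      using ji s by (simp add: rot)
  qed (rule inv mem; assumption)+
  finally have 2: "cyc (conv \<psi>' \<phi>') w = (\<Sum>(j, i)\<in>?A. smul (?s j) (smul ((-1) ^ (i * (?N - i)))
      (\<psi>' (drop i (rotate j w)) * \<phi>' (take i (rotate j w)))))" .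
  show ?thesis unfolding 1 2 case_prod_unfold
  proof (rule fa.cong_sum[OF K], rule fa.cong_scale[OF K])
    fix a assume "a \<in> ?A"
    then obtain j i where [simp]: "a = (j, i)" and ji: "j < ?N" "1 \<le> i" "i < ?N" by auto
    have "length (take i (rotate j w)) = i" "length (drop i (rotate j w)) = ?N - i" using ji by auto
    then show "\<phi> (take (snd a) (rotate (fst a) w)) * \<psi> (drop (snd a) (rotate (fst a) w))
      - smul ((-1) ^ (snd a * (?N - snd a))) (\<psi>' (drop (snd a) (rotate (fst a) w)) *
          \<phi>' (take (snd a) (rotate (fst a) w))) \<in> K"
      using comm[of "take i (rotate j w)" "drop i (rotate j w)"] ji
      by (metis \<open>a = (j, i)\<close> fst_conv length_greater_0_conv less_le_trans snd_conv zero_less_diff zero_less_one)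
  qed
qed

text \<open>Rotating the argument permutes the summands, so that cyclic sums respect the relations of Connes'
  complex.\<close>

lemma cyc_rotate1:
  fixes \<phi> :: "'a list \<Rightarrow> ('x, 'k::field) free_alg"
  shows "cyc \<phi> (rotate1 w) = smul ((-1) ^ (length w - 1)) (cyc \<phi> w)"
proof (cases "w = []")
  case False
  let ?N = "length w"
  let ?s = "\<lambda>j. (-1 :: 'k) ^ ((?N - 1) * j)"
  have "cyc \<phi> (rotate1 w) = (\<Sum>j<?N. smul (?s j) (\<phi> (rotate (Suc j) w)))"
    by (simp add: cyc_def rotate1_rotate_swap)
  also have "\<dots> = (\<Sum>j<?N. smul ((-1) ^ (?N - 1)) (smul (?s j) (\<phi> (rotate j w))))"
  proof (rule sum.reindex_bij_witness[where i = "\<lambda>j. (j + (?N - 1)) mod ?N" and j = "\<lambda>j. Suc j mod ?N"])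
    fix j assume "j \<in> {..<?N}"
    then have j: "j < ?N" by simp
    show "(Suc j mod ?N + (?N - 1)) mod ?N = j"
    proof -
      have "(Suc j mod ?N + (?N - 1)) mod ?N = (Suc j + (?N - 1)) mod ?N" by (rule mod_add_left_eq)
      also have "Suc j + (?N - 1) = j + ?N" using j by simp
      finally show ?thesis using j by simp
    qed
    show "Suc ((j + (?N - 1)) mod ?N) mod ?N = j"
    proof -
      have "Suc (j + (?N - 1)) = j + ?N" using j by simp
      then show ?thesis using j by (simp only: mod_Suc_eq) simp
    qed
    have "0 < ?N" using j by linarith
    then show "Suc j mod ?N \<in> {..<?N}" "(j + (?N - 1)) mod ?N \<in> {..<?N}"
      by (simp_all only: lessThan_iff mod_less_divisor)
    have "rotate (Suc j mod ?N) w = rotate (Suc j) w" by (simp add: rotate_conv_mod[symmetric])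
    moreover have "(-1 :: 'k) ^ (?N - 1) * ?s (Suc j mod ?N) = ?s j"
    proof -
      have "?s (Suc j mod ?N) = ?s (Suc j)"
        by (rule neg_one_power_mod) (use j in \<open>cases ?N; auto\<close>)
      then show ?thesis by (simp add: power_add[symmetric]) (rule neg_one_power_cong, auto)
    qed
    ultimately show "smul ((-1) ^ (?N - 1)) (smul (?s (Suc j mod ?N)) (\<phi> (rotate (Suc j mod ?N) w)))
        = smul (?s j) (\<phi> (rotate (Suc j) w))"
      by simp
  qed
  finally show ?thesis by (simp add: cyc_def fa.scale_sum_right)
qed (simp add: cyc_def)

lemma cyc_last_butlast:
  assumes "w \<noteq> []"
  shows "cyc \<phi> w = smul ((-1) ^ (length w - 1)) (cyc \<phi> (last w # butlast w))"
proof -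
  have "rotate1 (last w # butlast w) = w" using assms by simp
  then show ?thesis using cyc_rotate1[of \<phi> "last w # butlast w"] assms by simp
qed

lemma length_contract: "Suc i < length w \<Longrightarrow> length (contract i w) = length w - 1"
  by (simp add: contract_def)

lemma nth_contract:
  assumes "Suc i < length w" "k < length w - 1"
  shows "contract i w ! k = (if k < i then w ! k else if k = i then w ! i * w ! Suc i else w ! Suc k)"
proof -
  have "take i w ! k = w ! k" if "k < i" using that by simp
  moreover have "drop (i + 2) w ! (k - Suc i) = w ! Suc k" if "k > i"
    using that assms by simp
  ultimately show ?thesis
    using assms by (auto simp: contract_def nth_append nth_Cons')
qed

lemma mod_less_twice: "(x::nat) < 2 * N \<Longrightarrow> x mod N = (if x < N then x else x - N)"
  by (simp add: mod_if)

text \<open>Adjacent letters of a rotation of \<open>w\<close> are adjacent in the cyclic word. The three cases are that they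
  come from the part of \<open>w\<close> moved to the front, that they are the last and the first letter of \<open>w\<close>, and that they
  come from the part moved to the end.\<close>

lemma contract_rotate:
  assumes "i < length w - 1" "j < length w"
  shows "i + j < length w - 1 \<Longrightarrow> contract i (rotate j w) = rotate j (contract (i + j) w)"
    and "i + j = length w - 1 \<Longrightarrow>
        contract i (rotate j w) = rotate j ((last w * hd w) # butlast (tl w))"
    and "i + j \<ge> length w \<Longrightarrow>
        contract i (rotate j w) = rotate (j - 1) (contract (i + j - length w) w)"
proof -
  let ?N = "length w"
  have N: "?N \<ge> 2" using assms by simp
  have L: "contract i (rotate j w) ! k = (if k < i then w ! ((j + k) mod ?N)
      else if k = i then w ! ((j + i) mod ?N) * w ! ((j + Suc i) mod ?N) else w ! ((j + Suc k) mod ?N))"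
    if "k < ?N - 1" for k
    using that assms by (simp add: nth_contract nth_rotate)
  show "contract i (rotate j w) = rotate j (contract (i + j) w)" if ij: "i + j < ?N - 1"
  proof (rule nth_equalityI)
    show "length (contract i (rotate j w)) = length (rotate j (contract (i + j) w))"
      using ij assms by (simp add: length_contract)
    fix k assume "k < length (contract i (rotate j w))"
    then have k: "k < ?N - 1" using assms by (simp add: length_contract)
    have "rotate j (contract (i + j) w) ! k = contract (i + j) w ! ((j + k) mod (?N - 1))"
      using k ij by (simp add: nth_rotate length_contract)
    also have "\<dots> = (if j + k < ?N - 1 then contract (i + j) w ! (j + k)
        else contract (i + j) w ! (j + k - (?N - 1)))"
      by (subst mod_less_twice) (use k ij in auto)
    also have "\<dots> = contract i (rotate j w) ! k"
      unfolding L[OF k] using k ij assms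
      by (auto simp: nth_contract mod_less_twice add.commute split: if_splits)
    finally show "contract i (rotate j w) ! k = rotate j (contract (i + j) w) ! k" by simp
  qed
  show "contract i (rotate j w) = rotate (j - 1) (contract (i + j - ?N) w)" if ij: "i + j \<ge> ?N"
  proof (rule nth_equalityI)
    have j: "j \<ge> 2" "Suc (i + j - ?N) < ?N" using ij assms by auto
    show "length (contract i (rotate j w)) = length (rotate (j - 1) (contract (i + j - ?N) w))"
      using ij assms j by (simp add: length_contract)
    fix k assume "k < length (contract i (rotate j w))"
    then have k: "k < ?N - 1" using assms by (simp add: length_contract)
    have "rotate (j - 1) (contract (i + j - ?N) w) ! k = contract (i + j - ?N) w ! ((j - 1 + k) mod (?N - 1))"
      using k ij j by (simp add: nth_rotate length_contract)
    also have "\<dots> = (if j - 1 + k < ?N - 1 then contract (i + j - ?N) w ! (j - 1 + k)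
        else contract (i + j - ?N) w ! (j - 1 + k - (?N - 1)))"
      by (subst mod_less_twice) (use k ij assms in auto)
    also have "\<dots> = contract i (rotate j w) ! k"
    proof (cases "j - 1 + k < ?N - 1")
      case True
      then have "k < i" "j + k < ?N" "j - 1 + k > i + j - ?N" using ij j assms by auto
      then show ?thesis unfolding L[OF k] using True j by (simp add: nth_contract)
    next
      case False
      define m where "m = j - 1 + k - (?N - 1)"
      have m: "m + ?N = j + k" using False j unfolding m_def by simp
      have mN: "m < ?N - 1" using m k assms by simp
      have *: "(j + k) mod ?N = m" "(j + Suc k) mod ?N = Suc m" "k = i \<Longrightarrow> (j + i) mod ?N = m"
        "k = i \<Longrightarrow> (j + Suc i) mod ?N = Suc m" "k < i \<longleftrightarrow> m < i + j - ?N" "k = i \<longleftrightarrow> m = i + j - ?N"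
        using m mN k assms ij by (auto simp: mod_less_twice)
      show ?thesis unfolding L[OF k] m_def[symmetric] using False * j mN
        by (auto simp: nth_contract)
    qed
    finally show "contract i (rotate j w) ! k = rotate (j - 1) (contract (i + j - ?N) w) ! k" by simp
  qed
  show "contract i (rotate j w) = rotate j ((last w * hd w) # butlast (tl w))" if ij: "i + j = ?N - 1"
  proof (rule nth_equalityI)
    let ?c = "(last w * hd w) # butlast (tl w)"
    have lc: "length ?c = ?N - 1" using N by simp
    have wn: "w \<noteq> []" using N by auto
    have c: "?c ! m = (if m = 0 then w ! (?N - 1) * w ! 0 else w ! m)" if "m < ?N - 1" for m
    proof (cases m)
      case 0 then show ?thesis using wn by (simp add: last_conv_nth hd_conv_nth)
    next
      case (Suc m')
      then show ?thesis using that by (simp add: nth_butlast nth_tl)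
    qed
    show "length (contract i (rotate j w)) = length (rotate j ?c)"
      using assms lc by (simp add: length_contract)
    fix k assume "k < length (contract i (rotate j w))"
    then have k: "k < ?N - 1" using assms by (simp add: length_contract)
    have "rotate j ?c ! k = ?c ! ((j + k) mod (?N - 1))"
      using k lc by (simp add: nth_rotate)
    also have "\<dots> = (if j + k < ?N - 1 then ?c ! (j + k) else ?c ! (j + k - (?N - 1)))"
      by (subst mod_less_twice) (use k ij assms in auto)
    also have "\<dots> = contract i (rotate j w) ! k"
    proof (cases "j + k < ?N - 1")
      case True
      then have "k < i" "j \<noteq> 0" using ij assms by auto
      then show ?thesis unfolding L[OF k] if_P[OF True] c[OF True] using True by simp
    next
      case False
      define m where "m = j + k - (?N - 1)"
      have m: "Suc m + ?N = Suc (Suc (j + k))" "m + i = k" using False ij N unfolding m_def by auto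
      then have mN: "m < ?N - 1" using k by simp
      show ?thesis
      proof (cases "m = 0")
        case True
        then have "k = i" using m by simp
        moreover have "(j + i) mod ?N = ?N - 1" "(j + Suc i) mod ?N = 0"
        proof -
          have "j + i = ?N - 1" "j + Suc i = ?N" using ij N by auto
          then show "(j + i) mod ?N = ?N - 1" "(j + Suc i) mod ?N = 0" using N by auto
        qed
        ultimately show ?thesis
          unfolding L[OF k] m_def[symmetric] if_not_P[OF False] c[OF mN] using True by simp
      next
        case mpos: False
        then have "\<not> k < i" "k \<noteq> i" using m by auto
        moreover have "(j + Suc k) mod ?N = m" using m mN by (simp add: mod_less_twice)
        ultimately show ?thesis
          unfolding L[OF k] m_def[symmetric] if_not_P[OF False] c[OF mN] using mpos by simp
      qed
    qed
    finally show "contract i (rotate j w) ! k = rotate j ?c ! k" by simp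
  qed
qed

lemma lin_hochschild_word:
  assumes "length w \<ge> 2"
  shows "lin smul \<phi> (hochschild_word w) = bar \<phi> w
    + smul ((-1) ^ (length w - 1)) (\<phi> ((last w * hd w) # butlast (tl w)))"
  using assms
  by (simp add: hochschild_word_def Let_def bar_def linear_add[OF linear_lin_smul]
      linear_sum[OF linear_lin_smul] linear_scale[OF linear_lin_smul])

text \<open>Summing over rotations, every pair of neighbours in the cyclic word gets multiplied, including the
  last and the first letter. The summands on the two sides match by the bijection of
  \<open>contract_rotate\<close>, where the pair \<open>(last, first)\<close> has the index \<open>length w - 1\<close>.\<close>

lemma cyc_bar:
  fixes \<phi> :: "'a::ring list \<Rightarrow> ('x, 'k::field) free_alg"
  shows "cyc (bar \<phi>) w = lin smul (cyc \<phi>) (hochschild_word w)"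
proof (cases "length w \<ge> 2")
  case False
  then have "length w = 0 \<or> length w = 1" by linarith
  then show ?thesis
    by (auto simp: cyc_def bar_def hochschild_word_def linear_0[OF linear_lin_smul])
next
  case True
  let ?N = "length w"
  let ?c = "(last w * hd w) # butlast (tl w)"
  let ?v = "\<lambda>i. if i < ?N - 1 then contract i w else ?c"
  have lc: "length ?c = ?N - 1" using True by simp
  have "cyc (bar \<phi>) w = (\<Sum>(j, i)\<in>{..<?N} \<times> {..<?N - 1}.
      smul ((-1) ^ ((?N - 1) * j)) (smul ((-1) ^ i) (\<phi> (contract i (rotate j w)))))"
    by (simp add: cyc_def bar_def fa.scale_sum_right sum.cartesian_product del: fa.scale_scale)
  also have "\<dots> = (\<Sum>(i, j)\<in>{..<?N} \<times> {..<?N - 1}.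
      smul ((-1) ^ i) (smul ((-1) ^ ((?N - 2) * j)) (\<phi> (rotate j (?v i)))))"
  proof (rule sum.reindex_bij_witness[where
        j = "\<lambda>(j, i). ((i + j) mod ?N, if i + j < ?N - 1 then j else if i + j = ?N - 1 then j mod (?N - 1) else j - 1)"
        and i = "\<lambda>(i, j). if i < ?N - 1 then (if j \<le> i then (j, i - j) else (j + 1, i + ?N - j - 1))
            else (if j = 0 then (?N - 1, 0) else (j, ?N - 1 - j))"])
    fix a assume "a \<in> {..<?N} \<times> {..<?N - 1}"
    then obtain j i where a: "a = (j, i)" and j: "j < ?N" and i: "i < ?N - 1" by auto
    let ?a' = "\<lambda>(j, i). ((i + j) mod ?N, if i + j < ?N - 1 then j else if i + j = ?N - 1 then j mod (?N - 1) else j - 1)"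
    consider (1) "i + j < ?N - 1" | (2) "i + j = ?N - 1" "i = 0" | (3) "i + j = ?N - 1" "i > 0" | (4) "i + j \<ge> ?N"
      by linarith
    then have "(case ?a' a of (i, j) \<Rightarrow> if i < ?N - 1 then (if j \<le> i then (j, i - j) else (j + 1, i + ?N - j - 1))
            else (if j = 0 then (?N - 1, 0) else (j, ?N - 1 - j))) = a \<and>
          ?a' a \<in> {..<?N} \<times> {..<?N - 1} \<and>
          (case ?a' a of (i, j) \<Rightarrow> smul ((-1) ^ i) (smul ((-1) ^ ((?N - 2) * j)) (\<phi> (rotate j (?v i)))))
          = (case a of (j, i) \<Rightarrow> smul ((-1) ^ ((?N - 1) * j)) (smul ((-1) ^ i) (\<phi> (contract i (rotate j w)))))"
    proof cases
      case 1
      have "(-1 :: 'k) ^ (i + j) * (-1) ^ ((?N - 2) * j) = (-1) ^ ((?N - 1) * j) * (-1) ^ i"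
        unfolding power_add[symmetric]
        by (rule neg_one_power_cong) (use True in \<open>auto simp: less_iff_Suc_add le_iff_add\<close>)
      then show ?thesis using 1 i j a contract_rotate(1)[OF i j] by simp
    next
      case 2
      then have "j = ?N - 1" by simp
      moreover have "rotate j ?c = ?c" using \<open>j = ?N - 1\<close> lc by (metis mod_self rotate0 rotate_conv_mod id_apply)
      moreover have "(-1 :: 'k) ^ (?N - 1) = (-1) ^ ((?N - 1) * (?N - 1))"
        by (rule neg_one_power_cong) auto
      ultimately show ?thesis using 2 i j a contract_rotate(2)[OF i j] by simp
    next
      case 3
      have "(-1 :: 'k) ^ (?N - 1) * (-1) ^ ((?N - 2) * j) = (-1) ^ ((?N - 1) * j) * (-1) ^ i"
        unfolding power_add[symmetric]
        by (rule neg_one_power_cong) (use True 3 in \<open>auto simp: le_iff_add; presburger\<close>)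
      then show ?thesis using 3 i j a contract_rotate(2)[OF i j] by auto
    next
      case 4
      have "(-1 :: 'k) ^ (i + j - ?N) * (-1) ^ ((?N - 2) * (j - 1)) = (-1) ^ ((?N - 1) * j) * (-1) ^ i"
        unfolding power_add[symmetric]
        by (rule neg_one_power_cong) (use True 4 i j in \<open>cases j; auto simp: le_iff_add\<close>)
      then show ?thesis using 4 i j a contract_rotate(3)[OF i j] by (auto simp: mod_less_twice)
    qed
    then show "(\<lambda>(i, j). if i < ?N - 1 then (if j \<le> i then (j, i - j) else (j + 1, i + ?N - j - 1))
            else (if j = 0 then (?N - 1, 0) else (j, ?N - 1 - j))) (?a' a) = a"
      and "?a' a \<in> {..<?N} \<times> {..<?N - 1}"
      and "(case ?a' a of (i, j) \<Rightarrow> smul ((-1) ^ i) (smul ((-1) ^ ((?N - 2) * j)) (\<phi> (rotate j (?v i)))))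
          = (case a of (j, i) \<Rightarrow> smul ((-1) ^ ((?N - 1) * j)) (smul ((-1) ^ i) (\<phi> (contract i (rotate j w)))))"
      by blast+
  next
    fix b assume "b \<in> {..<?N} \<times> {..<?N - 1}"
    then obtain i j where b: "b = (i, j)" and i: "i < ?N" and j: "j < ?N - 1" by auto
    consider "i < ?N - 1" "j \<le> i" | "i < ?N - 1" "j > i" | "i = ?N - 1" "j = 0" | "i = ?N - 1" "j > 0"
      using i by linarith
    then show "(\<lambda>(j, i). ((i + j) mod ?N, if i + j < ?N - 1 then j else if i + j = ?N - 1 then j mod (?N - 1) else j - 1))
          ((\<lambda>(i, j). if i < ?N - 1 then (if j \<le> i then (j, i - j) else (j + 1, i + ?N - j - 1))
            else (if j = 0 then (?N - 1, 0) else (j, ?N - 1 - j))) b) = b"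
      and "(\<lambda>(i, j). if i < ?N - 1 then (if j \<le> i then (j, i - j) else (j + 1, i + ?N - j - 1))
            else (if j = 0 then (?N - 1, 0) else (j, ?N - 1 - j))) b \<in> {..<?N} \<times> {..<?N - 1}"
      using b i j by (cases; auto simp: mod_less_twice)+
  qed
  also have "\<dots> = (\<Sum>i<?N. smul ((-1) ^ i) (cyc \<phi> (?v i)))"
  proof -
    have "length (?v i) = ?N - 1" for i using lc by (simp add: length_contract)
    then show ?thesis
      by (simp add: cyc_def fa.scale_sum_right sum.cartesian_product[symmetric] numeral_2_eq_2
          del: fa.scale_scale cong: if_cong)
  qed
  also have "\<dots> = (\<Sum>i<?N - 1. smul ((-1) ^ i) (cyc \<phi> (contract i w))) + smul ((-1) ^ (?N - 1)) (cyc \<phi> ?c)"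
  proof -
    have "{..<?N} = insert (?N - 1) {..<?N - 1}" using True by auto
    then show ?thesis by (simp add: add.commute)
  qed
  finally show ?thesis using lin_hochschild_word[OF True, of "cyc \<phi>"] by (simp add: bar_def)
qed

text \<open>The product of two neighbours lies in one of the two pieces of a cut.\<close>

lemma bar_conv: "bar (conv \<phi> \<psi>) w = conv (bar \<phi>) \<psi> w + conv (twist \<phi>) (bar \<psi>) w"
proof -
  let ?N = "length w"
  let ?t = "\<lambda>i k. smul ((-1) ^ i) (\<phi> (take k (contract i w)) * \<psi> (drop k (contract i w)))"
  let ?A = "{(i, k). i < ?N - 1 \<and> 1 \<le> k \<and> k < ?N - 1}"
  let ?L = "{(i, k). i < ?N - 1 \<and> 1 \<le> k \<and> k < ?N - 1 \<and> i < k}"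
  let ?R = "{(i, k). i < ?N - 1 \<and> 1 \<le> k \<and> k < ?N - 1 \<and> \<not> i < k}"
  have fin: "finite ?A" by (rule finite_subset[of _ "{..<?N} \<times> {..<?N}"]) auto
  have "bar (conv \<phi> \<psi>) w = (\<Sum>i<?N - 1. \<Sum>k=1..<?N - 1. ?t i k)"
    by (auto simp: bar_def conv_def fa.scale_sum_right length_contract intro!: sum.cong)
  also have "\<dots> = (\<Sum>(i, k)\<in>{..<?N - 1} \<times> {1..<?N - 1}. ?t i k)"
    by (rule sum.cartesian_product)
  also have "{..<?N - 1} \<times> {1..<?N - 1} = ?A" by auto
  also have "(\<Sum>(i, k)\<in>?A. ?t i k) = (\<Sum>(i, k)\<in>?L. ?t i k) + (\<Sum>(i, k)\<in>?R. ?t i k)"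
  proof -
    have "?A = ?L \<union> ?R" "?L \<inter> ?R = {}" "finite ?L" "finite ?R"
      using fin by (auto intro: finite_subset[OF _ fin])
    then show ?thesis by (metis (no_types, lifting) sum.union_disjoint)
  qed
  also have "(\<Sum>(i, k)\<in>?L. ?t i k) = (\<Sum>(m, i)\<in>(SIGMA m:{1..<?N}. {..<m - 1}).
      smul ((-1) ^ i) (\<phi> (contract i (take m w))) * \<psi> (drop m w))"
  proof (rule sum.reindex_bij_witness[where i = "\<lambda>(m, i). (i, m - 1)" and j = "\<lambda>(i, k). (Suc k, i)"])
    fix a assume "a \<in> ?L"
    then obtain i k where a: "a = (i, k)" "i < k" "k < ?N - 1" by auto
    have "take k (contract i w) = contract i (take (Suc k) w)"
      using a by (intro nth_equalityI) (auto simp: length_contract nth_contract)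
    moreover have "drop k (contract i w) = drop (Suc k) w"
      using a by (intro nth_equalityI) (auto simp: length_contract nth_contract)
    ultimately show "(case (case a of (i, k) \<Rightarrow> (Suc k, i)) of (m, i) \<Rightarrow>
        smul ((-1) ^ i) (\<phi> (contract i (take m w))) * \<psi> (drop m w)) = (case a of (i, k) \<Rightarrow> ?t i k)"
      by (simp add: a)
  qed auto
  also have "\<dots> = conv (bar \<phi>) \<psi> w"
    by (auto simp: sum.Sigma[symmetric] conv_def bar_def sum_distrib_right min_def intro!: sum.cong)
  also have "(\<Sum>(i, k)\<in>?R. ?t i k) = (\<Sum>(k, i)\<in>(SIGMA k:{1..<?N}. {..<?N - k - 1}).
      twist \<phi> (take k w) * smul ((-1) ^ i) (\<psi> (contract i (drop k w))))"
  proof (rule sum.reindex_bij_witness[where i = "\<lambda>(k, i). (i + k, k)" and j = "\<lambda>(i, k). (k, i - k)"])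
    fix a assume "a \<in> ?R"
    then obtain i k where a: "a = (i, k)" "k \<le> i" "i < ?N - 1" by auto
    have "take k (contract i w) = take k w"
      using a by (intro nth_equalityI) (auto simp: length_contract nth_contract)
    moreover have "drop k (contract i w) = contract (i - k) (drop k w)"
      using a by (intro nth_equalityI) (auto simp: length_contract nth_contract Suc_diff_le)
    moreover have "length (take k w) = k" using a by simp
    ultimately show "(case (case a of (i, k) \<Rightarrow> (k, i - k)) of (k, i) \<Rightarrow>
        twist \<phi> (take k w) * smul ((-1) ^ i) (\<psi> (contract i (drop k w)))) = (case a of (i, k) \<Rightarrow> ?t i k)"
      using a by (simp add: twist_def power_add[symmetric])
  qed auto
  also have "\<dots> = conv (twist \<phi>) (bar \<psi>) w"
    by (auto simp: sum.Sigma[symmetric] conv_def bar_def sum_distrib_left intro!: sum.cong)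
  finally show ?thesis .
qed


section \<open>The logarithm of a twisting cochain\<close>

lemma smul_of_nat_Suc: "smul (of_nat n) x + x = smul (of_nat (Suc n)) x"
  by (simp add: fa.scale_left_distrib add.commute)

lemma bar_mult_right: "bar (\<lambda>w. \<phi> w * x) w = bar \<phi> w * x"
  by (simp add: bar_def sum_distrib_right)

lemma conv_mult_right: "conv \<phi> (\<lambda>w. \<psi> w * x) w = conv \<phi> \<psi> w * x"
  by (simp add: conv_def sum_distrib_right mult.assoc)

lemma bar_into:
  assumes "fa.subspace K" "\<And>v. Suc (length v) = length w \<Longrightarrow> v \<noteq> [] \<Longrightarrow> \<phi> v \<in> K"
  shows "bar \<phi> w \<in> K"
  unfolding bar_def
proof (rule fa.subspace_sum[OF assms(1)], rule fa.subspace_scale[OF assms(1)], rule assms(2))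
  fix i assume "i \<in> {..<length w - 1}"
  then show "Suc (length (contract i w)) = length w" by (simp add: length_contract)
  show "contract i w \<noteq> []" by (simp add: contract_def)
qed

definition unit_letter :: "(unit, 'r, 'k::field) fp" where "unit_letter = gen (Ext ())"

lemma subspace_adj_part [intro, simp]: "fa.subspace (adj_part R n)"
  by (simp add: adj_part_def)

lemma adj_part_mult: "x \<in> adj_part R m \<Longrightarrow> y \<in> adj_part R n \<Longrightarrow> x * y \<in> adj_part R (m + n)"
  unfolding adj_part_def by (rule fp_part_mult)

lemma elt_adj_part: "r \<in> dg_part R n \<Longrightarrow> elt n r \<in> adj_part R n"
  unfolding adj_part_def by (rule elt_fp_part)

lemma adj_part_adm: "x \<in> adj_part R n \<Longrightarrow> x \<in> adm {()} R"
  unfolding adj_part_def by (rule fp_part_adm)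

lemma hat_adj_part: "x \<in> adj_part R n \<Longrightarrow> hat 1 x = smul ((-1) ^ n) x"
  unfolding adj_part_def by (rule hat_fp_part)

lemma unit_letter_part: "unit_letter \<in> adj_part R (Suc 0)"
  unfolding unit_letter_def adj_part_def One_nat_def[symmetric] by (rule ext_fp_part) simp

definition adj_ideal :: "('k::field, 'r::{ring, monoid_mult}) dga \<Rightarrow> (unit, 'r, 'k) fp set"
  where "adj_ideal R = fp_ideal {()} R (elt_relations R)"

text \<open>Relations of \<open>R\<langle>x\<rangle>\<^sub>\<natural>\<close>, whereas \<open>adj_ideal\<close> presents \<open>R\<langle>x\<rangle>\<close> itself.\<close>

definition adj_rel :: "('k::field, 'r::{ring, monoid_mult}) dga \<Rightarrow> (unit, 'r, 'k) fp set"
  where "adj_rel R = module.span smul (adj_nat_relations R)"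

lemma subspace_adj_ideal [intro, simp]: "fa.subspace (adj_ideal R)"
  by (simp add: adj_ideal_def)

lemma subspace_adj_rel [intro, simp]: "fa.subspace (adj_rel R)"
  by (simp add: adj_rel_def)

lemma adj_ideal_rel: "x \<in> adj_ideal R \<Longrightarrow> x \<in> adj_rel R"
  unfolding adj_ideal_def adj_rel_def adj_nat_relations_def by (rule fa.span_base) simp

lemma adj_comm:
  "u \<in> adj_part R p \<Longrightarrow> v \<in> adj_part R q \<Longrightarrow> u * v - smul ((-1) ^ (p * q)) (v * u) \<in> adj_rel R"
  unfolding adj_rel_def adj_nat_relations_def
  by (rule fa.span_base) (auto simp: graded_commutators_def)

lemma adj_diff_fp_diff: "adj_diff R = fp_diff 1 1 R"
  by (simp add: adj_diff_def)

lemma linear_adj_diff [intro, simp]: "Vector_Spaces.linear smul smul (adj_diff R)"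
  by (simp add: adj_diff_def)


subsection \<open>Setting the adjoined letter to zero\<close>

text \<open>The value \<open>0\<close> at the additional letters makes \<open>retract\<close> the map \<open>R\<langle>x\<rangle> \<rightarrow> R\<close> with \<open>x \<mapsto> 0\<close>. It does not commute
  with the differentials, but it is a left inverse of the inclusion of \<open>R\<close> that respects
  commutators, and therefore makes explicit the pull back to \<open>R\<^sub>\<natural>\<close> in the connecting homomorphism.\<close>

definition elt_value :: "('y, 'r) letter \<Rightarrow> 'r::zero"
  where "elt_value l = (case l of Ext y \<Rightarrow> 0 | Elt n r \<Rightarrow> r)"

definition retract :: "('k::field, 'r::{ring, monoid_mult}) dga \<Rightarrow> ('y, 'r, 'k) fp \<Rightarrow> 'r"
  where "retract R = lin (dg_scale R) (\<lambda>w. prod_list (map elt_value w))"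

context dga
begin

lemma linear_retract [intro, simp]: "Vector_Spaces.linear smul (dg_scale R) (retract R)"
  unfolding retract_def by (rule linear_lin) unfold_locales

lemma retract_mon: "retract R (mon w) = prod_list (map elt_value w)"
  unfolding retract_def by (rule lin_mon) unfold_locales

lemma retract_mult: "retract R (p * q) = retract R p * retract R q"
proof (rule bilinear_eq_on_mon[where F = "\<lambda>p q. retract R (p * q)"
      and G = "\<lambda>p q. retract R p * retract R q" and sc = "dg_scale R"])
  have 1: "Vector_Spaces.linear (dg_scale R) (dg_scale R) (\<lambda>x. x * y)" for y
    by (rule linearI) (auto intro: vector_space_axioms simp: algebra_simps scale_mult_left)
  have 2: "Vector_Spaces.linear (dg_scale R) (dg_scale R) (\<lambda>y. x * y)" for x
    by (rule linearI) (auto intro: vector_space_axioms simp: algebra_simps scale_mult_right)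
  show "Vector_Spaces.linear smul (dg_scale R) (\<lambda>p. retract R p * retract R q)" for q :: "('b, 'r, 'k) fp"
    by (rule linear_comp[OF linear_retract 1])
  show "Vector_Spaces.linear smul (dg_scale R) (\<lambda>q. retract R p * retract R q)" for p :: "('b, 'r, 'k) fp"
    by (rule linear_comp[OF linear_retract 2])
qed (auto intro: linear_comp[OF linear_mult_left linear_retract] linear_comp[OF linear_mult_right linear_retract]
    simp: mon_mult retract_mon)

lemma retract_elt [simp]: "retract R (elt n r) = r"
  by (simp add: elt_def gen_def retract_mon elt_value_def)

lemma retract_one [simp]: "retract R 1 = 1"
  by (simp add: mon_Nil[symmetric] retract_mon)

lemma retract_elt_relations: "s \<in> elt_relations R \<Longrightarrow> retract R s = 0"
  by (erule elt_relations_cases)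
    (simp_all add: linear_diff[OF linear_retract] linear_scale[OF linear_retract] retract_mult)

lemma retract_ideal:
  assumes "x \<in> fp_ideal Y R (elt_relations R)"
  shows "retract R x = 0"
proof -
  have "retract R x \<in> {0}"
    by (rule linear_fp_ideal_into[OF linear_retract _ _ assms])
      (auto simp: retract_mult retract_elt_relations)
  then show ?thesis by simp
qed

lemma prod_elt_value_part:
  assumes "set w \<subseteq> fp_letters Y R" "word_deg e w = n"
  shows "prod_list (map elt_value w) \<in> dg_part R n"
  using assms
proof (induction w arbitrary: n)
  case Nil then show ?case by simp
next
  case (Cons l w)
  have IH: "prod_list (map elt_value w) \<in> dg_part R (word_deg e w)" using Cons by auto
  show ?case
  proof (cases l)
    case (Ext y)
    then show ?thesis by (simp add: elt_value_def)
  next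
    case (Elt m r)
    then have "r \<in> dg_part R m" using Cons.prems by (auto simp: fp_letters_def)
    then have "r * prod_list (map elt_value w) \<in> dg_part R (m + word_deg e w)"
      using mult_part[OF _ IH] by blast
    moreover have "elt_value l = r" "n = m + word_deg e w"
      using Elt Cons.prems by (auto simp: elt_value_def)
    ultimately show ?thesis by simp
  qed
qed

lemma retract_part:
  fixes x :: "('y, 'r, 'k) fp"
  assumes "x \<in> fp_part Y e R n"
  shows "retract R x \<in> dg_part R n"
proof (rule linear_span_into[OF linear_retract subspace_part _ assms[unfolded fp_part_def]])
  fix x :: "('y, 'r, 'k) fp"
  assume "x \<in> {mon w |w. set w \<subseteq> fp_letters Y R \<and> word_deg e w = n}"
  then obtain w where w: "x = mon w" "set w \<subseteq> fp_letters Y R" "word_deg e w = n" by blast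
  show "retract R x \<in> dg_part R n"
    unfolding w(1) retract_mon by (rule prod_elt_value_part[OF w(2,3)])
qed

definition nat_rel :: "'r set" where "nat_rel = span (graded_commutators (dg_scale R) (dg_part R))"

lemma subspace_nat_rel [intro, simp]: "subspace nat_rel"
  by (simp add: nat_rel_def)

lemma retract_adj_rel:
  assumes "x \<in> adj_rel R"
  shows "retract R x \<in> nat_rel"
proof (rule linear_span_into[OF linear_retract _ _ assms[unfolded adj_rel_def]])
  fix x assume "x \<in> adj_nat_relations R"
  then consider "x \<in> fp_ideal {()} R (elt_relations R)" | "x \<in> graded_commutators smul (adj_part R)"
    by (auto simp: adj_nat_relations_def)
  then show "retract R x \<in> nat_rel"
  proof cases
    case 1 then show ?thesis by (simp add: retract_ideal subspace_0)
  next
    case 2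
    then obtain p q u v where x: "x = u * v - smul ((-1) ^ (p * q)) (v * u)"
      and u: "u \<in> adj_part R p" and v: "v \<in> adj_part R q"
      by (auto simp: graded_commutators_def)
    have "retract R x = retract R u * retract R v - dg_scale R ((-1) ^ (p * q)) (retract R v * retract R u)"
      by (simp add: x linear_diff[OF linear_retract] linear_scale[OF linear_retract] retract_mult)
    then show ?thesis
      unfolding nat_rel_def graded_commutators_def
      using retract_part[OF u[unfolded adj_part_def]] retract_part[OF v[unfolded adj_part_def]] by (intro span_base) blast
  qed
qed simp

lemma adj_diff_part: "x \<in> adj_part R (Suc n) \<Longrightarrow> adj_diff R x \<in> adj_part R n"
  unfolding adj_diff_fp_diff adj_part_def by (rule fp_diff_part[rotated]) auto

lemma adj_ideal_left: "y \<in> adm {()} R \<Longrightarrow> x \<in> adj_ideal R \<Longrightarrow> y * x \<in> adj_ideal R"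
  unfolding adj_ideal_def by (rule fp_ideal_mult_left)

lemma adj_ideal_right: "x \<in> adj_ideal R \<Longrightarrow> y \<in> adm {()} R \<Longrightarrow> x * y \<in> adj_ideal R"
  unfolding adj_ideal_def by (rule fp_ideal_mult_right)

lemma adj_diff_rel:
  assumes "x \<in> adj_rel R"
  shows "adj_diff R x \<in> adj_rel R"
proof (rule linear_span_into[OF linear_adj_diff _ _ assms[unfolded adj_rel_def]])
  fix x assume "x \<in> adj_nat_relations R"
  then consider "x \<in> fp_ideal {()} R (elt_relations R)" | "x \<in> graded_commutators smul (adj_part R)"
    by (auto simp: adj_nat_relations_def)
  then show "adj_diff R x \<in> adj_rel R"
  proof cases
    case 1
    then have "adj_diff R x \<in> adj_ideal R"
      unfolding adj_ideal_def adj_diff_fp_diff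
      by (rule fp_diff_ideal[OF _ elt_relations_part fp_diff_elt_relations, rotated -1]) auto
    then show ?thesis by (rule adj_ideal_rel)
  next
    case 2
    then have "adj_diff R x \<in> fa.span (graded_commutators smul (adj_part R))"
      unfolding adj_diff_fp_diff adj_part_def by (rule fp_diff_commutators[rotated]) auto
    then show ?thesis
      unfolding adj_rel_def adj_nat_relations_def
      by (rule subsetD[OF fa.span_mono, rotated]) auto
  qed
qed simp

end

subsection \<open>Cyclic sums over the twisting cochain\<close>

locale twisting = dga R
  for R :: "('k::field_char_0, 'r::{ring, monoid_mult}) dga" +
  fixes scA :: "'k \<Rightarrow> 'a::{ring, monoid_mult} \<Rightarrow> 'a" and f :: "'a list \<Rightarrow> 'r"
  assumes multilinear: "multilinear_family R scA f"
    and f_diff: "\<And>w. length w \<ge> 2 \<Longrightarrow> dg_diff R (f w) =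
        (\<Sum>i=1..length w-1. dg_scale R ((-1) ^ (i - 1)) (f (contract (i - 1) w))) +
        (\<Sum>i=1..length w-1. dg_scale R ((-1) ^ i) (f (take i w) * f (drop i w)))"
begin

lemma f_part: "w \<noteq> [] \<Longrightarrow> f w \<in> dg_part R (length w - 1)"
  using multilinear by (simp add: multilinear_family_def)

lemma linear_f: "Vector_Spaces.linear scA (dg_scale R) (\<lambda>a. f (u @ a # v))"
proof -
  have "Vector_Spaces.linear scA (dg_scale R) (\<lambda>a. f (u @ [a] @ v))"
    using multilinear unfolding multilinear_family_def by blast
  then show ?thesis by simp
qed

text \<open>The cochain \<open>f\<close> with values in the letters of \<open>R\<langle>x\<rangle>\<close>.\<close>

definition f' :: "'a list \<Rightarrow> (unit, 'r, 'k) fp" where "f' w = elt (length w - 1) (f w)"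

text \<open>The cochain \<open>f x\<close>. The degree of a value is the length of the word, so that \<open>g\<close> is even in the total grading
  and behaves like a commuting variable under the trace.\<close>

definition g :: "'a list \<Rightarrow> (unit, 'r, 'k) fp" where "g w = f' w * unit_letter"

text \<open>The differential of the algebra of cochains; it vanishes if \<open>\<phi>\<close> is a morphism of complexes from the bar
  construction.\<close>

definition defect :: "('a list \<Rightarrow> (unit, 'r, 'k) fp) \<Rightarrow> 'a list \<Rightarrow> (unit, 'r, 'k) fp"
  where "defect \<phi> w = adj_diff R (\<phi> w) - bar \<phi> w"

lemma f'_part: "w \<noteq> [] \<Longrightarrow> f' w \<in> adj_part R (length w - 1)"
  unfolding f'_def by (rule elt_adj_part) (rule f_part)

lemma g_part: "w \<noteq> [] \<Longrightarrow> g w \<in> adj_part R (length w)"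
  using adj_part_mult[OF f'_part[of w] unit_letter_part] by (cases w) (auto simp: g_def)

lemma cpow_part:
  fixes \<phi> :: "'z list \<Rightarrow> (unit, 'r, 'k) fp"
  assumes "\<And>w. w \<noteq> [] \<Longrightarrow> \<phi> w \<in> adj_part R (length w)" "w \<noteq> []"
  shows "cpow \<phi> p w \<in> adj_part R (length w)"
  using assms(2)
proof (induction p arbitrary: w)
  case 0 then show ?case using assms(1) by simp
next
  case (Suc p)
  show ?case unfolding cpow.simps
  proof (rule conv_into[OF subspace_adj_part])
    fix u v :: "'z list" assume "u \<noteq> []" "v \<noteq> []" and l: "length u + length v = length w"
    then show "cpow \<phi> p u * \<phi> v \<in> adj_part R (length w)"
      using adj_part_mult[OF Suc.IH assms(1)] by (metis l)
  qed
qed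

lemma defect_part:
  fixes \<phi> :: "'a list \<Rightarrow> (unit, 'r, 'k) fp"
  assumes \<phi>: "\<And>w. w \<noteq> [] \<Longrightarrow> \<phi> w \<in> adj_part R (length w)" and w: "w \<noteq> []"
  shows "defect \<phi> w \<in> adj_part R (length w - 1)"
  unfolding defect_def
proof (rule fa.subspace_diff[OF subspace_adj_part])
  show "adj_diff R (\<phi> w) \<in> adj_part R (length w - 1)"
    by (rule adj_diff_part) (use \<phi>[OF w] w in simp)
  show "bar \<phi> w \<in> adj_part R (length w - 1)"
  proof (rule bar_into[OF subspace_adj_part])
    fix v :: "'a list" assume "Suc (length v) = length w" "v \<noteq> []"
    then show "\<phi> v \<in> adj_part R (length w - 1)" using \<phi>[of v] by (metis diff_Suc_1)
  qed
qed

lemma twist_part: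
  "\<phi> w \<in> adj_part R n \<Longrightarrow> twist \<phi> w \<in> adj_part R n"
  unfolding twist_def by (rule fa.subspace_scale[OF subspace_adj_part])

text \<open>Both the differential and \<open>bar\<close> are derivations of the convolution.\<close>

lemma defect_conv:
  assumes "\<And>w. w \<noteq> [] \<Longrightarrow> \<phi> w \<in> adj_part R (length w)"
  shows "defect (conv \<phi> \<psi>) w = conv (defect \<phi>) \<psi> w + conv (twist \<phi>) (defect \<psi>) w"
proof -
  have "adj_diff R (conv \<phi> \<psi> w)
      = conv (\<lambda>w. adj_diff R (\<phi> w)) \<psi> w + conv (twist \<phi>) (\<lambda>w. adj_diff R (\<psi> w)) w"
  proof -
    have "adj_diff R (\<phi> (take i w) * \<psi> (drop i w)) = adj_diff R (\<phi> (take i w)) * \<psi> (drop i w)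
        + twist \<phi> (take i w) * adj_diff R (\<psi> (drop i w))" if "i \<in> {1..<length w}" for i
    proof -
      have "hat 1 (\<phi> (take i w)) = twist \<phi> (take i w)"
        using hat_adj_part[OF assms[of "take i w"]] that by (cases w) (auto simp: twist_def)
      then show ?thesis by (simp add: adj_diff_fp_diff fp_diff_mult)
    qed
    then show ?thesis by (simp add: conv_def linear_sum[OF linear_adj_diff] sum.distrib)
  qed
  then show ?thesis
    by (simp add: defect_def[abs_def] bar_conv conv_diff_right)
      (simp add: conv_def algebra_simps sum_subtractf)
qed

text \<open>The hypothesis on \<open>d f\<close> is the equation of a twisting cochain; only the summation indices have to be
  shifted and the scalars moved out of the letters.\<close>

lemma f'_diff:
  assumes w: "w \<noteq> []"
  shows "adj_diff R (f' w) - (bar f' w + conv (twist f') f' w) \<in> adj_ideal R"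
proof (cases "length w \<ge> 2")
  case False
  then have "length w = 1" using w by (cases w) (auto simp: not_le)
  then show ?thesis
    by (simp add: f'_def adj_diff_fp_diff fp_diff_elt_0 bar_def conv_def fa.subspace_0)
next
  case True
  let ?N = "length w"
  let ?I = "adj_ideal R"
  have I: "fa.subspace ?I" by simp
  let ?a = "\<lambda>i. dg_scale R ((-1) ^ i) (f (contract i w))"
  let ?b = "\<lambda>i. dg_scale R ((-1) ^ i) (f (take i w) * f (drop i w))"
  have c: "f (contract i w) \<in> dg_part R (?N - 2)" if "i \<in> {..<?N - 1}" for i
    using f_part[of "contract i w"] that by (simp add: length_contract contract_def)
  have m: "f (take i w) * f (drop i w) \<in> dg_part R (?N - 2)" if "i \<in> {1..<?N}" for i
  proof -
    have "f (take i w) \<in> dg_part R (i - 1)" "f (drop i w) \<in> dg_part R (?N - i - 1)"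
      using f_part[of "take i w"] f_part[of "drop i w"] that w by (auto simp: min_def)
    moreover have "(i - 1) + (?N - i - 1) = ?N - 2" using that by auto
    ultimately show ?thesis using mult_part by metis
  qed
  have "dg_diff R (f w) = (\<Sum>i<?N - 1. ?a i) + (\<Sum>i=1..<?N. ?b i)"
  proof -
    have "(\<Sum>i=1..?N - 1. dg_scale R ((-1) ^ (i - 1)) (f (contract (i - 1) w))) = (\<Sum>i<?N - 1. ?a i)"
      by (rule sum.reindex_bij_witness[where i = Suc and j = "\<lambda>i. i - 1"]) auto
    moreover have "{1..?N - 1} = {1..<?N}" using True by auto
    ultimately show ?thesis using f_diff[OF True] by simp
  qed
  moreover have "adj_diff R (f' w) = elt (?N - 2) (dg_diff R (f w))"
  proof -
    have "?N - 1 = Suc (?N - 2)" using True by simp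
    then show ?thesis by (simp add: f'_def adj_diff_fp_diff fp_diff_elt_Suc)
  qed
  ultimately have eq: "adj_diff R (f' w) = elt (?N - 2) ((\<Sum>i<?N - 1. ?a i) + (\<Sum>i=1..<?N. ?b i))"
    by simp
  have 1: "elt (?N - 2) (\<Sum>i<?N - 1. ?a i) - bar f' w \<in> ?I"
  proof (rule fa.cong_trans[OF I])
    show "elt (?N - 2) (\<Sum>i<?N - 1. ?a i) - (\<Sum>i<?N - 1. elt (?N - 2) (?a i)) \<in> ?I"
      unfolding adj_ideal_def by (rule elt_sum[OF subset_refl finite_lessThan subspace_scale[OF subspace_part c]])
    show "(\<Sum>i<?N - 1. elt (?N - 2) (?a i)) - bar f' w \<in> ?I"
      unfolding bar_def
    proof (rule fa.cong_sum[OF I])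
      fix i assume i: "i \<in> {..<?N - 1}"
      then have "f' (contract i w) = elt (?N - 2) (f (contract i w))"
        by (simp add: f'_def length_contract numeral_2_eq_2)
      then show "elt (?N - 2) (?a i) - smul ((-1) ^ i) (f' (contract i w)) \<in> ?I"
        unfolding adj_ideal_def using elt_scale[OF subset_refl c[OF i]] by simp
    qed
  qed
  have 2: "elt (?N - 2) (\<Sum>i=1..<?N. ?b i) - conv (twist f') f' w \<in> ?I"
  proof (rule fa.cong_trans[OF I])
    show "elt (?N - 2) (\<Sum>i=1..<?N. ?b i) - (\<Sum>i=1..<?N. elt (?N - 2) (?b i)) \<in> ?I"
      unfolding adj_ideal_def by (rule elt_sum[OF subset_refl finite_atLeastLessThan subspace_scale[OF subspace_part m]])
    show "(\<Sum>i=1..<?N. elt (?N - 2) (?b i)) - conv (twist f') f' w \<in> ?I"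
      unfolding conv_def
    proof (rule fa.cong_sum[OF I])
      fix i assume i: "i \<in> {1..<?N}"
      have fp: "f (take i w) \<in> dg_part R (i - 1)" "f (drop i w) \<in> dg_part R (?N - i - 1)"
        using f_part[of "take i w"] f_part[of "drop i w"] i w by (auto simp: min_def)
      have "elt (?N - 2) (?b i) - smul ((-1) ^ i) (elt (?N - 2) (f (take i w) * f (drop i w))) \<in> ?I"
        unfolding adj_ideal_def by (rule elt_scale[OF subset_refl m[OF i]])
      moreover have "elt (?N - 2) (f (take i w) * f (drop i w))
          - elt (i - 1) (f (take i w)) * elt (?N - i - 1) (f (drop i w)) \<in> ?I"
      proof -
        have "(i - 1) + (?N - i - 1) = ?N - 2" using i by auto
        then show ?thesis unfolding adj_ideal_def using elt_mult[OF subset_refl fp] by metis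
      qed
      ultimately have "elt (?N - 2) (?b i)
          - smul ((-1) ^ i) (elt (i - 1) (f (take i w)) * elt (?N - i - 1) (f (drop i w))) \<in> ?I"
        using fa.cong_trans[OF I] fa.cong_scale[OF I] by blast
      moreover have "length (take i w) = i" "length (drop i w) = ?N - i" using i by auto
      ultimately show "elt (?N - 2) (?b i) - twist f' (take i w) * f' (drop i w) \<in> ?I"
        by (simp add: twist_def f'_def)
    qed
  qed
  have "elt (?N - 2) ((\<Sum>i<?N - 1. ?a i) + (\<Sum>i=1..<?N. ?b i))
      - (elt (?N - 2) (\<Sum>i<?N - 1. ?a i) + elt (?N - 2) (\<Sum>i=1..<?N. ?b i)) \<in> ?I"
    unfolding adj_ideal_def
    by (rule elt_add) (auto intro!: subspace_sum[OF subspace_part] subspace_scale[OF subspace_part] c m)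
  then show ?thesis unfolding eq using fa.cong_trans[OF I _ fa.cong_add[OF I 1 2]] by blast
qed

text \<open>As \<open>d x = 1\<close>, the differential of \<open>f x\<close> is \<open>(d f) x\<close> minus a twist of \<open>f\<close>, and the twisting equation applies
  to \<open>d f\<close>. In short, \<open>g\<close> changes by \<open>-f (1 - g)\<close>.\<close>

lemma defect_g:
  assumes w: "w \<noteq> []"
  shows "defect g w - (conv (twist f') g w - twist f' w) \<in> adj_ideal R"
proof -
  have "adj_diff R unit_letter = 1"
    by (simp add: adj_diff_fp_diff unit_letter_def fp_diff_ext)
  moreover have "hat 1 (f' w) = - twist f' w"
  proof -
    obtain n where "length w = Suc n" using w by (cases w) auto
    then show ?thesis using hat_adj_part[OF f'_part[OF w]] by (simp add: twist_def)
  qed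
  ultimately have "adj_diff R (g w) = adj_diff R (f' w) * unit_letter - twist f' w"
    by (simp add: g_def adj_diff_fp_diff fp_diff_mult)
  then have "defect g w - (conv (twist f') g w - twist f' w)
      = (adj_diff R (f' w) - (bar f' w + conv (twist f') f' w)) * unit_letter"
    by (simp add: defect_def g_def[abs_def] bar_mult_right conv_mult_right algebra_simps)
  then show ?thesis using adj_ideal_right[OF f'_diff[OF w] adj_part_adm[OF unit_letter_part]] by simp
qed

text \<open>In a cyclic sum a factor \<open>g\<close> may be moved from the end to the front. Passing an odd cochain,
  whose degree is one less than the length, it gets twisted.\<close>

lemma cyc_conv_g:
  assumes "\<And>w. w \<noteq> [] \<Longrightarrow> \<phi> w \<in> adj_part R (length w - 1)"
  shows "cyc (conv \<phi> g) w - cyc (conv (twist g) \<phi>) w \<in> adj_rel R"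
proof (rule cyc_conv_swap[OF subspace_adj_rel])
  fix u v :: "'a list" assume uv: "u \<noteq> []" "v \<noteq> []"
  have "(-1 :: 'k) ^ ((length u - 1) * length v) = (-1) ^ (length u * length v) * (-1) ^ length v"
    unfolding power_add[symmetric] by (rule neg_one_power_cong) (use uv in \<open>cases u; auto\<close>)
  then show "\<phi> u * g v - smul ((-1) ^ (length u * length v)) (twist g v * \<phi> u) \<in> adj_rel R"
    using adj_comm[OF assms[OF uv(1)] g_part[OF uv(2)]] by (simp add: twist_def)
qed

lemma twist_g_part: "w \<noteq> [] \<Longrightarrow> twist g w \<in> adj_part R (length w)"
  by (rule twist_part) (rule g_part)

lemma conv_part_odd:
  fixes \<phi> \<psi> :: "'z list \<Rightarrow> (unit, 'r, 'k) fp"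
  assumes "\<And>w. w \<noteq> [] \<Longrightarrow> \<phi> w \<in> adj_part R (length w)"
    and "\<And>w. w \<noteq> [] \<Longrightarrow> \<psi> w \<in> adj_part R (length w - 1)"
  shows "conv \<phi> \<psi> w \<in> adj_part R (length w - 1)"
proof (rule conv_into[OF subspace_adj_part])
  fix u v :: "'z list" assume uv: "u \<noteq> []" "v \<noteq> []" "length u + length v = length w"
  then have "length u + (length v - 1) = length w - 1" by (cases v) auto
  then show "\<phi> u * \<psi> v \<in> adj_part R (length w - 1)"
    using adj_part_mult[OF assms(1) assms(2)] uv by metis
qed

lemma cpow_g_part: "w \<noteq> [] \<Longrightarrow> cpow g p w \<in> adj_part R (length w)"
  by (rule cpow_part, rule g_part)

lemma cpow_twist_g_part: "w \<noteq> [] \<Longrightarrow> cpow (twist g) p w \<in> adj_part R (length w)"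
  by (rule cpow_part, rule twist_g_part)

lemma defect_cpow_part: "w \<noteq> [] \<Longrightarrow> defect (cpow g p) w \<in> adj_part R (length w - 1)"
  by (rule defect_part, rule cpow_g_part)

lemma twist_f'_part: "w \<noteq> [] \<Longrightarrow> twist f' w \<in> adj_part R (length w - 1)"
  by (rule twist_part, rule f'_part)

text \<open>The cyclic sum of \<open>g\<^sup>p f\<close>, with the twists that moving factors produces.\<close>

definition odd_cyc :: "nat \<Rightarrow> 'a list \<Rightarrow> (unit, 'r, 'k) fp"
  where "odd_cyc p = (case p of 0 \<Rightarrow> cyc (twist f') | Suc q \<Rightarrow> cyc (conv (cpow (twist g) q) (twist f')))"

text \<open>This is \<open>d tr(g\<^sup>n) = n tr(g\<^sup>n\<^sup>-\<^sup>1 d g)\<close>: in a cyclic sum all terms of the Leibniz rule agree. The additional power \<open>q\<close>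
  collects the factors moved to the front in the course of the induction.\<close>

lemma cyc_conv_defect_cpow:
  "cyc (conv (cpow (twist g) q) (defect (cpow g p))) w
    - smul (of_nat (Suc p)) (cyc (conv (cpow (twist g) (q + p)) (defect g)) w) \<in> adj_rel R"
proof (induction p arbitrary: q)
  case 0
  then show ?case by (simp add: fa.subspace_0)
next
  case (Suc p)
  let ?h = "cpow (twist g)"
  let ?Z = "cyc (conv (?h (Suc (q + p))) (defect g)) w"
  have K: "fa.subspace (adj_rel R)" by simp
  have d: "defect (cpow g (Suc p)) = (\<lambda>w. conv (defect (cpow g p)) g w + conv (?h p) (defect g) w)"
    unfolding cpow.simps by (rule ext, subst defect_conv) (simp_all add: cpow_part g_part twist_cpow)
  have "cyc (conv (?h q) (defect (cpow g (Suc p)))) w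
      = cyc (conv (conv (?h q) (defect (cpow g p))) g) w + ?Z"
    unfolding d
    by (simp add: conv_add_right[abs_def] cyc_add conv_assoc)
      (simp add: conv_assoc[symmetric] conv_cpow)
  moreover have "cyc (conv (conv (?h q) (defect (cpow g p))) g) w
      - cyc (conv (twist g) (conv (?h q) (defect (cpow g p)))) w \<in> adj_rel R"
    by (rule cyc_conv_g, rule conv_part_odd, rule cpow_twist_g_part, assumption, rule defect_cpow_part)
  moreover have "conv (twist g) (conv (?h q) (defect (cpow g p))) = conv (?h (Suc q)) (defect (cpow g p))"
    by (simp only: conv_assoc[symmetric] conv_cpow_left)
  moreover have "cyc (conv (?h (Suc q)) (defect (cpow g p))) w - smul (of_nat (Suc p)) ?Z \<in> adj_rel R"
    using Suc.IH[of "Suc q"] by simp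
  ultimately have "cyc (conv (?h q) (defect (cpow g (Suc p)))) w - (smul (of_nat (Suc p)) ?Z + ?Z) \<in> adj_rel R"
    using fa.cong_trans[OF K] fa.cong_add[OF K] by (metis (no_types, lifting) add_diff_cancel_right)
  then show ?case by (simp only: smul_of_nat_Suc add_Suc_right)
qed

text \<open>From \<open>d g = -f (1 - g)\<close> one gets \<open>tr(g\<^sup>q\<^sup>+\<^sup>1 d g) = tr(g\<^sup>q\<^sup>+\<^sup>2 f) - tr(g\<^sup>q\<^sup>+\<^sup>1 f)\<close>.\<close>

lemma cyc_conv_defect_g:
  "cyc (conv (cpow (twist g) q) (defect g)) w - (odd_cyc (Suc (Suc q)) w - odd_cyc (Suc q) w) \<in> adj_rel R"
proof -
  let ?h = "cpow (twist g)"
  let ?E = "\<lambda>w. conv (twist f') g w - twist f' w"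
  have K: "fa.subspace (adj_rel R)" by simp
  have "cyc (conv (?h q) (defect g)) w - cyc (conv (?h q) ?E) w \<in> adj_rel R"
  proof (rule cyc_cong_mod[OF K], rule conv_cong_mod[OF K])
    fix u v :: "'a list" assume uv: "u \<noteq> []" "v \<noteq> []"
    have "?h q u * (defect g v - ?E v) \<in> adj_ideal R"
      by (rule adj_ideal_left[OF adj_part_adm[OF cpow_part[OF twist_g_part uv(1)]] defect_g[OF uv(2)]])
    then show "?h q u * defect g v - ?h q u * ?E v \<in> adj_rel R"
      by (simp add: algebra_simps adj_ideal_rel)
  qed
  moreover have "cyc (conv (?h q) ?E) w = cyc (conv (conv (?h q) (twist f')) g) w - odd_cyc (Suc q) w"
    by (simp add: conv_diff_right[abs_def] cyc_diff conv_assoc odd_cyc_def)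
  moreover have "cyc (conv (conv (?h q) (twist f')) g) w - cyc (conv (twist g) (conv (?h q) (twist f'))) w \<in> adj_rel R"
    by (rule cyc_conv_g, rule conv_part_odd, rule cpow_twist_g_part, assumption, rule twist_f'_part)
  moreover have "cyc (conv (twist g) (conv (?h q) (twist f'))) w = odd_cyc (Suc (Suc q)) w"
    by (simp only: conv_assoc[symmetric] conv_cpow_left odd_cyc_def nat.case)
  ultimately show ?thesis
    using fa.cong_trans[OF K] by (smt (verit) add_diff_cancel_left' diff_diff_eq2 diff_add_cancel add_diff_eq)
qed

lemma cyc_defect_g: "cyc (defect g) w - (odd_cyc 1 w - odd_cyc 0 w) \<in> adj_rel R"
proof -
  let ?E = "\<lambda>w. conv (twist f') g w - twist f' w"
  have K: "fa.subspace (adj_rel R)" by simp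
  have 1: "cyc (defect g) w - cyc ?E w \<in> adj_rel R"
    by (rule cyc_cong_mod[OF K]) (use defect_g adj_ideal_rel in blast)
  have 2: "cyc ?E w = cyc (conv (twist f') g) w - odd_cyc 0 w"
    by (simp add: cyc_diff odd_cyc_def)
  have 3: "cyc (conv (twist f') g) w - odd_cyc 1 w \<in> adj_rel R"
    using cyc_conv_g[of "twist f'" w, OF twist_part[OF f'_part]] by (simp add: odd_cyc_def)
  have "cyc ?E w - (odd_cyc 1 w - odd_cyc 0 w) \<in> adj_rel R" using 3 by (simp add: 2)
  then show ?thesis by (rule fa.cong_trans[OF K 1])
qed

lemma cyc_defect_cpow:
  "cyc (defect (cpow g p)) w - smul (of_nat (Suc p)) (odd_cyc (Suc p) w - odd_cyc p w) \<in> adj_rel R"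
proof (cases p)
  case 0 then show ?thesis using cyc_defect_g by simp
next
  case (Suc q)
  let ?h = "cpow (twist g)"
  let ?Z = "cyc (conv (?h q) (defect g)) w"
  have K: "fa.subspace (adj_rel R)" by simp
  have "cyc (defect (cpow g p)) w = cyc (conv (defect (cpow g q)) g) w + ?Z"
  proof -
    have "defect (cpow g p) = (\<lambda>w. conv (defect (cpow g q)) g w + conv (?h q) (defect g) w)"
      unfolding Suc cpow.simps
      by (rule ext, subst defect_conv) (simp_all add: cpow_part g_part twist_cpow)
    then show ?thesis by (simp add: cyc_add)
  qed
  moreover have "cyc (conv (defect (cpow g q)) g) w - cyc (conv (twist g) (defect (cpow g q))) w \<in> adj_rel R"
    by (rule cyc_conv_g, rule defect_cpow_part)
  moreover have "cyc (conv (twist g) (defect (cpow g q))) w - smul (of_nat (Suc q)) ?Z \<in> adj_rel R"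
    using cyc_conv_defect_cpow[of 0 q w] by simp
  ultimately have "cyc (defect (cpow g p)) w - (smul (of_nat (Suc q)) ?Z + ?Z) \<in> adj_rel R"
    using fa.cong_trans[OF K] fa.cong_add[OF K] by (metis (no_types, lifting) add_diff_cancel_right)
  then have "cyc (defect (cpow g p)) w - smul (of_nat (Suc p)) ?Z \<in> adj_rel R"
    by (simp only: smul_of_nat_Suc Suc)
  then show ?thesis
    using fa.cong_trans[OF K _ fa.cong_scale[OF K cyc_conv_defect_g]] Suc by blast
qed

text \<open>The cyclic sum of \<open>- log (1 - g)\<close>. By \<open>cpow_short\<close> all further powers vanish on \<open>w\<close>.\<close>

definition log_cyc :: "'a list \<Rightarrow> (unit, 'r, 'k) fp"
  where "log_cyc w = (\<Sum>p<length w. smul (inverse (of_nat (Suc p))) (cyc (cpow g p) w))"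

lemma log_cyc_superset:
  assumes "length w \<le> M" "w \<noteq> []"
  shows "log_cyc w = (\<Sum>p<M. smul (inverse (of_nat (Suc p))) (cyc (cpow g p) w))"
  unfolding log_cyc_def
proof (rule sum.mono_neutral_left)
  show "\<forall>p\<in>{..<M} - {..<length w}. smul (inverse (of_nat (Suc p))) (cyc (cpow g p) w) = 0"
  proof
    fix p assume p: "p \<in> {..<M} - {..<length w}"
    have "cyc (cpow g p) w = 0"
      unfolding cyc_def
      by (rule sum.neutral, rule ballI, subst cpow_short) (use p assms in \<open>auto simp: Suc_le_eq\<close>)
    then show "smul (inverse (of_nat (Suc p))) (cyc (cpow g p) w) = 0" by simp
  qed
qed (use assms in auto)

lemma lin_cong_mon:
  assumes "\<And>v. v \<in> V \<Longrightarrow> \<phi> v = \<psi> v" "x \<in> fa.span (mon ` V)"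
  shows "lin smul \<phi> x = lin smul \<psi> x"
proof -
  have "lin smul \<phi> x - lin smul \<psi> x \<in> {0}"
    by (rule linear_span_into[OF linear_diffI[OF linear_lin_smul linear_lin_smul] _ _ assms(2)])
      (use assms(1) in auto)
  then show ?thesis by simp
qed

lemma hochschild_word_span:
  "hochschild_word w \<in> fa.span (mon ` {v. Suc (length v) = length w \<and> v \<noteq> []})"
proof (cases "length w \<ge> 2")
  case False
  then have "length w - 1 = 0" by simp
  then show ?thesis by (simp add: hochschild_word_def fa.span_zero)
next
  case True
  then show ?thesis
  proof -
    have "mon (contract i w) \<in> fa.span (mon ` {v. Suc (length v) = length w \<and> v \<noteq> []})"
      if "i < length w - 1" for i
      using that by (intro fa.span_base imageI) (auto simp: length_contract contract_def)
    moreover have "mon ((last w * hd w) # butlast (tl w))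
        \<in> fa.span (mon ` {v. Suc (length v) = length w \<and> v \<noteq> []})"
      using True by (intro fa.span_base imageI) auto
    ultimately show ?thesis using True
      by (auto simp: hochschild_word_def Let_def intro!: fa.span_add fa.span_scale fa.span_sum fa.span_zero)
  qed
qed

text \<open>The coefficient \<open>1/(p + 1)\<close> of the logarithm cancels the number of factors, so the sum telescopes.
  Its upper end vanishes for reasons of length, and its lower end is the cyclic sum of \<open>f\<close>.\<close>

lemma adj_diff_log_cyc:
  assumes w: "w \<noteq> []"
  shows "adj_diff R (log_cyc w) - (lin smul log_cyc (hochschild_word w)
    + smul ((-1) ^ (length w - 1)) (cyc f' w)) \<in> adj_rel R"
proof -
  let ?N = "length w"
  let ?c = "\<lambda>p. inverse (of_nat (Suc p) :: 'k)"
  have K: "fa.subspace (adj_rel R)" by simp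
  have 1: "lin smul log_cyc (hochschild_word w) = (\<Sum>p<?N. smul (?c p) (cyc (bar (cpow g p)) w))"
  proof -
    have "lin smul log_cyc (hochschild_word w)
        = lin smul (\<lambda>v. \<Sum>p<?N. smul (?c p) (cyc (cpow g p) v)) (hochschild_word w)"
      by (rule lin_cong_mon[OF _ hochschild_word_span]) (auto simp del: of_nat_Suc intro: log_cyc_superset)
    also have "\<dots> = (\<Sum>p<?N. smul (?c p) (lin smul (cyc (cpow g p)) (hochschild_word w)))"
      by (rule linear_eq_on_mon[OF linear_lin_smul])
        (auto intro!: linear_sumI vector_space_smul linear_scaleI)
    finally show ?thesis by (simp add: cyc_bar)
  qed
  have 2: "adj_diff R (log_cyc w) = (\<Sum>p<?N. smul (?c p) (cyc (\<lambda>v. adj_diff R (cpow g p v)) w))"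
    by (simp add: log_cyc_def linear_sum[OF linear_adj_diff] linear_scale[OF linear_adj_diff]
        cyc_linear[OF linear_adj_diff])
  have "adj_diff R (log_cyc w) - lin smul log_cyc (hochschild_word w)
      = (\<Sum>p<?N. smul (?c p) (cyc (defect (cpow g p)) w))"
    by (simp add: 1 2 defect_def[abs_def] cyc_diff sum_subtractf[symmetric] fa.scale_right_diff_distrib)
  moreover have "(\<Sum>p<?N. smul (?c p) (cyc (defect (cpow g p)) w))
      - (\<Sum>p<?N. odd_cyc (Suc p) w - odd_cyc p w) \<in> adj_rel R"
  proof (rule fa.cong_sum[OF K])
    fix p
    have "smul (?c p) (cyc (defect (cpow g p)) w)
        - smul (?c p) (smul (of_nat (Suc p)) (odd_cyc (Suc p) w - odd_cyc p w)) \<in> adj_rel R"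
      by (rule fa.cong_scale[OF K cyc_defect_cpow])
    moreover have "?c p * of_nat (Suc p) = 1" by (simp del: of_nat_Suc)
    ultimately show "smul (?c p) (cyc (defect (cpow g p)) w) - (odd_cyc (Suc p) w - odd_cyc p w) \<in> adj_rel R"
      by (simp del: of_nat_Suc)
  qed
  moreover have "(\<Sum>p<?N. odd_cyc (Suc p) w - odd_cyc p w) = smul ((-1) ^ (?N - 1)) (cyc f' w)"
  proof -
    obtain m where m: "?N = Suc m" using w by (cases w) auto
    have "conv (cpow (twist g) m) (twist f') v = 0" if "length v = ?N" for v
      unfolding conv_def
    proof (rule sum.neutral, rule ballI)
      fix i assume "i \<in> {1..<length v}"
      then have "cpow (twist g) m (take i v) = 0"
        using that m by (intro cpow_short) auto
      then show "cpow (twist g) m (take i v) * twist f' (drop i v) = 0" by simp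
    qed
    then have "odd_cyc ?N w = 0" by (simp add: m odd_cyc_def cyc_def)
    moreover have "odd_cyc 0 w = smul ((-1) ^ ?N) (cyc f' w)"
      by (simp add: odd_cyc_def cyc_def twist_def fa.scale_sum_right fa.scale_left_commute mult.commute)
    moreover have "(\<Sum>p<?N. odd_cyc (Suc p) w - odd_cyc p w) = odd_cyc ?N w - odd_cyc 0 w"
      by (rule sum_lessThan_telescope)
    ultimately show ?thesis by (simp only: m) simp
  qed
  ultimately show ?thesis by (simp add: algebra_simps)
qed

text \<open>The trace of the square of an odd element is half of a commutator.\<close>

lemma cyc_conv_f'_f': "cyc (conv (twist f') f') w \<in> adj_rel R"
proof -
  let ?x = "cyc (conv (twist f') f') w"
  have "?x - cyc (conv (twist f') (\<lambda>v. smul (-1) (f' v))) w \<in> adj_rel R"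
  proof (rule cyc_conv_swap[OF subspace_adj_rel])
    fix u v :: "'a list" assume uv: "u \<noteq> []" "v \<noteq> []"
    obtain m n where mn: "length u = Suc m" "length v = Suc n" using uv by (cases u; cases v) auto
    have "smul ((-1) ^ length u) (f' u * f' v - smul ((-1) ^ ((length u - 1) * (length v - 1))) (f' v * f' u)) \<in> adj_rel R"
      by (rule fa.subspace_scale[OF subspace_adj_rel adj_comm[OF f'_part f'_part]]) (use uv in auto)
    moreover have "(-1 :: 'k) ^ (length u + (length u - 1) * (length v - 1))
        = (-1) ^ (length u * length v + length v + 1)"
      by (rule neg_one_power_cong) (auto simp: mn)
    ultimately show "twist f' u * f' v - smul ((-1) ^ (length u * length v)) (twist f' v * smul (-1) (f' u)) \<in> adj_rel R"
      by (simp add: twist_def fa.scale_right_diff_distrib power_add mult.commute)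
  qed
  moreover have "cyc (conv (twist f') (\<lambda>v. smul (-1) (f' v))) w = - ?x"
    by (simp add: conv_def cyc_def sum_negf fa.scale_minus_right)
  ultimately have "smul (1/2) (?x + ?x) \<in> adj_rel R"
    by (intro fa.subspace_scale) auto
  then show ?thesis by (simp add: fa.scale_right_distrib fa.scale_left_distrib[symmetric])
qed

lemma adj_diff_cyc_f':
  assumes "w \<noteq> []"
  shows "adj_diff R (cyc f' w) - lin smul (cyc f') (hochschild_word w) \<in> adj_rel R"
proof -
  have K: "fa.subspace (adj_rel R)" by simp
  have "cyc (\<lambda>v. adj_diff R (f' v)) w - cyc (\<lambda>v. bar f' v + conv (twist f') f' v) w \<in> adj_rel R"
    by (rule cyc_cong_mod[OF K], rule adj_ideal_rel, rule f'_diff)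
  then have "adj_diff R (cyc f' w) - (lin smul (cyc f') (hochschild_word w) + cyc (conv (twist f') f') w) \<in> adj_rel R"
    by (simp add: cyc_linear[OF linear_adj_diff] cyc_add cyc_bar)
  from fa.subspace_add[OF K this cyc_conv_f'_f'[of w]] show ?thesis by (simp add: algebra_simps)
qed

end


section \<open>Degree projections\<close>

definition fp_proj :: "nat \<Rightarrow> nat \<Rightarrow> ('y, 'r, 'k::field) fp \<Rightarrow> ('y, 'r, 'k) fp"
  where "fp_proj e n = lin smul (\<lambda>w. if word_deg e w = n then mon w else 0)"

lemma linear_fp_proj [intro, simp]: "Vector_Spaces.linear smul smul (fp_proj e n)"
  by (simp add: fp_proj_def)

lemma fp_proj_part:
  assumes "x \<in> fp_part Y e R m"
  shows "fp_proj e n x = (if n = m then x else 0)"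
proof -
  have "fp_proj e n x - smul (if n = m then 1 else 0) x \<in> {0}"
    by (rule linear_span_into[OF linear_diffI[OF linear_fp_proj linear_smulI] _ _ assms[unfolded fp_part_def]])
      (auto simp: fp_proj_def)
  then show ?thesis by (auto split: if_splits)
qed

lemma fp_proj_ideal:
  assumes hom: "\<And>s. s \<in> S \<Longrightarrow> \<exists>m. s \<in> fp_part Y e R m" and x: "x \<in> fp_ideal Y R S"
  shows "fp_proj e n x \<in> fp_ideal Y R S"
proof (rule linear_fp_ideal_into[OF linear_fp_proj _ _ x])
  fix u s v
  assume u: "set u \<subseteq> fp_letters Y R" and s: "s \<in> S" and v: "set v \<subseteq> fp_letters Y R"
  obtain m where m: "s \<in> fp_part Y e R m" using hom[OF s] by auto
  have "mon u * s * mon v \<in> fp_part Y e R (word_deg e u + m + word_deg e v)"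
    by (intro fp_part_mult mon_fp_part u v m refl)
  then show "fp_proj e n (mon u * s * mon v) \<in> fp_ideal Y R S"
    using fp_ideal_sandwich[OF u s v] by (auto simp: fp_proj_part fa.subspace_0)
qed simp

context dga
begin

definition components :: "'r \<Rightarrow> nat \<Rightarrow> 'r" where
  "components x = (THE c. (\<forall>n. c n \<in> dg_part R n) \<and> finite {n. c n \<noteq> 0} \<and> x = (\<Sum>n | c n \<noteq> 0. c n))"

lemma components_ex1:
  "\<exists>!c. (\<forall>n. c n \<in> dg_part R n) \<and> finite {n. c n \<noteq> 0} \<and> x = (\<Sum>n | c n \<noteq> 0. c n)"
  using is_dga by (simp add: is_dga_def)

lemma components_part [intro, simp]: "components x n \<in> dg_part R n"
  and finite_components: "finite {n. components x n \<noteq> 0}"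
  and components_sum: "x = (\<Sum>n | components x n \<noteq> 0. components x n)"
  using theI'[OF components_ex1[of x]] by (auto simp: components_def)

lemma components_eqI:
  assumes "\<And>n. c n \<in> dg_part R n" "finite A" "{n. c n \<noteq> 0} \<subseteq> A" "x = (\<Sum>n\<in>A. c n)"
  shows "components x = c"
proof -
  have "x = (\<Sum>n | c n \<noteq> 0. c n)"
    unfolding assms(4) by (rule sum.mono_neutral_right) (use assms in auto)
  moreover have "finite {n. c n \<noteq> 0}" using assms finite_subset by blast
  ultimately show ?thesis
    unfolding components_def using assms(1) by (intro the1_equality components_ex1) auto
qed

lemma components_sum_superset:
  assumes "finite A" "{n. components x n \<noteq> 0} \<subseteq> A"
  shows "x = (\<Sum>n\<in>A. components x n)"
  by (subst components_sum, rule sum.mono_neutral_left) (use assms in auto)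

lemma components_homogeneous:
  assumes "x \<in> dg_part R m"
  shows "components x n = (if n = m then x else 0)"
proof -
  have "components x = (\<lambda>n. if n = m then x else 0)"
    by (rule components_eqI[of _ "{m}"]) (use assms in auto)
  then show ?thesis by simp
qed

lemma linear_components: "Vector_Spaces.linear (dg_scale R) (dg_scale R) (\<lambda>x. components x n)"
proof (rule linearI)
  fix x y
  let ?A = "{n. components x n \<noteq> 0} \<union> {n. components y n \<noteq> 0}"
  have fin: "finite ?A" by (simp add: finite_components)
  have "components (x + y) = (\<lambda>n. components x n + components y n)"
  proof (rule components_eqI[OF _ fin])
    show "x + y = (\<Sum>n\<in>?A. components x n + components y n)"
      using components_sum_superset[OF fin, of x] components_sum_superset[OF fin, of y]
      by (simp add: sum.distrib)
  qed (auto intro: subspace_add[OF subspace_part])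
  then show "components (x + y) n = components x n + components y n" by simp
next
  fix c x
  have "components (dg_scale R c x) = (\<lambda>n. dg_scale R c (components x n))"
  proof (rule components_eqI[OF _ finite_components[of x]])
    show "dg_scale R c x = (\<Sum>n | components x n \<noteq> 0. dg_scale R c (components x n))"
      using components_sum[of x] by (metis (no_types, lifting) scale_sum_right sum.cong)
  qed (auto intro: subspace_scale[OF subspace_part])
  then show "components (dg_scale R c x) n = dg_scale R c (components x n)" by simp
qed (auto intro: vector_space_axioms)

text \<open>Components are determined by uniqueness, so it suffices that the right hand side is a
  finitely supported family of elements of the correct degrees with sum \<open>d x\<close>. The set \<open>A\<close> contains the degrees that can occur
  on either side, and \<open>0\<close> is treated apart because \<open>d\<close> vanishes on degree \<open>0\<close>.\<close>

lemma components_diff: "components (dg_diff R x) n = dg_diff R (components x (Suc n))"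
proof -
  define A where "A = (\<Union>m\<in>{m. components x m \<noteq> 0}. {m - 1, m})"
  have fin: "finite A" unfolding A_def using finite_components by auto
  have "components (dg_diff R x) = (\<lambda>n. dg_diff R (components x (Suc n)))"
  proof (rule components_eqI[OF _ fin])
    show "dg_diff R (components x (Suc n)) \<in> dg_part R n" for n by (simp add: diff_part)
    show "{n. dg_diff R (components x (Suc n)) \<noteq> 0} \<subseteq> A"
    proof
      fix n assume "n \<in> {n. dg_diff R (components x (Suc n)) \<noteq> 0}"
      then have "components x (Suc n) \<noteq> 0" using linear_0[OF linear_diff_R] by auto
      then show "n \<in> A" unfolding A_def by (intro UN_I[of "Suc n"]) auto
    qed
    have "dg_diff R x = (\<Sum>m\<in>insert 0 (Suc ` A). dg_diff R (components x m))"
    proof -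
      have "{m. components x m \<noteq> 0} \<subseteq> insert 0 (Suc ` A)"
      proof
        fix m assume "m \<in> {m. components x m \<noteq> 0}"
        then have "m - 1 \<in> A" unfolding A_def by blast
        then show "m \<in> insert 0 (Suc ` A)" by (cases m) auto
      qed
      then have "x = (\<Sum>m\<in>insert 0 (Suc ` A). components x m)"
        by (rule components_sum_superset[rotated]) (use fin in simp)
      from arg_cong[OF this, of "dg_diff R"] show ?thesis
        unfolding linear_sum[OF linear_diff_R] .
    qed
    also have "\<dots> = (\<Sum>n\<in>A. dg_diff R (components x (Suc n)))"
    proof -
      have "dg_diff R (components x 0) = 0" by (rule diff_part0[OF components_part])
      moreover have "finite (Suc ` A)" "0 \<notin> Suc ` A" using fin by auto
      ultimately show ?thesis by (simp add: sum.reindex)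
    qed
    finally show "dg_diff R x = (\<Sum>n\<in>A. dg_diff R (components x (Suc n)))" .
  qed
  then show ?thesis by simp
qed

lemma comm_part:
  assumes u: "u \<in> dg_part R p" and v: "v \<in> dg_part R q"
  shows "u * v - dg_scale R c (v * u) \<in> dg_part R (p + q)"
proof -
  have "v * u \<in> dg_part R (p + q)" using mult_part[OF v u] by (simp add: add.commute)
  then show ?thesis
    by (rule subspace_diff[OF subspace_part mult_part[OF u v] subspace_scale[OF subspace_part]])
qed

text \<open>The trace of an element of \<open>R\<close> is defined on each homogeneous part separately. A relation is therefore
  first rewritten as a combination of commutators of its own degree.\<close>

definition nat_rel_deg :: "nat \<Rightarrow> 'r set"
  where "nat_rel_deg n = span {u * v - dg_scale R ((-1) ^ (p * q)) (v * u) |p q u v.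
    u \<in> dg_part R p \<and> v \<in> dg_part R q \<and> p + q = n}"

lemma components_graded_commutators:
  assumes x: "x \<in> graded_commutators (dg_scale R) (dg_part R)"
  shows "components x n \<in> nat_rel_deg n"
proof -
  obtain p q u v where xe: "x = u * v - dg_scale R ((-1) ^ (p * q)) (v * u)"
    and u: "u \<in> dg_part R p" and v: "v \<in> dg_part R q"
    using x by (auto simp: graded_commutators_def)
  have "x \<in> dg_part R (p + q)"
    unfolding xe by (rule comm_part[OF u v])
  then show ?thesis
    unfolding nat_rel_deg_def using xe u v by (auto simp: components_homogeneous span_zero intro!: span_base)
qed

lemma subspace_nat_rel_deg: "subspace (nat_rel_deg n)"
  by (simp add: nat_rel_deg_def)

lemma components_nat_rel:
  assumes "u \<in> span (insert 1 (graded_commutators (dg_scale R) (dg_part R)))" "n \<ge> 1"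
  shows "components u n \<in> nat_rel_deg n"
proof (rule linear_span_into[OF linear_components subspace_nat_rel_deg _ assms(1)])
  fix x assume "x \<in> insert 1 (graded_commutators (dg_scale R) (dg_part R))"
  moreover have "components 1 n \<in> nat_rel_deg n"
    using assms(2) components_homogeneous[OF one_part, of n] subspace_0[OF subspace_nat_rel_deg] by simp
  ultimately show "components x n \<in> nat_rel_deg n" using components_graded_commutators by auto
qed

lemma components_nat_rel_deg: "u \<in> nat_rel \<Longrightarrow> components u n \<in> nat_rel_deg n"
  unfolding nat_rel_def
  by (rule linear_span_into[OF linear_components subspace_nat_rel_deg components_graded_commutators])

lemma nat_rel_deg_nat_rel: "u \<in> nat_rel_deg n \<Longrightarrow> u \<in> nat_rel"
  unfolding nat_rel_deg_def nat_rel_def graded_commutators_def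
  by (erule subsetD[OF span_mono, rotated]) blast

end


section \<open>Matrix elements\<close>

locale rep = dga R
  for R :: "('k::field, 'r::{ring, monoid_mult}) dga" +
  fixes scV :: "'k \<Rightarrow> 'v::ab_group_add \<Rightarrow> 'v" and bs :: "'v list"
  assumes vector_space_V: "vector_space scV" and basis: "is_basis_list scV bs"
begin

interpretation V: vector_space scV by (rule vector_space_V)

abbreviation "rel_ideal \<equiv> end_ideal scV R"
abbreviation "ext \<phi> \<equiv> (gen (Ext \<phi>) :: ('v \<Rightarrow> 'v, 'r, 'k) fp)"
abbreviation "mu \<equiv> matrix_unit scV bs"
abbreviation "part \<equiv> fp_part (End scV) 0 R"
abbreviation "coord v j \<equiv> V.representation (set bs) v (bs ! j)"

lemma indep: "V.independent (set bs)" and span_bs: "V.span (set bs) = UNIV" and dist: "distinct bs"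
  using basis by (auto simp: is_basis_list_def)

lemma coord_add: "coord (v + w) j = coord v j + coord w j"
  by (simp add: V.representation_add indep span_bs)

lemma coord_scale: "coord (scV c v) j = c * coord v j"
  by (simp add: V.representation_scale indep span_bs)

lemma coord_basis: "i < length bs \<Longrightarrow> j < length bs \<Longrightarrow> coord (bs ! i) j = (if i = j then 1 else 0)"
  by (simp add: V.representation_basis indep nth_eq_iff_index_eq[OF dist] eq_commute)

lemma coord_expand: "v = (\<Sum>j<length bs. scV (coord v j) (bs ! j))"
proof -
  have "v = (\<Sum>b\<in>set bs. scV (V.representation (set bs) v b) b)"
    by (rule V.sum_representation_eq[symmetric]) (auto simp: indep span_bs)
  also have "\<dots> = (\<Sum>j<length bs. scV (coord v j) (bs ! j))"
    by (rule sum.reindex_bij_betw[OF bij_betw_nth[OF dist refl refl], symmetric])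
  finally show ?thesis .
qed

lemma End_add: "\<phi> \<in> End scV \<Longrightarrow> \<phi> (v + w) = \<phi> v + \<phi> w"
  and End_scale: "\<phi> \<in> End scV \<Longrightarrow> \<phi> (scV c v) = scV c (\<phi> v)"
  by (auto simp: End_def linear_add linear_scale)

lemma End_sum: "\<phi> \<in> End scV \<Longrightarrow> \<phi> (\<Sum>i\<in>A. h i) = (\<Sum>i\<in>A. \<phi> (h i))"
  unfolding End_def by (simp add: linear_sum)

lemma EndI:
  "(\<And>v w. \<phi> (v + w) = \<phi> v + \<phi> w) \<Longrightarrow> (\<And>c v. \<phi> (scV c v) = scV c (\<phi> v)) \<Longrightarrow> \<phi> \<in> End scV"
  by (simp add: End_def linearI[OF vector_space_V vector_space_V])

lemma mu_End [intro, simp]: "mu i j \<in> End scV"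
  by (rule EndI) (simp_all add: matrix_unit_def coord_add coord_scale V.scale_left_distrib)

lemma zero_End [intro, simp]: "(\<lambda>v. 0) \<in> End scV"
  by (rule EndI) simp_all

lemma id_End [intro, simp]: "id \<in> End scV"
  by (rule EndI) simp_all

lemma comp_End: "\<phi> \<in> End scV \<Longrightarrow> \<psi> \<in> End scV \<Longrightarrow> \<phi> \<circ> \<psi> \<in> End scV"
  by (rule EndI) (simp_all add: End_add End_scale)

lemma scale_End: "\<phi> \<in> End scV \<Longrightarrow> (\<lambda>v. scV c (\<phi> v)) \<in> End scV"
  by (rule EndI) (simp_all add: End_add End_scale V.scale_right_distrib V.scale_left_commute)

lemma sum_End: "(\<And>i. i \<in> A \<Longrightarrow> \<phi> i \<in> End scV) \<Longrightarrow> (\<lambda>v. \<Sum>i\<in>A. \<phi> i v) \<in> End scV"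
  by (rule EndI) (simp_all add: End_add End_scale sum.distrib V.scale_sum_right)

lemma mu_mu:
  assumes "j < length bs" "k < length bs"
  shows "mu i j \<circ> mu k l = (if j = k then mu i l else (\<lambda>v. 0))"
  using assms by (auto simp: fun_eq_iff matrix_unit_def coord_scale coord_basis)

lemma sum_mu: "(\<lambda>v. \<Sum>l<length bs. mu l l v) = id"
  by (auto simp: fun_eq_iff matrix_unit_def coord_expand[symmetric])

text \<open>The columns of the matrix of \<open>\<phi>\<close>; together with the rows in \<open>mu_End_comp\<close> they show that matrix elements
  commute with endomorphisms.\<close>

lemma End_mu:
  assumes "\<phi> \<in> End scV"
  shows "\<phi> \<circ> mu l i = (\<lambda>v. \<Sum>k<length bs. scV (coord (\<phi> (bs ! l)) k) (mu k i v))"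
proof
  fix v
  have "(\<phi> \<circ> mu l i) v = scV (coord v i) (\<phi> (bs ! l))"
    by (simp add: matrix_unit_def End_scale[OF assms])
  also have "\<phi> (bs ! l) = (\<Sum>k<length bs. scV (coord (\<phi> (bs ! l)) k) (bs ! k))"
    by (rule coord_expand)
  finally show "(\<phi> \<circ> mu l i) v = (\<Sum>k<length bs. scV (coord (\<phi> (bs ! l)) k) (mu k i v))"
    by (simp add: matrix_unit_def V.scale_sum_right V.scale_left_commute mult.commute)
qed

lemma coord_sum: "coord (\<Sum>i\<in>A. h i) j = (\<Sum>i\<in>A. coord (h i) j)"
  by (simp add: V.representation_sum indep span_bs)

lemma mu_End_comp:
  assumes "\<phi> \<in> End scV"
  shows "mu j l \<circ> \<phi> = (\<lambda>v. \<Sum>m<length bs. scV (coord (\<phi> (bs ! m)) l) (mu j m v))"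
proof
  fix v
  have "\<phi> v = (\<Sum>m<length bs. scV (coord v m) (\<phi> (bs ! m)))"
    by (subst coord_expand[of v]) (simp add: End_sum[OF assms] End_scale[OF assms])
  then have "coord (\<phi> v) l = (\<Sum>m<length bs. coord v m * coord (\<phi> (bs ! m)) l)"
    by (simp add: coord_sum coord_scale)
  then show "(mu j l \<circ> \<phi>) v = (\<Sum>m<length bs. scV (coord (\<phi> (bs ! m)) l) (mu j m v))"
    by (simp add: matrix_unit_def V.scale_sum_left mult.commute)
qed

lemma end_relations_addI:
  "\<phi> \<in> End scV \<Longrightarrow> \<psi> \<in> End scV \<Longrightarrow>
    gen (Ext (\<lambda>v. \<phi> v + \<psi> v)) - gen (Ext \<phi>) - gen (Ext \<psi>) \<in> end_relations scV"
  unfolding end_relations_def by (rule UnI1, rule UnI1, rule UnI1) blast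

lemma end_relations_scaleI:
  "\<phi> \<in> End scV \<Longrightarrow> gen (Ext (\<lambda>v. scV c (\<phi> v))) - smul c (gen (Ext \<phi>)) \<in> end_relations scV"
  unfolding end_relations_def by (rule UnI1, rule UnI1, rule UnI2) blast

lemma end_relations_compI:
  "\<phi> \<in> End scV \<Longrightarrow> \<psi> \<in> End scV \<Longrightarrow>
    gen (Ext (\<phi> \<circ> \<psi>)) - gen (Ext \<phi>) * gen (Ext \<psi>) \<in> end_relations scV"
  unfolding end_relations_def by (rule UnI1, rule UnI2) blast

lemma end_relations_idI: "gen (Ext id) - 1 \<in> end_relations scV"
  unfolding end_relations_def by (rule UnI2) blast

lemma end_relations_cases:
  assumes "s \<in> end_relations scV"
  obtains (add) \<phi> \<psi> where "s = gen (Ext (\<lambda>v. \<phi> v + \<psi> v)) - gen (Ext \<phi>) - gen (Ext \<psi>)" "\<phi> \<in> End scV" "\<psi> \<in> End scV"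
    | (scale) c \<phi> where "s = gen (Ext (\<lambda>v. scV c (\<phi> v))) - smul c (gen (Ext \<phi>))" "\<phi> \<in> End scV"
    | (comp) \<phi> \<psi> where "s = gen (Ext (\<phi> \<circ> \<psi>)) - gen (Ext \<phi>) * gen (Ext \<psi>)" "\<phi> \<in> End scV" "\<psi> \<in> End scV"
    | (one) "s = gen (Ext id) - 1"
  using assms unfolding end_relations_def
  by (elim UnE CollectE exE conjE insertE emptyE) (rule that; assumption)+

text \<open>The relations of \<open>End V\<close> involve no letters of the other factor.\<close>

lemma end_relations_hom:
  assumes lin: "Vector_Spaces.linear smul smul F" and mult: "\<And>x y. F (x * y) = F x * F y" and one: "F 1 = 1"
    and ext: "\<And>\<phi>. F (gen (Ext \<phi>)) = gen (Ext \<phi>)" and s: "s \<in> end_relations scV"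
  shows "F s \<in> end_relations scV"
proof -
  note F = linear_diff[OF lin] linear_scale[OF lin] mult one ext
  from s show ?thesis
  proof (cases rule: end_relations_cases)
    case (add \<phi> \<psi>)
    then show ?thesis using end_relations_addI[OF add(2,3)] by (simp add: F)
  next
    case (scale c \<phi>)
    then show ?thesis using end_relations_scaleI[OF scale(2)] by (simp add: F)
  next
    case (comp \<phi> \<psi>)
    then show ?thesis using end_relations_compI[OF comp(2,3)] by (simp add: F)
  next
    case one
    then show ?thesis using end_relations_idI by (simp add: F)
  qed
qed

lemma subspace_rel_ideal [intro, simp]: "fa.subspace rel_ideal"
  by (simp add: end_ideal_def)

lemma end_relations_rel_ideal: "x \<in> end_relations scV \<Longrightarrow> x \<in> rel_ideal"
  unfolding end_ideal_def by (rule fp_ideal_base) simp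

lemma ext_add: "\<phi> \<in> End scV \<Longrightarrow> \<psi> \<in> End scV \<Longrightarrow> ext (\<lambda>v. \<phi> v + \<psi> v) - (ext \<phi> + ext \<psi>) \<in> rel_ideal"
  unfolding diff_diff_eq[symmetric]
  by (rule end_relations_rel_ideal[OF end_relations_addI])

lemma ext_scale: "\<phi> \<in> End scV \<Longrightarrow> ext (\<lambda>v. scV c (\<phi> v)) - smul c (ext \<phi>) \<in> rel_ideal"
  by (rule end_relations_rel_ideal[OF end_relations_scaleI])

lemma ext_comp: "\<phi> \<in> End scV \<Longrightarrow> \<psi> \<in> End scV \<Longrightarrow> ext (\<phi> \<circ> \<psi>) - ext \<phi> * ext \<psi> \<in> rel_ideal"
  by (rule end_relations_rel_ideal[OF end_relations_compI])

lemma ext_id: "ext id - 1 \<in> rel_ideal"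
  by (rule end_relations_rel_ideal[OF end_relations_idI])

lemma ext_zero: "ext (\<lambda>v. 0) \<in> rel_ideal"
  using ext_scale[OF zero_End, of 0] by simp

lemma ext_sum:
  assumes "finite A" "\<And>i. i \<in> A \<Longrightarrow> \<phi> i \<in> End scV"
  shows "ext (\<lambda>v. \<Sum>i\<in>A. scV (c i) (\<phi> i v)) - (\<Sum>i\<in>A. smul (c i) (ext (\<phi> i))) \<in> rel_ideal"
  using assms
proof (induction A rule: finite_induct)
  case empty
  then show ?case by (simp add: ext_zero)
next
  case (insert a A)
  have I: "fa.subspace rel_ideal" by simp
  have "ext (\<lambda>v. scV (c a) (\<phi> a v) + (\<Sum>i\<in>A. scV (c i) (\<phi> i v)))
      - (ext (\<lambda>v. scV (c a) (\<phi> a v)) + ext (\<lambda>v. \<Sum>i\<in>A. scV (c i) (\<phi> i v))) \<in> rel_ideal"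
    by (intro ext_add scale_End sum_End) (use insert.prems in auto)
  then show ?case
    using fa.cong_trans[OF I _ fa.cong_add[OF I ext_scale[of "\<phi> a" "c a"] insert.IH]] insert
    by simp
qed

lemma ext_part: "\<phi> \<in> End scV \<Longrightarrow> ext \<phi> \<in> part 0"
  by (rule ext_fp_part)

lemma ext_adm: "\<phi> \<in> End scV \<Longrightarrow> ext \<phi> \<in> adm (End scV) R"
  by (rule fp_part_adm[OF ext_part])

lemma rel_ideal_mult_left: "a \<in> adm (End scV) R \<Longrightarrow> x \<in> rel_ideal \<Longrightarrow> a * x \<in> rel_ideal"
  unfolding end_ideal_def by (rule fp_ideal_mult_left)

lemma rel_ideal_mult_right: "x \<in> rel_ideal \<Longrightarrow> a \<in> adm (End scV) R \<Longrightarrow> x * a \<in> rel_ideal"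
  unfolding end_ideal_def by (rule fp_ideal_mult_right)

lemma rel_cong_mult_left: "a \<in> adm (End scV) R \<Longrightarrow> x - y \<in> rel_ideal \<Longrightarrow> a * x - a * y \<in> rel_ideal"
  using rel_ideal_mult_left[of a "x - y"] by (simp add: algebra_simps)

lemma rel_cong_mult_right: "x - y \<in> rel_ideal \<Longrightarrow> a \<in> adm (End scV) R \<Longrightarrow> x * a - y * a \<in> rel_ideal"
  using rel_ideal_mult_right[of "x - y" a] by (simp add: algebra_simps)

text \<open>The matrix element of an arbitrary element of the free product, not only of a letter.\<close>

definition mat :: "nat \<Rightarrow> nat \<Rightarrow> ('v \<Rightarrow> 'v, 'r, 'k) fp \<Rightarrow> ('v \<Rightarrow> 'v, 'r, 'k) fp"
  where "mat i j y = (\<Sum>l<length bs. ext (mu l i) * y * ext (mu j l))"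

lemma mat_elt_mat: "mat_elt scV bs n r i j = mat i j (elt n r)"
  by (simp add: mat_elt_def mat_def elt_def)

lemma linear_mat [intro, simp]: "Vector_Spaces.linear smul smul (mat i j)"
  unfolding mat_def
  by (intro linear_sumI vector_space_smul linear_comp[OF linear_mult_right linear_mult_left])

lemma mat_part: "y \<in> part n \<Longrightarrow> mat i j y \<in> part n"
  unfolding mat_def
proof (rule fa.subspace_sum[OF subspace_fp_part])
  fix l assume y: "y \<in> part n"
  have "ext (mu l i) * y * ext (mu j l) \<in> part (0 + n + 0)"
    by (intro fp_part_mult ext_part y) auto
  then show "ext (mu l i) * y * ext (mu j l) \<in> part n" by simp
qed

lemma mat_adm: "y \<in> adm (End scV) R \<Longrightarrow> mat i j y \<in> adm (End scV) R"
  unfolding mat_def by (intro fa.subspace_sum[OF subspace_adm] adm_mult ext_adm mu_End)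

lemma mat_rel_ideal: "y \<in> rel_ideal \<Longrightarrow> mat i j y \<in> rel_ideal"
  unfolding mat_def
  by (intro fa.subspace_sum[OF subspace_rel_ideal] rel_ideal_mult_left rel_ideal_mult_right ext_adm mu_End)

lemma mat_cong: "x - y \<in> rel_ideal \<Longrightarrow> mat i j x - mat i j y \<in> rel_ideal"
  using mat_rel_ideal[of "x - y" i j] by (simp add: linear_diff[OF linear_mat])

text \<open>Both products expand to the sum of all \<open>\<phi>\<^sub>k\<^sub>l e\<^sub>k\<^sub>i y e\<^sub>j\<^sub>l\<close>.\<close>

lemma mat_commute:
  assumes y: "y \<in> adm (End scV) R" and \<phi>: "\<phi> \<in> End scV"
  shows "ext \<phi> * mat i j y - mat i j y * ext \<phi> \<in> rel_ideal"
proof -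
  let ?N = "length bs"
  let ?c = "\<lambda>k l. coord (\<phi> (bs ! l)) k"
  have I: "fa.subspace rel_ideal" by simp
  have 1: "ext \<phi> * ext (mu l i) - (\<Sum>k<?N. smul (?c k l) (ext (mu k i))) \<in> rel_ideal" for l
    using fa.cong_trans[OF I fa.cong_sym[OF I ext_comp[OF \<phi> mu_End[of l i]]]
        ext_sum[of "{..<?N}" "\<lambda>k. mu k i" "\<lambda>k. ?c k l", OF finite_lessThan mu_End, folded End_mu[OF \<phi>]]]
    by simp
  have 2: "ext (mu j l) * ext \<phi> - (\<Sum>m<?N. smul (?c l m) (ext (mu j m))) \<in> rel_ideal" for l
    using fa.cong_trans[OF I fa.cong_sym[OF I ext_comp[OF mu_End[of j l] \<phi>]]
        ext_sum[of "{..<?N}" "\<lambda>m. mu j m" "\<lambda>m. ?c l m", OF finite_lessThan mu_End, folded mu_End_comp[OF \<phi>]]]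
    by simp
  have L: "ext \<phi> * mat i j y - (\<Sum>l<?N. (\<Sum>k<?N. smul (?c k l) (ext (mu k i))) * (y * ext (mu j l))) \<in> rel_ideal"
    unfolding mat_def sum_distrib_left mult.assoc
    unfolding mult.assoc[symmetric, of "ext \<phi>"]
    by (intro fa.cong_sum[OF I] rel_cong_mult_right 1 adm_mult y ext_adm mu_End)
  have M: "mat i j y * ext \<phi> - (\<Sum>l<?N. ext (mu l i) * y * (\<Sum>m<?N. smul (?c l m) (ext (mu j m)))) \<in> rel_ideal"
    unfolding mat_def sum_distrib_right mult.assoc[of "_ * _" _ "ext \<phi>"]
    by (intro fa.cong_sum[OF I] rel_cong_mult_left 2 adm_mult y ext_adm mu_End)
  have eq: "(\<Sum>l<?N. (\<Sum>k<?N. smul (?c k l) (ext (mu k i))) * (y * ext (mu j l)))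
      = (\<Sum>l<?N. ext (mu l i) * y * (\<Sum>m<?N. smul (?c l m) (ext (mu j m))))"
    unfolding sum_distrib_right sum_distrib_left smul_mult_left smul_mult_right mult.assoc
    by (rule sum.swap)
  show ?thesis
    by (rule fa.cong_trans[OF I L]) (use fa.cong_sym[OF I M] in \<open>simp only: eq\<close>)
qed

lemma mat_centralizer: "y \<in> part n \<Longrightarrow> mat i j y \<in> centralizer scV R n"
  by (simp add: centralizer_def mat_part mat_commute fp_part_adm)

lemma centralizer_part: "u \<in> centralizer scV R n \<Longrightarrow> u \<in> part n"
  by (simp add: centralizer_def)

lemma subspace_centralizer [intro, simp]: "fa.subspace (centralizer scV R n)"
proof -
  have "fa.subspace {u. ext \<phi> * u - u * ext \<phi> \<in> rel_ideal}" for \<phi>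
  proof (rule fa.subspaceI)
    fix x y assume "x \<in> {u. ext \<phi> * u - u * ext \<phi> \<in> rel_ideal}" "y \<in> {u. ext \<phi> * u - u * ext \<phi> \<in> rel_ideal}"
    then show "x + y \<in> {u. ext \<phi> * u - u * ext \<phi> \<in> rel_ideal}"
      using fa.subspace_add[OF subspace_rel_ideal, of "ext \<phi> * x - x * ext \<phi>" "ext \<phi> * y - y * ext \<phi>"]
      by (simp add: algebra_simps)
  next
    fix c x assume "x \<in> {u. ext \<phi> * u - u * ext \<phi> \<in> rel_ideal}"
    then show "smul c x \<in> {u. ext \<phi> * u - u * ext \<phi> \<in> rel_ideal}"
      using fa.subspace_scale[OF subspace_rel_ideal, of "ext \<phi> * x - x * ext \<phi>" c]
      by (simp add: fa.scale_right_diff_distrib)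
  qed (simp add: fa.subspace_0)
  moreover have "centralizer scV R n = part n \<inter> (\<Inter>\<phi>\<in>End scV. {u. ext \<phi> * u - u * ext \<phi> \<in> rel_ideal})"
    by (auto simp: centralizer_def)
  ultimately show ?thesis by (auto intro!: fa.subspace_inter fa.subspace_Int)
qed

lemma one_centralizer [intro, simp]: "1 \<in> centralizer scV R 0"
  by (simp add: centralizer_def fa.subspace_0)

text \<open>For \<open>u\<close> commuting with matrix units, \<open>e\<^sub>l\<^sub>i u e\<^sub>i\<^sub>l = u e\<^sub>l\<^sub>l\<close>, and these add up to \<open>u\<close>. So the matrix element at
  \<open>(i, i)\<close> is a projection onto the centralizer.\<close>

lemma mat_diag_centralizer:
  assumes u: "u \<in> centralizer scV R n" and i: "i < length bs"
  shows "mat i i u - u \<in> rel_ideal"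
proof -
  have I: "fa.subspace rel_ideal" by simp
  have ua: "u \<in> adm (End scV) R" by (rule fp_part_adm[OF centralizer_part[OF u]])
  have 1: "ext (mu l i) * u * ext (mu i l) - u * ext (mu l l) \<in> rel_ideal" if "l < length bs" for l
  proof (rule fa.cong_trans[OF I])
    show "ext (mu l i) * u * ext (mu i l) - u * ext (mu l i) * ext (mu i l) \<in> rel_ideal"
      by (rule rel_cong_mult_right) (use u in \<open>auto simp: centralizer_def intro: ext_adm\<close>)
    have "mu l i \<circ> mu i l = mu l l" using mu_mu[OF i i] by simp
    then have "ext (mu l i) * ext (mu i l) - ext (mu l l) \<in> rel_ideal"
      using fa.cong_sym[OF I ext_comp[OF mu_End[of l i] mu_End[of i l]]] by simp
    then show "u * ext (mu l i) * ext (mu i l) - u * ext (mu l l) \<in> rel_ideal"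
      unfolding mult.assoc by (rule rel_cong_mult_left[OF ua])
  qed
  have a: "mat i i u - (\<Sum>l<length bs. u * ext (mu l l)) \<in> rel_ideal"
    unfolding mat_def by (rule fa.cong_sum[OF I]) (use 1 in auto)
  have b: "(\<Sum>l<length bs. u * ext (mu l l)) - u * 1 \<in> rel_ideal"
    unfolding sum_distrib_left[symmetric]
  proof (rule rel_cong_mult_left[OF ua])
    have "(\<Sum>l<length bs. ext (mu l l)) - ext id \<in> rel_ideal"
      using fa.cong_sym[OF I ext_sum[of "{..<length bs}" "\<lambda>l. mu l l" "\<lambda>l. 1", OF finite_lessThan mu_End]] by (simp add: sum_mu)
    then show "(\<Sum>l<length bs. ext (mu l l)) - 1 \<in> rel_ideal"
      using fa.cong_trans[OF I _ ext_id] by simp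
  qed
  show ?thesis using fa.cong_trans[OF I a b] by simp
qed

text \<open>Insert \<open>1 = \<Sum>\<^sub>j e\<^sub>j\<^sub>j\<close> between the factors.\<close>

lemma mat_mult:
  assumes u: "u \<in> adm (End scV) R" and v: "v \<in> adm (End scV) R"
  shows "mat i k (u * v) - (\<Sum>j<length bs. mat i j u * mat j k v) \<in> rel_ideal"
proof -
  let ?N = "length bs"
  have I: "fa.subspace rel_ideal" by simp
  let ?E = "\<lambda>j. ext (mu j j)"
  have one: "(\<Sum>j<?N. ?E j) - 1 \<in> rel_ideal"
    using fa.cong_trans[OF I fa.cong_sym[OF I ext_sum[of "{..<?N}" "\<lambda>l. mu l l" "\<lambda>l. 1", OF finite_lessThan mu_End]], of 1] ext_id
    by (simp add: sum_mu)
  have a: "mat i j u * mat j k v - (\<Sum>l<?N. ext (mu l i) * u * ?E j * (v * ext (mu k l))) \<in> rel_ideal"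
    if j: "j < ?N" for j
  proof -
    have "mat i j u * mat j k v = (\<Sum>l<?N. \<Sum>m<?N. ext (mu l i) * u * (ext (mu j l) * ext (mu m j)) * (v * ext (mu k m)))"
      by (simp add: mat_def sum_product mult.assoc)
    moreover have "\<dots> - (\<Sum>l<?N. \<Sum>m<?N. ext (mu l i) * u * (if m = l then ?E j else 0) * (v * ext (mu k m))) \<in> rel_ideal"
    proof (intro fa.cong_sum[OF I])
      fix l m assume lm: "l \<in> {..<?N}" "m \<in> {..<?N}"
      have "ext (mu j l) * ext (mu m j) - (if m = l then ?E j else 0) \<in> rel_ideal"
      proof (cases "m = l")
        case True
        then show ?thesis
          using fa.cong_sym[OF I ext_comp[OF mu_End[of j l] mu_End[of m j]]] mu_mu[of l m j j] lm by simp
      next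
        case False
        then have "mu j l \<circ> mu m j = (\<lambda>v. 0)" using mu_mu[of l m j j] lm by simp
        then show ?thesis
          using fa.cong_trans[OF I fa.cong_sym[OF I ext_comp[OF mu_End[of j l] mu_End[of m j]]], of 0]
            ext_zero False by simp
      qed
      then show "ext (mu l i) * u * (ext (mu j l) * ext (mu m j)) * (v * ext (mu k m))
          - ext (mu l i) * u * (if m = l then ?E j else 0) * (v * ext (mu k m)) \<in> rel_ideal"
        by (intro rel_cong_mult_right rel_cong_mult_left adm_mult u v ext_adm mu_End)
    qed
    moreover have "(\<Sum>l<?N. \<Sum>m<?N. ext (mu l i) * u * (if m = l then ?E j else 0) * (v * ext (mu k m)))
        = (\<Sum>l<?N. ext (mu l i) * u * ?E j * (v * ext (mu k l)))"
    proof (rule sum.cong[OF refl])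
      fix l assume l: "l \<in> {..<?N}"
      have "(\<Sum>m<?N. ext (mu l i) * u * (if m = l then ?E j else 0) * (v * ext (mu k m)))
          = (\<Sum>m<?N. if m = l then ext (mu l i) * u * ?E j * (v * ext (mu k m)) else 0)"
        by (rule sum.cong) auto
      then show "(\<Sum>m<?N. ext (mu l i) * u * (if m = l then ?E j else 0) * (v * ext (mu k m)))
          = ext (mu l i) * u * ?E j * (v * ext (mu k l))"
        using l by simp
    qed
    ultimately show ?thesis by simp
  qed
  have 1: "(\<Sum>j<?N. mat i j u * mat j k v)
      - (\<Sum>j<?N. \<Sum>l<?N. ext (mu l i) * u * ?E j * (v * ext (mu k l))) \<in> rel_ideal"
    by (rule fa.cong_sum[OF I]) (use a in auto)
  have 2: "(\<Sum>j<?N. \<Sum>l<?N. ext (mu l i) * u * ?E j * (v * ext (mu k l)))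
      = (\<Sum>l<?N. ext (mu l i) * u * (\<Sum>j<?N. ?E j) * (v * ext (mu k l)))"
    by (subst sum.swap) (simp add: sum_distrib_left sum_distrib_right)
  have 3: "(\<Sum>l<?N. ext (mu l i) * u * (\<Sum>j<?N. ?E j) * (v * ext (mu k l)))
      - (\<Sum>l<?N. ext (mu l i) * u * 1 * (v * ext (mu k l))) \<in> rel_ideal"
    by (intro fa.cong_sum[OF I] rel_cong_mult_right rel_cong_mult_left adm_mult u v ext_adm mu_End one)
  have 4: "(\<Sum>l<?N. ext (mu l i) * u * 1 * (v * ext (mu k l))) = mat i k (u * v)"
    by (simp add: mat_def mult.assoc)
  show ?thesis
    by (rule fa.cong_sym[OF I]) (rule fa.cong_trans[OF I 1[unfolded 2] 3[unfolded 4]])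
qed

definition rep_rel :: "('v \<Rightarrow> 'v, 'r, 'k) fp set" where "rep_rel = fa.span (rep_relations scV R)"

lemma subspace_rep_rel [intro, simp]: "fa.subspace rep_rel"
  by (simp add: rep_rel_def)

lemma rel_ideal_rep_rel: "x \<in> rel_ideal \<Longrightarrow> x \<in> rep_rel"
  unfolding rep_rel_def rep_relations_def by (rule fa.span_base) simp

lemma centralizer_comm:
  assumes "u \<in> centralizer scV R p" "v \<in> centralizer scV R q"
  shows "u * v - smul ((-1) ^ (p * q)) (v * u) \<in> rep_rel"
proof -
  have "u * v - smul ((-1) ^ (p * q)) (v * u) \<in> graded_commutators smul (centralizer scV R)"
    using assms by (auto simp: graded_commutators_def)
  then have "1 * (u * v - smul ((-1) ^ (p * q)) (v * u)) * 1 \<in> rep_relations scV R"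
    unfolding rep_relations_def using one_centralizer by blast
  then show ?thesis unfolding rep_rel_def by (simp add: fa.span_base)
qed

lemma elt_end_S: "elt_relations R \<subseteq> end_relations scV \<union> elt_relations R" by simp

abbreviation mtr :: "nat \<Rightarrow> 'r \<Rightarrow> ('v \<Rightarrow> 'v, 'r, 'k) fp" where "mtr \<equiv> mat_trace scV bs"

lemma mat_trace_mat: "mtr n r = (\<Sum>i<length bs. mat i i (elt n r))"
  by (simp add: mat_trace_def mat_elt_mat)

lemma mat_trace_add:
  "r \<in> dg_part R n \<Longrightarrow> s \<in> dg_part R n \<Longrightarrow> mtr n (r + s) - (mtr n r + mtr n s) \<in> rel_ideal"
  unfolding mat_trace_mat sum.distrib[symmetric] linear_add[OF linear_mat, symmetric]
  by (intro fa.cong_sum mat_cong) (auto simp: end_ideal_def intro: elt_add[OF elt_end_S])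

lemma mat_trace_scale:
  "r \<in> dg_part R n \<Longrightarrow> mtr n (dg_scale R c r) - smul c (mtr n r) \<in> rel_ideal"
  unfolding mat_trace_mat fa.scale_sum_right linear_scale[OF linear_mat, symmetric]
  by (intro fa.cong_sum mat_cong) (auto simp: end_ideal_def intro: elt_scale[OF elt_end_S])

lemma mat_trace_diff:
  assumes "r \<in> dg_part R n" "s \<in> dg_part R n"
  shows "mtr n (r - s) - (mtr n r - mtr n s) \<in> rel_ideal"
proof -
  have "mat i i (elt n (r - s)) - mat i i (elt n r - elt n s) \<in> rel_ideal" for i
    by (rule mat_cong) (auto simp: end_ideal_def intro: elt_diff[OF elt_end_S] assms)
  then have "(\<Sum>i<length bs. mat i i (elt n (r - s)) - mat i i (elt n r - elt n s)) \<in> rel_ideal"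
    by (rule fa.subspace_sum[OF subspace_rel_ideal])
  then show ?thesis
    by (simp add: mat_trace_mat sum_subtractf linear_diff[OF linear_mat])
qed

lemma mat_trace_zero: "mtr n 0 \<in> rel_ideal"
  using mat_trace_diff[OF zero_part zero_part, of n] by simp

lemma mat_trace_centralizer: "r \<in> dg_part R n \<Longrightarrow> mtr n r \<in> centralizer scV R n"
  unfolding mat_trace_mat
  by (intro fa.subspace_sum[OF subspace_centralizer] mat_centralizer elt_fp_part)

abbreviation "rdiff \<equiv> fp_diff 0 0 R"

lemma rdiff_mat: "rdiff (mat i j y) = mat i j (rdiff y)"
proof -
  have "rdiff (ext \<phi> * z) = ext \<phi> * rdiff z" for \<phi> z
    by (simp add: fp_diff_mult gen_def mon_Nil)
  moreover have "rdiff (ext (mu l i) * y * ext (mu j l)) = rdiff (ext (mu l i) * y) * ext (mu j l)" for l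
    by (simp add: fp_diff_mult gen_def mon_Nil)
  ultimately show ?thesis by (simp add: mat_def linear_sum[OF linear_lin_smul])
qed

lemma rdiff_mat_trace: "rdiff (mtr (Suc n) r) = mtr n (dg_diff R r)"
  by (simp add: mat_trace_mat linear_sum[OF linear_lin_smul] rdiff_mat)
     (simp add: elt_def gen_def mon_Nil)

text \<open>The traces of \<open>r s\<close> and of \<open>s r\<close> are the sums of the products \<open>r\<^sub>i\<^sub>j s\<^sub>j\<^sub>i\<close> in the two orders, and matrix elements
  commute in \<open>R\<^sub>V\<close>.\<close>

lemma mat_trace_comm:
  assumes r: "r \<in> dg_part R p" and s: "s \<in> dg_part R q"
  shows "mtr (p + q) (r * s - dg_scale R ((-1) ^ (p * q)) (s * r)) \<in> rep_rel"
proof -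
  let ?N = "length bs"
  have I: "fa.subspace rel_ideal" and K: "fa.subspace rep_rel" by simp_all
  have prod: "mtr (p + q) (r * s) - (\<Sum>i<?N. \<Sum>j<?N. mat i j (elt p r) * mat j i (elt q s)) \<in> rel_ideal"
    if "r \<in> dg_part R p" "s \<in> dg_part R q" for r s p q
    unfolding mat_trace_mat
  proof (rule fa.cong_sum[OF I], rule fa.cong_trans[OF I])
    fix i
    show "mat i i (elt (p + q) (r * s)) - mat i i (elt p r * elt q s) \<in> rel_ideal"
      using elt_mult[OF elt_end_S that] by (intro mat_cong) (auto simp: end_ideal_def)
    show "mat i i (elt p r * elt q s) - (\<Sum>j<?N. mat i j (elt p r) * mat j i (elt q s)) \<in> rel_ideal"
      by (rule mat_mult) (use that in \<open>auto intro: fp_part_adm elt_fp_part\<close>)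
  qed
  let ?s = "(-1 :: 'k) ^ (p * q)"
  have rs: "r * s \<in> dg_part R (p + q)" and sr: "s * r \<in> dg_part R (p + q)"
    using mult_part[OF r s] mult_part[OF s r] by (auto simp: add.commute)
  have 1: "mtr (p + q) (r * s - dg_scale R ?s (s * r)) - (mtr (p + q) (r * s) - smul ?s (mtr (p + q) (s * r))) \<in> rel_ideal"
    by (rule fa.cong_trans[OF I mat_trace_diff[OF rs] fa.cong_diff[OF I _ mat_trace_scale[OF sr]]])
      (auto intro: subspace_scale[OF subspace_part] sr simp: fa.subspace_0)
  have 2: "(mtr (p + q) (r * s) - smul ?s (mtr (p + q) (s * r)))
      - ((\<Sum>i<?N. \<Sum>j<?N. mat i j (elt p r) * mat j i (elt q s))
        - smul ?s (\<Sum>i<?N. \<Sum>j<?N. mat i j (elt q s) * mat j i (elt p r))) \<in> rel_ideal"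
    using prod[OF s r] by (intro fa.cong_diff[OF I] prod r s fa.cong_scale[OF I]) (simp add: add.commute)
  have "(\<Sum>i<?N. \<Sum>j<?N. mat i j (elt p r) * mat j i (elt q s))
        - smul ?s (\<Sum>i<?N. \<Sum>j<?N. mat i j (elt q s) * mat j i (elt p r)) \<in> rep_rel"
    unfolding sum.swap[of "\<lambda>i j. mat i j (elt q s) * mat j i (elt p r)"] fa.scale_sum_right
    by (intro fa.cong_sum[OF K] centralizer_comm mat_centralizer elt_fp_part r s)
  then show ?thesis
    using rel_ideal_rep_rel[OF fa.cong_trans[OF I 1 2]] fa.cong_mem[OF K] by blast
qed

text \<open>The degree is carried along in the induction because \<open>mtr n\<close> is additive only on the degree \<open>n\<close> part.\<close>

lemma mat_trace_nat_rel_deg: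
  assumes u: "u \<in> nat_rel_deg n"
  shows "mtr n u \<in> rep_rel"
proof -
  let ?S = "{u \<in> dg_part R n. mtr n u \<in> rep_rel}"
  have I: "fa.subspace rel_ideal" and K: "fa.subspace rep_rel" by simp_all
  have S: "subspace ?S"
  proof (rule subspaceI)
    show "0 \<in> ?S" using rel_ideal_rep_rel[OF mat_trace_zero] by simp
    fix x y assume x: "x \<in> ?S"
    { assume y: "y \<in> ?S"
      show "x + y \<in> ?S"
        using x y rel_ideal_rep_rel[OF mat_trace_add[of x n y]] fa.cong_mem[OF K, of "mtr n (x + y)"]
        by (auto intro: subspace_add[OF subspace_part] fa.subspace_add[OF K]) }
    fix c show "dg_scale R c x \<in> ?S"
        using x rel_ideal_rep_rel[OF mat_trace_scale[of x n c]] fa.cong_mem[OF K, of "mtr n (dg_scale R c x)"]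
        by (auto intro: subspace_scale[OF subspace_part] fa.subspace_scale[OF K])
  qed
  have "nat_rel_deg n \<subseteq> ?S"
  proof
    fix x assume x: "x \<in> nat_rel_deg n"
    show "x \<in> ?S"
      using x unfolding nat_rel_deg_def
    proof (rule subsetD[OF span_minimal, rotated -1])
      show "subspace ?S" by (rule S)
      show "{u * v - dg_scale R ((-1) ^ (p * q)) (v * u) |p q u v.
        u \<in> dg_part R p \<and> v \<in> dg_part R q \<and> p + q = n} \<subseteq> ?S"
      proof safe
        fix p q u v assume uv: "u \<in> dg_part R p" "v \<in> dg_part R q" and "n = p + q"
        show "mtr (p + q) (u * v - dg_scale R ((-1) ^ (p * q)) (v * u)) \<in> rep_rel"
          by (rule mat_trace_comm[OF uv])
        show "u * v - dg_scale R ((-1) ^ (p * q)) (v * u) \<in> dg_part R (p + q)"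
          by (rule comm_part[OF uv])
      qed
    qed
  qed
  then show ?thesis using u by auto
qed

lemma mat_trace_nat_rel:
  assumes "u \<in> nat_rel" "u \<in> dg_part R n"
  shows "mtr n u \<in> rep_rel"
  using mat_trace_nat_rel_deg[OF components_nat_rel_deg[OF assms(1), of n]] components_homogeneous[OF assms(2), of n]
  by simp

lemma mat_trace_nat_rel_unit:
  assumes "u \<in> span (insert 1 (graded_commutators (dg_scale R) (dg_part R)))" "n \<ge> 1" "u \<in> dg_part R n"
  shows "mtr n u \<in> rep_rel"
  using mat_trace_nat_rel_deg[OF components_nat_rel[OF assms(1,2)]] components_homogeneous[OF assms(3), of n]
  by simp

lemma end_relations_part: "s \<in> end_relations scV \<Longrightarrow> s \<in> part 0"
  unfolding end_relations_def
proof (elim UnE CollectE exE conjE insertE emptyE)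
  fix \<phi> \<psi> assume "s = ext (\<lambda>v. \<phi> v + \<psi> v) - ext \<phi> - ext \<psi>" "\<phi> \<in> End scV" "\<psi> \<in> End scV"
  then show "s \<in> part 0"
    by (auto intro!: fa.subspace_diff[OF subspace_fp_part] ext_part EndI simp: End_add End_scale V.scale_right_distrib)
next
  fix c \<phi> assume "s = ext (\<lambda>v. scV c (\<phi> v)) - smul c (ext \<phi>)" "\<phi> \<in> End scV"
  then show "s \<in> part 0"
    by (auto intro!: fa.subspace_diff[OF subspace_fp_part] fa.subspace_scale[OF subspace_fp_part] ext_part scale_End)
next
  fix \<phi> \<psi> assume s: "s = ext (\<phi> \<circ> \<psi>) - ext \<phi> * ext \<psi>" "\<phi> \<in> End scV" "\<psi> \<in> End scV"
  then have "ext \<phi> * ext \<psi> \<in> part (0 + 0)" by (intro fp_part_mult ext_part)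
  then show "s \<in> part 0"
    using s by (auto intro!: fa.subspace_diff[OF subspace_fp_part] ext_part comp_End)
next
  assume "s = ext id - 1"
  then show "s \<in> part 0"
    by (auto intro!: fa.subspace_diff[OF subspace_fp_part] ext_part)
qed

lemma rel_ideal_generators_part:
  "s \<in> end_relations scV \<union> elt_relations R \<Longrightarrow> \<exists>m. s \<in> part m"
  using end_relations_part elt_relations_part by (metis UnE)

lemma rdiff_rel_ideal: "x \<in> rel_ideal \<Longrightarrow> rdiff x \<in> rel_ideal"
  unfolding end_ideal_def
proof (erule fp_diff_ideal[rotated -1])
  fix s assume s: "s \<in> end_relations scV \<union> elt_relations R"
  show "\<exists>m. s \<in> part m" by (rule rel_ideal_generators_part[OF s])
  show "rdiff s \<in> fp_ideal (End scV) R (end_relations scV \<union> elt_relations R)"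
    using s
  proof
    assume "s \<in> end_relations scV"
    then have "rdiff s = 0" by (intro fp_diff_part0[OF _ end_relations_part]) auto
    then show ?thesis by (simp add: fa.subspace_0)
  next
    assume "s \<in> elt_relations R"
    then show ?thesis by (intro fp_diff_elt_relations) auto
  qed
qed simp

text \<open>The relations other than \<open>1\<close> span a graded subspace, and the projection to a positive degree kills \<open>1\<close>.\<close>

lemma fp_proj_rep_rel:
  assumes x: "x \<in> fa.span (insert 1 (rep_relations scV R))" and n: "n \<ge> 1"
  shows "fp_proj 0 n x \<in> rep_rel"
proof (rule linear_span_into[OF linear_fp_proj subspace_rep_rel _ x])
  fix x assume "x \<in> insert 1 (rep_relations scV R)"
  then consider "x = 1" | "x \<in> rel_ideal" | p q u s v where "x = u * s * v" "u \<in> centralizer scV R p"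
      "s \<in> graded_commutators smul (centralizer scV R)" "v \<in> centralizer scV R q" "x \<in> rep_relations scV R"
    unfolding rep_relations_def by blast
  then show "fp_proj 0 n x \<in> rep_rel"
  proof cases
    case 1
    then show ?thesis using n
      by (subst 1, subst fp_proj_part[OF one_fp_part[of "End scV" 0 R]]) (simp add: fa.subspace_0)
  next
    case 2
    then show ?thesis
      unfolding end_ideal_def
      by (intro rel_ideal_rep_rel[unfolded end_ideal_def] fp_proj_ideal rel_ideal_generators_part)
  next
    case 3
    obtain a b y z where s: "s = y * z - smul ((-1) ^ (a * b)) (z * y)"
      and y: "y \<in> centralizer scV R a" and z: "z \<in> centralizer scV R b"
      using 3 by (auto simp: graded_commutators_def)
    have zy: "z * y \<in> part (a + b)"
      using fp_part_mult[OF centralizer_part[OF z] centralizer_part[OF y]] by (simp add: add.commute)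
    have "s \<in> part (a + b)" unfolding s
      by (rule fa.subspace_diff[OF subspace_fp_part
            fp_part_mult[OF centralizer_part[OF y] centralizer_part[OF z]]
            fa.subspace_scale[OF subspace_fp_part zy]])
    then have "x \<in> part (p + (a + b) + q)"
      unfolding 3(1)
      by (rule fp_part_mult[OF fp_part_mult[OF centralizer_part[OF 3(2)]] centralizer_part[OF 3(4)]])
    then show ?thesis
      using 3(5) by (auto simp: fp_proj_part fa.subspace_0 rep_rel_def fa.span_base)
  qed
qed

end


section \<open>Cyclic words of blocks\<close>

text \<open>The pair \<open>(n, r)\<close> stands for \<open>r x\<close> with \<open>r\<close> of degree \<open>n\<close>. Modulo commutators and \<open>R\<close>, every element of \<open>R\<langle>x\<rangle>\<close> is
  a combination of products \<open>r\<^sub>1x \<dots> r\<^sub>mx\<close>, that is, of cyclic words of blocks.\<close>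

type_synonym 'r block = "nat \<times> 'r"

definition block_mult :: "'r::times block \<Rightarrow> 'r block \<Rightarrow> 'r block"
  where "block_mult b c = (fst b + fst c, snd b * snd c)"

lemma block_mult_assoc: "block_mult (block_mult a b) c = block_mult a (block_mult b (c :: 'r::semigroup_mult block))"
  by (simp add: block_mult_def mult.assoc)

lemma fst_block_mult [simp]: "fst (block_mult b c) = fst b + fst c"
  by (simp add: block_mult_def)

text \<open>Cutting a word at its letters \<open>x\<close> and multiplying the letters in between. A word with \<open>m\<close> letters \<open>x\<close> has
  \<open>m + 1\<close> blocks, the last of which is not followed by \<open>x\<close>.\<close>

fun blocks :: "(unit, 'r::monoid_mult) letter list \<Rightarrow> 'r block list" where
  "blocks [] = [(0, 1)]"
| "blocks (Elt n r # w) = block_mult (n, r) (hd (blocks w)) # tl (blocks w)"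
| "blocks (Ext y # w) = (0, 1) # blocks w"

text \<open>The degree of \<open>r\<^sub>1x \<dots> r\<^sub>mx\<close>, where each \<open>x\<close> has degree one.\<close>

definition blocks_deg :: "'r block list \<Rightarrow> nat"
  where "blocks_deg bs = sum_list (map (\<lambda>b. Suc (fst b)) bs)"

lemma blocks_deg_simps [simp]:
  "blocks_deg [] = 0" "blocks_deg (b # bs) = Suc (fst b) + blocks_deg bs"
  "blocks_deg (bs @ cs) = blocks_deg bs + blocks_deg cs"
  by (simp_all add: blocks_deg_def)

lemma blocks_nonempty [simp]: "blocks w \<noteq> []"
  by (induction w rule: blocks.induct) auto

lemma block_mult_one_left [simp]: "block_mult (0, 1) b = (b :: 'r::monoid_mult block)"
  by (simp add: block_mult_def)

lemma block_mult_one_right [simp]: "block_mult b (0, 1) = (b :: 'r::monoid_mult block)"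
  by (simp add: block_mult_def)

lemma blocks_append:
  "blocks (u @ v) = butlast (blocks u) @ block_mult (last (blocks u)) (hd (blocks v)) # tl (blocks v)"
proof (induction u rule: blocks.induct)
  case 1
  then show ?case by simp
next
  case (2 n r w)
  show ?case
  proof (cases "tl (blocks w)")
    case Nil
    then obtain b where b: "blocks w = [b]" by (cases "blocks w") auto
    then show ?thesis using 2 by (simp add: block_mult_assoc)
  next
    case (Cons c cs)
    then obtain b where b: "blocks w = b # c # cs" by (cases "blocks w") auto
    then show ?thesis using 2 by simp
  qed
next
  case (3 y w)
  then show ?case by simp
qed

lemma blocks_deg_blocks: "blocks_deg (blocks w) = Suc (word_deg 1 w)"
proof (induction w rule: blocks.induct)
  case (2 n r w)
  then show ?case by (cases "blocks w") auto
qed auto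

definition xcount :: "('y, 'r) letter list \<Rightarrow> nat"
  where "xcount w = length (filter (\<lambda>l. case l of Ext y \<Rightarrow> True | Elt n r \<Rightarrow> False) w)"

lemma xcount_simps [simp]: "xcount [] = 0" "xcount (Ext y # w) = Suc (xcount w)" "xcount (Elt n r # w) = xcount w"
  "xcount (u @ v) = xcount u + xcount v"
  by (simp_all add: xcount_def)

lemma length_blocks: "length (blocks w) = Suc (xcount w)"
proof (induction w rule: blocks.induct)
  case (2 n r w)
  then show ?case by (cases "blocks w") auto
qed auto

definition adm_blocks :: "('k, 'r) dga \<Rightarrow> 'r block list \<Rightarrow> bool"
  where "adm_blocks R bs \<longleftrightarrow> (\<forall>b\<in>set bs. snd b \<in> dg_part R (fst b))"

lemma adm_blocks_simps [simp]:
  "adm_blocks R []" "adm_blocks R (b # bs) \<longleftrightarrow> snd b \<in> dg_part R (fst b) \<and> adm_blocks R bs"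
  "adm_blocks R (bs @ cs) \<longleftrightarrow> adm_blocks R bs \<and> adm_blocks R cs"
  by (auto simp: adm_blocks_def)

text \<open>The last block, which lacks its \<open>x\<close>, is moved to the front with the Koszul sign and multiplied
  into the first one. A word without \<open>x\<close> belongs to \<open>R\<close> and counts as \<open>0\<close>.\<close>

definition close_blocks :: "('r::times block list \<Rightarrow> ('x, 'k::field) free_alg) \<Rightarrow> 'r block list \<Rightarrow> ('x, 'k) free_alg"
  where "close_blocks \<Theta> bs = (if tl bs = [] then 0 else
    smul ((-1) ^ (fst (last bs) * blocks_deg bs)) (\<Theta> (block_mult (last bs) (hd bs) # butlast (tl bs))))"

lemma close_blocks_single [simp]: "close_blocks \<Theta> [b] = 0"
  by (simp add: close_blocks_def)

lemma close_blocks_two: "close_blocks \<Theta> (b # M @ [c])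
    = smul ((-1) ^ (fst c * blocks_deg (b # M @ [c]))) (\<Theta> (block_mult c b # M))"
  by (simp add: close_blocks_def)

lemma list_two_cases:
  assumes "xs \<noteq> []"
  obtains (one) b where "xs = [b]" | (two) b M c where "xs = b # M @ [c]"
  using assms by (metis append_butlast_last_id neq_Nil_conv)

definition close :: "('r::monoid_mult block list \<Rightarrow> ('x, 'k::field) free_alg) \<Rightarrow>
    (unit, 'r, 'k) fp \<Rightarrow> ('x, 'k) free_alg"
  where "close \<Theta> = lin smul (\<lambda>w. close_blocks \<Theta> (blocks w))"

lemma linear_close [intro, simp]: "Vector_Spaces.linear smul smul (close \<Theta>)"
  by (simp add: close_def)

lemma close_mon [simp]: "close \<Theta> (mon w) = close_blocks \<Theta> (blocks w)"
  by (simp add: close_def)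

text \<open>Together with \<open>blocks_cyclic\<close> this says that \<open>\<Theta>\<close> is a function of the element \<open>r\<^sub>1x \<dots> r\<^sub>mx\<close> modulo commutators.\<close>

definition blocks_linear :: "('k::field, 'r::ring) dga \<Rightarrow> ('x, 'k) free_alg set \<Rightarrow>
    ('r block list \<Rightarrow> ('x, 'k) free_alg) \<Rightarrow> bool"
  where "blocks_linear R K \<Theta> \<longleftrightarrow> (\<forall>X Y n r s c. adm_blocks R X \<longrightarrow> adm_blocks R Y \<longrightarrow>
    r \<in> dg_part R n \<longrightarrow> s \<in> dg_part R n \<longrightarrow>
    \<Theta> (X @ (n, r + dg_scale R c s) # Y) - (\<Theta> (X @ (n, r) # Y) + smul c (\<Theta> (X @ (n, s) # Y))) \<in> K)"

definition blocks_cyclic :: "('k::field, 'r) dga \<Rightarrow> ('x, 'k) free_alg set \<Rightarrow>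
    ('r block list \<Rightarrow> ('x, 'k) free_alg) \<Rightarrow> bool"
  where "blocks_cyclic R K \<Theta> \<longleftrightarrow> (\<forall>X Y. adm_blocks R X \<longrightarrow> adm_blocks R Y \<longrightarrow> X \<noteq> [] \<longrightarrow> Y \<noteq> [] \<longrightarrow>
    \<Theta> (X @ Y) - smul ((-1) ^ (blocks_deg X * blocks_deg Y)) (\<Theta> (Y @ X)) \<in> K)"

text \<open>Relations of \<open>R\<langle>x\<rangle>\<^sub>\<natural>/R\<^sub>\<natural>\<close>.\<close>

definition adj_relq :: "('k::field, 'r::{ring, monoid_mult}) dga \<Rightarrow> (unit, 'r, 'k) fp set"
  where "adj_relq R = module.span smul (adj_nat_relations R \<union> {gen (Elt m r) |m r. r \<in> dg_part R m})"

lemma subspace_adj_relq [intro, simp]: "fa.subspace (adj_relq R)"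
  by (simp add: adj_relq_def)

lemma adj_rel_relq: "x \<in> adj_rel R \<Longrightarrow> x \<in> adj_relq R"
  unfolding adj_rel_def adj_relq_def by (rule subsetD[OF fa.span_mono]) auto

lemma elt_adj_relq: "r \<in> dg_part R n \<Longrightarrow> elt n r \<in> adj_relq R"
  unfolding adj_relq_def elt_def by (rule fa.span_base) auto

lemma adj_ideal_relq: "x \<in> adj_ideal R \<Longrightarrow> x \<in> adj_relq R"
  by (intro adj_rel_relq adj_ideal_rel)

context dga
begin

lemma adm_blocks_blocks:
  "set w \<subseteq> fp_letters Y R \<Longrightarrow> adm_blocks R (blocks w)"
proof (induction w rule: blocks.induct)
  case (2 n r w)
  then have r: "r \<in> dg_part R n" and IH: "adm_blocks R (blocks w)" by (auto simp: fp_letters_def)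
  obtain b bs where b: "blocks w = b # bs" by (cases "blocks w") auto
  show ?case using IH r by (simp add: b block_mult_def mult_part)
qed auto

lemma close_blocks_linear:
  assumes \<Theta>: "blocks_linear R K \<Theta>" and K: "fa.subspace K"
    and P: "adm_blocks R P" and Q: "adm_blocks R Q" and r: "r \<in> dg_part R n" and s: "s \<in> dg_part R n"
  shows "close_blocks \<Theta> (P @ (n, r + dg_scale R c s) # Q)
    - (close_blocks \<Theta> (P @ (n, r) # Q) + smul c (close_blocks \<Theta> (P @ (n, s) # Q))) \<in> K"
proof -
  have main: "\<Theta> (X @ (m, r' + dg_scale R c s') # Y) - (\<Theta> (X @ (m, r') # Y) + smul c (\<Theta> (X @ (m, s') # Y))) \<in> K"
    if "adm_blocks R X" "adm_blocks R Y" "r' \<in> dg_part R m" "s' \<in> dg_part R m" for X Y m r' s'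
    using \<Theta> that unfolding blocks_linear_def by blast
  have scaled: "smul a x - (smul a y + smul c (smul a z)) \<in> K" if "x - (y + smul c z) \<in> K" for a x y z
    using fa.subspace_scale[OF K that, of a]
    by (simp add: fa.scale_right_diff_distrib fa.scale_right_distrib mult.commute)
  show ?thesis
  proof (cases P)
    case Nil
    show ?thesis
    proof (cases Q rule: rev_cases)
      case Nil
      then show ?thesis using \<open>P = []\<close> K by (simp add: fa.subspace_0)
    next
      case (snoc Q' q)
      have q: "snd q \<in> dg_part R (fst q)" "adm_blocks R Q'" using Q snoc by auto
      have eq: "close_blocks \<Theta> (P @ (n, t) # Q)
          = smul ((-1) ^ (fst q * blocks_deg ((n, r) # Q' @ [q]))) (\<Theta> ([] @ (fst q + n, snd q * t) # Q'))" for t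
        using close_blocks_two[of \<Theta> "(n, t)" Q' q] by (simp add: Nil snoc block_mult_def)
      show ?thesis
        unfolding eq distrib_left scale_mult_right
        by (rule scaled, rule main) (use q r s in \<open>auto intro: mult_part\<close>)
    qed
  next
    case (Cons p P')
    have p: "snd p \<in> dg_part R (fst p)" "adm_blocks R P'" using P Cons by auto
    show ?thesis
    proof (cases Q rule: rev_cases)
      case Nil
      have eq: "close_blocks \<Theta> (P @ (n, t) # Q)
          = smul ((-1) ^ (n * blocks_deg (p # P' @ [(n, r)]))) (\<Theta> ([] @ (n + fst p, t * snd p) # P'))" for t
        using close_blocks_two[of \<Theta> p P' "(n, t)"] by (simp add: Nil Cons block_mult_def)
      show ?thesis
        unfolding eq distrib_right scale_mult_left
        by (rule scaled, rule main) (use p r s in \<open>auto intro: mult_part\<close>)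
    next
      case (snoc Q' q)
      have q: "snd q \<in> dg_part R (fst q)" "adm_blocks R Q'" using Q snoc by auto
      have eq: "close_blocks \<Theta> (P @ (n, t) # Q)
          = smul ((-1) ^ (fst q * blocks_deg (p # (P' @ (n, r) # Q') @ [q])))
            (\<Theta> ((block_mult q p # P') @ (n, t) # Q'))" for t
        using close_blocks_two[of \<Theta> p "P' @ (n, t) # Q'" q] by (simp add: snoc Cons)
      show ?thesis
        unfolding eq
        by (rule scaled, rule main) (use p q r s in \<open>auto simp: block_mult_def intro: mult_part\<close>)
    qed
  qed
qed

text \<open>A multilinear and cyclically invariant function of blocks extends to \<open>R\<langle>x\<rangle>\<^sub>\<natural>/R\<^sub>\<natural>\<close>. The
  homotopy and the section are constructed in this way. In the case of a commutator \<open>[u, v]\<close> of words, the last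
  block of \<open>u\<close> merges with the first of \<open>v\<close> and conversely, so that closing \<open>u v\<close> and \<open>v u\<close> gives
  rotations of one cyclic word; one or both words may consist of a single block.\<close>

lemma close_relq:
  assumes lin: "blocks_linear R K \<Theta>" and cyclic: "blocks_cyclic R K \<Theta>" and K: "fa.subspace K"
    and x: "x \<in> adj_relq R"
  shows "close \<Theta> x \<in> K"
proof (rule linear_span_into[OF linear_close K _ x[unfolded adj_relq_def]])
  fix x :: "(unit, 'r, 'k) fp"
  assume "x \<in> adj_nat_relations R \<union> {gen (Elt m r) |m r. r \<in> dg_part R m}"
  then consider (ideal) "x \<in> fp_ideal {()} R (elt_relations R)"
    | (comm) "x \<in> graded_commutators smul (adj_part R)" | (elt) m r where "x = gen (Elt m r)"
    by (auto simp: adj_nat_relations_def)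
  then show "close \<Theta> x \<in> K"
  proof cases
    case elt
    then show ?thesis by (simp add: gen_def fa.subspace_0[OF K] block_mult_def)
  next
    case ideal
    show ?thesis
    proof (rule linear_fp_ideal_into[OF linear_close K _ ideal])
      fix u v and s :: "(unit, 'r, 'k) fp"
      assume u: "set u \<subseteq> fp_letters {()} R" and s: "s \<in> elt_relations R" and v: "set v \<subseteq> fp_letters {()} R"
      define P where "P = butlast (blocks u)"
      define a where "a = last (blocks u)"
      define b where "b = hd (blocks v)"
      define Q where "Q = tl (blocks v)"
      have U: "blocks u = P @ [a]" and V: "blocks v = b # Q" by (simp_all add: P_def a_def b_def Q_def)
      have adm: "adm_blocks R P" "snd a \<in> dg_part R (fst a)" "snd b \<in> dg_part R (fst b)" "adm_blocks R Q"
        using adm_blocks_blocks[OF u] adm_blocks_blocks[OF v] by (simp_all add: U V)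
      define F where "F n t = close_blocks \<Theta> (P @ (fst a + n + fst b, snd a * t * snd b) # Q)" for n t
      have F: "close \<Theta> (mon u * elt n t * mon v) = F n t" for n t
      proof -
        have "mon u * elt n t * mon v = (mon (u @ Elt n t # v) :: (unit, 'r, 'k) fp)"
          by (simp add: elt_def gen_def mon_mult)
        then show ?thesis
          by (simp only: close_mon) (simp add: blocks_append U V F_def block_mult_def add.assoc mult.assoc)
      qed
      have Flin: "F n (r + dg_scale R c t) - (F n r + smul c (F n t)) \<in> K"
        if "r \<in> dg_part R n" "t \<in> dg_part R n" for n r t c
        unfolding F_def distrib_left distrib_right scale_mult_right scale_mult_left
        by (rule close_blocks_linear[OF lin K]) (use adm that in \<open>auto intro!: mult_part\<close>)
      have F0: "F n 0 \<in> K" for n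
        using fa.subspace_neg[OF K Flin[of 0 n 0 1]] by simp
      note dl = linear_diff[OF linear_close] linear_scale[OF linear_close]
      from s show "close \<Theta> (mon u * s * mon v) \<in> K"
      proof (cases rule: elt_relations_cases)
        case (add n r r')
        then have "close \<Theta> (mon u * s * mon v) = F n (r + dg_scale R 1 r') - (F n r + smul 1 (F n r'))"
          by (simp add: left_diff_distrib right_diff_distrib dl F)
        then show ?thesis using Flin[OF add(2,3), of 1] by simp
      next
        case (scale n c r)
        then have "close \<Theta> (mon u * s * mon v) = (F n (0 + dg_scale R c r) - (F n 0 + smul c (F n r))) + F n 0"
          by (simp add: left_diff_distrib right_diff_distrib dl F)
        then show ?thesis using fa.subspace_add[OF K Flin[OF zero_part scale(2), of c] F0[of n]] by simp
      next
        case (mult m n r r')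
        have "mon u * (elt m r * elt n r') * mon v = (mon (u @ Elt m r # Elt n r' # v) :: (unit, 'r, 'k) fp)"
          by (simp add: elt_def gen_def mon_mult)
        then have "close \<Theta> (mon u * (elt m r * elt n r') * mon v) = F (m + n) (r * r')"
          by (simp only: close_mon) (simp add: blocks_append U V F_def block_mult_def add.assoc mult.assoc)
        then have "close \<Theta> (mon u * s * mon v) = 0"
          by (simp add: mult(1) left_diff_distrib right_diff_distrib dl F)
        then show ?thesis by (simp add: fa.subspace_0[OF K])
      next
        case one
        have "close \<Theta> (mon u * 1 * mon v) = F 0 1"
          by (simp add: mon_mult blocks_append U V F_def block_mult_def)
        then have "close \<Theta> (mon u * s * mon v) = 0"
          by (simp add: one(1) left_diff_distrib right_diff_distrib dl F)
        then show ?thesis by (simp add: fa.subspace_0[OF K])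
      qed
    qed
  next
    case comm
    then obtain p q x1 x2 where x: "x = x1 * x2 - smul ((-1) ^ (p * q)) (x2 * x1)"
      and x1: "x1 \<in> adj_part R p" and x2: "x2 \<in> adj_part R q"
      by (auto simp: graded_commutators_def)
    show ?thesis unfolding x
    proof (rule bilinear_into[where F = "\<lambda>x1 x2. close \<Theta> (x1 * x2 - smul ((-1) ^ (p * q)) (x2 * x1))",
          OF _ _ K _ x1[unfolded adj_part_def fp_part_def] x2[unfolded adj_part_def fp_part_def]])
      show "Vector_Spaces.linear smul smul (\<lambda>p'. close \<Theta> (p' * q' - smul ((- 1) ^ (p * q)) (q' * p')))" for q'
        by (intro linear_comp[OF _ linear_close] linear_diffI linear_scaleI linear_mult_left linear_mult_right)
      show "Vector_Spaces.linear smul smul (\<lambda>q'. close \<Theta> (p' * q' - smul ((- 1) ^ (p * q)) (q' * p')))" for p'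
        by (intro linear_comp[OF _ linear_close] linear_diffI linear_scaleI linear_mult_left linear_mult_right)
      fix x1 x2 :: "(unit, 'r, 'k) fp"
      assume "x1 \<in> {mon w |w. set w \<subseteq> fp_letters {()} R \<and> word_deg 1 w = p}"
        and "x2 \<in> {mon w |w. set w \<subseteq> fp_letters {()} R \<and> word_deg 1 w = q}"
      then obtain u v where u: "x1 = mon u" "set u \<subseteq> fp_letters {()} R" "word_deg 1 u = p"
        and v: "x2 = mon v" "set v \<subseteq> fp_letters {()} R" "word_deg 1 v = q" by blast
      have du: "blocks_deg (blocks u) = Suc p" and dv: "blocks_deg (blocks v) = Suc q"
        using u v by (simp_all add: blocks_deg_blocks)
      have au: "adm_blocks R (blocks u)" and av: "adm_blocks R (blocks v)"
        using u v by (auto intro: adm_blocks_blocks)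
      have "close_blocks \<Theta> (blocks (u @ v)) - smul ((-1) ^ (p * q)) (close_blocks \<Theta> (blocks (v @ u))) \<in> K"
      using blocks_nonempty[of u]
      proof (cases rule: list_two_cases)
        case (one b)
        show ?thesis
        using blocks_nonempty[of v]
        proof (cases rule: list_two_cases)
          case (one c)
          with \<open>blocks u = [b]\<close> show ?thesis by (simp add: blocks_append fa.subspace_0[OF K])
        next
          case (two c N d)
          have dN: "fst b = p" "q = Suc (fst c + blocks_deg N + fst d)" using du dv one two by auto
          have 1: "close_blocks \<Theta> (blocks (u @ v)) = smul ((-1) ^ (fst d * Suc (p + q))) (\<Theta> (block_mult d (block_mult b c) # N))"
            using close_blocks_two[of \<Theta> "block_mult b c" N d] dN by (simp add: blocks_append one two algebra_simps)
          have 2: "close_blocks \<Theta> (blocks (v @ u)) = smul ((-1) ^ ((fst d + p) * Suc (p + q))) (\<Theta> (block_mult d (block_mult b c) # N))"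
            using close_blocks_two[of \<Theta> c N "block_mult d b"] dN
            by (simp add: blocks_append one two block_mult_assoc butlast_append algebra_simps)
          have "(-1 :: 'k) ^ (p * q) * (-1) ^ ((fst d + p) * Suc (p + q)) = (-1) ^ (fst d * Suc (p + q))"
            unfolding power_add[symmetric] by (rule neg_one_power_cong) auto
          then show ?thesis unfolding 1 2 by (simp add: fa.subspace_0[OF K])
        qed
      next
        case (two b M d)
        show ?thesis
        using blocks_nonempty[of v]
        proof (cases rule: list_two_cases)
          case (one c)
          have dM: "fst c = q" "p = Suc (fst b + blocks_deg M + fst d)" using du dv one two by auto
          have 1: "close_blocks \<Theta> (blocks (u @ v)) = smul ((-1) ^ ((fst d + q) * Suc (p + q))) (\<Theta> (block_mult d (block_mult c b) # M))"
            using close_blocks_two[of \<Theta> b M "block_mult d c"] dM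
            by (simp add: blocks_append one two block_mult_assoc butlast_append algebra_simps)
          have 2: "close_blocks \<Theta> (blocks (v @ u)) = smul ((-1) ^ (fst d * Suc (p + q))) (\<Theta> (block_mult d (block_mult c b) # M))"
            using close_blocks_two[of \<Theta> "block_mult c b" M d] dM
            by (simp add: blocks_append one two algebra_simps)
          have "(-1 :: 'k) ^ (p * q) * (-1) ^ (fst d * Suc (p + q)) = (-1) ^ ((fst d + q) * Suc (p + q))"
            unfolding power_add[symmetric] by (rule neg_one_power_cong) auto
          then show ?thesis unfolding 1 2 by (simp add: fa.subspace_0[OF K])
        next
          case (two c N e)
          note U = \<open>blocks u = b # M @ [d]\<close>
          let ?X = "block_mult e b # M" and ?Y = "block_mult d c # N"
          have dU: "p = Suc (fst b + blocks_deg M + fst d)" "q = Suc (fst c + blocks_deg N + fst e)"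
            using du dv U two by auto
          have 1: "close_blocks \<Theta> (blocks (u @ v)) = smul ((-1) ^ (fst e * Suc (p + q))) (\<Theta> (?X @ ?Y))"
            using close_blocks_two[of \<Theta> b "M @ block_mult d c # N" e] dU
            by (simp add: blocks_append U two butlast_append algebra_simps)
          have 2: "close_blocks \<Theta> (blocks (v @ u)) = smul ((-1) ^ (fst d * Suc (p + q))) (\<Theta> (?Y @ ?X))"
            using close_blocks_two[of \<Theta> c "N @ block_mult e b # M" d] dU
            by (simp add: blocks_append U two butlast_append algebra_simps)
          have "adm_blocks R ?X" "adm_blocks R ?Y"
            using au av U two by (auto simp: block_mult_def intro: mult_part)
          then have "smul ((-1) ^ (fst e * Suc (p + q))) (\<Theta> (?X @ ?Y)
              - smul ((-1) ^ (blocks_deg ?X * blocks_deg ?Y)) (\<Theta> (?Y @ ?X))) \<in> K"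
            using cyclic unfolding blocks_cyclic_def by (intro fa.subspace_scale[OF K]) blast
          moreover have "(-1 :: 'k) ^ (fst e * Suc (p + q)) * (-1) ^ (blocks_deg ?X * blocks_deg ?Y)
              = (-1) ^ (p * q) * (-1) ^ (fst d * Suc (p + q))"
            unfolding power_add[symmetric] by (rule neg_one_power_cong) (auto simp: dU)
          ultimately show ?thesis
            unfolding 1 2 by (simp only: fa.scale_right_diff_distrib fa.scale_scale)
        qed
      qed
      then show "close \<Theta> (x1 * x2 - smul ((-1) ^ (p * q)) (x2 * x1)) \<in> K"
        by (simp add: u v mon_mult linear_diff[OF linear_close] linear_scale[OF linear_close])
    qed
  qed
qed

lemma close_into:
  assumes K: "fa.subspace K" and K': "\<And>bs. bs \<noteq> [] \<Longrightarrow> adm_blocks R bs \<Longrightarrow> \<Theta> bs \<in> K"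
    and x: "x \<in> adm {()} R"
  shows "close \<Theta> x \<in> K"
proof (rule linear_span_into[OF linear_close K _ x[unfolded adm_def]])
  fix x :: "(unit, 'r, 'k) fp" assume "x \<in> {mon w |w. set w \<subseteq> fp_letters {()} R}"
  then obtain w where w: "x = mon w" "set w \<subseteq> fp_letters {()} R" by blast
  have a: "adm_blocks R (blocks w)" by (rule adm_blocks_blocks[OF w(2)])
  show "close \<Theta> x \<in> K"
  using blocks_nonempty[of w]
  proof (cases rule: list_two_cases)
    case (two b M c)
    then show ?thesis using a
      by (auto simp: w close_blocks_two block_mult_def intro!: fa.subspace_scale[OF K] K' mult_part)
  qed (auto simp: w fa.subspace_0[OF K])
qed

lemma close_part:
  assumes K': "\<And>bs. bs \<noteq> [] \<Longrightarrow> adm_blocks R bs \<Longrightarrow> \<Theta> bs \<in> adj_part R' (blocks_deg bs + s)"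
    and x: "x \<in> adj_part R n"
  shows "close \<Theta> x \<in> adj_part R' (n + s)"
proof (rule linear_span_into[OF linear_close subspace_adj_part _ x[unfolded adj_part_def fp_part_def]])
  fix x :: "(unit, 'r, 'k) fp"
  assume "x \<in> {mon w |w. set w \<subseteq> fp_letters {()} R \<and> word_deg 1 w = n}"
  then obtain w where w: "x = mon w" "set w \<subseteq> fp_letters {()} R" "word_deg 1 w = n" by blast
  have a: "adm_blocks R (blocks w)" by (rule adm_blocks_blocks[OF w(2)])
  have d: "blocks_deg (blocks w) = Suc n" using w by (simp add: blocks_deg_blocks)
  show "close \<Theta> x \<in> adj_part R' (n + s)"
  using blocks_nonempty[of w]
  proof (cases rule: list_two_cases)
    case (two b M c)
    have "blocks_deg (block_mult c b # M) = n" using d two by simp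
    moreover have "adm_blocks R (block_mult c b # M)"
      using a two by (auto simp: block_mult_def intro: mult_part)
    ultimately have "\<Theta> (block_mult c b # M) \<in> adj_part R' (n + s)"
      using K'[of "block_mult c b # M"] by simp
    then show ?thesis using two
      by (simp add: w close_blocks_two fa.subspace_scale del: blocks_deg_simps)
  qed (auto simp: w fa.subspace_0)
qed

end


section \<open>The value of a cyclic word\<close>

fun block_word :: "'r block list \<Rightarrow> (unit, 'r) letter list" where
  "block_word [] = []"
| "block_word ((n, r) # bs) = Elt n r # Ext () # block_word bs"

text \<open>The element \<open>r\<^sub>1x \<dots> r\<^sub>mx\<close>.\<close>

definition ev :: "'r block list \<Rightarrow> (unit, 'r, 'k::field) fp" where "ev bs = mon (block_word bs)"

lemma block_word_append: "block_word (X @ Y) = block_word X @ block_word Y"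
  by (induction X rule: block_word.induct) auto

lemma ev_Nil [simp]: "ev [] = 1"
  by (simp add: ev_def mon_Nil)

lemma ev_Cons: "ev (b # bs) = elt (fst b) (snd b) * unit_letter * ev bs"
  by (cases b) (simp add: ev_def elt_def unit_letter_def mon_Cons mult.assoc)

lemma ev_append: "ev (X @ Y) = ev X * ev Y"
  by (simp add: ev_def block_word_append mon_append)

lemma blocks_block_word: "blocks (block_word bs) = bs @ [(0, 1)]"
  by (induction bs rule: block_word.induct) auto

lemma close_ev:
  assumes "bs \<noteq> []"
  shows "close \<Theta> (ev bs) = \<Theta> bs"
proof -
  obtain b M where b: "bs = b # M" using assms by (cases bs) auto
  then show ?thesis by (simp add: ev_def blocks_block_word close_blocks_def)
qed

lemma ev_part: "adm_blocks R bs \<Longrightarrow> ev bs \<in> adj_part R (blocks_deg bs)"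
proof (induction bs)
  case Nil then show ?case by (simp add: adj_part_def)
next
  case (Cons b bs)
  have "elt (fst b) (snd b) * unit_letter * ev bs \<in> adj_part R (fst b + Suc 0 + blocks_deg bs)"
    by (intro adj_part_mult elt_adj_part unit_letter_part Cons.IH) (use Cons in auto)
  then show ?case by (simp add: ev_Cons)
qed

lemma ev_adm: "adm_blocks R bs \<Longrightarrow> ev bs \<in> adm {()} R"
  by (rule adj_part_adm[OF ev_part])

lemma fp_map_unit_letter [simp]: "fp_map h unit_letter = unit_letter"
  by (simp add: unit_letter_def)

lemma fp_map_ev: "fp_map h (ev bs) = ev (map (\<lambda>b. (fst b, h (snd b))) bs)"
  by (induction bs) (simp_all add: ev_Cons fp_map_mult)

context dga
begin

lemma elt_lin:
  assumes "r \<in> dg_part R n" "s \<in> dg_part R n"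
  shows "elt n (r + dg_scale R c s) - (elt n r + smul c (elt n s)) \<in> adj_ideal R"
proof -
  have I: "fa.subspace (adj_ideal R)" by simp
  have "elt n (r + dg_scale R c s) - (elt n r + elt n (dg_scale R c s)) \<in> adj_ideal R"
    unfolding adj_ideal_def using assms by (intro elt_add subspace_scale subspace_part) auto
  moreover have "(elt n r + elt n (dg_scale R c s)) - (elt n r + smul c (elt n s)) \<in> adj_ideal R"
    unfolding adj_ideal_def using elt_scale[OF subset_refl assms(2)] by simp
  ultimately show ?thesis by (rule fa.cong_trans[OF I])
qed

lemma ev_lin:
  assumes "adm_blocks R X" "adm_blocks R Y" "r \<in> dg_part R n" "s \<in> dg_part R n"
  shows "ev (X @ (n, r + dg_scale R c s) # Y) - (ev (X @ (n, r) # Y) + smul c (ev (X @ (n, s) # Y))) \<in> adj_ideal R"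
proof -
  have "ev X * ((elt n (r + dg_scale R c s) - (elt n r + smul c (elt n s))) * (unit_letter * ev Y)) \<in> adj_ideal R"
    by (intro adj_ideal_left adj_ideal_right elt_lin assms ev_adm adm_mult
        adj_part_adm[OF unit_letter_part])
  then show ?thesis
    by (simp add: ev_append ev_Cons algebra_simps)
qed

text \<open>In \<open>R\<langle>x\<rangle>\<close> adjacent letters of \<open>R\<close> may be multiplied and letters \<open>1\<close> inserted before an \<open>x\<close>.\<close>

lemma mon_blocks:
  assumes "set w \<subseteq> fp_letters {()} R"
  shows "mon w - ev (butlast (blocks w)) * elt (fst (last (blocks w))) (snd (last (blocks w))) \<in> adj_ideal R"
  using assms
proof (induction w rule: blocks.induct)
  case 1
  then show ?case
    using fa.subspace_neg[OF subspace_adj_ideal elt_one[OF subset_refl, of "{()}", folded adj_ideal_def]]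
    by (simp add: mon_Nil)
next
  case (2 n r w)
  have I: "fa.subspace (adj_ideal R)" by simp
  have r: "r \<in> dg_part R n" and w: "set w \<subseteq> fp_letters {()} R" using 2 by (auto simp: fp_letters_def)
  have a: "adm_blocks R (blocks w)" by (rule adm_blocks_blocks[OF w])
  have er: "elt n r \<in> adm {()} R" by (rule adj_part_adm[OF elt_adj_part[OF r]])
  have em: "elt n r * elt m s - elt (n + m) (r * s) \<in> adj_ideal R" if "s \<in> dg_part R m" for m s
    unfolding adj_ideal_def by (rule fa.cong_sym[OF subspace_fp_ideal elt_mult[OF subset_refl r that]])
  have 1: "mon (Elt n r # w) - elt n r * (ev (butlast (blocks w)) * elt (fst (last (blocks w))) (snd (last (blocks w)))) \<in> adj_ideal R"
    using adj_ideal_left[OF er 2(1)[OF w]] by (simp add: mon_Cons elt_def algebra_simps)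
  show ?case
  using blocks_nonempty[of w]
  proof (cases rule: list_two_cases)
    case (one b)
    then show ?thesis
      using fa.cong_trans[OF I 1, of "elt (n + fst b) (r * snd b)"] em[of "snd b" "fst b"] a
      by (simp add: block_mult_def)
  next
    case (two b M c)
    have b: "snd b \<in> dg_part R (fst b)" and c: "snd c \<in> dg_part R (fst c)" "adm_blocks R M" using a two by auto
    have "(elt n r * elt (fst b) (snd b) - elt (n + fst b) (r * snd b)) * (unit_letter * ev M * elt (fst c) (snd c)) \<in> adj_ideal R"
      by (rule adj_ideal_right[OF em[OF b]])
        (intro adm_mult ev_adm c adj_part_adm[OF unit_letter_part] adj_part_adm[OF elt_adj_part])
    then have "elt n r * (ev (butlast (blocks w)) * elt (fst (last (blocks w))) (snd (last (blocks w))))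
        - ev (butlast (blocks (Elt n r # w))) * elt (fst (last (blocks (Elt n r # w)))) (snd (last (blocks (Elt n r # w)))) \<in> adj_ideal R"
      by (simp add: two ev_Cons block_mult_def algebra_simps butlast_append)
    then show ?thesis by (rule fa.cong_trans[OF I 1])
  qed
next
  case (3 y w)
  have I: "fa.subspace (adj_ideal R)" by simp
  have w: "set w \<subseteq> fp_letters {()} R" using 3 by auto
  have one: "elt 0 1 - 1 \<in> adj_ideal R" unfolding adj_ideal_def by (rule elt_one[OF subset_refl])
  let ?z = "ev (butlast (blocks w)) * elt (fst (last (blocks w))) (snd (last (blocks w)))"
  have a: "adm_blocks R (blocks w)" by (rule adm_blocks_blocks[OF w])
  then have "adm_blocks R (butlast (blocks w) @ [last (blocks w)])" by simp
  then have z: "?z \<in> adm {()} R"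
    by (intro adm_mult ev_adm adj_part_adm[OF elt_adj_part]) (simp_all del: append_butlast_last_id)
  have x: "unit_letter \<in> adm {()} R" by (rule adj_part_adm[OF unit_letter_part])
  have "unit_letter * (mon w - ?z) \<in> adj_ideal R" by (rule adj_ideal_left[OF x 3(1)[OF w]])
  moreover have "(elt 0 1 - 1) * (unit_letter * ?z) \<in> adj_ideal R"
    by (rule adj_ideal_right[OF one adm_mult[OF x z]])
  ultimately have "unit_letter * (mon w - ?z) - (elt 0 1 - 1) * (unit_letter * ?z) \<in> adj_ideal R"
    by (rule fa.subspace_diff[OF I])
  then show ?case
    by (simp add: ev_Cons mon_Cons unit_letter_def algebra_simps)
qed

text \<open>The last block is moved to the front by a commutator. So cyclic words of blocks span the quotient.\<close>

lemma close_ev_cong: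
  assumes x: "x \<in> adm {()} R"
  shows "x - close ev x \<in> adj_relq R"
proof (rule linear_span_into[OF linear_diffI[OF linear_idI[OF vector_space_smul] linear_close] subspace_adj_relq _ x[unfolded adm_def]])
  fix x :: "(unit, 'r, 'k) fp" assume "x \<in> {mon w |w. set w \<subseteq> fp_letters {()} R}"
  then obtain w where w: "x = mon w" "set w \<subseteq> fp_letters {()} R" by blast
  have K: "fa.subspace (adj_relq R)" by simp
  have a: "adm_blocks R (blocks w)" by (rule adm_blocks_blocks[OF w(2)])
  have m: "mon w - ev (butlast (blocks w)) * elt (fst (last (blocks w))) (snd (last (blocks w))) \<in> adj_relq R"
    by (rule adj_ideal_relq[OF mon_blocks[OF w(2)]])
  show "x - close ev x \<in> adj_relq R"
  using blocks_nonempty[of w]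
  proof (cases rule: list_two_cases)
    case (one b)
    then have "elt (fst b) (snd b) \<in> adj_relq R" using a by (intro elt_adj_relq) simp
    then show ?thesis using m one fa.cong_mem[OF K m] by (simp add: w)
  next
    case (two b M c)
    have b: "snd b \<in> dg_part R (fst b)" and c: "snd c \<in> dg_part R (fst c)" and M: "adm_blocks R M"
      using a two by auto
    let ?d = "blocks_deg (b # M)"
    have A: "ev (b # M) * elt (fst c) (snd c) - smul ((-1) ^ (?d * fst c)) (elt (fst c) (snd c) * ev (b # M)) \<in> adj_relq R"
      by (rule adj_rel_relq[OF adj_comm[OF ev_part elt_adj_part]]) (use b c M in auto)
    have B: "smul ((-1) ^ (?d * fst c)) (elt (fst c) (snd c) * ev (b # M))
        - smul ((-1) ^ (?d * fst c)) (ev (block_mult c b # M)) \<in> adj_relq R"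
    proof (rule fa.cong_scale[OF K], rule adj_ideal_relq)
      have "elt (fst c) (snd c) * elt (fst b) (snd b) - elt (fst c + fst b) (snd c * snd b) \<in> adj_ideal R"
        unfolding adj_ideal_def by (rule fa.cong_sym[OF subspace_fp_ideal elt_mult[OF subset_refl c b]])
      then have "(elt (fst c) (snd c) * elt (fst b) (snd b) - elt (fst c + fst b) (snd c * snd b)) * (unit_letter * ev M) \<in> adj_ideal R"
        by (rule adj_ideal_right[OF _ adm_mult[OF adj_part_adm[OF unit_letter_part] ev_adm[OF M]]])
      then show "elt (fst c) (snd c) * ev (b # M) - ev (block_mult c b # M) \<in> adj_ideal R"
        by (simp add: ev_Cons block_mult_def algebra_simps)
    qed
    have C: "(-1 :: 'k) ^ (?d * fst c) = (-1) ^ (fst c * blocks_deg (b # M @ [c]))"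
      by (rule neg_one_power_cong) auto
    have "ev (b # M) * elt (fst c) (snd c) - close_blocks ev (b # M @ [c]) \<in> adj_relq R"
      unfolding close_blocks_two C[symmetric] by (rule fa.cong_trans[OF K A B])
    then show ?thesis using fa.cong_trans[OF K m] two by (simp add: w butlast_append)
  qed
qed

end


section \<open>Invariance of the cyclic complex under a homotopy retract\<close>

context dga
begin

lemma adj_diff_diff: "x \<in> adm {()} R \<Longrightarrow> adj_diff R (adj_diff R x) \<in> adj_ideal R"
  unfolding adj_diff_fp_diff adj_ideal_def by (rule fp_diff_diff) auto

lemma adj_diff_relq:
  assumes "x \<in> adj_relq R"
  shows "adj_diff R x \<in> adj_relq R"
proof (rule linear_span_into[OF linear_adj_diff _ _ assms[unfolded adj_relq_def]])
  fix x :: "(unit, 'r, 'k) fp"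
  assume "x \<in> adj_nat_relations R \<union> {gen (Elt m r) |m r. r \<in> dg_part R m}"
  then consider "x \<in> adj_nat_relations R" | m r where "x = elt m r" "r \<in> dg_part R m"
    by (auto simp: elt_def)
  then show "adj_diff R x \<in> adj_relq R"
  proof cases
    case 1
    then have "x \<in> adj_rel R" unfolding adj_rel_def by (rule fa.span_base)
    then show ?thesis by (intro adj_rel_relq adj_diff_rel)
  next
    case 2
    show ?thesis
    proof (cases m)
      case 0 then show ?thesis by (simp add: 2 adj_diff_fp_diff fp_diff_elt_0 fa.subspace_0)
    next
      case (Suc n)
      then show ?thesis using 2
        by (simp add: adj_diff_fp_diff fp_diff_elt_Suc elt_adj_relq diff_part)
    qed
  qed
qed simp

text \<open>The differential of \<open>R\<langle>x\<rangle>\<close> is the sum of a part that keeps the number of letters \<open>x\<close> and a part, due to \<open>d x = 1\<close>,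
  that lowers it by one.\<close>

definition xspan :: "nat \<Rightarrow> (unit, 'r, 'k) fp set"
  where "xspan q = fa.span {mon w |w. set w \<subseteq> fp_letters {()} R \<and> xcount w = q}"

lemma subspace_xspan [intro, simp]: "fa.subspace (xspan q)"
  by (simp add: xspan_def)

lemma mon_xspan: "set w \<subseteq> fp_letters {()} R \<Longrightarrow> xcount w = q \<Longrightarrow> mon w \<in> xspan q"
  unfolding xspan_def by (rule fa.span_base) auto

lemma xspan_mult:
  assumes "x \<in> xspan p" "y \<in> xspan q"
  shows "x * y \<in> xspan (p + q)"
  by (rule bilinear_into[OF linear_mult_left linear_mult_right _ _ assms[unfolded xspan_def]])
    (auto simp: mon_mult intro!: mon_xspan, blast+)

lemma elt_xspan: "r \<in> dg_part R n \<Longrightarrow> elt n r \<in> xspan 0"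
  unfolding elt_def gen_def by (rule mon_xspan) (auto simp: fp_letters_def)

lemma unit_letter_xspan: "unit_letter \<in> xspan (Suc 0)"
  unfolding unit_letter_def gen_def by (rule mon_xspan) (auto simp: fp_letters_def)

lemma ev_xspan: "adm_blocks R bs \<Longrightarrow> ev bs \<in> xspan (length bs)"
proof (induction bs)
  case Nil
  then show ?case by (auto simp: mon_Nil[symmetric] intro: mon_xspan)
next
  case (Cons b bs)
  have "elt (fst b) (snd b) * unit_letter * ev bs \<in> xspan (0 + Suc 0 + length bs)"
    by (intro xspan_mult elt_xspan unit_letter_xspan Cons.IH) (use Cons in auto)
  then show ?case by (simp add: ev_Cons)
qed

lemma word_diff_unit_part:
  assumes "set w \<subseteq> fp_letters {()} R"
  shows "(xcount w = 0 \<longrightarrow> word_diff 1 1 R w = word_diff 1 0 R w) \<and>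
    (\<forall>q. xcount w = Suc q \<longrightarrow> word_diff 1 1 R w - word_diff 1 0 R w \<in> xspan q)"
  using assms
proof (induction w)
  case Nil then show ?case by simp
next
  case (Cons l w)
  let ?d = "word_diff 1 1 R w - word_diff 1 0 R w"
  have w: "set w \<subseteq> fp_letters {()} R" and IH0: "xcount w = 0 \<Longrightarrow> word_diff 1 1 R w = word_diff 1 0 R w"
    and IH: "\<And>q. xcount w = Suc q \<Longrightarrow> ?d \<in> xspan q" using Cons by auto
  show ?case
  proof (cases l)
    case (Elt n r)
    then have r: "r \<in> dg_part R n" using Cons.prems by (auto simp: fp_letters_def)
    have "letter_diff 1 R l = letter_diff 0 R l" using Elt by (cases n) auto
    then have eq: "word_diff 1 1 R (l # w) - word_diff 1 0 R (l # w) = smul ((-1) ^ n) (elt n r * ?d)"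
      using Elt by (simp add: elt_def right_diff_distrib fa.scale_right_diff_distrib)
    have "?d \<in> xspan q \<Longrightarrow> smul ((-1) ^ n) (elt n r * ?d) \<in> xspan q" for q
      using xspan_mult[OF elt_xspan[OF r], of ?d q] by (simp add: fa.subspace_scale)
    then show ?thesis unfolding eq using IH0 IH Elt eq by auto
  next
    case (Ext y)
    have eq: "word_diff 1 1 R (l # w) - word_diff 1 0 R (l # w) = mon w - unit_letter * ?d"
      using Ext by (simp add: unit_letter_def right_diff_distrib)
    have "unit_letter * ?d \<in> xspan (xcount w)"
    proof (cases "xcount w")
      case 0
      then show ?thesis using IH0 by (simp add: fa.subspace_0)
    next
      case (Suc q)
      then show ?thesis using xspan_mult[OF unit_letter_xspan IH[OF Suc]] by simp
    qed
    then show ?thesis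
      unfolding eq using Ext by (auto intro!: fa.subspace_diff[OF subspace_xspan] mon_xspan w)
  qed
qed

text \<open>The differential obtained by setting \<open>d x = 0\<close>.\<close>

definition D0 :: "(unit, 'r, 'k) fp \<Rightarrow> (unit, 'r, 'k) fp" where "D0 = fp_diff 1 0 R"

lemma linear_D0 [intro, simp]: "Vector_Spaces.linear smul smul D0"
  by (simp add: D0_def)

lemma adj_diff_unit_part:
  assumes x: "x \<in> xspan (Suc q)"
  shows "adj_diff R x - D0 x \<in> xspan q"
proof (rule linear_span_into[OF linear_diffI[OF linear_adj_diff linear_D0] subspace_xspan _ x[unfolded xspan_def]])
  fix x :: "(unit, 'r, 'k) fp"
  assume "x \<in> {mon w |w. set w \<subseteq> fp_letters {()} R \<and> xcount w = Suc q}"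
  then obtain w where w: "x = mon w" "set w \<subseteq> fp_letters {()} R" "xcount w = Suc q" by blast
  then show "adj_diff R x - D0 x \<in> xspan q"
    using word_diff_unit_part[OF w(2)] by (simp add: adj_diff_fp_diff D0_def)
qed

end

lemma fp_map_adj_relq:
  assumes h: "dga_hom R R' h" and x: "x \<in> adj_relq R"
  shows "fp_map h x \<in> adj_relq R'"
proof (rule linear_span_into[OF linear_fp_map subspace_adj_relq _ x[unfolded adj_relq_def]])
  have part: "\<And>n. h ` dg_part R n \<subseteq> dg_part R' n" using h by (simp add: dga_hom_def)
  fix x :: "(unit, 'b, 'a) fp"
  assume "x \<in> adj_nat_relations R \<union> {gen (Elt m r) |m r. r \<in> dg_part R m}"
  then consider "x \<in> fp_ideal {()} R (elt_relations R)" | "x \<in> graded_commutators smul (adj_part R)"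
    | m r where "x = elt m r" "r \<in> dg_part R m"
    by (auto simp: adj_nat_relations_def elt_def)
  then show "fp_map h x \<in> adj_relq R'"
  proof cases
    case 1
    then have "fp_map h x \<in> adj_ideal R'"
      unfolding adj_ideal_def
      by (rule fp_map_ideal[OF part, rotated]) (auto intro: fp_ideal_base fp_map_elt_relations[OF h])
    then show ?thesis by (rule adj_ideal_relq)
  next
    case 2
    then have "fp_map h x \<in> adj_nat_relations R'"
      using fp_map_commutators[OF part] by (auto simp: adj_nat_relations_def adj_part_def)
    then show ?thesis unfolding adj_relq_def by (intro fa.span_base) simp
  next
    case 3
    then show ?thesis using part by (auto intro: elt_adj_relq)
  qed
qed

lemma fp_map_adj_diff:
  assumes "\<And>r. h (dg_diff R r) = dg_diff R' (h r)"
  shows "fp_map h (adj_diff R x) = adj_diff R' (fp_map h x)"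
  unfolding adj_diff_fp_diff by (rule fp_map_diff) (use assms in auto)

lemma fp_map_comp:
  fixes x :: "('y, 'r, 'k::field) fp"
  shows "fp_map g (fp_map h x) = fp_map (\<lambda>r. g (h r)) x"
proof (rule linear_eq_on_mon[OF linear_comp[OF linear_fp_map linear_fp_map] linear_fp_map])
  have "map_letter id g (map_letter id h l) = map_letter id (\<lambda>r. g (h r)) l" for l :: "('y, 'r) letter"
    by (cases l) auto
  then show "fp_map g (fp_map h (mon w)) = (fp_map (\<lambda>r. g (h r)) (mon w) :: ('y, _, 'k) fp)"
    for w :: "('y, 'r) letter list"
    by (simp add: o_def)
qed

lemma fp_map_ident:
  fixes x :: "('y, 'r, 'k::field) fp"
  shows "fp_map (\<lambda>r. r) x = x"
proof (rule linear_eq_on_mon[OF linear_fp_map linear_idI[OF vector_space_smul]])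
  have "map_letter id (\<lambda>r. r) l = l" for l :: "('y, 'r) letter" by (cases l) auto
  then show "fp_map (\<lambda>r. r) (mon w) = (mon w :: ('y, 'r, 'k) fp)" for w by (simp add: map_idI)
qed

text \<open>The section \<open>s\<close> is linear but not multiplicative, so it does not induce a morphism of algebras from \<open>A\<langle>x\<rangle>\<close> to
  \<open>R\<langle>x\<rangle>\<close>. The last condition makes the homotopy invisible in \<open>A\<langle>x\<rangle>\<close>.\<close>

locale homotopy_retract = dga R + A: dga A
  for R :: "('k::field_char_0, 'r::{ring, monoid_mult}) dga"
    and A :: "('k, 'a::{ring, monoid_mult}) dga" +
  fixes \<pi> :: "'r \<Rightarrow> 'a" and s :: "'a \<Rightarrow> 'r" and h :: "nat \<Rightarrow> 'r \<Rightarrow> 'r"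
  assumes hom: "dga_hom R A \<pi>"
    and linear_s: "Vector_Spaces.linear (dg_scale A) (dg_scale R) s"
    and s_part: "a \<in> dg_part A n \<Longrightarrow> s a \<in> dg_part R n"
    and pi_s: "\<pi> (s a) = a"
    and h_part: "r \<in> dg_part R n \<Longrightarrow> h n r \<in> dg_part R (Suc n)"
    and h_lin: "r \<in> dg_part R n \<Longrightarrow> t \<in> dg_part R n \<Longrightarrow> h n (r + dg_scale R c t) = h n r + dg_scale R c (h n t)"
    and h_0: "r \<in> dg_part R 0 \<Longrightarrow> dg_diff R (h 0 r) = r - s (\<pi> r)"
    and h_Suc: "r \<in> dg_part R (Suc n) \<Longrightarrow> dg_diff R (h (Suc n) r) + h n (dg_diff R r) = r - s (\<pi> r)"
    and pi_h: "r \<in> dg_part R n \<Longrightarrow> \<pi> (h n r) = 0"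
begin

lemma linear_pi: "Vector_Spaces.linear (dg_scale R) (dg_scale A) \<pi>"
  and pi_part: "r \<in> dg_part R n \<Longrightarrow> \<pi> r \<in> dg_part A n"
  and pi_diff: "\<pi> (dg_diff R r) = dg_diff A (\<pi> r)"
  using hom by (auto simp: dga_hom_def image_subset_iff)

abbreviation \<sigma> :: "'r \<Rightarrow> 'r" where "\<sigma> r \<equiv> s (\<pi> r)"

lemma sigma_part: "r \<in> dg_part R n \<Longrightarrow> \<sigma> r \<in> dg_part R n"
  by (intro s_part pi_part)

text \<open>The extension of \<open>h\<close> to words as a derivation, \<open>\<Sum>\<^sub>i \<plusminus> b\<^sub>1 \<dots> h(b\<^sub>i) \<dots> b\<^sub>m\<close>. The usual homotopy on a tensor power applies
  \<open>\<sigma>\<close> to the factors on one side of \<open>h\<close>, which is not cyclically symmetric. The derivation is, at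
  the price of a homotopy equation that counts factors.\<close>

fun eta :: "'r block list \<Rightarrow> (unit, 'r, 'k) fp" where
  "eta [] = 0"
| "eta (b # bs) = elt (Suc (fst b)) (h (fst b) (snd b)) * unit_letter * ev bs
    + smul ((-1) ^ Suc (fst b)) (elt (fst b) (snd b) * unit_letter * eta bs)"

lemma eta_append: "eta (X @ Y) = eta X * ev Y + smul ((-1) ^ blocks_deg X) (ev X * eta Y)"
proof (induction X)
  case Nil then show ?case by simp
next
  case (Cons b X)
  then show ?case
    by (simp add: ev_append ev_Cons algebra_simps fa.scale_right_distrib power_add fa.scale_right_diff_distrib)
qed

lemma eta_part: "adm_blocks R bs \<Longrightarrow> eta bs \<in> adj_part R (blocks_deg bs + 1)"
proof (induction bs)
  case Nil then show ?case by (simp add: fa.subspace_0)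
next
  case (Cons b bs)
  have "elt (Suc (fst b)) (h (fst b) (snd b)) * unit_letter * ev bs \<in> adj_part R (Suc (fst b) + Suc 0 + blocks_deg bs)"
    by (intro adj_part_mult elt_adj_part unit_letter_part h_part ev_part) (use Cons in auto)
  moreover have "elt (fst b) (snd b) * unit_letter * eta bs \<in> adj_part R (fst b + Suc 0 + (blocks_deg bs + 1))"
    by (intro adj_part_mult elt_adj_part unit_letter_part Cons.IH) (use Cons in auto)
  ultimately show ?case by (simp add: fa.subspace_add fa.subspace_diff fa.subspace_scale)
qed

lemma eta_adm: "adm_blocks R bs \<Longrightarrow> eta bs \<in> adm {()} R"
  by (rule adj_part_adm[OF eta_part])

lemma eta_xspan: "adm_blocks R bs \<Longrightarrow> eta bs \<in> xspan (length bs)"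
proof (induction bs)
  case Nil then show ?case by (simp add: fa.subspace_0)
next
  case (Cons b bs)
  have "elt (Suc (fst b)) (h (fst b) (snd b)) * unit_letter * ev bs \<in> xspan (0 + Suc 0 + length bs)"
    by (intro xspan_mult elt_xspan unit_letter_xspan h_part ev_xspan) (use Cons in auto)
  moreover have "elt (fst b) (snd b) * unit_letter * eta bs \<in> xspan (0 + Suc 0 + length bs)"
    by (intro xspan_mult elt_xspan unit_letter_xspan Cons.IH) (use Cons in auto)
  ultimately show ?case by (simp add: fa.subspace_add fa.subspace_diff fa.subspace_scale)
qed

text \<open>Split off the block in question; \<open>h\<close> hits the blocks before it, itself, or the blocks after it.\<close>

lemma blocks_linear_eta: "blocks_linear R (adj_relq R) eta"
  unfolding blocks_linear_def
proof (intro allI impI adj_ideal_relq)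
  fix X Y n r t c
  assume X: "adm_blocks R X" and Y: "adm_blocks R Y" and r: "r \<in> dg_part R n" and t: "t \<in> dg_part R n"
  let ?s = "(-1 :: 'k) ^ blocks_deg X"
  have x: "unit_letter \<in> adm {()} R" by (rule adj_part_adm[OF unit_letter_part])
  have 1: "eta X * ((elt n (r + dg_scale R c t) - (elt n r + smul c (elt n t))) * (unit_letter * ev Y)) \<in> adj_ideal R"
    by (intro adj_ideal_left adj_ideal_right elt_lin r t ev_adm eta_adm adm_mult X Y x)
  have 2: "smul ?s (ev X * ((elt (Suc n) (h n r + dg_scale R c (h n t)) - (elt (Suc n) (h n r) + smul c (elt (Suc n) (h n t))))
      * (unit_letter * ev Y))) \<in> adj_ideal R"
    by (intro fa.subspace_scale subspace_adj_ideal adj_ideal_left adj_ideal_right elt_lin h_part r t ev_adm adm_mult X Y x)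
  have 3: "smul (?s * (-1) ^ Suc n) (ev X * ((elt n (r + dg_scale R c t) - (elt n r + smul c (elt n t))) * (unit_letter * eta Y))) \<in> adj_ideal R"
    by (intro fa.subspace_scale subspace_adj_ideal adj_ideal_left adj_ideal_right elt_lin r t ev_adm eta_adm adm_mult X Y x)
  have e: "eta (X @ (n, u) # Y) = eta X * (elt n u * (unit_letter * ev Y))
      + smul ?s (ev X * (elt (Suc n) (h n u) * (unit_letter * ev Y)))
      + smul (?s * (-1) ^ Suc n) (ev X * (elt n u * (unit_letter * eta Y)))" for u
    by (simp add: eta_append ev_Cons algebra_simps fa.scale_right_distrib fa.scale_right_diff_distrib)
  have "eta (X @ (n, r + dg_scale R c t) # Y) - (eta (X @ (n, r) # Y) + smul c (eta (X @ (n, t) # Y)))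
      = eta X * ((elt n (r + dg_scale R c t) - (elt n r + smul c (elt n t))) * (unit_letter * ev Y))
      + smul ?s (ev X * ((elt (Suc n) (h n r + dg_scale R c (h n t)) - (elt (Suc n) (h n r) + smul c (elt (Suc n) (h n t))))
      * (unit_letter * ev Y)))
      + smul (?s * (-1) ^ Suc n) (ev X * ((elt n (r + dg_scale R c t) - (elt n r + smul c (elt n t))) * (unit_letter * eta Y)))"
    unfolding e h_lin[OF r t] left_diff_distrib right_diff_distrib distrib_left distrib_right
      fa.scale_right_diff_distrib fa.scale_right_distrib smul_mult_left smul_mult_right fa.scale_scale
    by (simp add: mult.commute mult.left_commute)
  then show "eta (X @ (n, r + dg_scale R c t) # Y) - (eta (X @ (n, r) # Y) + smul c (eta (X @ (n, t) # Y))) \<in> adj_ideal R"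
    using fa.subspace_add[OF subspace_adj_ideal fa.subspace_add[OF subspace_adj_ideal 1 2] 3] by simp
qed

text \<open>A derivation of odd degree maps commutators to commutators.\<close>

lemma blocks_cyclic_eta: "blocks_cyclic R (adj_relq R) eta"
  unfolding blocks_cyclic_def
proof (intro allI impI adj_rel_relq)
  fix X Y assume X: "adm_blocks R X" and Y: "adm_blocks R Y"
  let ?x = "blocks_deg X" and ?y = "blocks_deg Y"
  have 1: "eta X * ev Y - smul ((-1) ^ ((?x + 1) * ?y)) (ev Y * eta X) \<in> adj_rel R"
    by (rule adj_comm[OF eta_part[OF X] ev_part[OF Y]])
  have 2: "smul ((-1) ^ ?x) (ev X * eta Y - smul ((-1) ^ (?x * (?y + 1))) (eta Y * ev X)) \<in> adj_rel R"
    by (rule fa.subspace_scale[OF subspace_adj_rel adj_comm[OF ev_part[OF X] eta_part[OF Y]]])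
  have s1: "(-1 :: 'k) ^ ((?x + 1) * ?y) = (-1) ^ (?x * ?y) * (-1) ^ ?y"
    by (simp add: power_add[symmetric] algebra_simps)
  have s2: "(-1 :: 'k) ^ ?x * (-1) ^ (?x * (?y + 1)) = (-1) ^ (?x * ?y)"
    unfolding power_add[symmetric] by (rule neg_one_power_cong) auto
  have "eta (X @ Y) - smul ((-1) ^ (?x * ?y)) (eta (Y @ X))
      = (eta X * ev Y - smul ((-1) ^ ((?x + 1) * ?y)) (ev Y * eta X))
      + smul ((-1) ^ ?x) (ev X * eta Y - smul ((-1) ^ (?x * (?y + 1))) (eta Y * ev X))"
    unfolding eta_append fa.scale_right_diff_distrib fa.scale_right_distrib fa.scale_scale s1 s2 by simp
  then show "eta (X @ Y) - smul ((-1) ^ (?x * ?y)) (eta (Y @ X)) \<in> adj_rel R"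
    using fa.subspace_add[OF subspace_adj_rel 1 2] by simp
qed

abbreviation "H \<equiv> close eta"

lemma H_relq: "x \<in> adj_relq R \<Longrightarrow> H x \<in> adj_relq R"
  by (rule close_relq[OF blocks_linear_eta blocks_cyclic_eta subspace_adj_relq])

lemma H_part: "x \<in> adj_part R n \<Longrightarrow> H x \<in> adj_part R (Suc n)"
  using close_part[OF eta_part, of x n] by simp

lemma H_xspan:
  assumes x: "x \<in> xspan q"
  shows "H x \<in> xspan q"
proof (rule linear_span_into[OF linear_close subspace_xspan _ x[unfolded xspan_def]])
  fix x :: "(unit, 'r, 'k) fp"
  assume "x \<in> {mon w |w. set w \<subseteq> fp_letters {()} R \<and> xcount w = q}"
  then obtain w where w: "x = mon w" "set w \<subseteq> fp_letters {()} R" "xcount w = q" by blast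
  have a: "adm_blocks R (blocks w)" by (rule adm_blocks_blocks[OF w(2)])
  have l: "length (blocks w) = Suc q" using w by (simp add: length_blocks)
  show "H x \<in> xspan q"
    using blocks_nonempty[of w]
  proof (cases rule: list_two_cases)
    case (two b M c)
    have "eta (block_mult c b # M) \<in> xspan (length (block_mult c b # M))"
      by (rule eta_xspan) (use a two in \<open>auto simp: block_mult_def intro: mult_part\<close>)
    then show ?thesis using two l
      by (simp add: w close_blocks_two fa.subspace_scale del: eta.simps blocks_deg_simps)
  qed (auto simp: w fa.subspace_0)
qed

lemma D0_unit_letter: "D0 unit_letter = 0"
  by (simp add: D0_def unit_letter_def fp_diff_ext)

lemma D0_one: "D0 1 = 0"
  by (simp add: D0_def mon_Nil[symmetric])

lemma D0_elt_0: "D0 (elt 0 r) = 0"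
  by (simp add: D0_def fp_diff_elt_0)

lemma D0_elt_Suc: "D0 (elt (Suc n) r) = elt n (dg_diff R r)"
  by (simp add: D0_def fp_diff_elt_Suc)

lemma D0_mult: "D0 (p * q) = D0 p * q + hat 1 p * D0 q"
  unfolding D0_def by (rule fp_diff_mult)

lemma hat_one_letter: "r \<in> dg_part R n \<Longrightarrow> hat 1 (elt n r * unit_letter :: (unit, 'r, 'k) fp) = smul ((-1) ^ Suc n) (elt n r * unit_letter)"
  using hat_adj_part[OF adj_part_mult[OF elt_adj_part unit_letter_part]] by simp

lemma D0_letter_mult:
  assumes "r \<in> dg_part R n"
  shows "D0 (elt n r * unit_letter * z) = D0 (elt n r) * unit_letter * z + smul ((-1) ^ Suc n) (elt n r * unit_letter * D0 z)"
  unfolding D0_mult[of "elt n r * unit_letter" z] D0_mult[of "elt n r" unit_letter]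
    hat_one_letter[OF assms] D0_unit_letter by (simp del: power_Suc)

text \<open>A closed form of \<open>H (D0 (ev bs))\<close>. The recursion follows the one of \<open>D0\<close>, so that it can be compared summand by
  summand with \<open>D0 (eta bs)\<close>.\<close>

fun etaD :: "'r block list \<Rightarrow> (unit, 'r, 'k) fp" where
  "etaD [] = 0"
| "etaD (b # bs) = (case fst b of 0 \<Rightarrow> 0 | Suc m \<Rightarrow> eta ((m, dg_diff R (snd b)) # bs))
    + smul ((-1) ^ Suc (fst b)) (eta [b] * D0 (ev bs) + smul ((-1) ^ Suc (fst b)) (ev [b] * etaD bs))"

text \<open>The blocks \<open>X\<close> that \<open>D0\<close> has passed already are kept in front, where \<open>H\<close> sees them again.\<close>

lemma H_D0_ev_aux:
  assumes "adm_blocks R X" "adm_blocks R Y"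
  shows "H (ev X * D0 (ev Y)) = eta X * D0 (ev Y) + smul ((-1) ^ blocks_deg X) (ev X * etaD Y)"
  using assms
proof (induction Y arbitrary: X)
  case Nil
  then show ?case by (simp add: D0_one linear_0[OF linear_close])
next
  case (Cons b Y)
  obtain n r where b: "b = (n, r)" by (cases b)
  have r: "r \<in> dg_part R n" and Y: "adm_blocks R Y" and X: "adm_blocks R X" using Cons.prems b by auto
  let ?s = "(-1 :: 'k) ^ Suc n" and ?x = "(-1 :: 'k) ^ blocks_deg X"
  let ?f = "case n of 0 \<Rightarrow> 0 | Suc m \<Rightarrow> ev ((m, dg_diff R r) # Y)"
  let ?g = "case n of 0 \<Rightarrow> 0 | Suc m \<Rightarrow> eta ((m, dg_diff R r) # Y)"
  have D: "D0 (ev (b # Y)) = ?f + smul ?s (ev [b] * D0 (ev Y))"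
    using D0_letter_mult[OF r, of "ev Y"]
    by (cases n) (simp_all add: b ev_Cons D0_elt_0 D0_elt_Suc)
  have IH: "H (ev (X @ [b]) * D0 (ev Y)) = eta (X @ [b]) * D0 (ev Y) + smul (?x * ?s) (ev (X @ [b]) * etaD Y)"
    using Cons.IH[of "X @ [b]"] X Y r b by (simp add: power_add)
  have F: "H (ev X * ?f) = eta X * ?f + smul ?x (ev X * ?g)"
  proof (cases n)
    case 0 then show ?thesis by (simp add: linear_0[OF linear_close])
  next
    case (Suc m)
    have "H (ev (X @ (m, dg_diff R r) # Y)) = eta (X @ (m, dg_diff R r) # Y)" by (rule close_ev) simp
    then show ?thesis using Suc by (simp add: ev_append eta_append del: eta.simps)
  qed
  have IH': "H (ev X * (ev [b] * D0 (ev Y))) = eta (X @ [b]) * D0 (ev Y) + smul (?x * ?s) (ev (X @ [b]) * etaD Y)"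
    using IH by (simp only: ev_append mult.assoc)
  have "H (ev X * D0 (ev (b # Y))) = H (ev X * ?f) + smul ?s (H (ev X * (ev [b] * D0 (ev Y))))"
    unfolding D by (simp add: distrib_left linear_add[OF linear_close] linear_scale[OF linear_close] ev_append mult.assoc
       linear_diff[OF linear_close] right_diff_distrib)
  also have "\<dots> = eta X * (?f + smul ?s (ev [b] * D0 (ev Y)))
      + smul ?x (ev X * (?g + smul ?s (eta [b] * D0 (ev Y) + smul ?s (ev [b] * etaD Y))))"
    unfolding F IH' eta_append ev_append distrib_left distrib_right fa.scale_right_distrib
      smul_mult_left smul_mult_right fa.scale_scale mult.assoc
    by (simp add: mult.commute mult.left_commute add.assoc add.left_commute del: eta.simps power_Suc)
  also have "\<dots> = eta X * D0 (ev (b # Y)) + smul ?x (ev X * etaD (b # Y))"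
    unfolding D by (simp add: b del: eta.simps power_Suc cong: nat.case_cong)
  finally show ?case .
qed

lemma H_D0_ev: "adm_blocks R bs \<Longrightarrow> H (D0 (ev bs)) = etaD bs"
  using H_D0_ev_aux[of "[]" bs] by simp

text \<open>As \<open>\<sigma>\<close> is idempotent, each block is the sum of a fixed one and a killed one.\<close>

definition pure :: "'r block list \<Rightarrow> bool"
  where "pure bs \<longleftrightarrow> (\<forall>b\<in>set bs. \<sigma> (snd b) = snd b \<or> \<sigma> (snd b) = 0)"

definition weight :: "'r block list \<Rightarrow> nat"
  where "weight bs = length (filter (\<lambda>b. \<sigma> (snd b) \<noteq> snd b) bs)"

text \<open>In \<open>D0 H + H D0\<close> the terms in which \<open>D0\<close> and \<open>h\<close> hit different blocks cancel, and those in which they hit the same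
  block \<open>r\<close> give \<open>r - \<sigma> r\<close>, which is \<open>0\<close> or \<open>r\<close>.\<close>

lemma homotopy_weight:
  assumes "adm_blocks R bs" "pure bs"
  shows "D0 (eta bs) + etaD bs - smul (of_nat (weight bs)) (ev bs) \<in> adj_ideal R"
  using assms
proof (induction bs)
  case Nil
  then show ?case by (simp add: linear_0[OF linear_D0] weight_def fa.subspace_0)
next
  case (Cons b Y)
  obtain n r where b: "b = (n, r)" by (cases b)
  have r: "r \<in> dg_part R n" and Y: "adm_blocks R Y" "pure Y" and pr: "\<sigma> r = r \<or> \<sigma> r = 0"
    using Cons.prems b by (auto simp: pure_def)
  have I: "fa.subspace (adj_ideal R)" by simp
  let ?s = "(-1 :: 'k) ^ Suc n"
  let ?z = "case n of 0 \<Rightarrow> elt 0 (dg_diff R (h 0 r))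
    | Suc m \<Rightarrow> elt n (dg_diff R (h n r)) + elt n (h m (dg_diff R r))"
  \<comment> \<open>The factor by which \<open>1 - \<sigma>\<close> multiplies \<open>r\<close>.\<close>
  let ?c = "if \<sigma> r = r then 0 else (1 :: 'k)"
  have x: "unit_letter * ev Y \<in> adm {()} R"
    by (intro adm_mult ev_adm Y adj_part_adm[OF unit_letter_part])
  have hr: "h n r \<in> dg_part R (Suc n)" by (rule h_part[OF r])
  have D1: "D0 (elt (Suc n) (h n r) * unit_letter * ev Y) = elt n (dg_diff R (h n r)) * unit_letter * ev Y
      + smul (- ?s) (elt (Suc n) (h n r) * unit_letter * D0 (ev Y))"
    using D0_letter_mult[OF hr, of "ev Y"] by (simp add: D0_elt_Suc)
  have D2: "D0 (elt n r * unit_letter * eta Y) = D0 (elt n r) * unit_letter * eta Y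
      + smul ?s (elt n r * unit_letter * D0 (eta Y))"
    by (rule D0_letter_mult[OF r])
  have sum: "D0 (eta (b # Y)) + etaD (b # Y)
      = ?z * (unit_letter * ev Y) + (elt n r * unit_letter) * (D0 (eta Y) + etaD Y)"
  proof (cases n)
    case 0
    then show ?thesis
      using D1 D2
      by (simp add: b linear_add[OF linear_D0] linear_diff[OF linear_D0] linear_scale[OF linear_D0] D0_elt_0
          ev_Cons distrib_left mult.assoc)
  next
    case (Suc m)
    then show ?thesis
      using D1 D2
      by (simp add: b linear_add[OF linear_D0] linear_diff[OF linear_D0] linear_scale[OF linear_D0] D0_elt_Suc
          ev_Cons algebra_simps fa.scale_right_distrib fa.scale_right_diff_distrib)
  qed
  have z: "?z - smul ?c (elt n r) \<in> adj_ideal R"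
  proof -
    have zr: "?z - elt n (r - \<sigma> r) \<in> adj_ideal R"
    proof (cases n)
      case 0 then show ?thesis using h_0 r by (simp add: fa.subspace_0)
    next
      case (Suc m)
      have "dg_diff R (h n r) \<in> dg_part R n" "h m (dg_diff R r) \<in> dg_part R n"
        using diff_part[OF hr] h_part[of "dg_diff R r" m] diff_part r Suc by auto
      then have "elt n (dg_diff R (h n r) + h m (dg_diff R r)) - (elt n (dg_diff R (h n r)) + elt n (h m (dg_diff R r))) \<in> adj_ideal R"
        unfolding adj_ideal_def by (intro elt_add) auto
      then show ?thesis using h_Suc[of r m] r Suc fa.cong_sym[OF I] by simp
    qed
    show ?thesis
    proof (cases "\<sigma> r = r")
      case True
      then have "?z - elt n 0 \<in> adj_ideal R" using zr by simp
      moreover have "elt n 0 \<in> adj_ideal R" unfolding adj_ideal_def by (rule elt_zero) simp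
      ultimately show ?thesis using True fa.cong_mem[OF I] by simp
    next
      case False
      then show ?thesis using zr pr by simp
    qed
  qed
  have 1: "?z * (unit_letter * ev Y) - smul ?c (elt n r) * (unit_letter * ev Y) \<in> adj_ideal R"
    using adj_ideal_right[OF z x] by (simp add: left_diff_distrib)
  have 2: "(elt n r * unit_letter) * (D0 (eta Y) + etaD Y) - (elt n r * unit_letter) * smul (of_nat (weight Y)) (ev Y) \<in> adj_ideal R"
  proof -
    have "(elt n r * unit_letter) * (D0 (eta Y) + etaD Y - smul (of_nat (weight Y)) (ev Y)) \<in> adj_ideal R"
      by (rule adj_ideal_left[OF _ Cons.IH[OF Y]])
        (intro adm_mult adj_part_adm[OF unit_letter_part] adj_part_adm[OF elt_adj_part] r)
    then show ?thesis by (simp add: right_diff_distrib)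
  qed
  have "smul ?c (elt n r) * (unit_letter * ev Y) + (elt n r * unit_letter) * smul (of_nat (weight Y)) (ev Y)
      = smul (of_nat (weight (b # Y))) (ev (b # Y))"
    by (simp add: b weight_def ev_Cons mult.assoc fa.scale_left_distrib)
  then show ?case unfolding sum using fa.cong_add[OF I 1 2] by simp
qed

text \<open>Cyclic words with fewer than \<open>P\<close> blocks, or with \<open>P\<close> blocks at most \<open>m\<close> of which are killed by \<open>\<sigma>\<close>.\<close>

definition filtration :: "nat \<Rightarrow> nat \<Rightarrow> (unit, 'r, 'k) fp set"
  where "filtration P m = fa.span (adj_relq R \<union> {ev bs |bs. bs \<noteq> [] \<and> adm_blocks R bs \<and> pure bs \<and>
    (length bs < P \<or> length bs = P \<and> weight bs \<le> m)})"

lemma subspace_filtration [intro, simp]: "fa.subspace (filtration P m)"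
  by (simp add: filtration_def)

lemma relq_filtration: "x \<in> adj_relq R \<Longrightarrow> x \<in> filtration P m"
  unfolding filtration_def by (rule fa.span_base) simp

lemma ev_filtration: "bs \<noteq> [] \<Longrightarrow> adm_blocks R bs \<Longrightarrow> pure bs \<Longrightarrow>
    length bs < P \<or> length bs = P \<and> weight bs \<le> m \<Longrightarrow> ev bs \<in> filtration P m"
  unfolding filtration_def by (rule fa.span_base) blast

lemma filtration_into:
  assumes F: "Vector_Spaces.linear smul smul F" and K: "fa.subspace K"
    and rel: "\<And>x. x \<in> adj_relq R \<Longrightarrow> F x \<in> K"
    and ev: "\<And>bs. bs \<noteq> [] \<Longrightarrow> adm_blocks R bs \<Longrightarrow> pure bs \<Longrightarrow>
        length bs < P \<or> length bs = P \<and> weight bs \<le> m \<Longrightarrow> F (ev bs) \<in> K"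
    and x: "x \<in> filtration P m"
  shows "F x \<in> K"
  by (rule linear_span_into[OF F K _ x[unfolded filtration_def]]) (use rel ev in blast)

lemma filtration_mono:
  assumes "P < P' \<or> P = P' \<and> m \<le> m'" "x \<in> filtration P m"
  shows "x \<in> filtration P' m'"
  by (rule filtration_into[OF linear_idI[OF vector_space_smul] subspace_filtration relq_filtration ev_filtration assms(2)])
    (use assms(1) in auto)

lemma weight_le: "weight bs \<le> length bs"
  by (simp add: weight_def)

lemma sigma_sigma: "\<sigma> (\<sigma> r) = \<sigma> r"
  by (simp add: pi_s)

lemma sigma_diff: "\<sigma> (r - \<sigma> r) = 0"
  by (simp add: linear_diff[OF linear_pi] linear_diff[OF linear_s] linear_0[OF linear_s] pi_s)

text \<open>Split the blocks one after the other into a fixed and a killed part.\<close>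

lemma ev_filtration_length_aux:
  assumes "adm_blocks R X" "pure X" "adm_blocks R Y" "X @ Y \<noteq> []"
  shows "ev (X @ Y) \<in> filtration (length (X @ Y)) (length (X @ Y))"
  using assms
proof (induction Y arbitrary: X)
  case Nil
  then show ?case using weight_le[of X] by (intro ev_filtration) auto
next
  case (Cons b Y)
  obtain n r where b: "b = (n, r)" by (cases b)
  have r: "r \<in> dg_part R n" and Y: "adm_blocks R Y" and X: "adm_blocks R X" "pure X" using Cons.prems b by auto
  let ?L = "length (X @ b # Y)"
  have rr: "r - \<sigma> r \<in> dg_part R n" using r sigma_part subspace_diff[OF subspace_part] by blast
  have 1: "ev (X @ (n, \<sigma> r) # Y) \<in> filtration ?L ?L"
    using Cons.IH[of "X @ [(n, \<sigma> r)]"] X Y sigma_part[OF r] by (simp add: pure_def sigma_sigma)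
  have 2: "ev (X @ (n, r - \<sigma> r) # Y) \<in> filtration ?L ?L"
    using Cons.IH[of "X @ [(n, r - \<sigma> r)]"] X Y rr sigma_diff by (auto simp add: pure_def)
  have "ev (X @ (n, \<sigma> r + dg_scale R 1 (r - \<sigma> r)) # Y)
      - (ev (X @ (n, \<sigma> r) # Y) + smul 1 (ev (X @ (n, r - \<sigma> r) # Y))) \<in> filtration ?L ?L"
    by (intro relq_filtration adj_ideal_relq ev_lin X Y sigma_part r rr)
  then have "ev (X @ b # Y) - (ev (X @ (n, \<sigma> r) # Y) + ev (X @ (n, r - \<sigma> r) # Y)) \<in> filtration ?L ?L"
    by (simp add: b)
  then show ?case
    using fa.cong_mem[OF subspace_filtration] fa.subspace_add[OF subspace_filtration 1 2] by blast
qed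

lemma ev_filtration_length:
  "adm_blocks R bs \<Longrightarrow> bs \<noteq> [] \<Longrightarrow> ev bs \<in> filtration (length bs) (length bs)"
  using ev_filtration_length_aux[of "[]" bs] by (simp add: pure_def)

lemma mon_filtration:
  assumes w: "set w \<subseteq> fp_letters {()} R"
  shows "mon w \<in> filtration (xcount w) (xcount w)"
proof -
  have a: "adm_blocks R (blocks w)" by (rule adm_blocks_blocks[OF w])
  have l: "length (blocks w) = Suc (xcount w)" by (rule length_blocks)
  have "close ev (mon w) \<in> filtration (xcount w) (xcount w)"
    using blocks_nonempty[of w]
  proof (cases rule: list_two_cases)
    case (two b M c)
    have "ev (block_mult c b # M) \<in> filtration (length (block_mult c b # M)) (length (block_mult c b # M))"
      by (rule ev_filtration_length) (use a two in \<open>auto simp: block_mult_def intro: mult_part\<close>)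
    then show ?thesis using two l
      by (simp add: close_blocks_two fa.subspace_scale del: blocks_deg_simps)
  qed (auto simp: fa.subspace_0)
  then show ?thesis
    using relq_filtration[OF close_ev_cong[OF mon_adm[OF w]]] fa.cong_mem[OF subspace_filtration] by blast
qed

lemma xspan_filtration:
  assumes "x \<in> xspan q"
  shows "x \<in> filtration q q"
  by (rule linear_span_into[OF linear_idI[OF vector_space_smul] subspace_filtration _ assms[unfolded xspan_def]])
    (use mon_filtration in auto)

lemma part_filtration:
  assumes "x \<in> adj_part R n"
  shows "x \<in> filtration n n"
proof (rule linear_span_into[OF linear_idI[OF vector_space_smul] subspace_filtration _ assms[unfolded adj_part_def fp_part_def]])
  fix x :: "(unit, 'r, 'k) fp"
  assume "x \<in> {mon w |w. set w \<subseteq> fp_letters {()} R \<and> word_deg 1 w = n}"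
  then obtain w where w: "x = mon w" "set w \<subseteq> fp_letters {()} R" "word_deg 1 w = n" by blast
  have "xcount w \<le> word_deg 1 w"
  proof (induction w)
    case (Cons l w) then show ?case by (cases l) auto
  qed simp
  then show "x \<in> filtration n n"
    using filtration_mono[OF _ mon_filtration[OF w(2)], of n n] w by (auto simp: le_less)
qed

text \<open>The parts of the differentials due to \<open>d x = 1\<close> shorten words, so that up to shorter words the
  homotopy operator still acts as the weight.\<close>

lemma homotopy_ev:
  assumes bs: "adm_blocks R bs" "pure bs" "length bs = Suc p"
  shows "adj_diff R (H (ev bs)) + H (adj_diff R (ev bs)) - smul (of_nat (weight bs)) (ev bs) \<in> filtration p p"
proof -
  have F: "fa.subspace (filtration p p)" by simp
  have "bs \<noteq> []" using bs by auto
  then have He: "H (ev bs) = eta bs" by (rule close_ev)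
  have 1: "adj_diff R (eta bs) - D0 (eta bs) \<in> filtration p p"
    by (rule xspan_filtration[OF adj_diff_unit_part]) (use eta_xspan bs in metis)
  have 2: "H (adj_diff R (ev bs)) - H (D0 (ev bs)) \<in> filtration p p"
    unfolding linear_diff[OF linear_close, symmetric]
    by (rule xspan_filtration[OF H_xspan[OF adj_diff_unit_part]]) (use ev_xspan bs in metis)
  have 3: "D0 (eta bs) + H (D0 (ev bs)) - smul (of_nat (weight bs)) (ev bs) \<in> filtration p p"
    unfolding H_D0_ev[OF bs(1)] by (intro relq_filtration adj_ideal_relq homotopy_weight bs)
  show ?thesis unfolding He by (rule fa.cong_trans[OF F fa.cong_add[OF F 1 2] 3])
qed

text \<open>Each summand contains a letter in the image of \<open>h\<close>.\<close>

lemma fp_map_eta: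
  "adm_blocks R bs \<Longrightarrow> fp_map \<pi> (eta bs) \<in> adj_ideal A"
proof (induction bs)
  case Nil
  then show ?case by (simp add: linear_0[OF linear_fp_map] fa.subspace_0)
next
  case (Cons b bs)
  have I: "fa.subspace (adj_ideal A)" by simp
  have p: "\<And>n. \<pi> ` dg_part R n \<subseteq> dg_part A n" using pi_part by auto
  have b: "snd b \<in> dg_part R (fst b)" and bs: "adm_blocks R bs" using Cons by auto
  have "elt (Suc (fst b)) 0 \<in> adj_ideal A" unfolding adj_ideal_def by (rule A.elt_zero) simp
  then have "elt (Suc (fst b)) 0 * (unit_letter * fp_map \<pi> (ev bs)) \<in> adj_ideal A"
    by (rule A.adj_ideal_right) (intro adm_mult adj_part_adm[OF unit_letter_part] fp_map_adm[OF p] ev_adm bs)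
  moreover have "(elt (fst b) (\<pi> (snd b)) * unit_letter) * fp_map \<pi> (eta bs) \<in> adj_ideal A"
    by (rule A.adj_ideal_left[OF _ Cons.IH[OF bs]])
      (intro adm_mult adj_part_adm[OF unit_letter_part] adj_part_adm[OF elt_adj_part] pi_part b)
  ultimately show ?case
    by (simp add: linear_add[OF linear_fp_map] linear_diff[OF linear_fp_map] linear_scale[OF linear_fp_map] fp_map_mult pi_h[OF b]
        mult.assoc fa.subspace_add fa.subspace_diff fa.subspace_scale)
qed

lemma fp_map_H: "x \<in> adm {()} R \<Longrightarrow> fp_map \<pi> (H x) \<in> adj_relq A"
proof -
  assume x: "x \<in> adm {()} R"
  have eq: "fp_map \<pi> (H x) = close (\<lambda>bs. fp_map \<pi> (eta bs)) x" for x
    by (rule linear_eq_on_mon[OF linear_comp[OF linear_close linear_fp_map] linear_close])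
      (simp add: close_blocks_def linear_scale[OF linear_fp_map] linear_0[OF linear_fp_map])
  show ?thesis unfolding eq
    by (rule close_into[OF subspace_adj_relq _ x]) (rule adj_ideal_relq[OF fp_map_eta])
qed

abbreviation "sec \<equiv> \<lambda>bs. ev (map (\<lambda>b. (fst b, s (snd b))) bs)"

lemma adm_blocks_map_s: "adm_blocks A bs \<Longrightarrow> adm_blocks R (map (\<lambda>b. (fst b, s (snd b))) bs)"
  by (auto simp: adm_blocks_def s_part)

text \<open>Although \<open>s\<close> is not multiplicative, it maps cyclic words to cyclic words.\<close>

lemma close_sec_relq: "x \<in> adj_relq A \<Longrightarrow> close sec x \<in> adj_relq R"
proof (rule A.close_relq[OF _ _ subspace_adj_relq])
  show "blocks_linear A (adj_relq R) sec"
    unfolding blocks_linear_def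
  proof (intro allI impI)
    fix X Y n r t c assume *: "adm_blocks A X" "adm_blocks A Y" "r \<in> dg_part A n" "t \<in> dg_part A n"
    show "sec (X @ (n, r + dg_scale A c t) # Y) - (sec (X @ (n, r) # Y) + smul c (sec (X @ (n, t) # Y))) \<in> adj_relq R"
      using adj_ideal_relq[OF ev_lin[OF adm_blocks_map_s[OF *(1)] adm_blocks_map_s[OF *(2)] s_part[OF *(3)] s_part[OF *(4)], of c]]
      by (simp add: linear_add[OF linear_s] linear_scale[OF linear_s])
  qed
  show "blocks_cyclic A (adj_relq R) sec"
    unfolding blocks_cyclic_def
  proof (intro allI impI)
    fix X Y :: "'a block list" assume *: "adm_blocks A X" "adm_blocks A Y"
    have d: "blocks_deg (map (\<lambda>b. (fst b, s (snd b))) Z) = blocks_deg Z" for Z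
      by (simp add: blocks_deg_def o_def)
    show "sec (X @ Y) - smul ((-1) ^ (blocks_deg X * blocks_deg Y)) (sec (Y @ X)) \<in> adj_relq R"
      using adj_rel_relq[OF adj_comm[OF ev_part[OF adm_blocks_map_s[OF *(1)]] ev_part[OF adm_blocks_map_s[OF *(2)]]]]
      by (simp add: ev_append d)
  qed
qed

text \<open>On words fixed by \<open>\<sigma>\<close>, going to \<open>A\<langle>x\<rangle>\<close> and back by \<open>s\<close> is the identity. If the image is a relation, the longest words,
  all fixed when \<open>m = 0\<close>, thus contribute nothing.\<close>

lemma filtration_step:
  assumes z: "z \<in> filtration (Suc P) 0" and pz: "fp_map \<pi> z \<in> adj_relq A"
  shows "z \<in> filtration P P"
proof -
  have F: "fa.subspace (filtration P P)" by simp
  have "z - close sec (fp_map \<pi> z) \<in> filtration P P"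
  proof (rule filtration_into[OF linear_diffI[OF linear_idI[OF vector_space_smul] linear_comp[OF linear_fp_map linear_close]] F _ _ z])
    fix x assume "x \<in> adj_relq R"
    then show "x - close sec (fp_map \<pi> x) \<in> filtration P P"
      by (intro relq_filtration fa.subspace_diff subspace_adj_relq close_sec_relq fp_map_adj_relq[OF hom])
  next
    fix bs assume bs: "bs \<noteq> []" "adm_blocks R bs" "pure bs"
      and l: "length bs < Suc P \<or> length bs = Suc P \<and> weight bs \<le> 0"
    let ?bs = "map (\<lambda>b. (fst b, \<sigma> (snd b))) bs"
    have eq: "close sec (fp_map \<pi> (ev bs)) = ev ?bs"
      unfolding fp_map_ev by (subst close_ev) (use bs in \<open>simp_all add: o_def\<close>)
    show "ev bs - close sec (fp_map \<pi> (ev bs)) \<in> filtration P P"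
    proof (cases "weight bs = 0")
      case True
      then have "?bs = bs" by (auto simp: weight_def filter_empty_conv intro!: map_idI)
      then show ?thesis unfolding eq by (simp add: fa.subspace_0)
    next
      case False
      then have lP: "length bs \<le> P" using l by auto
      have "adm_blocks R ?bs" "pure ?bs"
        using bs by (auto simp: adm_blocks_def pure_def sigma_part sigma_sigma)
      then have "ev bs \<in> filtration P P" "ev ?bs \<in> filtration P P"
        using bs lP weight_le[of bs] weight_le[of ?bs] by (auto intro!: ev_filtration)
      then show ?thesis unfolding eq by (rule fa.subspace_diff[OF F])
    qed
  qed
  then show ?thesis
    using fa.cong_mem[OF F] relq_filtration[OF close_sec_relq[OF pz]] by blast
qed

text \<open>The homotopy operator is \<open>m + 1\<close> times the identity on the top part, where the weight is \<open>m + 1\<close>, so dividing it by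
  \<open>m + 1\<close> and subtracting removes that part.\<close>

lemma weight_step:
  assumes z: "z \<in> filtration (Suc P) (Suc m)"
  shows "z - smul (inverse (of_nat (Suc m))) (adj_diff R (H z) + H (adj_diff R z)) \<in> filtration (Suc P) m"
proof -
  let ?c = "inverse (of_nat (Suc m) :: 'k)"
  have F: "fa.subspace (filtration (Suc P) m)" by simp
  show ?thesis
  proof (rule filtration_into[OF _ F _ _ z])
    show "Vector_Spaces.linear smul smul (\<lambda>z. z - smul ?c (adj_diff R (H z) + H (adj_diff R z)))"
      by (intro linear_diffI linear_idI vector_space_smul linear_scaleI linear_addI
          linear_comp[OF linear_close linear_adj_diff] linear_comp[OF linear_adj_diff linear_close])
    fix x assume "x \<in> adj_relq R"
    then show "x - smul ?c (adj_diff R (H x) + H (adj_diff R x)) \<in> filtration (Suc P) m"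
      by (intro relq_filtration fa.subspace_diff fa.subspace_scale fa.subspace_add subspace_adj_relq
          adj_diff_relq H_relq)
  next
    fix bs assume bs: "bs \<noteq> []" "adm_blocks R bs" "pure bs"
      and l: "length bs < Suc P \<or> length bs = Suc P \<and> weight bs \<le> Suc m"
    obtain p where p: "length bs = Suc p" using bs by (cases bs) auto
    let ?E = "adj_diff R (H (ev bs)) + H (adj_diff R (ev bs))"
    have "?E - smul (of_nat (weight bs)) (ev bs) \<in> filtration (Suc P) m"
      using filtration_mono[OF _ homotopy_ev[OF bs(2,3) p]] l p by auto
    then have 1: "smul ?c ?E - smul ?c (smul (of_nat (weight bs)) (ev bs)) \<in> filtration (Suc P) m"
      by (rule fa.cong_scale[OF F])
    have 2: "ev bs - smul ?c (smul (of_nat (weight bs)) (ev bs)) \<in> filtration (Suc P) m"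
    proof (cases "length bs = Suc P \<and> weight bs = Suc m")
      case True
      have "?c * of_nat (weight bs) = 1" using True by (simp del: of_nat_Suc)
      then show ?thesis by (simp add: fa.subspace_0)
    next
      case False
      then have "ev bs \<in> filtration (Suc P) m" using bs l by (intro ev_filtration) auto
      then show ?thesis by (intro fa.subspace_diff fa.subspace_scale F)
    qed
    show "ev bs - smul ?c ?E \<in> filtration (Suc P) m"
      by (rule fa.cong_trans[OF F 2 fa.cong_sym[OF F 1]])
  qed
qed

text \<open>For a cycle \<open>z\<close> with trivial image, subtracting the boundary of \<open>H z/(m + 1)\<close> lowers the weight; once the
  weight is \<open>0\<close>, the number of blocks drops.\<close>

lemma cycle_boundary_aux:
  assumes "z \<in> adj_part R n" "z \<in> filtration P m" "adj_diff R z \<in> adj_relq R" "fp_map \<pi> z \<in> adj_relq A"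
  shows "\<exists>y\<in>adj_part R (Suc n). z - adj_diff R y \<in> adj_relq R"
  using assms
proof (induction P arbitrary: m z)
  case 0
  have "z \<in> adj_relq R"
    by (rule filtration_into[OF linear_idI[OF vector_space_smul] subspace_adj_relq _ _ 0(2)]) auto
  then show ?case by (intro bexI[of _ 0]) (simp_all add: linear_0[OF linear_adj_diff] fa.subspace_0)
next
  case (Suc P)
  from Suc.prems show ?case
  proof (induction m arbitrary: z)
    case 0
    then show ?case using Suc.IH[of z P] filtration_step by blast
  next
    case (Suc m)
    let ?c = "inverse (of_nat (Suc m) :: 'k)"
    let ?y = "smul ?c (H z)"
    let ?z = "z - adj_diff R ?y"
    have K: "fa.subspace (adj_relq R)" "fa.subspace (adj_relq A)" by simp_all
    have y: "?y \<in> adj_part R (Suc n)"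
      by (intro fa.subspace_scale[OF subspace_adj_part] H_part Suc.prems)
    have 1: "?z \<in> adj_part R n"
      by (intro fa.subspace_diff[OF subspace_adj_part] Suc.prems adj_diff_part y)
    have 2: "?z \<in> filtration (Suc P) m"
    proof -
      have "H (adj_diff R z) \<in> filtration (Suc P) m"
        by (rule relq_filtration[OF H_relq[OF Suc.prems(3)]])
      then have "z - smul ?c (adj_diff R (H z) + H (adj_diff R z)) + smul ?c (H (adj_diff R z)) \<in> filtration (Suc P) m"
        by (intro fa.subspace_add[OF subspace_filtration] fa.subspace_scale[OF subspace_filtration] weight_step Suc.prems)
      then show ?thesis
        by (simp only: fa.scale_right_distrib linear_scale[OF linear_adj_diff] diff_diff_eq[symmetric] diff_add_cancel)
    qed
    have 3: "adj_diff R ?z \<in> adj_relq R"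
      unfolding linear_diff[OF linear_adj_diff]
      by (intro fa.subspace_diff[OF K(1)] Suc.prems adj_ideal_relq adj_diff_diff adj_part_adm[OF y])
    have "fp_map \<pi> ?y \<in> adj_relq A"
      unfolding linear_scale[OF linear_fp_map]
      by (rule fa.subspace_scale[OF K(2) fp_map_H[OF adj_part_adm[OF Suc.prems(1)]]])
    then have 4: "fp_map \<pi> ?z \<in> adj_relq A"
      unfolding linear_diff[OF linear_fp_map] fp_map_adj_diff[of \<pi>, OF pi_diff]
      by (intro fa.subspace_diff[OF K(2)] Suc.prems A.adj_diff_relq)
    obtain y' where y': "y' \<in> adj_part R (Suc n)" "?z - adj_diff R y' \<in> adj_relq R"
      using Suc.IH[OF 1 2 3 4] by blast
    show ?case
      by (rule bexI[of _ "?y + y'"])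
        (use y y' in \<open>auto simp: linear_add[OF linear_adj_diff] diff_diff_eq intro: fa.subspace_add[OF subspace_adj_part]\<close>)
  qed
qed

text \<open>If the image of \<open>z\<close> bounds \<open>y\<close>, then \<open>y\<close> lifts to \<open>R\<langle>x\<rangle>\<close> by applying \<open>s\<close> to the letters, which is possible on
  representatives, and the corrected cycle has trivial image.\<close>

theorem adj_nat_quot_injective:
  assumes z: "z \<in> adj_part R n" "adj_diff R z \<in> adj_relq R"
    and y: "y \<in> adj_part A (Suc n)" "fp_map \<pi> z - adj_diff A y \<in> adj_relq A"
  shows "\<exists>y\<in>adj_part R (Suc n). z - adj_diff R y \<in> adj_relq R"
proof -
  have ps: "\<And>n. s ` dg_part A n \<subseteq> dg_part R n" using s_part by auto
  let ?y = "fp_map s y"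
  have yR: "?y \<in> adj_part R (Suc n)"
    using fp_map_part[OF ps, of y "{()}" 1 "Suc n"] y(1) by (simp add: adj_part_def)
  have py: "fp_map \<pi> ?y = y" by (simp add: fp_map_comp pi_s fp_map_ident)
  have "\<exists>y'\<in>adj_part R (Suc n). (z - adj_diff R ?y) - adj_diff R y' \<in> adj_relq R"
  proof (rule cycle_boundary_aux[OF _ part_filtration])
    show 1: "z - adj_diff R ?y \<in> adj_part R n"
      by (intro fa.subspace_diff[OF subspace_adj_part] z adj_diff_part yR)
    then show "z - adj_diff R ?y \<in> adj_part R n" .
    show "adj_diff R (z - adj_diff R ?y) \<in> adj_relq R"
      unfolding linear_diff[OF linear_adj_diff]
      by (intro fa.subspace_diff[OF subspace_adj_relq] z adj_ideal_relq adj_diff_diff adj_part_adm[OF yR])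
    show "fp_map \<pi> (z - adj_diff R ?y) \<in> adj_relq A"
      unfolding linear_diff[OF linear_fp_map] fp_map_adj_diff[of \<pi>, OF pi_diff] py by (rule y(2))
  qed
  then obtain y' where y': "y' \<in> adj_part R (Suc n)" "(z - adj_diff R ?y) - adj_diff R y' \<in> adj_relq R"
    by blast
  show ?thesis
    by (rule bexI[of _ "?y + y'"])
      (use yR y' in \<open>auto simp: linear_add[OF linear_adj_diff] diff_diff_eq intro: fa.subspace_add[OF subspace_adj_part]\<close>)
qed

end


section \<open>Homology classes as cosets\<close>

lemma mem_boundaries:
  "x \<in> boundaries K n \<longleftrightarrow> (\<exists>y\<in>cx_part K (n + 1). x - cx_diff K y \<in> cx_rel K n)"
proof
  assume "x \<in> boundaries K n"
  then obtain y u where "x = cx_diff K y + u" "y \<in> cx_part K (n + 1)" "u \<in> cx_rel K n"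
    by (auto simp: boundaries_def)
  then show "\<exists>y\<in>cx_part K (n + 1). x - cx_diff K y \<in> cx_rel K n" by (intro bexI[of _ y]) auto
next
  assume "\<exists>y\<in>cx_part K (n + 1). x - cx_diff K y \<in> cx_rel K n"
  then obtain y where "y \<in> cx_part K (n + 1)" "x - cx_diff K y \<in> cx_rel K n" by blast
  moreover have "x = cx_diff K y + (x - cx_diff K y)" by simp
  ultimately show "x \<in> boundaries K n" unfolding boundaries_def by blast
qed

lemma subspace_boundaries:
  assumes D: "Vector_Spaces.linear sc sc (cx_diff K)"
    and P: "module.subspace sc (cx_part K (n + 1))" and U: "module.subspace sc (cx_rel K n)"
  shows "module.subspace sc (boundaries K n)"
proof -
  interpret vector_space sc using D by (rule linear_vs1)
  show ?thesis
  proof (rule subspaceI)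
    show "0 \<in> boundaries K n"
      unfolding mem_boundaries
      by (rule bexI[of _ 0]) (use subspace_0[OF P] subspace_0[OF U] in \<open>auto simp: linear_0[OF D]\<close>)
    fix x y assume x: "x \<in> boundaries K n"
    then obtain a where a: "a \<in> cx_part K (n + 1)" "x - cx_diff K a \<in> cx_rel K n"
      unfolding mem_boundaries by blast
    show "sc c x \<in> boundaries K n" for c
      unfolding mem_boundaries
      by (rule bexI[of _ "sc c a"]) (use a cong_scale[OF U a(2)] subspace_scale[OF P] in \<open>auto simp: linear_scale[OF D]\<close>)
    assume "y \<in> boundaries K n"
    then obtain b where b: "b \<in> cx_part K (n + 1)" "y - cx_diff K b \<in> cx_rel K n"
      unfolding mem_boundaries by blast
    show "x + y \<in> boundaries K n"
      unfolding mem_boundaries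
      by (rule bexI[of _ "a + b"]) (use a b cong_add[OF U a(2) b(2)] subspace_add[OF P] in \<open>auto simp: linear_add[OF D]\<close>)
  qed
qed

lemma (in vector_space) coset_eq_iff:
  assumes "subspace B"
  shows "(+) x ` B = (+) y ` B \<longleftrightarrow> x - y \<in> B"
proof
  assume "(+) x ` B = (+) y ` B"
  then have "x + 0 \<in> (+) y ` B" using subspace_0[OF assms] by blast
  then show "x - y \<in> B" by auto
next
  have sub: "(+) x ` B \<subseteq> (+) y ` B" if "x - y \<in> B" for x y
  proof
    fix z assume "z \<in> (+) x ` B"
    then obtain b where "b \<in> B" "z = y + ((x - y) + b)" by auto
    then show "z \<in> (+) y ` B" using subspace_add[OF assms that] by blast
  qed
  assume "x - y \<in> B"
  then show "(+) x ` B = (+) y ` B" using sub cong_sym[OF assms] by blast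
qed

text \<open>The value of a map on a single homology class. Only the behaviour of \<open>g\<close> at the chosen representative
  matters, so that \<open>g\<close> need not be linear; the trace with values in the free product is not.\<close>

lemma (in vector_space) induced_coset:
  fixes g :: "'l::ab_group_add \<Rightarrow> 'b"
  assumes L: "subspace (boundaries L n)" and B: "0 \<in> B"
    and g: "\<And>b. b \<in> B \<Longrightarrow> g (z + b) - g z \<in> boundaries L n"
  shows "induced L g n ((+) z ` B) = (+) (g z) ` boundaries L n"
proof
  show "induced L g n ((+) z ` B) \<subseteq> (+) (g z) ` boundaries L n"
  proof
    fix x assume "x \<in> induced L g n ((+) z ` B)"
    then obtain b b' where "b \<in> B" "b' \<in> boundaries L n" "x = g z + ((g (z + b) - g z) + b')"
      by (auto simp: induced_def)
    then show "x \<in> (+) (g z) ` boundaries L n"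
      using subspace_add[OF L g] by blast
  qed
  show "(+) (g z) ` boundaries L n \<subseteq> induced L g n ((+) z ` B)"
  proof
    fix x assume "x \<in> (+) (g z) ` boundaries L n"
    then obtain b where b: "b \<in> boundaries L n" "x = g z + b" by auto
    have "x = g (z + 0) + b" by (simp add: b)
    moreover have "z + 0 \<in> (+) z ` B" by (rule imageI[OF B])
    ultimately show "x \<in> induced L g n ((+) z ` B)" unfolding induced_def using b by blast
  qed
qed


section \<open>A contraction of the kernel of the resolution\<close>

lemma is_dga_deg0:
  assumes "k_algebra sc"
  shows "is_dga (deg0 sc)"
proof -
  interpret k_algebra sc by fact
  have 1: "\<exists>!c :: nat \<Rightarrow> 'b. (\<forall>n. c n \<in> (if n = 0 then UNIV else {0})) \<and> finite {n. c n \<noteq> 0} \<and> x = (\<Sum>n | c n \<noteq> 0. c n)"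
    for x :: 'b
  proof -
    have key: "c = (\<lambda>n. if n = 0 then x else 0)"
      if c: "\<forall>n. c n \<in> (if n = 0 then UNIV else {0})" "finite {n. c n \<noteq> 0}" "x = (\<Sum>n | c n \<noteq> 0. c n)" for c :: "nat \<Rightarrow> 'b"
    proof -
      have z: "c n = 0" if "n \<noteq> 0" for n using c(1) that by (metis singletonD)
      have "(\<Sum>n | c n \<noteq> 0. c n) = (\<Sum>n\<in>{0}. c n)"
        by (rule sum.mono_neutral_left) (use z in auto)
      then show ?thesis using c(3) z by auto
    qed
    show ?thesis
    proof (rule ex1I[of _ "\<lambda>n. if n = 0 then x else 0"])
      have "{n. (if n = 0 then x else 0) \<noteq> (0 :: 'b)} = (if x = 0 then {} else {0 :: nat})" by auto
      then show "(\<forall>n. (if n = 0 then x else 0) \<in> (if n = 0 then UNIV else {0})) \<and>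
          finite {n. (if n = 0 then x else 0) \<noteq> (0 :: 'b)} \<and>
          x = (\<Sum>n | (if n = 0 then x else 0) \<noteq> 0. if n = 0 then x else 0)" by simp
    next
      fix c :: "nat \<Rightarrow> 'b"
      assume c: "(\<forall>n. c n \<in> (if n = 0 then UNIV else {0})) \<and> finite {n. c n \<noteq> 0} \<and> x = (\<Sum>n | c n \<noteq> 0. c n)"
      show "c = (\<lambda>n. if n = 0 then x else 0)" by (rule key) (use c in blast)+
    qed
  qed
  have 2: "Vector_Spaces.linear sc sc (\<lambda>_. 0)"
    by (rule linearI) (auto intro: vector_space_axioms)
  show ?thesis
    unfolding is_dga_def deg0_def using assms 1 2
    by (auto simp: subspace_def)
qed

lemma quasi_iso_kernel_boundary:
  assumes q: "quasi_iso (dga_cplx R) (dga_cplx (deg0 scA)) (\<lambda>_. \<pi>)"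
    and R: "is_dga R" and A: "k_algebra scA" and hom: "dga_hom R (deg0 scA) \<pi>"
    and x: "x \<in> dg_part R n" "dg_diff R x = 0" "\<pi> x = 0"
  shows "\<exists>y\<in>dg_part R (Suc n). dg_diff R y = x"
proof -
  interpret R: dga R by unfold_locales fact
  interpret A: k_algebra scA by fact
  interpret A': dga "deg0 scA" by unfold_locales (rule is_dga_deg0[OF A])
  let ?K = "dga_cplx R" and ?L = "dga_cplx (deg0 scA)"
  have pl: "Vector_Spaces.linear (dg_scale R) (dg_scale (deg0 scA)) \<pi>"
    and pd: "\<And>r. \<pi> (dg_diff R r) = 0"
    using hom by (auto simp: dga_hom_def deg0_def)
  have scA: "dg_scale (deg0 scA) = scA" by (simp add: deg0_def)
  have BR: "R.subspace (boundaries ?K n)"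
    by (rule subspace_boundaries) (auto simp: dga_cplx_def)
  have BA: "A.subspace (boundaries ?L n)"
    by (rule subspace_boundaries) (use A'.linear_diff_R A'.subspace_part[of "n + 1"] in \<open>auto simp: dga_cplx_def scA\<close>)
  have eq: "induced ?L \<pi> n ((+) z ` boundaries ?K n) = (+) (\<pi> z) ` boundaries ?L n" for z
  proof (rule A.induced_coset[OF BA R.subspace_0[OF BR]])
    fix b assume "b \<in> boundaries ?K n"
    then obtain y where "b = dg_diff R y" by (auto simp: boundaries_def dga_cplx_def)
    then have "\<pi> (z + b) - \<pi> z = 0" by (simp add: linear_add[OF pl] pd)
    then show "\<pi> (z + b) - \<pi> z \<in> boundaries ?L n" using A.subspace_0[OF BA] by simp
  qed
  have a: "inj_on (induced ?L \<pi> n) (homology ?K n)"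
    using q unfolding quasi_iso_def bij_betw_def by blast
  have b: "(+) x ` boundaries ?K n \<in> homology ?K n" "(+) 0 ` boundaries ?K n \<in> homology ?K n"
    unfolding homology_def
    by (rule imageI, use x in \<open>simp add: cycles_def dga_cplx_def\<close>)
      (rule imageI, simp add: cycles_def dga_cplx_def linear_0[OF R.linear_diff_R])
  have c: "induced ?L \<pi> n ((+) x ` boundaries ?K n) = induced ?L \<pi> n ((+) 0 ` boundaries ?K n)"
    unfolding eq by (simp add: x linear_0[OF pl])
  have "(+) x ` boundaries ?K n = (+) 0 ` boundaries ?K n"
    by (rule inj_onD[OF a c b])
  then have "x \<in> boundaries ?K n"
    using R.coset_eq_iff[OF BR, of x 0] by simp
  then show ?thesis by (auto simp: boundaries_def dga_cplx_def)
qed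

locale resolved = twisting R scA f + rep R scV bs
  for R :: "('k::field_char_0, 'r::{ring, monoid_mult}) dga"
    and scA :: "'k \<Rightarrow> 'a::{ring, monoid_mult} \<Rightarrow> 'a" and f :: "'a list \<Rightarrow> 'r"
    and scV :: "'k \<Rightarrow> 'v::ab_group_add \<Rightarrow> 'v" and bs :: "'v list" +
  fixes \<pi> :: "'r \<Rightarrow> 'a"
  assumes k_algebra_A: "k_algebra scA"
    and resolution: "almost_free_resolution R scA \<pi>"
    and pi_f: "\<pi> (f [a]) = a" and f_one: "f [1] = 1"
    and f_normal: "length w \<ge> 2 \<Longrightarrow> 1 \<in> set w \<Longrightarrow> f w = 0"
    and bs_nonempty: "length bs \<ge> 1"
begin

abbreviation "A \<equiv> deg0 scA"

sublocale A: dga A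
  by unfold_locales (rule is_dga_deg0[OF k_algebra_A])

sublocale Arep: rep A scV bs
  by (intro rep.intro rep_axioms.intro A.dga_axioms vector_space_V basis)

lemma scale_A [simp]: "dg_scale A = scA" and diff_A [simp]: "dg_diff A = (\<lambda>_. 0)"
  and part_A: "dg_part A n = (if n = 0 then UNIV else {0})"
  by (simp_all add: deg0_def)

lemma pi_hom: "dga_hom R A \<pi>"
  using resolution by (simp add: almost_free_resolution_def)

lemma linear_pi': "Vector_Spaces.linear (dg_scale R) scA \<pi>" and pi_one: "\<pi> 1 = 1"
  and pi_mult: "\<pi> (x * y) = \<pi> x * \<pi> y" and pi_part': "x \<in> dg_part R n \<Longrightarrow> \<pi> x \<in> dg_part A n"
  and pi_diff': "\<pi> (dg_diff R x) = 0"
  using pi_hom by (auto simp: dga_hom_def image_subset_iff)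

lemma pi_Suc: "x \<in> dg_part R (Suc n) \<Longrightarrow> \<pi> x = 0"
  using pi_part'[of x "Suc n"] by (simp add: part_A)

lemma linear_f1: "Vector_Spaces.linear scA (dg_scale R) (\<lambda>a. f [a])"
  using linear_f[of "[]" "[]"] by simp

lemma f1_part: "f [a] \<in> dg_part R 0"
  using f_part[of "[a]"] by simp

lemma kernel_boundary:
  "x \<in> dg_part R n \<Longrightarrow> dg_diff R x = 0 \<Longrightarrow> \<pi> x = 0 \<Longrightarrow> \<exists>y\<in>dg_part R (Suc n). dg_diff R y = x"
  by (rule quasi_iso_kernel_boundary[OF _ is_dga k_algebra_A pi_hom])
    (use resolution in \<open>auto simp: almost_free_resolution_def\<close>)

text \<open>The kernel of \<open>\<pi>\<close> is an acyclic complex of vector spaces. Let \<open>q\<close> be a linear right inverse of \<open>d\<close> on its range,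
  corrected by \<open>f\<^sub>1 \<pi> q\<close> so as to take values in that kernel. Then \<open>x - \<sigma> x - q (d x)\<close> is a cycle in the
  kernel, hence a boundary, and \<open>h x = q (x - \<sigma> x - q (d x))\<close> is a contraction. It need not be
  homogeneous, but its component of degree one is again a contraction.\<close>

lemma contraction_exists: "\<exists>h. homotopy_retract R A \<pi> (\<lambda>a. f [a]) h"
proof -
  let ?d = "dg_diff R"
  have fd: "?d (f [a]) = 0" for a by (rule diff_part0[OF f1_part])
  have ker: "x \<in> range ?d" if dx: "?d x = 0" and px: "\<pi> x = 0" for x
  proof -
    have "\<exists>y\<in>dg_part R (Suc n). ?d y = components x n" for n
    proof (rule kernel_boundary[OF components_part])
      show "?d (components x n) = 0"
      proof (cases n)
        case 0 then show ?thesis using diff_part0[OF components_part] by metis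
      next
        case (Suc m)
        then show ?thesis
          using components_diff[of x m] dx linear_0[OF linear_components] by simp
      qed
      have pS: "\<pi> (components x n) = 0" if "n > 0" for n
        using pi_Suc[of "components x n" "n - 1"] that by simp
      show "\<pi> (components x n) = 0"
      proof (cases "n = 0")
        case True
        let ?N = "insert 0 {n. components x n \<noteq> 0}"
        have fin: "finite ?N" using finite_components by simp
        have "\<pi> x = \<pi> (\<Sum>n\<in>?N. components x n)"
          by (rule arg_cong[OF components_sum_superset[OF fin]]) auto
        also have "\<dots> = (\<Sum>n\<in>?N. \<pi> (components x n))" by (rule linear_sum[OF linear_pi'])
        also have "\<dots> = (\<Sum>n\<in>{0}. \<pi> (components x n))"
          by (rule sum.mono_neutral_right) (use fin pS in auto)
        finally show ?thesis using px True by simp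
      qed (use pS in simp)
    qed
    then obtain y where y: "\<And>n. y n \<in> dg_part R (Suc n) \<and> ?d (y n) = components x n" by metis
    have "x = (\<Sum>n | components x n \<noteq> 0. components x n)" by (rule components_sum)
    also have "\<dots> = ?d (\<Sum>n | components x n \<noteq> 0. y n)"
      using y by (simp add: linear_sum[OF linear_diff_R])
    finally show ?thesis by blast
  qed
  interpret pair: vector_space_pair "dg_scale R" "dg_scale R" by unfold_locales
  obtain q0 where q0: "Vector_Spaces.linear (dg_scale R) (dg_scale R) q0" "\<And>v. v \<in> range ?d \<Longrightarrow> ?d (q0 v) = v"
    using pair.linear_exists_right_inverse_on[OF linear_diff_R subspace_UNIV] by blast
  have lfp: "Vector_Spaces.linear (dg_scale R) (dg_scale R) (\<lambda>x. f [\<pi> x])"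
    by (rule linear_comp[OF linear_pi' linear_f1])
  define q where "q x = q0 x - f [\<pi> (q0 x)]" for x
  have lq: "Vector_Spaces.linear (dg_scale R) (dg_scale R) q"
    unfolding q_def by (rule linear_diffI[OF q0(1) linear_comp[OF q0(1) lfp]])
  have dq: "?d (q v) = v" if "v \<in> range ?d" for v
    using q0(2)[OF that] by (simp add: q_def linear_diff[OF linear_diff_R] fd)
  have pq: "\<pi> (q v) = 0" for v
    by (simp add: q_def linear_diff[OF linear_pi'] pi_f)
  define h0 where "h0 x = q (x - f [\<pi> x] - q (?d x))" for x
  have lh: "Vector_Spaces.linear (dg_scale R) (dg_scale R) h0"
    unfolding h0_def
    by (intro linear_comp[OF _ lq] linear_diffI linear_idI lfp linear_comp[OF linear_diff_R lq] vector_space_axioms)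
  have dh: "?d (h0 x) + h0 (?d x) = x - f [\<pi> x]" for x
  proof -
    let ?y = "x - f [\<pi> x] - q (?d x)"
    have "?d ?y = 0" "\<pi> ?y = 0"
      by (simp_all add: linear_diff[OF linear_diff_R] linear_diff[OF linear_pi'] fd dq pq pi_f)
    then have "?d (h0 x) = ?y" unfolding h0_def by (intro dq ker)
    moreover have "h0 (?d x) = q (?d x)"
      by (simp add: h0_def pi_diff' diff_diff linear_0[OF linear_f1] linear_0[OF lq])
    ultimately show ?thesis by simp
  qed
  define h where "h n x = components (h0 x) (Suc n)" for n x
  have sig: "components (f [\<pi> x]) n = f [\<pi> x]" if "x \<in> dg_part R n" for x n
  proof (cases n)
    case 0 then show ?thesis using components_homogeneous[OF f1_part, of "\<pi> x" 0] by simp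
  next
    case (Suc m)
    then have "f [\<pi> x] = 0" using pi_Suc[of x m] that by (simp add: linear_0[OF linear_f1])
    then show ?thesis by (simp add: linear_0[OF linear_components])
  qed
  have comp_dh: "?d (h n x) + components (h0 (?d x)) n = x - f [\<pi> x]" if "x \<in> dg_part R n" for n x
    using arg_cong[OF dh[of x], of "\<lambda>z. components z n"] components_homogeneous[OF that, of n]
    by (simp add: linear_add[OF linear_components] linear_diff[OF linear_components] components_diff
        h_def sig[OF that])
  have "homotopy_retract R A \<pi> (\<lambda>a. f [a]) h"
  proof (intro homotopy_retract.intro homotopy_retract_axioms.intro dga_axioms A.dga_axioms)
    show "dga_hom R A \<pi>" by (rule pi_hom)
    show "Vector_Spaces.linear (dg_scale A) (dg_scale R) (\<lambda>a. f [a])" by (simp add: linear_f1)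
    show "f [a] \<in> dg_part R n" if "a \<in> dg_part A n" for a n
      using that f1_part by (cases n) (auto simp: part_A linear_0[OF linear_f1])
    show "\<pi> (f [a]) = a" for a by (rule pi_f)
    show "h n r \<in> dg_part R (Suc n)" for n r by (simp add: h_def)
    show "h n (r + dg_scale R c t) = h n r + dg_scale R c (h n t)" for n r t c
      by (simp add: h_def linear_add[OF lh] linear_scale[OF lh] linear_add[OF linear_components]
          linear_scale[OF linear_components])
    show "dg_diff R (h 0 r) = r - f [\<pi> r]" if "r \<in> dg_part R 0" for r
      using comp_dh[OF that] diff_part0[OF that] by (simp add: linear_0[OF lh] linear_0[OF linear_components])
    show "dg_diff R (h (Suc n) r) + h n (dg_diff R r) = r - f [\<pi> r]" if "r \<in> dg_part R (Suc n)" for r n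
      using comp_dh[OF that] by (simp add: h_def)
    show "\<pi> (h n r) = 0" for n r by (rule pi_Suc[of _ n]) (simp add: h_def)
  qed
  then show ?thesis by (rule exI[of _ h])
qed


section \<open>Degree zero homology of the representation algebra\<close>

abbreviation "push \<equiv> fp_map \<pi> :: ('v \<Rightarrow> 'v, 'r, 'k) fp \<Rightarrow> ('v \<Rightarrow> 'v, 'a, 'k) fp"

lemma pi_image: "\<pi> ` dg_part R n \<subseteq> dg_part A n"
  using pi_part' by auto

lemma push_rel_ideal: "x \<in> rel_ideal \<Longrightarrow> push x \<in> Arep.rel_ideal"
  unfolding end_ideal_def
proof (erule fp_map_ideal[OF pi_image, rotated])
  fix s assume "s \<in> end_relations scV \<union> elt_relations R"
  then have "push s \<in> end_relations scV \<union> elt_relations A"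
    using end_relations_hom[OF linear_fp_map fp_map_mult fp_map_one fp_map_ext] fp_map_elt_relations[OF pi_hom] by blast
  then show "push s \<in> fp_ideal (End scV) A (end_relations scV \<union> elt_relations A)" by (rule fp_ideal_base)
qed

lemma push_centralizer:
  assumes u: "u \<in> centralizer scV R n"
  shows "push u \<in> centralizer scV A n"
proof -
  have "gen (Ext \<phi>) * push u - push u * gen (Ext \<phi>) \<in> Arep.rel_ideal" if "\<phi> \<in> End scV" for \<phi>
  proof -
    have "gen (Ext \<phi>) * u - u * gen (Ext \<phi>) \<in> rel_ideal"
      using u that by (simp add: centralizer_def)
    from push_rel_ideal[OF this] show ?thesis
      by (simp add: linear_diff[OF linear_fp_map] fp_map_mult)
  qed
  then show ?thesis
    using fp_map_part[OF pi_image centralizer_part[OF u]] by (simp add: centralizer_def)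
qed

lemma push_rep_rel:
  assumes "x \<in> rep_rel"
  shows "push x \<in> Arep.rep_rel"
proof (rule linear_span_into[OF linear_fp_map Arep.subspace_rep_rel _ assms[unfolded rep_rel_def]])
  fix x assume "x \<in> rep_relations scV R"
  then consider "x \<in> rel_ideal" | p q u s v where "x = u * s * v" "u \<in> centralizer scV R p"
      "s \<in> graded_commutators smul (centralizer scV R)" "v \<in> centralizer scV R q"
    unfolding rep_relations_def by blast
  then show "push x \<in> Arep.rep_rel"
  proof cases
    case 1
    then show ?thesis by (intro Arep.rel_ideal_rep_rel push_rel_ideal)
  next
    case 2
    obtain a b y z where s: "s = y * z - smul ((-1) ^ (a * b)) (z * y)"
      and y: "y \<in> centralizer scV R a" and z: "z \<in> centralizer scV R b"
      using 2 by (auto simp: graded_commutators_def)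
    have "push s = push y * push z - smul ((-1) ^ (a * b)) (push z * push y)"
      by (simp add: s linear_diff[OF linear_fp_map] linear_scale[OF linear_fp_map] fp_map_mult)
    then have "push s \<in> graded_commutators smul (centralizer scV A)"
      unfolding graded_commutators_def using push_centralizer y z by blast
    then have "push u * push s * push v \<in> rep_relations scV A"
      unfolding rep_relations_def using push_centralizer 2 by blast
    then show ?thesis unfolding Arep.rep_rel_def 2(1) fp_map_mult by (rule fa.span_base)
  qed
qed

lemma push_rdiff: "push (rdiff x) = Arep.rdiff (push x)"
  by (rule fp_map_diff) (simp_all add: pi_diff' linear_0[OF linear_fp_map])

text \<open>A letter of positive degree is a letter of \<open>0\<close>.\<close>

lemma A_part_Suc:
  assumes y: "y \<in> Arep.part (Suc n)"
  shows "y \<in> Arep.rel_ideal"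
proof (rule linear_span_into[OF linear_idI[OF vector_space_smul] Arep.subspace_rel_ideal _ y[unfolded fp_part_def]])
  fix x :: "('v \<Rightarrow> 'v, 'a, 'k) fp"
  assume "x \<in> {mon w |w. set w \<subseteq> fp_letters (End scV) A \<and> word_deg 0 w = Suc n}"
  then obtain w where w: "x = mon w" "set w \<subseteq> fp_letters (End scV) A" "word_deg 0 w = Suc n" by blast
  have "\<exists>l\<in>set w. letter_deg 0 l \<noteq> 0"
  proof (rule ccontr)
    assume "\<not> (\<exists>l\<in>set w. letter_deg 0 l \<noteq> 0)"
    then have "word_deg 0 w = 0" by simp
    then show False using w by simp
  qed
  then obtain l where l: "l \<in> set w" "letter_deg 0 l \<noteq> 0" by blast
  then obtain k a where "l = Elt k a" "k \<noteq> 0" by (cases l rule: letter.exhaust) auto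
  then obtain m where ma: "l = Elt (Suc m) a" by (cases k) auto
  have "l \<in> fp_letters (End scV) A" using l w by blast
  then have l0: "l = Elt (Suc m) 0" using ma by (auto simp: fp_letters_def part_A)
  obtain u v where uv: "w = u @ l # v" using l by (meson split_list)
  have "mon u * elt (Suc m) 0 * mon v \<in> Arep.rel_ideal"
    unfolding end_ideal_def
    by (intro fp_ideal_mult_left fp_ideal_mult_right mon_adm A.elt_zero) (use w uv in auto)
  then show "x \<in> Arep.rel_ideal"
    by (simp add: w uv l0 elt_def gen_def mon_mult)
qed

text \<open>The letter of \<open>a\<close> goes to that of \<open>f\<^sub>1(a)\<close>. Letters of positive degree, which are letters of \<open>0\<close>, are killed
  rather than lifted, since \<open>f\<^sub>1(a)\<close> has degree \<open>0\<close>.\<close>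

definition lift :: "('v \<Rightarrow> 'v, 'a, 'k) fp \<Rightarrow> ('v \<Rightarrow> 'v, 'r, 'k) fp"
  where "lift = lin smul (\<lambda>w. if word_deg 0 w = 0 then mon (map (map_letter id (\<lambda>a. f [a])) w) else 0)"

text \<open>Modulo this ideal the degree zero part of the free product is its homology in degree zero.\<close>

definition deg0_ideal :: "('v \<Rightarrow> 'v, 'r, 'k) fp set"
  where "deg0_ideal = fp_ideal (End scV) R
    (end_relations scV \<union> elt_relations R \<union> {elt 0 (dg_diff R r) |r. r \<in> dg_part R 1})"

lemma linear_lift [intro, simp]: "Vector_Spaces.linear smul smul lift"
  by (simp add: lift_def)

lemma subspace_deg0_ideal [intro, simp]: "fa.subspace deg0_ideal"
  by (simp add: deg0_ideal_def)

lemma lift_mon: "lift (mon w) = (if word_deg 0 w = 0 then mon (map (map_letter id (\<lambda>a. f [a])) w) else 0)"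
  by (simp add: lift_def)

lemma lift_mult: "lift (p * q) = lift p * lift q"
  by (rule bilinear_eq_on_mon[where F = "\<lambda>p q. lift (p * q)" and G = "\<lambda>p q. lift p * lift q"])
    (auto intro: linear_comp[OF linear_mult_left] linear_comp[OF linear_mult_right]
      linear_comp[OF linear_lift linear_mult_left] linear_comp[OF linear_lift linear_mult_right]
      simp: mon_mult lift_mon)

lemma lift_one: "lift 1 = 1"
  by (simp add: lift_def mon_Nil[symmetric])

lemma lift_ext: "lift (gen (Ext \<phi>)) = gen (Ext \<phi>)"
  by (simp add: lift_def gen_def)

lemma lift_elt_0: "lift (elt 0 a) = elt 0 (f [a])"
  by (simp add: lift_def gen_def elt_def)

lemma lift_elt_Suc: "lift (elt (Suc n) a) = 0"
  by (simp add: lift_def gen_def elt_def)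

lemma deg0_ideal_left: "y \<in> adm (End scV) R \<Longrightarrow> x \<in> deg0_ideal \<Longrightarrow> y * x \<in> deg0_ideal"
  unfolding deg0_ideal_def by (rule fp_ideal_mult_left)

lemma deg0_ideal_right: "x \<in> deg0_ideal \<Longrightarrow> y \<in> adm (End scV) R \<Longrightarrow> x * y \<in> deg0_ideal"
  unfolding deg0_ideal_def by (rule fp_ideal_mult_right)

lemma deg0_ideal_boundary: "r \<in> dg_part R 1 \<Longrightarrow> elt 0 (dg_diff R r) \<in> deg0_ideal"
  unfolding deg0_ideal_def by (rule fp_ideal_base) auto

lemma elt_deg0_ideal_cong:
  assumes a: "a \<in> dg_part R 0" and b: "b \<in> dg_part R 0" and r: "r \<in> dg_part R 1" and eq: "a - b = dg_diff R r"
  shows "elt 0 a - elt 0 b \<in> deg0_ideal"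
proof -
  have "elt 0 (a - b) - (elt 0 a - elt 0 b) \<in> deg0_ideal"
    unfolding deg0_ideal_def by (rule elt_diff[OF _ a b]) auto
  moreover have "elt 0 (a - b) \<in> deg0_ideal" unfolding eq by (rule deg0_ideal_boundary[OF r])
  ultimately show ?thesis using fa.cong_mem[OF subspace_deg0_ideal] by blast
qed

lemma lift_mon_part:
  assumes "set w \<subseteq> fp_letters (End scV) A"
  shows "lift (mon w) \<in> part (word_deg 0 w)"
proof (cases "word_deg 0 w = 0")
  case True
  have f: "f [a] \<in> dg_part R n" if "a \<in> dg_part A n" for a n
    using that f1_part by (cases n) (auto simp: part_A linear_0[OF linear_f1])
  have "mon (map (map_letter id (\<lambda>a. f [a])) w) \<in> part 0"
    by (rule mon_fp_part[OF map_letter_fp_letters[OF _ assms]]) (use f True in auto)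
  moreover have "lift (mon w) = mon (map (map_letter id (\<lambda>a. f [a])) w)"
    using True by (simp add: lift_def)
  ultimately show ?thesis unfolding True by simp
next
  case False
  then show ?thesis by (simp only: lift_mon if_False fa.subspace_0[OF subspace_fp_part])
qed

lemma lift_part: "x \<in> Arep.part n \<Longrightarrow> lift x \<in> part n"
proof -
  assume x: "x \<in> Arep.part n"
  show ?thesis
    by (rule linear_span_into[OF linear_lift subspace_fp_part _ x[unfolded fp_part_def]])
      (use lift_mon_part in blast)
qed

text \<open>The only relations that \<open>f\<^sub>1\<close> does not preserve on the nose are those for products, and there the error is the boundary of
  \<open>f\<^sub>2\<close>.\<close>

lemma lift_rel_ideal:
  assumes x: "x \<in> Arep.rel_ideal"
  shows "lift x \<in> deg0_ideal"
proof (rule linear_fp_ideal_into[OF linear_lift subspace_deg0_ideal _ x[unfolded end_ideal_def]])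
  fix u v and s :: "('v \<Rightarrow> 'v, 'a, 'k) fp"
  assume u: "set u \<subseteq> fp_letters (End scV) A" and s: "s \<in> end_relations scV \<union> elt_relations A"
    and v: "set v \<subseteq> fp_letters (End scV) A"
  have lf: "f [a + b] = f [a] + f [b]" "f [scA c a] = dg_scale R c (f [a])" for a b c
    using linear_add[OF linear_f1] linear_scale[OF linear_f1] by auto
  note L = linear_diff[OF linear_lift] linear_scale[OF linear_lift]
  have elt: "lift s \<in> deg0_ideal" if s: "s \<in> elt_relations A" for s
    using s
  proof (cases rule: elt_relations_cases)
    case (add n r r')
    then show ?thesis
    proof (cases n)
      case 0
      have "elt 0 (f [r] + f [r']) - elt 0 (f [r]) - elt 0 (f [r']) \<in> deg0_ideal"
        unfolding deg0_ideal_def by (rule fp_ideal_base) (auto intro: elt_relations_addI f1_part)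
      then show ?thesis by (simp add: add 0 L lift_elt_0 lf)
    next
      case (Suc m) then show ?thesis by (simp add: add L lift_elt_Suc fa.subspace_0)
    qed
  next
    case (scale n c r)
    then show ?thesis
    proof (cases n)
      case 0
      have "elt 0 (dg_scale R c (f [r])) - smul c (elt 0 (f [r])) \<in> deg0_ideal"
        unfolding deg0_ideal_def by (rule fp_ideal_base) (auto intro: elt_relations_scaleI f1_part)
      then show ?thesis by (simp add: scale 0 L lift_elt_0 lf)
    next
      case (Suc m) then show ?thesis by (simp add: scale L lift_elt_Suc fa.subspace_0)
    qed
  next
    case (mult m n r r')
    show ?thesis
    proof (cases "m + n")
      case 0
      have d: "dg_diff R (f [r, r']) = f [r * r'] - f [r] * f [r']"
        using f_diff[of "[r, r']"] by (simp add: contract_def)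
      have p: "f [r, r'] \<in> dg_part R 1" using f_part[of "[r, r']"] by simp
      have pp: "f [r] * f [r'] \<in> dg_part R 0" using mult_part[OF f1_part f1_part, of r r'] by simp
      have "elt 0 (f [r * r']) - elt 0 (f [r] * f [r']) \<in> deg0_ideal"
        by (rule elt_deg0_ideal_cong[OF f1_part pp p]) (simp add: d)
      moreover have "elt (0 + 0) (f [r] * f [r']) - elt 0 (f [r]) * elt 0 (f [r']) \<in> deg0_ideal"
        unfolding deg0_ideal_def by (rule elt_mult[OF _ f1_part f1_part]) auto
      ultimately show ?thesis
        using 0 fa.cong_trans[OF subspace_deg0_ideal] by (simp add: mult L lift_mult lift_elt_0)
    next
      case (Suc k)
      then have "lift (elt m r) = 0 \<or> lift (elt n r') = 0"
        by (cases m; cases n) (auto simp: lift_elt_Suc)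
      then show ?thesis using Suc by (auto simp: mult L lift_mult lift_elt_Suc fa.subspace_0)
    qed
  next
    case one
    have "elt 0 1 - 1 \<in> deg0_ideal"
      unfolding deg0_ideal_def by (rule elt_one) auto
    then show ?thesis by (simp add: one L lift_elt_0 lift_one f_one)
  qed
  have "lift s \<in> deg0_ideal"
    using s
  proof
    assume "s \<in> end_relations scV"
    then have "lift s \<in> end_relations scV"
      by (rule end_relations_hom[OF linear_lift lift_mult lift_one lift_ext])
    then show ?thesis unfolding deg0_ideal_def by (intro fp_ideal_base) simp
  qed (rule elt)
  then show "lift (mon u * s * mon v) \<in> deg0_ideal"
    unfolding lift_mult
    by (intro deg0_ideal_right deg0_ideal_left fp_part_adm[OF lift_mon_part] u v)
qed

text \<open>The difference \<open>r - f\<^sub>1(\<pi> r)\<close> is a cycle of degree zero in the kernel of \<open>\<pi>\<close>, hence a boundary.\<close>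

lemma lift_push:
  assumes v: "v \<in> part 0"
  shows "v - lift (push v) \<in> deg0_ideal"
proof (rule linear_span_into[OF linear_diffI[OF linear_idI[OF vector_space_smul] linear_comp[OF linear_fp_map linear_lift]]
      subspace_deg0_ideal _ v[unfolded fp_part_def]])
  fix x :: "('v \<Rightarrow> 'v, 'r, 'k) fp"
  assume "x \<in> {mon w |w. set w \<subseteq> fp_letters (End scV) R \<and> word_deg 0 w = 0}"
  then obtain w where w: "x = mon w" "set w \<subseteq> fp_letters (End scV) R" "word_deg 0 w = 0" by blast
  have "mon w - lift (push (mon w)) \<in> deg0_ideal"
    using w(2,3)
  proof (induction w)
    case Nil
    then show ?case by (simp add: mon_Nil lift_one fa.subspace_0)
  next
    case (Cons l w)
    then have IH: "mon w - lift (push (mon w)) \<in> deg0_ideal" and w: "set w \<subseteq> fp_letters (End scV) R"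
      and l: "l \<in> fp_letters (End scV) R" "letter_deg 0 l = 0" by auto
    have "gen l - lift (push (gen l)) \<in> deg0_ideal"
    proof (cases l)
      case (Ext \<phi>)
      then show ?thesis by (simp add: lift_ext fa.subspace_0)
    next
      case (Elt n r)
      then have n: "n = 0" and r: "r \<in> dg_part R 0" using l by (auto simp: fp_letters_def)
      have rp: "r - f [\<pi> r] \<in> dg_part R 0" using r f1_part by (intro subspace_diff subspace_part)
      have "\<exists>y\<in>dg_part R (Suc 0). dg_diff R y = r - f [\<pi> r]"
        by (rule kernel_boundary[OF rp diff_part0[OF rp]]) (simp add: linear_diff[OF linear_pi'] pi_f)
      then obtain y where "y \<in> dg_part R 1" "r - f [\<pi> r] = dg_diff R y" by auto
      then have "elt 0 r - elt 0 (f [\<pi> r]) \<in> deg0_ideal"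
        by (rule elt_deg0_ideal_cong[OF r f1_part])
      then show ?thesis using Elt n by (simp add: elt_def[symmetric] lift_elt_0)
    qed
    moreover have "lift (push (gen l)) \<in> adm (End scV) R"
    proof -
      have "push (gen l) \<in> Arep.part (letter_deg 0 l)"
        by (rule fp_map_part[OF pi_image gen_fp_part[OF l(1)]])
      then show ?thesis by (rule fp_part_adm[OF lift_part])
    qed
    ultimately have "gen l * mon w - lift (push (gen l)) * lift (push (mon w)) \<in> deg0_ideal"
      using fp_ideal_cong_mult[OF _ IH[unfolded deg0_ideal_def] _ mon_adm[OF w]] unfolding deg0_ideal_def by blast
    then show ?case by (simp only: mon_Cons fp_map_mult lift_mult)
  qed
  then show "x - lift (push x) \<in> deg0_ideal" by (simp add: w)
qed

lemma lift_mat: "lift (Arep.mat i j y) = mat i j (lift y)"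
  by (simp add: Arep.mat_def mat_def linear_sum[OF linear_lift] lift_mult lift_ext)

text \<open>A lift of an element of the centralizer commutes with \<open>End V\<close> only up to boundaries. Its matrix element at
  \<open>(0, 0)\<close> differs from it by a boundary and commutes exactly.\<close>

lemma lift_centralizer:
  assumes u: "u \<in> centralizer scV A p"
  shows "lift u - mat 0 0 (lift u) \<in> deg0_ideal" "mat 0 0 (lift u) \<in> centralizer scV R p"
proof -
  have "Arep.mat 0 0 u - u \<in> Arep.rel_ideal"
    by (rule Arep.mat_diag_centralizer[OF u]) (use bs_nonempty in auto)
  from lift_rel_ideal[OF this] have "mat 0 0 (lift u) - lift u \<in> deg0_ideal"
    by (simp add: linear_diff[OF linear_lift] lift_mat)
  then show "lift u - mat 0 0 (lift u) \<in> deg0_ideal" by (rule fa.cong_sym[OF subspace_deg0_ideal])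
  show "mat 0 0 (lift u) \<in> centralizer scV R p"
    by (rule mat_centralizer[OF lift_part[OF Arep.centralizer_part[OF u]]])
qed

lemma deg0_cong_mult:
  "x - x' \<in> deg0_ideal \<Longrightarrow> y - y' \<in> deg0_ideal \<Longrightarrow> x' \<in> adm (End scV) R \<Longrightarrow> y \<in> adm (End scV) R \<Longrightarrow>
    x * y - x' * y' \<in> deg0_ideal"
  unfolding deg0_ideal_def by (rule fp_ideal_cong_mult)

lemma lift_rep_rel:
  assumes x: "x \<in> Arep.rep_rel"
  shows "\<exists>\<rho>\<in>rep_rel. lift x - \<rho> \<in> deg0_ideal"
proof -
  let ?W = "{j + \<rho> |j \<rho>. j \<in> deg0_ideal \<and> \<rho> \<in> rep_rel}"
  have W: "fa.subspace ?W" by (rule fa.subspace_sums) auto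
  have WI: "z \<in> ?W" if "\<rho> \<in> rep_rel" "z - \<rho> \<in> deg0_ideal" for z \<rho>
  proof -
    have "z = (z - \<rho>) + \<rho>" by simp
    then show ?thesis using that by blast
  qed
  have "lift x \<in> ?W"
  proof (rule linear_span_into[OF linear_lift W _ x[unfolded Arep.rep_rel_def]])
    fix x assume "x \<in> rep_relations scV A"
    then consider "x \<in> Arep.rel_ideal" | p q u s v where "x = u * s * v" "u \<in> centralizer scV A p"
        "s \<in> graded_commutators smul (centralizer scV A)" "v \<in> centralizer scV A q"
      unfolding rep_relations_def by blast
    then show "lift x \<in> ?W"
    proof cases
      case 1
      show ?thesis by (rule WI[OF fa.subspace_0[OF subspace_rep_rel]]) (simp add: lift_rel_ideal[OF 1])
    next
      case 2
      obtain a b y z where s: "s = y * z - smul ((-1) ^ (a * b)) (z * y)"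
        and y: "y \<in> centralizer scV A a" and z: "z \<in> centralizer scV A b"
        using 2 by (auto simp: graded_commutators_def)
      let ?P = "\<lambda>u. mat 0 0 (lift u)"
      have J: "fa.subspace deg0_ideal" by simp
      have la: "lift u \<in> adm (End scV) R" "?P u \<in> adm (End scV) R" if "u \<in> centralizer scV A p" for u p
        using fp_part_adm[OF lift_part[OF Arep.centralizer_part[OF that]]] mat_adm by auto
      let ?s = "?P y * ?P z - smul ((-1) ^ (a * b)) (?P z * ?P y)"
      have c: "lift s - ?s \<in> deg0_ideal"
        unfolding s linear_diff[OF linear_lift] linear_scale[OF linear_lift] lift_mult
        by (intro fa.cong_diff[OF J] fa.cong_scale[OF J] deg0_cong_mult)
          (use la y z lift_centralizer in auto)
      have sa: "?s \<in> adm (End scV) R"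
        by (intro fa.subspace_diff fa.subspace_scale subspace_adm adm_mult la[OF y] la[OF z])
      have lsa: "lift s \<in> adm (End scV) R"
        unfolding s linear_diff[OF linear_lift] linear_scale[OF linear_lift] lift_mult
        by (intro fa.subspace_diff fa.subspace_scale subspace_adm adm_mult la[OF y] la[OF z])
      have "lift x - ?P u * ?s * ?P v \<in> deg0_ideal"
        unfolding 2(1) lift_mult
        by (rule deg0_cong_mult[OF deg0_cong_mult[OF lift_centralizer(1)[OF 2(2)] c la(2)[OF 2(2)] lsa]
              lift_centralizer(1)[OF 2(4)] adm_mult[OF la(2)[OF 2(2)] sa] la(1)[OF 2(4)]])
      moreover have "?s \<in> graded_commutators smul (centralizer scV R)"
        unfolding graded_commutators_def using lift_centralizer(2) y z by blast
      then have "?P u * ?s * ?P v \<in> rep_relations scV R"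
        unfolding rep_relations_def using lift_centralizer(2) 2 by blast
      then have "?P u * ?s * ?P v \<in> rep_rel" unfolding rep_rel_def by (rule fa.span_base)
      ultimately show ?thesis using WI by blast
    qed
  qed
  then obtain j \<rho> where "lift x = j + \<rho>" "j \<in> deg0_ideal" "\<rho> \<in> rep_rel" by blast
  then show ?thesis by (intro bexI[of _ \<rho>]) auto
qed

lemma centralizer_mult:
  assumes u: "u \<in> centralizer scV R p" and v: "v \<in> centralizer scV R q"
  shows "u * v \<in> centralizer scV R (p + q)"
proof -
  have "gen (Ext \<phi>) * (u * v) - u * v * gen (Ext \<phi>) \<in> rel_ideal" if "\<phi> \<in> End scV" for \<phi>
  proof -
    have "(gen (Ext \<phi>) * u - u * gen (Ext \<phi>)) * v + u * (gen (Ext \<phi>) * v - v * gen (Ext \<phi>)) \<in> rel_ideal"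
      by (intro fa.subspace_add[OF subspace_rel_ideal] rel_ideal_mult_left rel_ideal_mult_right)
        (use u v that in \<open>auto simp: centralizer_def intro: fp_part_adm\<close>)
    then show ?thesis by (simp add: algebra_simps)
  qed
  then show ?thesis
    using fp_part_mult[OF centralizer_part[OF u] centralizer_part[OF v]] by (simp add: centralizer_def)
qed

text \<open>By \<open>lift_push\<close> and \<open>lift_rep_rel\<close>, \<open>u\<close> is a relation up to \<open>deg0_ideal\<close>. The boundary found in this way lies
  in the free product. Taking the matrix element at \<open>(0, 0)\<close>, which commutes with the differential,
  projects it to the centralizer, and the degree projection discards relations of
  other degrees.\<close>

lemma degree_zero_injective:
  assumes u: "u \<in> centralizer scV R 0" and pu: "push u \<in> Arep.rep_rel"
  shows "\<exists>y\<in>centralizer scV R 1. u - rdiff y \<in> rep_rel"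
proof -
  let ?T = "{x. \<exists>y\<in>centralizer scV R 1. x - rdiff y \<in> rep_rel}"
  have K: "fa.subspace rep_rel" by simp
  have T: "fa.subspace ?T"
  proof (rule fa.subspaceI)
    show "0 \<in> ?T"
      by (simp, rule bexI[of _ 0]) (simp_all add: linear_0[OF linear_lin_smul] fa.subspace_0)
    fix x y assume x: "x \<in> ?T"
    then obtain a where a: "a \<in> centralizer scV R 1" "x - rdiff a \<in> rep_rel" by blast
    show "smul c x \<in> ?T" for c
      using fa.cong_scale[OF K a(2), of c] fa.subspace_scale[OF subspace_centralizer a(1), of c]
      by (auto simp: linear_scale[OF linear_lin_smul] intro!: bexI[of _ "smul c a"])
    assume "y \<in> ?T"
    then obtain b where b: "b \<in> centralizer scV R 1" "y - rdiff b \<in> rep_rel" by blast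
    show "x + y \<in> ?T"
      using fa.cong_add[OF K a(2) b(2)] fa.subspace_add[OF subspace_centralizer a(1) b(1)]
      by (auto simp: linear_add[OF linear_lin_smul] intro!: bexI[of _ "a + b"])
  qed
  have relT: "x \<in> ?T" if "x \<in> rep_rel" for x
    using that by (auto intro!: bexI[of _ 0] simp: linear_0[OF linear_lin_smul] fa.subspace_0)
  let ?P = "\<lambda>x. mat 0 0 (fp_proj 0 0 x)"
  have lP: "Vector_Spaces.linear smul smul ?P" by (rule linear_comp[OF linear_fp_proj linear_mat])
  have len: "0 < length bs" using bs_nonempty by linarith
  have PK: "?P x \<in> rep_rel" if x: "x \<in> rep_rel" for x
  proof (rule linear_span_into[OF lP K _ x[unfolded rep_rel_def]])
    fix x assume "x \<in> rep_relations scV R"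
    then consider "x \<in> rel_ideal" | p q u s v where "x = u * s * v" "u \<in> centralizer scV R p"
        "s \<in> graded_commutators smul (centralizer scV R)" "v \<in> centralizer scV R q" "x \<in> rep_relations scV R"
      unfolding rep_relations_def by blast
    then show "?P x \<in> rep_rel"
    proof cases
      case 1
      then have "fp_proj 0 0 x \<in> rel_ideal"
        unfolding end_ideal_def by (intro fp_proj_ideal rel_ideal_generators_part)
      then show ?thesis by (intro rel_ideal_rep_rel mat_rel_ideal)
    next
      case 2
      obtain a b y z where s: "s = y * z - smul ((-1) ^ (a * b)) (z * y)"
        and y: "y \<in> centralizer scV R a" and z: "z \<in> centralizer scV R b"
        using 2 by (auto simp: graded_commutators_def)
      have "z * y \<in> centralizer scV R (a + b)" using centralizer_mult[OF z y] by (simp add: add.commute)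
      then have "s \<in> centralizer scV R (a + b)"
        unfolding s by (rule fa.subspace_diff[OF subspace_centralizer centralizer_mult[OF y z]
              fa.subspace_scale[OF subspace_centralizer]])
      then have x: "x \<in> centralizer scV R (p + (a + b) + q)"
        unfolding 2(1) by (rule centralizer_mult[OF centralizer_mult[OF 2(2)] 2(4)])
      have "fp_proj 0 0 x = 0 \<or> fp_proj 0 0 x = x"
        using fp_proj_part[OF centralizer_part[OF x]] by metis
      moreover have "mat 0 0 x \<in> rep_rel"
      proof -
        have "x \<in> rep_rel" using 2(5) unfolding rep_rel_def by (rule fa.span_base)
        then show ?thesis
          using rel_ideal_rep_rel[OF mat_diag_centralizer[OF x len]] fa.cong_mem[OF K] by blast
      qed
      ultimately show ?thesis by (auto simp: linear_0[OF linear_mat] fa.subspace_0)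
    qed
  qed
  have PJ: "?P x \<in> ?T" if x: "x \<in> deg0_ideal" for x
  proof (rule linear_fp_ideal_into[OF lP T _ x[unfolded deg0_ideal_def]])
    fix a b and s :: "('v \<Rightarrow> 'v, 'r, 'k) fp"
    assume a: "set a \<subseteq> fp_letters (End scV) R" and b: "set b \<subseteq> fp_letters (End scV) R"
      and s: "s \<in> end_relations scV \<union> elt_relations R \<union> {elt 0 (dg_diff R r) |r. r \<in> dg_part R 1}"
    from s consider "s \<in> end_relations scV \<union> elt_relations R" | r where "s = elt 0 (dg_diff R r)" "r \<in> dg_part R 1"
      by blast
    then show "?P (mon a * s * mon b) \<in> ?T"
    proof cases
      case 1
      have "mon a * s * mon b \<in> rel_ideal"
        unfolding end_ideal_def by (rule fp_ideal_sandwich[OF a 1 b])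
      then have "fp_proj 0 0 (mon a * s * mon b) \<in> rel_ideal"
        unfolding end_ideal_def by (intro fp_proj_ideal rel_ideal_generators_part)
      then show ?thesis by (intro relT rel_ideal_rep_rel mat_rel_ideal)
    next
      case 2
      have "s \<in> part 0" unfolding 2(1) using 2(2) by (intro elt_fp_part diff_part) simp
      then have p: "mon a * s * mon b \<in> part (word_deg 0 a + 0 + word_deg 0 b)"
        by (intro fp_part_mult mon_fp_part a b refl)
      show ?thesis
      proof (cases "word_deg 0 a + 0 + word_deg 0 b = 0")
        case False
        have "fp_proj 0 0 (mon a * s * mon b) = 0"
          by (subst fp_proj_part[OF p], rule if_not_P) (metis False)
        then show ?thesis by (simp only: linear_0[OF linear_mat] fa.subspace_0[OF T])
      next
        case True
        then have ab: "mon a \<in> part 0" "mon b \<in> part 0" using a b by (auto intro: mon_fp_part)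
        have d0: "rdiff (mon a) = 0" "rdiff (mon b) = 0"
          by (rule fp_diff_part0[rotated, OF ab(1)], simp, rule fp_diff_part0[rotated, OF ab(2)], simp)
        have e: "elt 1 r \<in> part 1" by (rule elt_fp_part[OF 2(2)])
        have "rdiff (mon a * elt 1 r * mon b) = mon a * s * mon b"
          unfolding fp_diff_mult d0 hat_fp_part[OF ab(1)]
          by (simp add: 2(1) fp_diff_elt_Suc)
        moreover have "fp_proj 0 0 (mon a * s * mon b) = mon a * s * mon b"
          using fp_proj_part[OF p, of 0] True by simp
        ultimately have eq: "?P (mon a * s * mon b) = rdiff (mat 0 0 (mon a * elt 1 r * mon b))"
          by (simp only: rdiff_mat)
        have "mon a * elt 1 r * mon b \<in> part 1"
          using fp_part_mult[OF fp_part_mult[OF ab(1) e] ab(2)] by simp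
        then have "mat 0 0 (mon a * elt 1 r * mon b) \<in> centralizer scV R 1" by (rule mat_centralizer)
        then show ?thesis unfolding eq by (auto simp: fa.subspace_0 intro!: bexI)
      qed
    qed
  qed
  obtain \<rho> where \<rho>: "\<rho> \<in> rep_rel" "lift (push u) - \<rho> \<in> deg0_ideal" using lift_rep_rel[OF pu] by blast
  have "u - \<rho> \<in> deg0_ideal"
    by (rule fa.cong_trans[OF subspace_deg0_ideal lift_push[OF centralizer_part[OF u]] \<rho>(2)])
  then have "?P (u - \<rho>) + ?P \<rho> \<in> ?T"
    by (intro fa.subspace_add[OF T] PJ relT PK \<rho>)
  moreover have "?P (u - \<rho>) + ?P \<rho> = ?P u" by (simp add: linear_diff[OF lP])
  moreover have "?P u = mat 0 0 u" using fp_proj_part[OF centralizer_part[OF u], of 0] by simp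
  ultimately have "mat 0 0 u \<in> ?T" by simp
  moreover have "mat 0 0 u - u \<in> ?T"
    by (rule relT[OF rel_ideal_rep_rel[OF mat_diag_centralizer[OF u len]]])
  ultimately have "u \<in> ?T" using fa.cong_mem[OF T] by blast
  then show ?thesis by blast
qed

end


section \<open>Multilinear cochains\<close>

context twisting
begin

text \<open>Multilinearity holds only modulo the ideal, as the letter of a sum is not the sum of the letters.\<close>

definition mlin :: "('a list \<Rightarrow> (unit, 'r, 'k) fp) \<Rightarrow> bool"
  where "mlin \<phi> \<longleftrightarrow> (\<forall>u v a b c.
    \<phi> (u @ (a + scA c b) # v) - (\<phi> (u @ a # v) + smul c (\<phi> (u @ b # v))) \<in> adj_ideal R)"

lemma mlinD: "mlin \<phi> \<Longrightarrow> \<phi> (u @ (a + scA c b) # v) - (\<phi> (u @ a # v) + smul c (\<phi> (u @ b # v))) \<in> adj_ideal R"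
  by (simp add: mlin_def)

lemma mlin_f': "mlin f'"
  unfolding mlin_def
proof (intro allI)
  fix u v :: "'a list" and a b :: 'a and c :: 'k
  have p: "f (u @ x # v) \<in> dg_part R (length u + length v)" for x
    using f_part[of "u @ x # v"] by simp
  show "f' (u @ (a + scA c b) # v) - (f' (u @ a # v) + smul c (f' (u @ b # v))) \<in> adj_ideal R"
    using elt_lin[OF p[of a] p[of b], of c]
    by (simp add: f'_def linear_add[OF linear_f] linear_scale[OF linear_f])
qed

lemma mlin_g: "mlin g"
  unfolding mlin_def
proof (intro allI)
  fix u v :: "'a list" and a b :: 'a and c :: 'k
  have "(f' (u @ (a + scA c b) # v) - (f' (u @ a # v) + smul c (f' (u @ b # v)))) * unit_letter \<in> adj_ideal R"
    by (rule adj_ideal_right[OF mlinD[OF mlin_f'] adj_part_adm[OF unit_letter_part]])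
  then show "g (u @ (a + scA c b) # v) - (g (u @ a # v) + smul c (g (u @ b # v))) \<in> adj_ideal R"
    by (simp add: g_def algebra_simps)
qed

lemma mlin_conv:
  assumes \<phi>: "mlin \<phi>" and \<psi>: "mlin \<psi>"
    and adm: "\<And>w. w \<noteq> [] \<Longrightarrow> \<phi> w \<in> adm {()} R" "\<And>w. w \<noteq> [] \<Longrightarrow> \<psi> w \<in> adm {()} R"
  shows "mlin (conv \<phi> \<psi>)"
  unfolding mlin_def
proof (intro allI)
  fix u v :: "'a list" and a b :: 'a and c :: 'k
  have I: "fa.subspace (adj_ideal R)" by simp
  let ?t = "\<lambda>x i. \<phi> (take i (u @ x # v)) * \<psi> (drop i (u @ x # v))"
  let ?J = "{1..<length (u @ a # v)}"
  have e: "conv \<phi> \<psi> (u @ x # v) = (\<Sum>i\<in>?J. ?t x i)" for x :: 'a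
    by (simp add: conv_def)
  have "?t (a + scA c b) i - (?t a i + smul c (?t b i)) \<in> adj_ideal R" if i: "i \<in> ?J" for i
  proof (cases "i \<le> length u")
    case True
    have "take i u \<noteq> []" using i True by auto
    then have "\<phi> (take i u) * (\<psi> (drop i u @ (a + scA c b) # v) - (\<psi> (drop i u @ a # v) + smul c (\<psi> (drop i u @ b # v)))) \<in> adj_ideal R"
      by (intro adj_ideal_left adm mlinD[OF \<psi>])
    then show ?thesis using True by (simp add: algebra_simps)
  next
    case False
    then obtain k where k: "i = Suc (length u + k)" using less_imp_Suc_add[of "length u" i] by auto
    have "drop k v \<noteq> []" using i k by auto
    then have "(\<phi> (u @ (a + scA c b) # take k v) - (\<phi> (u @ a # take k v) + smul c (\<phi> (u @ b # take k v)))) * \<psi> (drop k v) \<in> adj_ideal R"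
      by (intro adj_ideal_right adm mlinD[OF \<phi>])
    then show ?thesis by (simp add: k algebra_simps)
  qed
  then have "(\<Sum>i\<in>?J. ?t (a + scA c b) i) - (\<Sum>i\<in>?J. ?t a i + smul c (?t b i)) \<in> adj_ideal R"
    by (rule fa.cong_sum[OF I])
  then show "conv \<phi> \<psi> (u @ (a + scA c b) # v) - (conv \<phi> \<psi> (u @ a # v) + smul c (conv \<phi> \<psi> (u @ b # v))) \<in> adj_ideal R"
    unfolding e by (simp only: sum.distrib fa.scale_sum_right)
qed

lemma mlin_cpow_g: "mlin (cpow g p)"
proof (induction p)
  case 0 then show ?case by (simp add: mlin_g)
next
  case (Suc p)
  show ?case unfolding cpow.simps
    by (rule mlin_conv[OF Suc mlin_g adj_part_adm[OF cpow_g_part] adj_part_adm[OF g_part]])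
qed

lemma rotate_insert:
  assumes "j < length (u @ x # v)"
  obtains u' v' where "\<And>x. rotate j (u @ x # v) = u' @ x # v'"
proof (cases "j \<le> length u")
  case True
  have "rotate j (u @ y # v) = drop j u @ y # (v @ take j u)" for y
    using True by (simp add: rotate_drop_take)
  then show ?thesis by (rule that)
next
  case False
  then obtain k where k: "j = Suc (length u + k)" using less_imp_Suc_add[of "length u" j] by auto
  have "rotate j (u @ y # v) = (drop k v @ u) @ y # take k v" for y
    using k assms by (simp add: rotate_drop_take)
  then show ?thesis by (rule that)
qed

lemma mlin_cyc:
  assumes \<phi>: "mlin \<phi>"
  shows "mlin (cyc \<phi>)"
  unfolding mlin_def
proof (intro allI)
  fix u v :: "'a list" and a b :: 'a and c :: 'k
  have I: "fa.subspace (adj_ideal R)" by simp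
  let ?N = "length (u @ a # v)"
  let ?s = "\<lambda>j. (-1 :: 'k) ^ ((?N - 1) * j)"
  let ?t = "\<lambda>x j. smul (?s j) (\<phi> (rotate j (u @ x # v)))"
  have e: "cyc \<phi> (u @ x # v) = (\<Sum>j<?N. ?t x j)" for x :: 'a
    by (simp add: cyc_def)
  have "?t (a + scA c b) j - (?t a j + smul c (?t b j)) \<in> adj_ideal R" if j: "j \<in> {..<?N}" for j
  proof -
    obtain u' v' where r: "\<And>x. rotate j (u @ x # v) = u' @ x # v'"
      by (rule rotate_insert[of j u a v]) (use j in auto)
    have "smul (?s j) (\<phi> (u' @ (a + scA c b) # v') - (\<phi> (u' @ a # v') + smul c (\<phi> (u' @ b # v')))) \<in> adj_ideal R"
      by (rule fa.subspace_scale[OF I mlinD[OF \<phi>]])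
    then show ?thesis
      by (simp only: r fa.scale_right_diff_distrib fa.scale_right_distrib fa.scale_left_commute)
  qed
  then have "(\<Sum>j<?N. ?t (a + scA c b) j) - (\<Sum>j<?N. ?t a j + smul c (?t b j)) \<in> adj_ideal R"
    by (rule fa.cong_sum[OF I])
  then show "cyc \<phi> (u @ (a + scA c b) # v) - (cyc \<phi> (u @ a # v) + smul c (cyc \<phi> (u @ b # v))) \<in> adj_ideal R"
    unfolding e by (simp only: sum.distrib fa.scale_sum_right)
qed

lemma mlin_log_cyc: "mlin log_cyc"
  unfolding mlin_def
proof (intro allI)
  fix u v :: "'a list" and a b :: 'a and c :: 'k
  have I: "fa.subspace (adj_ideal R)" by simp
  let ?N = "length (u @ a # v)"
  let ?t = "\<lambda>x p. smul (inverse (of_nat (Suc p))) (cyc (cpow g p) (u @ x # v))"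
  have e: "log_cyc (u @ x # v) = (\<Sum>p<?N. ?t x p)" for x :: 'a
    by (simp add: log_cyc_def)
  have "?t (a + scA c b) p - (?t a p + smul c (?t b p)) \<in> adj_ideal R" for p
    using fa.subspace_scale[OF I mlinD[OF mlin_cyc[OF mlin_cpow_g]], of "inverse (of_nat (Suc p))" p u a c b v]
    by (simp only: fa.scale_right_diff_distrib fa.scale_right_distrib fa.scale_left_commute)
  then have "(\<Sum>p<?N. ?t (a + scA c b) p) - (\<Sum>p<?N. ?t a p + smul c (?t b p)) \<in> adj_ideal R"
    by (intro fa.cong_sum[OF I])
  then show "log_cyc (u @ (a + scA c b) # v) - (log_cyc (u @ a # v) + smul c (log_cyc (u @ b # v))) \<in> adj_ideal R"
    unfolding e by (simp only: sum.distrib fa.scale_sum_right)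
qed

lemma log_cyc_last_butlast:
  assumes "w \<noteq> []"
  shows "log_cyc w = smul ((-1) ^ (length w - 1)) (log_cyc (last w # butlast w))"
proof -
  have l: "length (last w # butlast w) = length w" using assms by simp
  have "log_cyc w = (\<Sum>p<length w. smul (inverse (of_nat (Suc p))) (smul ((-1) ^ (length w - 1)) (cyc (cpow g p) (last w # butlast w))))"
    unfolding log_cyc_def by (subst cyc_last_butlast[OF assms]) (rule refl)
  also have "\<dots> = smul ((-1) ^ (length w - 1)) (log_cyc (last w # butlast w))"
    unfolding log_cyc_def l fa.scale_sum_right by (simp only: fa.scale_left_commute)
  finally show ?thesis .
qed

abbreviation "connes_part n \<equiv> cx_part (connes_cplx scA) n"
abbreviation "connes_rel n \<equiv> cx_rel (connes_cplx scA) n"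
abbreviation "hoch \<equiv> lin smul hochschild_word"

lemma connes_part_def': "connes_part n = fa.span {mon w |w. length w = n + 1}"
  by (simp add: connes_cplx_def)

lemma connes_rel_def': "connes_rel n = fa.span (multilinearity scA (n + 1) \<union> cyclic_relations n)"
  by (simp add: connes_cplx_def)

lemma mon_connes_part: "length w = n + 1 \<Longrightarrow> mon w \<in> connes_part n"
  unfolding connes_part_def' by (rule fa.span_base) auto

lemma subspace_connes_part [intro, simp]: "fa.subspace (connes_part n)"
  by (simp add: connes_part_def')

lemma subspace_connes_rel [intro, simp]: "fa.subspace (connes_rel n)"
  by (simp add: connes_rel_def')

lemma mlin_multilinearity:
  assumes \<phi>: "mlin \<phi>" and x: "x \<in> multilinearity scA m"
  shows "lin smul \<phi> x \<in> adj_ideal R"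
proof -
  note L = linear_diff[OF linear_lin_smul] linear_scale[OF linear_lin_smul]
  have I: "fa.subspace (adj_ideal R)" by simp
  have A: "vector_space scA" by (rule linear_vs1[OF linear_f])
  interpret A: vector_space scA by (rule A)
  have 0: "\<phi> (u @ 0 # v) \<in> adj_ideal R" for u v
    using fa.subspace_neg[OF I mlinD[OF \<phi>, of u 0 1 0 v]] by simp
  from x consider u v a b where "x = mon (u @ [a + b] @ v) - mon (u @ [a] @ v) - mon (u @ [b] @ v)"
    | u v c a where "x = mon (u @ [scA c a] @ v) - smul c (mon (u @ [a] @ v))"
    unfolding multilinearity_def by blast
  then show ?thesis
  proof cases
    case 1
    then show ?thesis using mlinD[OF \<phi>, of u a 1 b v] by (simp add: L) (simp add: algebra_simps)
  next
    case 2
    then show ?thesis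
      using fa.subspace_add[OF I mlinD[OF \<phi>, of u 0 c a v] 0[of u v]] by (simp add: L)
  qed
qed

text \<open>A multilinear cochain with the symmetry of cyclic sums descends to Connes' complex.\<close>

lemma lin_connes_rel:
  assumes \<phi>: "mlin \<phi>" and cyclic: "\<And>w. length w = n + 1 \<Longrightarrow> \<phi> w = smul ((-1) ^ (length w - 1)) (\<phi> (last w # butlast w))"
    and x: "x \<in> connes_rel n"
  shows "lin smul \<phi> x \<in> adj_ideal R"
proof (rule linear_span_into[OF linear_lin_smul subspace_adj_ideal _ x[unfolded connes_rel_def']])
  fix x assume "x \<in> multilinearity scA (n + 1) \<union> (cyclic_relations n :: ('a, 'k) free_alg set)"
  then show "lin smul \<phi> x \<in> adj_ideal R"
  proof
    assume "x \<in> cyclic_relations n"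
    then obtain w :: "'a list" where w: "x = mon w - smul ((-1) ^ n) (mon (last w # butlast w))" "length w = n + 1"
      unfolding cyclic_relations_def by blast
    have "lin smul \<phi> x = \<phi> w - smul ((-1) ^ n) (\<phi> (last w # butlast w))"
      by (simp only: w(1) linear_diff[OF linear_lin_smul] linear_scale[OF linear_lin_smul] lin_smul_mon)
    also have "\<dots> = 0" using cyclic[OF w(2)] w(2) by simp
    finally show ?thesis by (simp add: fa.subspace_0)
  qed (rule mlin_multilinearity[OF \<phi>])
qed

abbreviation "LogC \<equiv> lin smul log_cyc"
abbreviation "CycF \<equiv> lin smul (cyc f')"

lemma LogC_rel: "x \<in> connes_rel n \<Longrightarrow> LogC x \<in> adj_ideal R"
  by (rule lin_connes_rel[OF mlin_log_cyc log_cyc_last_butlast]) auto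

lemma CycF_rel: "x \<in> connes_rel n \<Longrightarrow> CycF x \<in> adj_ideal R"
  by (rule lin_connes_rel[OF mlin_cyc[OF mlin_f'] cyc_last_butlast]) auto

lemma log_cyc_part:
  assumes "w \<noteq> []"
  shows "log_cyc w \<in> adj_part R (length w)"
  unfolding log_cyc_def
proof (intro fa.subspace_sum[OF subspace_adj_part] fa.subspace_scale[OF subspace_adj_part] cyc_into[OF subspace_adj_part])
  fix p and v :: "'a list" assume v: "length v = length w"
  show "cpow g p v \<in> adj_part R (length w)"
    unfolding v[symmetric] by (rule cpow_g_part) (use v assms in auto)
qed

lemma LogC_part:
  assumes "x \<in> connes_part n"
  shows "LogC x \<in> adj_part R (Suc n)"
proof (rule linear_span_into[OF linear_lin_smul subspace_adj_part _ assms[unfolded connes_part_def']])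
  fix x :: "('a, 'k) free_alg" assume "x \<in> {mon w |w. length w = n + 1}"
  then obtain w :: "'a list" where w: "x = mon w" "length w = n + 1" by blast
  then have "w \<noteq> []" by auto
  from log_cyc_part[OF this] show "LogC x \<in> adj_part R (Suc n)" by (simp add: w)
qed

lemma hoch_part:
  assumes "x \<in> connes_part (Suc n)"
  shows "hoch x \<in> connes_part n"
proof (rule linear_span_into[OF linear_lin_smul subspace_connes_part _ assms[unfolded connes_part_def']])
  fix x :: "('a, 'k) free_alg" assume "x \<in> {mon w |w. length w = Suc n + 1}"
  then obtain w :: "'a list" where w: "x = mon w" "length w = Suc n + 1" by blast
  have "hochschild_word w \<in> connes_part n"
    unfolding connes_part_def'
    by (rule subsetD[OF fa.span_mono hochschild_word_span]) (use w in auto)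
  then show "hoch x \<in> connes_part n" by (simp add: w)
qed

lemma adj_diff_LogC:
  assumes x: "x \<in> connes_part n"
  shows "adj_diff R (LogC x) - (LogC (hoch x) + smul ((-1) ^ n) (CycF x)) \<in> adj_rel R"
proof (rule linear_span_into[OF _ subspace_adj_rel _ x[unfolded connes_part_def'],
      where F = "\<lambda>x. adj_diff R (LogC x) - (LogC (hoch x) + smul ((-1) ^ n) (CycF x))"])
  show "Vector_Spaces.linear smul smul (\<lambda>x. adj_diff R (LogC x) - (LogC (hoch x) + smul ((-1) ^ n) (CycF x)))"
    by (intro linear_diffI linear_addI linear_scaleI linear_comp[OF linear_lin_smul linear_adj_diff]
        linear_comp[OF linear_lin_smul linear_lin_smul] linear_lin_smul)
  fix x :: "('a, 'k) free_alg" assume "x \<in> {mon w |w. length w = n + 1}"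
  then obtain w :: "'a list" where w: "x = mon w" "length w = n + 1" by blast
  then have "w \<noteq> []" "length w - 1 = n" by auto
  then show "adj_diff R (LogC x) - (LogC (hoch x) + smul ((-1) ^ n) (CycF x)) \<in> adj_rel R"
    using adj_diff_log_cyc[of w] by (simp add: w)
qed

lemma adj_diff_CycF:
  assumes x: "x \<in> connes_part n"
  shows "adj_diff R (CycF x) - CycF (hoch x) \<in> adj_rel R"
proof (rule linear_span_into[OF _ subspace_adj_rel _ x[unfolded connes_part_def'],
      where F = "\<lambda>x. adj_diff R (CycF x) - CycF (hoch x)"])
  show "Vector_Spaces.linear smul smul (\<lambda>x. adj_diff R (CycF x) - CycF (hoch x))"
    by (intro linear_diffI linear_comp[OF linear_lin_smul linear_adj_diff]
        linear_comp[OF linear_lin_smul linear_lin_smul])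
  fix x :: "('a, 'k) free_alg" assume "x \<in> {mon w |w. length w = n + 1}"
  then obtain w :: "'a list" where w: "x = mon w" "length w = n + 1" by blast
  then have "w \<noteq> []" by auto
  then show "adj_diff R (CycF x) - CycF (hoch x) \<in> adj_rel R"
    using adj_diff_cyc_f'[of w] by (simp add: w)
qed

text \<open>The cyclic sum of \<open>f\<close> in \<open>R\<close>. The description by \<open>retract\<close> transports statements about \<open>CycF\<close> from \<open>R\<langle>x\<rangle>\<close> to \<open>R\<close>.\<close>

definition tr :: "('a, 'k) free_alg \<Rightarrow> 'r" where "tr x = retract R (CycF x)"

lemma linear_tr [intro, simp]: "Vector_Spaces.linear smul (dg_scale R) tr"
  unfolding tr_def by (rule linear_comp[OF linear_lin_smul linear_retract])

lemma tr_mon: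
  "tr (mon w) = (\<Sum>j<length w. dg_scale R ((-1) ^ ((length w - 1) * j)) (f (rotate j w)))"
  by (simp add: tr_def cyc_def linear_sum[OF linear_retract] linear_scale[OF linear_retract] f'_def)

lemma CycF_elt:
  assumes x: "x \<in> connes_part n"
  shows "tr x \<in> dg_part R n" and "CycF x - elt n (tr x) \<in> adj_ideal R"
proof -
  let ?S = "{y. retract R y \<in> dg_part R n \<and> y - elt n (retract R y) \<in> adj_ideal R}"
  have I: "fa.subspace (adj_ideal R)" by simp
  have S: "fa.subspace ?S"
  proof (rule fa.subspaceI)
    have "elt n 0 \<in> adj_ideal R" unfolding adj_ideal_def by (rule elt_zero) simp
    then show "0 \<in> ?S"
      using fa.subspace_neg[OF I] by (simp add: linear_0[OF linear_retract])
    fix y z c assume y: "y \<in> ?S"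
    { assume z: "z \<in> ?S"
      have "elt n (retract R y + dg_scale R 1 (retract R z)) - (elt n (retract R y) + smul 1 (elt n (retract R z))) \<in> adj_ideal R"
        by (rule elt_lin) (use y z in auto)
      then have e: "(elt n (retract R y) + elt n (retract R z)) - elt n (retract R (y + z)) \<in> adj_ideal R"
        using fa.cong_sym[OF I] by (simp add: linear_add[OF linear_retract])
      have "(y + z) - (elt n (retract R y) + elt n (retract R z)) \<in> adj_ideal R"
        by (rule fa.cong_add[OF I]) (use y z in auto)
      from fa.cong_trans[OF I this e] show "y + z \<in> ?S"
        using y z subspace_add[OF subspace_part] by (simp add: linear_add[OF linear_retract]) }
    have "elt n (dg_scale R c (retract R y)) - smul c (elt n (retract R y)) \<in> adj_ideal R"
      unfolding adj_ideal_def by (rule elt_scale) (use y in auto)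
    then have e: "smul c (elt n (retract R y)) - elt n (retract R (smul c y)) \<in> adj_ideal R"
      using fa.cong_sym[OF I] by (simp add: linear_scale[OF linear_retract])
    have "smul c y - smul c (elt n (retract R y)) \<in> adj_ideal R"
      by (rule fa.cong_scale[OF I]) (use y in auto)
    from fa.cong_trans[OF I this e] show "smul c y \<in> ?S"
      using y subspace_scale[OF subspace_part] by (simp add: linear_scale[OF linear_retract])
  qed
  have "CycF x \<in> ?S"
  proof (rule linear_span_into[OF linear_lin_smul S _ x[unfolded connes_part_def']])
    fix x :: "('a, 'k) free_alg" assume "x \<in> {mon w |w. length w = n + 1}"
    then obtain w :: "'a list" where w: "x = mon w" "length w = n + 1" by blast
    have "cyc f' w \<in> ?S"
    proof (rule cyc_into[OF S])
      fix v :: "'a list" assume v: "v \<noteq> []" "length v = length w"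
      have "f v \<in> dg_part R n" using f_part[OF v(1)] v w by simp
      then show "f' v \<in> ?S" using v w by (simp add: f'_def fa.subspace_0)
    qed
    then show "CycF x \<in> ?S" by (simp add: w)
  qed
  then show "tr x \<in> dg_part R n" "CycF x - elt n (tr x) \<in> adj_ideal R" by (auto simp: tr_def)
qed

lemma tr_rel: "x \<in> connes_rel n \<Longrightarrow> tr x = 0"
  unfolding tr_def by (rule retract_ideal) (use CycF_rel in \<open>auto simp: adj_ideal_def\<close>)

lemma tr_hoch:
  assumes x: "x \<in> connes_part (Suc n)"
  shows "dg_diff R (tr x) - tr (hoch x) \<in> nat_rel"
proof -
  have K: "fa.subspace (adj_rel R)" by simp
  have "adj_diff R (CycF x - elt (Suc n) (tr x)) \<in> adj_rel R"
    by (intro adj_diff_rel adj_ideal_rel CycF_elt(2)[OF x])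
  moreover have "adj_diff R (elt (Suc n) (tr x)) = elt n (dg_diff R (tr x))"
    by (simp add: adj_diff_fp_diff fp_diff_elt_Suc)
  ultimately have 1: "elt n (dg_diff R (tr x)) - adj_diff R (CycF x) \<in> adj_rel R"
    using fa.cong_sym[OF K] by (simp add: linear_diff[OF linear_adj_diff])
  have "retract R (elt n (dg_diff R (tr x)) - CycF (hoch x)) \<in> nat_rel"
    by (rule retract_adj_rel[OF fa.cong_trans[OF K 1 adj_diff_CycF[OF x]]])
  then show ?thesis by (simp add: linear_diff[OF linear_retract] tr_def)
qed

end


section \<open>Morphisms and homology\<close>

lemma morphism_boundaries:
  assumes m: "cplx_morphism K L g" and L: "module.subspace (cx_scale L) (cx_rel L n)"
    and x: "x \<in> boundaries K n"
  shows "g n x \<in> boundaries L n"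
proof -
  have lin: "Vector_Spaces.linear (cx_scale K) (cx_scale L) (g k)" for k
    using m by (simp add: cplx_morphism_def)
  interpret V: vector_space "cx_scale L" by (rule linear_vs2[OF lin])
  obtain y where y: "y \<in> cx_part K (n + 1)" "x - cx_diff K y \<in> cx_rel K n"
    using x unfolding mem_boundaries by blast
  have "g n (x - cx_diff K y) \<in> cx_rel L n" "g n (cx_diff K y) - cx_diff L (g (n + 1) y) \<in> cx_rel L n"
    and p: "g (n + 1) y \<in> cx_part L (n + 1)"
    using m y unfolding cplx_morphism_def by blast+
  then have "g n x - cx_diff L (g (n + 1) y) \<in> cx_rel L n"
    using V.cong_trans[OF L] by (metis lin linear_diff)
  then show ?thesis unfolding mem_boundaries using p by blast
qed

lemma morphism_cycles:
  assumes m: "cplx_morphism K L g" and L: "\<And>n. module.subspace (cx_scale L) (cx_rel L n)"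
    and x: "x \<in> cycles K n"
  shows "g n x \<in> cycles L n"
proof (cases n)
  case 0
  then show ?thesis using m x unfolding cycles_def cplx_morphism_def by blast
next
  case (Suc k)
  have lin: "Vector_Spaces.linear (cx_scale K) (cx_scale L) (g k)" for k
    using m by (simp add: cplx_morphism_def)
  interpret V: vector_space "cx_scale L" by (rule linear_vs2[OF lin])
  have x': "x \<in> cx_part K (k + 1)" "cx_diff K x \<in> cx_rel K k"
    using x Suc by (auto simp: cycles_def)
  have "g k (cx_diff K x) - cx_diff L (g (k + 1) x) \<in> cx_rel L k" "g k (cx_diff K x) \<in> cx_rel L k"
    and p: "g (k + 1) x \<in> cx_part L (k + 1)"
    using m x' unfolding cplx_morphism_def by blast+
  then have "cx_diff L (g (k + 1) x) \<in> cx_rel L k" using V.cong_mem[OF L] by blast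
  then show ?thesis using p Suc by (simp add: cycles_def)
qed

context resolved
begin

abbreviation "CC \<equiv> connes_cplx scA"
abbreviation "RV \<equiv> rep_cplx scV R"
abbreviation "AV \<equiv> rep_cplx scV A"
abbreviation "RVk \<equiv> rep_mod_k_cplx scV R"
abbreviation "Rk \<equiv> nat_mod_k_cplx R"
abbreviation "QR \<equiv> adj_nat_quot_cplx R"
abbreviation "QA \<equiv> adj_nat_quot_cplx A"
abbreviation "T \<equiv> T_map scV bs f"

lemma CC_simps: "cx_scale CC = smul" "cx_diff CC = hoch"
  by (simp_all add: connes_cplx_def)

lemma RV_simps [simp]: "cx_scale RV = smul" "cx_part RV = centralizer scV R"
  "cx_rel RV n = rep_rel \<inter> centralizer scV R n" "cx_diff RV = rdiff"
  by (simp_all add: rep_cplx_def rep_rel_def)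

lemma AV_simps [simp]: "cx_scale AV = smul" "cx_part AV = centralizer scV A"
  "cx_rel AV n = Arep.rep_rel \<inter> centralizer scV A n" "cx_diff AV = Arep.rdiff"
  by (simp_all add: rep_cplx_def Arep.rep_rel_def)

lemma RVk_simps [simp]: "cx_scale RVk = smul" "cx_part RVk = centralizer scV R"
  "cx_rel RVk n = fa.span (insert 1 (rep_relations scV R)) \<inter> centralizer scV R n" "cx_diff RVk = rdiff"
  by (simp_all add: rep_mod_k_cplx_def rep_cplx_def)

lemma Rk_simps [simp]: "cx_scale Rk = dg_scale R" "cx_part Rk = dg_part R"
  "cx_rel Rk n = span (insert 1 (graded_commutators (dg_scale R) (dg_part R))) \<inter> dg_part R n" "cx_diff Rk = dg_diff R"
  by (simp_all add: nat_mod_k_cplx_def nat_cplx_def)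

lemma QR_simps [simp]: "cx_scale QR = smul" "cx_part QR = adj_part R"
  "cx_rel QR n = adj_relq R \<inter> adj_part R n" "cx_diff QR = adj_diff R"
  by (simp_all add: adj_nat_quot_cplx_def adj_nat_cplx_def adj_relq_def)

lemma QA_simps [simp]: "cx_scale QA = smul" "cx_part QA = adj_part A"
  "cx_rel QA n = adj_relq A \<inter> adj_part A n" "cx_diff QA = adj_diff A"
  by (simp_all add: adj_nat_quot_cplx_def adj_nat_cplx_def adj_relq_def)

lemma subspace_RV_rel: "fa.subspace (rep_rel \<inter> centralizer scV R n)"
  by (intro fa.subspace_inter) auto

lemma subspace_bd_CC: "fa.subspace (boundaries CC n)"
  by (rule subspace_boundaries) (auto simp: CC_simps)

lemma subspace_bd_RV: "fa.subspace (boundaries RV n)"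
  by (rule subspace_boundaries) (auto intro!: fa.subspace_inter)

lemma subspace_bd_AV: "fa.subspace (boundaries AV n)"
  by (rule subspace_boundaries) (auto intro!: fa.subspace_inter)

lemma subspace_bd_RVk: "fa.subspace (boundaries RVk n)"
  by (rule subspace_boundaries) (auto intro!: fa.subspace_inter)

lemma subspace_bd_Rk: "subspace (boundaries Rk n)"
  by (rule subspace_boundaries) (auto intro!: subspace_inter)

lemma subspace_bd_QR: "fa.subspace (boundaries QR n)"
  by (rule subspace_boundaries) (auto intro!: fa.subspace_inter)

lemma subspace_bd_QA: "fa.subspace (boundaries QA n)"
  by (rule subspace_boundaries) (auto intro!: fa.subspace_inter)

lemma connes_rel_part: "x \<in> connes_rel n \<Longrightarrow> x \<in> connes_part n"
proof -
  assume x: "x \<in> connes_rel n"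
  show ?thesis
  proof (rule linear_span_into[OF linear_idI[OF vector_space_smul] subspace_connes_part _ x[unfolded connes_rel_def']])
    fix x assume "x \<in> multilinearity scA (n + 1) \<union> (cyclic_relations n :: ('a, 'k) free_alg set)"
    then show "x \<in> connes_part n"
      unfolding multilinearity_def cyclic_relations_def
      by (auto intro!: fa.subspace_diff[OF subspace_connes_part] fa.subspace_scale[OF subspace_connes_part] mon_connes_part)
  qed
qed

lemma boundaries_CC_part: "x \<in> boundaries CC n \<Longrightarrow> x \<in> connes_part n"
  unfolding mem_boundaries CC_simps
proof (elim bexE)
  fix y assume y: "y \<in> connes_part (n + 1)" "x - hoch y \<in> connes_rel n"
  have "hoch y \<in> connes_part n" using hoch_part y by simp
  then have "(x - hoch y) + hoch y \<in> connes_part n"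
    using connes_rel_part[OF y(2)] by (intro fa.subspace_add[OF subspace_connes_part])
  then show "x \<in> connes_part n" by simp
qed


section \<open>The trace map on cochains\<close>

lemma mat_trace_sum:
  assumes "finite J" "\<And>j. j \<in> J \<Longrightarrow> r j \<in> dg_part R n"
  shows "mtr n (\<Sum>j\<in>J. dg_scale R (c j) (r j)) - (\<Sum>j\<in>J. smul (c j) (mtr n (r j))) \<in> rel_ideal"
  using assms
proof (induction J rule: finite_induct)
  case empty
  then show ?case by (simp add: mat_trace_zero)
next
  case (insert a J)
  have I: "fa.subspace rel_ideal" by simp
  have ra: "r a \<in> dg_part R n" using insert by simp
  have "mtr n (dg_scale R (c a) (r a) + (\<Sum>j\<in>J. dg_scale R (c j) (r j)))
      - (mtr n (dg_scale R (c a) (r a)) + mtr n (\<Sum>j\<in>J. dg_scale R (c j) (r j))) \<in> rel_ideal"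
    by (rule mat_trace_add) (use insert in \<open>auto intro!: subspace_scale[OF subspace_part] subspace_sum[OF subspace_part]\<close>)
  moreover have "(mtr n (dg_scale R (c a) (r a)) + mtr n (\<Sum>j\<in>J. dg_scale R (c j) (r j)))
      - (smul (c a) (mtr n (r a)) + (\<Sum>j\<in>J. smul (c j) (mtr n (r j)))) \<in> rel_ideal"
    by (rule fa.cong_add[OF I mat_trace_scale[OF ra] insert.IH]) (use insert in auto)
  ultimately show ?case using fa.cong_trans[OF I] insert.hyps by (metis (no_types, lifting) sum.insert)
qed

lemma T_mon:
  assumes "length w = n + 1"
  shows "T n (mon w) = (\<Sum>j<n + 1. smul ((-1) ^ (n * j)) (mtr n (f (rotate j w))))"
proof -
  have "T n (mon w) = (\<Sum>i<length bs. \<Sum>j<n + 1. smul ((-1) ^ (n * j)) (mat i i (elt n (f (rotate j w)))))"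
    by (simp add: T_map_def mat_elt_mat)
  also have "\<dots> = (\<Sum>j<n + 1. smul ((-1) ^ (n * j)) (mtr n (f (rotate j w))))"
    by (subst sum.swap) (simp add: mat_trace_mat fa.scale_sum_right)
  finally show ?thesis .
qed

lemma linear_T [intro, simp]: "Vector_Spaces.linear smul smul (T n)"
  by (simp add: T_map_def)

lemma f_rotate_part: "length w = n + 1 \<Longrightarrow> f (rotate j w) \<in> dg_part R n"
  using f_part[of "rotate j w"] by (cases w) auto

lemma T_centralizer:
  assumes x: "x \<in> connes_part n"
  shows "T n x \<in> centralizer scV R n"
proof (rule linear_span_into[OF linear_T subspace_centralizer _ x[unfolded connes_part_def']])
  fix x :: "('a, 'k) free_alg" assume "x \<in> {mon w |w. length w = n + 1}"
  then obtain w :: "'a list" where w: "x = mon w" "length w = n + 1" by blast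
  show "T n x \<in> centralizer scV R n"
    unfolding w(1) T_mon[OF w(2)]
    by (intro fa.subspace_sum[OF subspace_centralizer] fa.subspace_scale[OF subspace_centralizer]
        mat_trace_centralizer f_rotate_part w)
qed

text \<open>The two sides differ because \<open>T\<close> takes the letters of the values of \<open>f\<close> one by one, and the right hand side the letter of
  their sum.\<close>

lemma T_mat_trace:
  assumes x: "x \<in> connes_part n"
  shows "T n x - mtr n (tr x) \<in> rel_ideal"
proof -
  have I: "fa.subspace rel_ideal" by simp
  let ?S = "{x. tr x \<in> dg_part R n \<and> T n x - mtr n (tr x) \<in> rel_ideal}"
  have S: "fa.subspace ?S"
  proof (rule fa.subspaceI)
    show "0 \<in> ?S"
      using fa.subspace_neg[OF I mat_trace_zero] by (simp add: linear_0[OF linear_T] linear_0[OF linear_tr])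
    fix x y c assume x: "x \<in> ?S"
    { assume y: "y \<in> ?S"
      have "(T n x + T n y) - (mtr n (tr x) + mtr n (tr y)) \<in> rel_ideal"
        by (rule fa.cong_add[OF I]) (use x y in auto)
      moreover have "(mtr n (tr x) + mtr n (tr y)) - mtr n (tr x + tr y) \<in> rel_ideal"
        by (rule fa.cong_sym[OF I mat_trace_add]) (use x y in auto)
      ultimately show "x + y \<in> ?S"
        using fa.cong_trans[OF I] x y subspace_add[OF subspace_part]
        by (auto simp: linear_add[OF linear_T] linear_add[OF linear_tr]) }
    have "smul c (T n x) - smul c (mtr n (tr x)) \<in> rel_ideal"
      by (rule fa.cong_scale[OF I]) (use x in auto)
    moreover have "smul c (mtr n (tr x)) - mtr n (dg_scale R c (tr x)) \<in> rel_ideal"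
      by (rule fa.cong_sym[OF I mat_trace_scale]) (use x in auto)
    ultimately show "smul c x \<in> ?S"
      using fa.cong_trans[OF I] x subspace_scale[OF subspace_part]
      by (auto simp: linear_scale[OF linear_T] linear_scale[OF linear_tr])
  qed
  have "x \<in> ?S"
  proof (rule linear_span_into[OF linear_idI[OF vector_space_smul] S _ x[unfolded connes_part_def']])
    fix x :: "('a, 'k) free_alg" assume "x \<in> {mon w |w. length w = n + 1}"
    then obtain w :: "'a list" where w: "x = mon w" "length w = n + 1" by blast
    have "mtr n (\<Sum>j<n + 1. dg_scale R ((-1) ^ (n * j)) (f (rotate j w)))
      - (\<Sum>j<n + 1. smul ((-1) ^ (n * j)) (mtr n (f (rotate j w)))) \<in> rel_ideal"
      by (rule mat_trace_sum) (use f_rotate_part w in auto)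
    then have "mtr n (tr x) - T n x \<in> rel_ideal"
      unfolding w(1) T_mon[OF w(2)] tr_mon w(2) by simp
    then show "x \<in> ?S"
      using CycF_elt(1)[OF mon_connes_part[OF w(2)]] fa.cong_sym[OF I] by (simp add: w)
  qed
  then show ?thesis by simp
qed

lemma rdiff_centralizer:
  assumes u: "u \<in> centralizer scV R (Suc n)"
  shows "rdiff u \<in> centralizer scV R n"
proof -
  have "gen (Ext \<phi>) * rdiff u - rdiff u * gen (Ext \<phi>) \<in> rel_ideal" if "\<phi> \<in> End scV" for \<phi>
  proof -
    have e: "rdiff (gen (Ext \<phi>)) = 0" by (simp add: fp_diff_ext)
    have "rdiff (gen (Ext \<phi>) * u - u * gen (Ext \<phi>)) \<in> rel_ideal"
      by (rule rdiff_rel_ideal) (use u that in \<open>simp add: centralizer_def\<close>)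
    moreover have "hat 0 (gen (Ext \<phi>)) = (gen (Ext \<phi>) :: ('v \<Rightarrow> 'v, 'r, 'k) fp)" by (simp add: gen_def)
    ultimately show ?thesis
      by (simp add: linear_diff[OF linear_lin_smul] fp_diff_mult e)
  qed
  then show ?thesis
    using fp_diff_part[OF _ centralizer_part[OF u], of 0] by (simp add: centralizer_def)
qed

text \<open>Modulo relations \<open>T\<close> is the trace of \<open>tr\<close>, which commutes with the differentials up to commutators, and these
  are killed by the trace.\<close>

theorem T_morphism: "cplx_morphism CC RV T"
  unfolding cplx_morphism_def CC_simps RV_simps
proof (intro allI conjI ballI image_subsetI)
  fix n
  have I: "fa.subspace rel_ideal" and K: "fa.subspace rep_rel" by simp_all
  show "Vector_Spaces.linear smul smul (T n)" by simp
  show "T n x \<in> centralizer scV R n" if "x \<in> connes_part n" for x by (rule T_centralizer[OF that])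
  show "T n x \<in> rep_rel \<inter> centralizer scV R n" if x: "x \<in> connes_rel n" for x
  proof
    have "T n x - mtr n 0 \<in> rel_ideal"
      using T_mat_trace[OF connes_rel_part[OF x]] by (simp add: tr_rel[OF x])
    then show "T n x \<in> rep_rel"
      using mat_trace_zero fa.cong_mem[OF I] rel_ideal_rep_rel by blast
    show "T n x \<in> centralizer scV R n" by (rule T_centralizer[OF connes_rel_part[OF x]])
  qed
  show "T n (hoch x) - rdiff (T (n + 1) x) \<in> rep_rel \<inter> centralizer scV R n" if x: "x \<in> connes_part (n + 1)" for x
  proof
    have x': "x \<in> connes_part (Suc n)" using x by simp
    have b: "hoch x \<in> connes_part n" by (rule hoch_part[OF x'])
    have "rdiff (T (Suc n) x - mtr (Suc n) (tr x)) \<in> rel_ideal"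
      by (rule rdiff_rel_ideal[OF T_mat_trace[OF x']])
    then have 1: "rdiff (T (Suc n) x) - mtr n (dg_diff R (tr x)) \<in> rel_ideal"
      by (simp add: linear_diff[OF linear_lin_smul] rdiff_mat_trace)
    have tb: "tr (hoch x) \<in> dg_part R n" "dg_diff R (tr x) \<in> dg_part R n"
      using CycF_elt(1)[OF b] CycF_elt(1)[OF x'] diff_part by auto
    have "mtr n (dg_diff R (tr x) - tr (hoch x)) \<in> rep_rel"
      by (rule mat_trace_nat_rel[OF tr_hoch[OF x']]) (use tb subspace_diff[OF subspace_part] in auto)
    moreover have "mtr n (dg_diff R (tr x) - tr (hoch x)) - (mtr n (dg_diff R (tr x)) - mtr n (tr (hoch x))) \<in> rep_rel"
      by (rule rel_ideal_rep_rel[OF mat_trace_diff[OF tb(2,1)]])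
    ultimately have 2: "mtr n (dg_diff R (tr x)) - mtr n (tr (hoch x)) \<in> rep_rel"
      using fa.cong_mem[OF K] by blast
    have 3: "T n (hoch x) - mtr n (dg_diff R (tr x)) \<in> rep_rel"
      by (rule fa.cong_trans[OF K rel_ideal_rep_rel[OF T_mat_trace[OF b]] fa.cong_sym[OF K 2]])
    show "T n (hoch x) - rdiff (T (n + 1) x) \<in> rep_rel"
      using fa.cong_trans[OF K 3 fa.cong_sym[OF K rel_ideal_rep_rel[OF 1]]] by simp
    show "T n (hoch x) - rdiff (T (n + 1) x) \<in> centralizer scV R n"
      using T_centralizer[OF b] rdiff_centralizer[OF T_centralizer[OF x']]
      by (simp add: fa.subspace_diff)
  qed
qed

lemma T_boundaries: "x \<in> boundaries CC n \<Longrightarrow> T n x \<in> boundaries RV n"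
  by (rule morphism_boundaries[OF T_morphism]) (auto intro: subspace_RV_rel)

lemma induced_T: "induced RV (T n) n ((+) z ` boundaries CC n) = (+) (T n z) ` boundaries RV n"
  by (rule fa.induced_coset[OF subspace_bd_RV fa.subspace_0[OF subspace_bd_CC]])
    (simp add: linear_add[OF linear_T] T_boundaries)

lemma T_homology: "z \<in> cycles CC n \<Longrightarrow> (+) (T n z) ` boundaries RV n \<in> homology RV n"
  unfolding homology_def
  by (rule imageI, rule morphism_cycles[OF T_morphism]) (auto intro: subspace_RV_rel)


section \<open>Comparison in degree zero\<close>

lemma push_morphism: "cplx_morphism RV AV (\<lambda>_. push)"
  unfolding cplx_morphism_def RV_simps AV_simps
  by (auto intro: push_centralizer push_rep_rel simp: push_rdiff fa.subspace_0)

lemma push_boundaries: "x \<in> boundaries RV n \<Longrightarrow> push x \<in> boundaries AV n"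
  by (rule morphism_boundaries[OF push_morphism]) (auto intro!: fa.subspace_inter)

lemma push_mat: "push (mat i j y) = Arep.mat i j (push y)"
  by (simp add: Arep.mat_def mat_def linear_sum[OF linear_fp_map] fp_map_mult)

lemma induced_push: "induced AV push n ((+) u ` boundaries RV n) = (+) (push u) ` boundaries AV n"
  by (rule fa.induced_coset[OF subspace_bd_AV fa.subspace_0[OF subspace_bd_RV]])
    (simp add: linear_add[OF linear_fp_map] push_boundaries)

text \<open>In degree zero \<open>T\<close> is the trace of \<open>f\<^sub>1(a)\<close>, and \<open>\<pi> f\<^sub>1(a) = a\<close>.\<close>

lemma push_T_0:
  assumes x: "x \<in> connes_part 0"
  shows "push (T 0 x) = lin smul (\<lambda>w. mat_trace scV bs 0 (hd w)) x"
proof -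
  have "push (T 0 x) - lin smul (\<lambda>w. mat_trace scV bs 0 (hd w)) x \<in> {0}"
  proof (rule linear_span_into[OF linear_diffI[OF linear_comp[OF linear_T linear_fp_map] linear_lin_smul] _ _ x[unfolded connes_part_def']])
    fix x :: "('a, 'k) free_alg" assume "x \<in> {mon w |w. length w = 0 + 1}"
    then obtain a where a: "x = mon [a]" by (auto simp: length_Suc_conv)
    have "push (T 0 (mon [a])) = push (mtr 0 (f [a]))" by (subst T_mon) simp_all
    also have "\<dots> = mat_trace scV bs 0 a"
      by (simp add: mat_trace_mat Arep.mat_trace_mat linear_sum[OF linear_fp_map] push_mat pi_f)
    finally show "push (T 0 x) - lin smul (\<lambda>w. mat_trace scV bs 0 (hd w)) x \<in> {0}" by (simp add: a)
  qed simp
  then show ?thesis by simp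
qed

lemma push_inj: "inj_on (induced AV push 0) (homology RV 0)"
proof (rule inj_onI)
  fix X Y assume X: "X \<in> homology RV 0" and Y: "Y \<in> homology RV 0"
    and eq: "induced AV push 0 X = induced AV push 0 Y"
  obtain u where u: "u \<in> centralizer scV R 0" "X = (+) u ` boundaries RV 0"
    using X by (auto simp: homology_def cycles_def)
  obtain v where v: "v \<in> centralizer scV R 0" "Y = (+) v ` boundaries RV 0"
    using Y by (auto simp: homology_def cycles_def)
  have uv: "u - v \<in> centralizer scV R 0" by (rule fa.subspace_diff[OF subspace_centralizer u(1) v(1)])
  have "push u - push v \<in> boundaries AV 0"
    using eq fa.coset_eq_iff[OF subspace_bd_AV] by (simp add: u(2) v(2) induced_push)
  then obtain y where y: "y \<in> centralizer scV A 1" "push (u - v) - Arep.rdiff y \<in> Arep.rep_rel"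
    unfolding mem_boundaries by (auto simp: linear_diff[OF linear_fp_map])
  have "y \<in> Arep.rel_ideal"
    using A_part_Suc[of y 0] Arep.centralizer_part[OF y(1)] by simp
  then have "Arep.rdiff y \<in> Arep.rep_rel" by (intro Arep.rel_ideal_rep_rel Arep.rdiff_rel_ideal)
  then have "push (u - v) \<in> Arep.rep_rel"
    using y(2) fa.cong_mem[OF Arep.subspace_rep_rel] by blast
  then obtain y' where y': "y' \<in> centralizer scV R 1" "u - v - rdiff y' \<in> rep_rel"
    using degree_zero_injective[OF uv] by blast
  have "u - v - rdiff y' \<in> centralizer scV R 0"
    using fa.subspace_diff[OF subspace_centralizer uv rdiff_centralizer] y' by simp
  then have "u - v \<in> boundaries RV 0"
    unfolding mem_boundaries using y' by auto
  then show "X = Y" unfolding u(2) v(2) by (simp add: fa.coset_eq_iff[OF subspace_bd_RV])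
qed

text \<open>Both sides have the same image in \<open>A\<^sub>V\<close>.\<close>

lemma trace_map_0:
  assumes c: "c \<in> HC scA 0"
  shows "induced RV (T 0) 0 c = trace_map R scA \<pi> scV bs 0 c"
proof -
  obtain z where z: "z \<in> cycles CC 0" "c = (+) z ` boundaries CC 0"
    using c by (auto simp: HC_def homology_def)
  have zp: "z \<in> connes_part 0" using z by (simp add: cycles_def)
  let ?t = "lin smul (\<lambda>w. mat_trace scV bs 0 (hd w))"
  have "induced AV ?t 0 c = (+) (?t z) ` boundaries AV 0"
    unfolding z(2)
  proof (rule fa.induced_coset[OF subspace_bd_AV fa.subspace_0[OF subspace_bd_CC]])
    fix b assume b: "b \<in> boundaries CC 0"
    have "?t (z + b) - ?t z = push (T 0 b)"
      using push_T_0[OF boundaries_CC_part[OF b]] by (simp add: linear_add[OF linear_lin_smul])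
    then show "?t (z + b) - ?t z \<in> boundaries AV 0"
      using push_boundaries[OF T_boundaries[OF b]] by simp
  qed
  also have "\<dots> = induced AV push 0 ((+) (T 0 z) ` boundaries RV 0)"
    by (simp add: induced_push push_T_0[OF zp])
  finally have "trace_map R scA \<pi> scV bs 0 c = inv_into (homology RV 0) (induced AV push 0)
      (induced AV push 0 ((+) (T 0 z) ` boundaries RV 0))"
    by (simp add: trace_map_def)
  also have "\<dots> = (+) (T 0 z) ` boundaries RV 0"
    by (rule inv_into_f_f[OF push_inj T_homology[OF z(1)]])
  finally show ?thesis by (simp add: z(2) induced_T)
qed


section \<open>The Feigin--Tsygan map\<close>

abbreviation "apush \<equiv> fp_map \<pi> :: (unit, 'r, 'k) fp \<Rightarrow> (unit, 'a, 'k) fp"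

lemma apush_morphism: "cplx_morphism QR QA (\<lambda>_. apush)"
  unfolding cplx_morphism_def QR_simps QA_simps
proof (intro allI conjI ballI image_subsetI)
  fix n
  have p: "apush x \<in> adj_part A n" if "x \<in> adj_part R n" for x
    using fp_map_part[OF pi_image, of x "{()}" 1 n] that by (simp add: adj_part_def)
  show "Vector_Spaces.linear smul smul apush" by simp
  show "apush x \<in> adj_part A n" if "x \<in> adj_part R n" for x by (rule p[OF that])
  show "apush x \<in> adj_relq A \<inter> adj_part A n" if "x \<in> adj_relq R \<inter> adj_part R n" for x
    using p fp_map_adj_relq[OF pi_hom] that by blast
  show "apush (adj_diff R x) - adj_diff A (apush x) \<in> adj_relq A \<inter> adj_part A n" for x
    using fp_map_adj_diff[of \<pi> R A x] by (simp add: pi_diff' fa.subspace_0)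
qed

lemma apush_boundaries: "x \<in> boundaries QR n \<Longrightarrow> apush x \<in> boundaries QA n"
  by (rule morphism_boundaries[OF apush_morphism]) (auto intro!: fa.subspace_inter)

lemma induced_apush: "induced QA apush n ((+) u ` boundaries QR n) = (+) (apush u) ` boundaries QA n"
  by (rule fa.induced_coset[OF subspace_bd_QA fa.subspace_0[OF subspace_bd_QR]])
    (simp add: linear_add[OF linear_fp_map] apush_boundaries)

lemma apush_inj: "inj_on (induced QA apush (Suc n)) (homology QR (Suc n))"
proof (rule inj_onI)
  obtain h where h: "homotopy_retract R A \<pi> (\<lambda>a. f [a]) h" using contraction_exists by blast
  interpret H: homotopy_retract R A \<pi> "\<lambda>a. f [a]" h by (rule h)
  fix X Y assume X: "X \<in> homology QR (Suc n)" and Y: "Y \<in> homology QR (Suc n)"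
    and eq: "induced QA apush (Suc n) X = induced QA apush (Suc n) Y"
  obtain u where u: "u \<in> adj_part R (Suc n)" "adj_diff R u \<in> adj_relq R" "X = (+) u ` boundaries QR (Suc n)"
    using X by (auto simp: homology_def cycles_def)
  obtain v where v: "v \<in> adj_part R (Suc n)" "adj_diff R v \<in> adj_relq R" "Y = (+) v ` boundaries QR (Suc n)"
    using Y by (auto simp: homology_def cycles_def)
  have uv: "u - v \<in> adj_part R (Suc n)" "adj_diff R (u - v) \<in> adj_relq R"
    using u v by (auto simp: linear_diff[OF linear_adj_diff] intro: fa.subspace_diff)
  have "apush u - apush v \<in> boundaries QA (Suc n)"
    using eq fa.coset_eq_iff[OF subspace_bd_QA] by (simp add: u(3) v(3) induced_apush)
  then obtain y where "y \<in> adj_part A (Suc (Suc n))" "apush (u - v) - adj_diff A y \<in> adj_relq A"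
    unfolding mem_boundaries by (auto simp: linear_diff[OF linear_fp_map])
  then obtain y' where y': "y' \<in> adj_part R (Suc (Suc n))" "u - v - adj_diff R y' \<in> adj_relq R"
    using H.adj_nat_quot_injective[OF uv] by blast
  have "u - v - adj_diff R y' \<in> adj_part R (Suc n)"
    by (intro fa.subspace_diff[OF subspace_adj_part uv(1)] adj_diff_part y')
  then have "u - v \<in> boundaries QR (Suc n)"
    unfolding mem_boundaries using y' by auto
  then show "X = Y" unfolding u(3) v(3) by (simp add: fa.coset_eq_iff[OF subspace_bd_QR])
qed

text \<open>The word \<open>a\<^sub>1x \<dots> a\<^sub>nx\<close>, as a word of blocks of degree zero.\<close>

definition xw :: "'a list \<Rightarrow> (unit, 'a, 'k) fp" where "xw w = ev (map (\<lambda>a. (0, a)) w)"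

lemma x_word_mon: "x_word (mon w) = xw w"
proof -
  have "block_word (map (\<lambda>a. (0, a)) w) = concat (map (\<lambda>a. [Elt 0 a, Ext ()]) w)"
    by (induction w) auto
  then show ?thesis by (simp add: x_word_def xw_def ev_def)
qed

lemma linear_x_word [intro, simp]: "Vector_Spaces.linear smul smul x_word"
  by (simp add: x_word_def)

lemma xw_append: "xw (u @ v) = xw u * xw v"
  by (simp add: xw_def ev_append)

lemma xw_part: "xw w \<in> adj_part A (length w)"
proof -
  have "adm_blocks A (map (\<lambda>a. (0, a)) w)" by (auto simp: adm_blocks_def part_A)
  from ev_part[OF this] show ?thesis by (simp add: xw_def blocks_deg_def o_def sum_list_triv)
qed

lemma x_word_part:
  assumes x: "x \<in> connes_part n"
  shows "x_word x \<in> adj_part A (Suc n)"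
proof (rule linear_span_into[OF linear_x_word subspace_adj_part _ x[unfolded connes_part_def']])
  fix x :: "('a, 'k) free_alg" assume "x \<in> {mon w |w. length w = n + 1}"
  then obtain w :: "'a list" where w: "x = mon w" "length w = Suc n" by auto
  show "x_word x \<in> adj_part A (Suc n)" using xw_part[of w] by (simp only: w x_word_mon)
qed

text \<open>The image of \<open>g\<close> under \<open>\<pi>\<close>: on longer words \<open>f\<close> has positive degree.\<close>

definition e1 :: "'a list \<Rightarrow> (unit, 'a, 'k) fp" where "e1 w = (if length w = 1 then xw w else 0)"

text \<open>A product of \<open>p + 1\<close> factors, each of which takes one letter.\<close>

lemma cpow_e1: "w \<noteq> [] \<Longrightarrow> cpow e1 p w = (if length w = Suc p then xw w else 0)"
proof (induction p arbitrary: w)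
  case 0 then show ?case by (simp add: e1_def)
next
  case (Suc p)
  have "cpow e1 (Suc p) w = (\<Sum>i=1..<length w. if i = Suc p \<and> length w = Suc (Suc p) then xw w else 0)"
    unfolding cpow.simps conv_def
  proof (rule sum.cong[OF refl])
    fix i assume i: "i \<in> {1..<length w}"
    then have ne: "take i w \<noteq> []" by auto
    have a: "cpow e1 p (take i w) = (if length (take i w) = Suc p then xw (take i w) else 0)"
      by (rule Suc.IH[OF ne])
    have b: "xw (take i w) * xw (drop i w) = xw w" by (simp only: xw_append[symmetric] append_take_drop_id)
    have c: "(i = Suc p \<and> length w = Suc (Suc p)) = (length (take i w) = Suc p \<and> length (drop i w) = 1)"
      using i by auto
    show "cpow e1 p (take i w) * e1 (drop i w) = (if i = Suc p \<and> length w = Suc (Suc p) then xw w else 0)"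
      unfolding a c e1_def
      by (cases "length (take i w) = Suc p"; cases "length (drop i w) = 1") (simp_all only: b if_True if_False simp_thms mult_zero_left mult_zero_right)
  qed
  also have "\<dots> = (if length w = Suc (Suc p) then xw w else 0)"
    by (cases "length w = Suc (Suc p)") (simp_all add: sum.delta)
  finally show ?case .
qed

lemma apush_cpow: "apush (cpow g p w) = cpow (\<lambda>w. apush (g w)) p w"
proof (induction p arbitrary: w)
  case (Suc p)
  then show ?case by (simp add: conv_def linear_sum[OF linear_fp_map] fp_map_mult)
qed simp

lemma apush_g:
  assumes w: "w \<noteq> []"
  shows "apush (g w) - e1 w \<in> adj_ideal A"
proof (cases "length w = 1")
  case True
  then obtain a where "w = [a]" by (cases w) auto
  then show ?thesis
    by (simp add: g_def f'_def e1_def xw_def ev_Cons fp_map_mult pi_f fa.subspace_0)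
next
  case False
  then obtain n where n: "length w - 1 = Suc n" using w by (cases w; cases "tl w") auto
  have "\<pi> (f w) = 0" using pi_Suc[of "f w" n] f_part[OF w] n by simp
  moreover have "elt (Suc n) 0 * unit_letter \<in> adj_ideal A"
    by (rule A.adj_ideal_right[OF _ adj_part_adm[OF unit_letter_part]])
      (unfold adj_ideal_def, rule A.elt_zero, simp)
  ultimately show ?thesis using False n by (simp add: g_def f'_def e1_def fp_map_mult)
qed

lemma cpow_e1_adm: "w \<noteq> [] \<Longrightarrow> cpow e1 p w \<in> adm {()} A"
  using adj_part_adm[OF xw_part] by (simp add: cpow_e1 fa.subspace_0)

lemma cpow_apush_g:
  "w \<noteq> [] \<Longrightarrow> cpow (\<lambda>w. apush (g w)) p w - cpow e1 p w \<in> adj_ideal A"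
proof (induction p arbitrary: w)
  case 0 then show ?case by (simp add: apush_g)
next
  case (Suc p)
  show ?case unfolding cpow.simps
  proof (rule conv_cong_mod[OF subspace_adj_ideal])
    fix u v :: "'a list" assume uv: "u \<noteq> []" "v \<noteq> []"
    have "apush (g v) \<in> adm {()} A"
      by (rule fp_map_adm[OF pi_image adj_part_adm[OF g_part[OF uv(2)]]])
    then show "cpow (\<lambda>w. apush (g w)) p u * apush (g v) - cpow e1 p u * e1 v \<in> adj_ideal A"
      unfolding adj_ideal_def
      by (intro fp_ideal_cong_mult Suc.IH[unfolded adj_ideal_def] apush_g[unfolded adj_ideal_def] uv cpow_e1_adm)
  qed
qed

text \<open>The word \<open>a\<^sub>1x \<dots> a\<^sub>n\<^sub>+\<^sub>1x\<close> is a product of \<open>n + 1\<close> factors of degree one, so that commuting them produces the signs of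
  the cyclic sum, and all summands agree.\<close>

lemma cyc_xw:
  assumes w: "length w = Suc n"
  shows "cyc (cpow e1 p) w - (if p = n then smul (of_nat (Suc n)) (xw w) else 0) \<in> adj_rel A"
proof (cases "p = n")
  case False
  have "cyc (cpow e1 p) w = 0"
    unfolding cyc_def by (rule sum.neutral, rule ballI, subst cpow_e1) (use w False in auto)
  then show ?thesis using False by (simp add: fa.subspace_0)
next
  case True
  have K: "fa.subspace (adj_rel A)" by simp
  have eq: "cyc (cpow e1 p) w = (\<Sum>j<Suc n. smul ((-1) ^ (n * j)) (xw (rotate j w)))"
    unfolding cyc_def w by (rule sum.cong[OF refl], subst cpow_e1) (use w True in auto)
  have "cyc (cpow e1 p) w - (\<Sum>j<Suc n. xw w) \<in> adj_rel A"
    unfolding eq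
  proof (rule fa.cong_sum[OF K])
    fix j assume j: "j \<in> {..<Suc n}"
    have r: "rotate j w = drop j w @ take j w" using j w by (simp add: rotate_drop_take)
    have l: "length (take j w) = j" "length (drop j w) = Suc n - j" using j w by auto
    obtain k where k: "Suc n = j + Suc k" using j less_imp_Suc_add[of j "Suc n"] by auto
    have "xw (take j w) * xw (drop j w) - smul ((-1) ^ (j * (Suc n - j))) (xw (drop j w) * xw (take j w)) \<in> adj_rel A"
      using adj_comm[OF xw_part xw_part, of "take j w" "drop j w"] by (simp only: l)
    moreover have "(-1 :: 'k) ^ (j * (Suc n - j)) = (-1) ^ (n * j)"
      by (rule neg_one_power_cong) (use k in auto)
    ultimately have "xw w - smul ((-1) ^ (n * j)) (xw (rotate j w)) \<in> adj_rel A"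
      by (simp only: r xw_append[symmetric] append_take_drop_id)
    then show "smul ((-1) ^ (n * j)) (xw (rotate j w)) - xw w \<in> adj_rel A"
      by (rule fa.cong_sym[OF K])
  qed
  moreover have "(\<Sum>j<Suc n. xw w) = smul (of_nat (Suc n)) (xw w)"
    by (simp only: fa.sum_constant_scale card_lessThan)
  ultimately show ?thesis using True by simp
qed

text \<open>Only the highest power survives, and its coefficient cancels the number of rotations: on the
  image of \<open>\<pi>\<close> the logarithm is the identification of Connes' complex with the cyclic words.\<close>

lemma apush_LogC:
  assumes x: "x \<in> connes_part n"
  shows "apush (LogC x) - x_word x \<in> adj_rel A"
proof (rule linear_span_into[OF linear_diffI[OF linear_comp[OF linear_lin_smul linear_fp_map] linear_x_word]
      subspace_adj_rel _ x[unfolded connes_part_def']])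
  have K: "fa.subspace (adj_rel A)" by simp
  fix x :: "('a, 'k) free_alg" assume "x \<in> {mon w |w. length w = n + 1}"
  then obtain w :: "'a list" where w: "x = mon w" "length w = Suc n" by auto
  let ?c = "\<lambda>p. inverse (of_nat (Suc p) :: 'k)"
  have "apush (log_cyc w) = (\<Sum>p<Suc n. smul (?c p) (cyc (cpow (\<lambda>w. apush (g w)) p) w))"
    by (simp only: log_cyc_def w linear_sum[OF linear_fp_map] linear_scale[OF linear_fp_map]
        cyc_linear[OF linear_fp_map] apush_cpow)
  moreover have "(\<Sum>p<Suc n. smul (?c p) (cyc (cpow (\<lambda>w. apush (g w)) p) w))
      - (\<Sum>p<Suc n. smul (?c p) (if p = n then smul (of_nat (Suc n)) (xw w) else 0)) \<in> adj_rel A"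
  proof (rule fa.cong_sum[OF K], rule fa.cong_scale[OF K], rule fa.cong_trans[OF K])
    fix p
    show "cyc (cpow (\<lambda>w. apush (g w)) p) w - cyc (cpow e1 p) w \<in> adj_rel A"
      by (rule cyc_cong_mod[OF K adj_ideal_rel[OF cpow_apush_g]])
    show "cyc (cpow e1 p) w - (if p = n then smul (of_nat (Suc n)) (xw w) else 0) \<in> adj_rel A"
      by (rule cyc_xw[OF w(2)])
  qed
  moreover have "(\<Sum>p<Suc n. smul (?c p) (if p = n then smul (of_nat (Suc n)) (xw w) else 0)) = xw w"
  proof -
    have "smul (?c p) (if p = n then smul (of_nat (Suc n)) (xw w) else 0) = (if p = n then xw w else 0)" for p
      by (simp del: of_nat_Suc)
    then show ?thesis by (simp del: of_nat_Suc)
  qed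
  ultimately show "apush (LogC x) - x_word x \<in> adj_rel A" by (simp add: w(1) x_word_mon)
qed

lemma CycF_relq: "x \<in> connes_part n \<Longrightarrow> CycF x \<in> adj_relq R"
  using adj_ideal_relq[OF CycF_elt(2)] elt_adj_relq[OF CycF_elt(1)] fa.cong_mem[OF subspace_adj_relq] by blast

text \<open>The cyclic sum of \<open>f\<close> consists of elements of \<open>R\<close>, so that modulo \<open>R\<close> the logarithm is a morphism of
  complexes up to sign.\<close>

lemma LogC_boundaries:
  assumes "b \<in> boundaries CC n"
  shows "LogC b \<in> boundaries QR (Suc n)"
proof -
  have K: "fa.subspace (adj_relq R)" by simp
  obtain y where y: "y \<in> connes_part (Suc n)" "b - hoch y \<in> connes_rel n"
    using assms unfolding mem_boundaries CC_simps by auto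
  have 1: "LogC b - LogC (hoch y) \<in> adj_relq R"
    unfolding linear_diff[OF linear_lin_smul, symmetric] by (rule adj_ideal_relq[OF LogC_rel[OF y(2)]])
  have "smul ((-1) ^ Suc n) (CycF y) \<in> adj_relq R"
    by (rule fa.subspace_scale[OF K CycF_relq[OF y(1)]])
  then have "(adj_diff R (LogC y) - (LogC (hoch y) + smul ((-1) ^ Suc n) (CycF y))) + smul ((-1) ^ Suc n) (CycF y) \<in> adj_relq R"
    by (intro fa.subspace_add[OF K] adj_rel_relq[OF adj_diff_LogC[OF y(1)]])
  then have 2: "adj_diff R (LogC y) - LogC (hoch y) \<in> adj_relq R" by (simp del: power_Suc)
  have "LogC b - adj_diff R (LogC y) \<in> adj_relq R"
    by (rule fa.cong_trans[OF K 1 fa.cong_sym[OF K 2]])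
  moreover have "LogC y \<in> adj_part R (Suc (Suc n))" by (rule LogC_part[OF y(1)])
  moreover have "LogC b - adj_diff R (LogC y) \<in> adj_part R (Suc n)"
    by (intro fa.subspace_diff[OF subspace_adj_part] LogC_part boundaries_CC_part[OF assms] adj_diff_part y)
  ultimately show ?thesis unfolding mem_boundaries by auto
qed

lemma adj_rel_boundaries_QA: "x \<in> adj_rel A \<Longrightarrow> x \<in> adj_part A n \<Longrightarrow> x \<in> boundaries QA n"
  unfolding mem_boundaries
  by (rule bexI[of _ 0]) (auto simp: linear_0[OF linear_adj_diff] adj_rel_relq fa.subspace_0)

lemma apush_LogC_boundaries:
  assumes x: "x \<in> connes_part n"
  shows "apush (LogC x) - x_word x \<in> boundaries QA (Suc n)"
proof (rule adj_rel_boundaries_QA[OF apush_LogC[OF x]])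
  have "apush (LogC x) \<in> adj_part A (Suc n)"
    using fp_map_part[OF pi_image, of "LogC x" "{()}" 1 "Suc n"] LogC_part[OF x] by (simp add: adj_part_def)
  then show "apush (LogC x) - x_word x \<in> adj_part A (Suc n)"
    by (rule fa.subspace_diff[OF subspace_adj_part _ x_word_part[OF x]])
qed

lemma x_word_boundaries:
  assumes b: "b \<in> boundaries CC n"
  shows "x_word b \<in> boundaries QA (Suc n)"
  using apush_LogC_boundaries[OF boundaries_CC_part[OF b]] apush_boundaries[OF LogC_boundaries[OF b]]
    fa.cong_mem[OF subspace_bd_QA] by blast

text \<open>The relations added in \<open>R\<langle>x\<rangle>\<^sub>\<natural>/R\<^sub>\<natural>\<close> are elements of \<open>R\<close>, whose differentials are boundaries in \<open>R\<close>. This is why the connecting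
  homomorphism does not depend on the lift.\<close>

lemma retract_adj_diff_relq:
  assumes u: "u \<in> adj_relq R"
  shows "\<exists>x\<in>nat_rel. \<exists>r. retract R (adj_diff R u) = x + dg_diff R r"
proof -
  let ?W = "{x + y |x y. x \<in> nat_rel \<and> y \<in> range (dg_diff R)}"
  have rng: "subspace (range (dg_diff R))"
  proof (rule subspaceI)
    show "0 \<in> range (dg_diff R)" using linear_0[OF linear_diff_R] by (metis rangeI)
    show "x + y \<in> range (dg_diff R)" if "x \<in> range (dg_diff R)" "y \<in> range (dg_diff R)" for x y
      using that by (auto simp: linear_add[OF linear_diff_R, symmetric])
    show "dg_scale R c x \<in> range (dg_diff R)" if "x \<in> range (dg_diff R)" for c x
      using that by (auto simp: linear_scale[OF linear_diff_R, symmetric])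
  qed
  have W: "subspace ?W" by (rule subspace_sums[OF subspace_nat_rel rng])
  have "retract R (adj_diff R u) \<in> ?W"
  proof (rule linear_span_into[OF linear_comp[OF linear_adj_diff linear_retract] W _ u[unfolded adj_relq_def]])
    fix x :: "(unit, 'r, 'k) fp"
    assume "x \<in> adj_nat_relations R \<union> {gen (Elt m r) |m r. r \<in> dg_part R m}"
    then consider "x \<in> adj_nat_relations R" | m r where "x = elt m r" "r \<in> dg_part R m"
      by (auto simp: elt_def)
    then show "retract R (adj_diff R x) \<in> ?W"
    proof cases
      case 1
      then have "x \<in> adj_rel R" unfolding adj_rel_def by (rule fa.span_base)
      then have "retract R (adj_diff R x) \<in> nat_rel" by (intro retract_adj_rel adj_diff_rel)
      moreover have "retract R (adj_diff R x) = retract R (adj_diff R x) + dg_diff R 0"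
        by (simp add: linear_0[OF linear_diff_R])
      ultimately show ?thesis by blast
    next
      case 2
      have "retract R (adj_diff R x) = 0 + dg_diff R r"
        using 2 by (cases m) (simp_all add: adj_diff_fp_diff fp_diff_elt_0 fp_diff_elt_Suc diff_part0
            linear_0[OF linear_retract])
      then show ?thesis using subspace_0[OF subspace_nat_rel] by blast
    qed
  qed
  then show ?thesis by blast
qed

lemma nat_rel_unit: "x \<in> nat_rel \<Longrightarrow> x \<in> span (insert 1 (graded_commutators (dg_scale R) (dg_part R)))"
  unfolding nat_rel_def by (rule subsetD[OF span_mono]) auto

lemma nat_rel_boundaries:
  assumes "r \<in> dg_part R n" "r = x + dg_diff R y" "x \<in> nat_rel"
  shows "r \<in> boundaries Rk n"
proof -
  have "r = components r n" using components_homogeneous[OF assms(1), of n] by simp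
  also have "\<dots> = components x n + dg_diff R (components y (Suc n))"
    unfolding assms(2) by (simp add: linear_add[OF linear_components] components_diff)
  finally have "r - dg_diff R (components y (Suc n)) = components x n" by simp
  moreover have "components x n \<in> nat_rel"
    by (rule nat_rel_deg_nat_rel[OF components_nat_rel_deg[OF assms(3)]])
  ultimately show ?thesis
    unfolding mem_boundaries
    by (intro bexI[of _ "components y (Suc n)"]) (simp_all add: nat_rel_unit)
qed

text \<open>The logarithm of \<open>z\<close> is a lift of the class of \<open>z\<close> in \<open>A\<langle>x\<rangle>\<^sub>\<natural>/A\<^sub>\<natural>\<close> with differential the cyclic sum of \<open>f\<close>. It remains
  that every other choice in the connecting homomorphism changes the result by a boundary, which
  \<open>retract\<close> shows.\<close>

lemma cyclic_to_nat_eq: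
  assumes n: "n \<ge> 1" and z: "z \<in> cycles CC n"
  shows "cyclic_to_nat R scA \<pi> n ((+) z ` boundaries CC n) = (+) (tr z) ` boundaries Rk n"
proof -
  let ?s = "(-1 :: 'k) ^ n"
  let ?c = "(+) z ` boundaries CC n"
  have zp: "z \<in> connes_part n" and zr: "hoch z \<in> connes_rel (n - 1)"
    using z n by (auto simp: cycles_def CC_simps)
  have K: "fa.subspace (adj_rel R)" by simp
  \<comment> \<open>The sign that normalises the identification with cyclic words also turns \<open>\<plusminus> tr z\<close> into \<open>tr z\<close>.\<close>
  define Z where "Z = smul ?s (LogC z)"
  have Zp: "Z \<in> adj_part R (Suc n)"
    unfolding Z_def by (rule fa.subspace_scale[OF subspace_adj_part LogC_part[OF zp]])
  have DZ: "adj_diff R Z - elt n (tr z) \<in> adj_rel R"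
  proof -
    have "(adj_diff R (LogC z) - (LogC (hoch z) + smul ?s (CycF z))) + LogC (hoch z) \<in> adj_rel R"
      by (intro fa.subspace_add[OF K] adj_diff_LogC[OF zp] adj_ideal_rel LogC_rel[OF zr])
    then have "adj_diff R (LogC z) - smul ?s (CycF z) \<in> adj_rel R" by simp
    from fa.cong_scale[OF K this, of ?s] have "adj_diff R Z - CycF z \<in> adj_rel R"
      by (simp add: Z_def linear_scale[OF linear_adj_diff])
    from fa.cong_trans[OF K this adj_ideal_rel[OF CycF_elt(2)[OF zp]]] show ?thesis .
  qed
  have trp: "tr z \<in> dg_part R n" by (rule CycF_elt(1)[OF zp])
  define cA where "cA = induced QA (\<lambda>z. smul ?s (x_word z)) (n + 1) ?c"
  define CR where "CR = (+) Z ` boundaries QR (Suc n)"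
  have "adj_diff R Z \<in> adj_relq R"
    using adj_rel_relq[OF DZ] elt_adj_relq[OF trp] fa.cong_mem[OF subspace_adj_relq] by blast
  then have CR: "CR \<in> homology QR (Suc n)"
    unfolding CR_def homology_def using Zp adj_diff_part[OF Zp] by (intro imageI) (simp add: cycles_def)
  have "cA = (+) (smul ?s (x_word z)) ` boundaries QA (Suc n)"
    unfolding cA_def Suc_eq_plus1[symmetric]
  proof (rule fa.induced_coset[OF subspace_bd_QA fa.subspace_0[OF subspace_bd_CC]])
    fix b assume b: "b \<in> boundaries CC n"
    show "smul ?s (x_word (z + b)) - smul ?s (x_word z) \<in> boundaries QA (Suc n)"
      using fa.subspace_scale[OF subspace_bd_QA x_word_boundaries[OF b], of ?s]
      by (simp add: linear_add[OF linear_x_word] fa.scale_right_distrib)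
  qed
  also have "\<dots> = (+) (apush Z) ` boundaries QA (Suc n)"
    unfolding fa.coset_eq_iff[OF subspace_bd_QA] Z_def linear_scale[OF linear_fp_map]
    by (rule fa.cong_scale[OF subspace_bd_QA fa.cong_sym[OF subspace_bd_QA apush_LogC_boundaries[OF zp]]])
  also have "\<dots> = induced QA apush (Suc n) CR"
    by (simp only: CR_def induced_apush)
  finally have cA: "cA = induced QA apush (Suc n) CR" .
  have cR: "inv_into (homology QR (n + 1)) (induced QA apush (n + 1)) cA = CR"
    unfolding Suc_eq_plus1[symmetric] cA by (rule inv_into_f_f[OF apush_inj CR])
  have conn1: "tr z \<in> connecting R n CR"
  proof -
    have "Z + 0 \<in> CR" unfolding CR_def by (rule imageI[OF fa.subspace_0[OF subspace_bd_QR]])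
    moreover have "adj_diff R Z - elt n (tr z) \<in> adj_part R n"
      by (intro fa.subspace_diff[OF subspace_adj_part] adj_diff_part Zp elt_adj_part trp)
    ultimately show ?thesis
      using DZ trp unfolding connecting_def adj_nat_cplx_def
      by (auto simp: adj_rel_def elt_def intro!: bexI[of _ Z])
  qed
  have conn2: "r - tr z \<in> boundaries Rk n" if r: "r \<in> connecting R n CR" for r
  proof -
    obtain w where w: "w \<in> CR" "adj_diff R w - elt n r \<in> adj_rel R" and rp: "r \<in> dg_part R n"
      using r unfolding connecting_def adj_nat_cplx_def by (auto simp: adj_rel_def elt_def)
    obtain b where b: "b \<in> boundaries QR (Suc n)" "w = Z + b" using w(1) by (auto simp: CR_def)
    obtain y where y: "y \<in> adj_part R (Suc (Suc n))" "b - adj_diff R y \<in> adj_relq R"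
      using b(1) unfolding mem_boundaries by auto
    obtain x r' where x: "x \<in> nat_rel" "retract R (adj_diff R (b - adj_diff R y)) = x + dg_diff R r'"
      using retract_adj_diff_relq[OF y(2)] by blast
    have "retract R (adj_diff R (adj_diff R y)) = 0"
      by (rule retract_ideal[OF adj_diff_diff[OF adj_part_adm[OF y(1)], unfolded adj_ideal_def]])
    then have a3: "retract R (adj_diff R b) = x + dg_diff R r'"
      using x(2) by (simp add: linear_diff[OF linear_adj_diff] linear_diff[OF linear_retract])
    have a1: "retract R (adj_diff R Z) - tr z \<in> nat_rel"
      using retract_adj_rel[OF DZ] by (simp add: linear_diff[OF linear_retract])
    have "retract R (adj_diff R Z) + retract R (adj_diff R b) - r \<in> nat_rel"
      using retract_adj_rel[OF w(2)]
      by (simp add: b(2) linear_diff[OF linear_retract] linear_add[OF linear_retract] linear_add[OF linear_adj_diff])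
    then have a2: "retract R (adj_diff R Z) + (x + dg_diff R r') - r \<in> nat_rel" by (simp only: a3)
    have "(retract R (adj_diff R Z) - tr z) - (retract R (adj_diff R Z) + (x + dg_diff R r') - r) + x \<in> nat_rel"
      by (rule subspace_add[OF subspace_nat_rel subspace_diff[OF subspace_nat_rel a1 a2] x(1)])
    moreover have "r - tr z = ((retract R (adj_diff R Z) - tr z) - (retract R (adj_diff R Z) + (x + dg_diff R r') - r) + x) + dg_diff R r'"
      by simp
    ultimately show ?thesis
      using nat_rel_boundaries[OF subspace_diff[OF subspace_part rp trp]] by blast
  qed
  have "induced Rk id n (connecting R n CR) = (+) (tr z) ` boundaries Rk n"
  proof
    show "induced Rk id n (connecting R n CR) \<subseteq> (+) (tr z) ` boundaries Rk n"
    proof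
      fix y assume "y \<in> induced Rk id n (connecting R n CR)"
      then obtain r b where rb: "r \<in> connecting R n CR" "b \<in> boundaries Rk n" "y = r + b"
        by (auto simp: induced_def)
      have "(r - tr z) + b \<in> boundaries Rk n"
        by (rule subspace_add[OF subspace_bd_Rk conn2[OF rb(1)] rb(2)])
      moreover have "y = tr z + ((r - tr z) + b)" using rb by simp
      ultimately show "y \<in> (+) (tr z) ` boundaries Rk n" by blast
    qed
    show "(+) (tr z) ` boundaries Rk n \<subseteq> induced Rk id n (connecting R n CR)"
      using conn1 by (auto simp: induced_def)
  qed
  then show ?thesis
    unfolding cyclic_to_nat_def Let_def cA_def[symmetric] cR .
qed

abbreviation "CCk \<equiv> reduced_connes_cplx scA"

text \<open>As \<open>f\<close> vanishes on longer words containing \<open>1\<close>, the cyclic sum kills the words \<open>1 \<dots> 1\<close> of positive degree.\<close>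

lemma tr_reduced_boundaries:
  assumes n: "n \<ge> 1" and x: "x \<in> boundaries CCk n"
  shows "tr x \<in> boundaries Rk n"
proof -
  obtain y where y: "y \<in> connes_part (Suc n)"
    and u: "x - hoch y \<in> fa.span (multilinearity scA (n + 1) \<union> cyclic_relations n \<union> {mon (replicate (n + 1) 1)})"
    using x unfolding mem_boundaries reduced_connes_cplx_def by (auto simp: connes_cplx_def)
  have "tr (x - hoch y) \<in> {0}"
  proof (rule linear_span_into[OF linear_tr _ _ u])
    fix v assume "v \<in> multilinearity scA (n + 1) \<union> cyclic_relations n \<union> {mon (replicate (n + 1) 1)}"
    then consider "v \<in> multilinearity scA (n + 1) \<union> cyclic_relations n" | "v = mon (replicate (n + 1) 1)" by blast
    then show "tr v \<in> {0}"
    proof cases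
      case 1
      then have "v \<in> connes_rel n" unfolding connes_rel_def' by (rule fa.span_base)
      then show ?thesis using tr_rel by simp
    next
      case 2
      have "f (rotate j (replicate (n + 1) 1)) = 0" for j
        by (rule f_normal) (use n in auto)
      then show ?thesis unfolding 2 tr_mon by simp
    qed
  qed simp
  then have e: "tr x = tr (hoch y)" by (simp add: linear_diff[OF linear_tr])
  have b: "tr (hoch y) \<in> dg_part R n" by (rule CycF_elt(1)[OF hoch_part[OF y]])
  have "tr (hoch y) = (tr (hoch y) - dg_diff R (tr y)) + dg_diff R (tr y)" by simp
  moreover have "tr (hoch y) - dg_diff R (tr y) \<in> nat_rel"
    by (rule cong_sym[OF subspace_nat_rel tr_hoch[OF y]])
  ultimately show ?thesis unfolding e using nat_rel_boundaries[OF b] by blast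
qed

lemma subspace_bd_CCk: "fa.subspace (boundaries CCk n)"
  by (rule subspace_boundaries) (auto simp: reduced_connes_cplx_def connes_cplx_def)

lemma to_reduced_HC_coset: "to_reduced_HC scA n ((+) z ` boundaries CC n) = (+) z ` boundaries CCk n"
  unfolding to_reduced_HC_def
proof (subst fa.induced_coset[OF subspace_bd_CCk fa.subspace_0[OF subspace_bd_CC]])
  fix b assume "b \<in> boundaries CC n"
  then obtain y where y: "y \<in> connes_part (n + 1)" "b - hoch y \<in> connes_rel n"
    unfolding mem_boundaries CC_simps by blast
  have "b - hoch y \<in> fa.span (multilinearity scA (n + 1) \<union> cyclic_relations n \<union> {mon (replicate (n + 1) 1)})"
    by (rule subsetD[OF fa.span_mono y(2)[unfolded connes_rel_def']]) auto
  then show "id (z + b) - id z \<in> boundaries CCk n"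
    unfolding mem_boundaries using y(1)
    by (auto simp: reduced_connes_cplx_def connes_cplx_def intro!: bexI[of _ y])
qed simp

text \<open>All classes with the same image in reduced cyclic homology as \<open>z\<close> have the same value, so the union
  over them is that value.\<close>

lemma feigin_tsygan_eq:
  assumes n: "n \<ge> 1" and z: "z \<in> cycles CC n"
  shows "feigin_tsygan R scA \<pi> n (to_reduced_HC scA n ((+) z ` boundaries CC n)) = (+) (tr z) ` boundaries Rk n"
proof -
  let ?c = "(+) z ` boundaries CC n"
  let ?C = "{c \<in> HC scA n. to_reduced_HC scA n c = to_reduced_HC scA n ?c}"
  have "cyclic_to_nat R scA \<pi> n c = (+) (tr z) ` boundaries Rk n" if c: "c \<in> ?C" for c
  proof -
    obtain z2 where z2: "z2 \<in> cycles CC n" "c = (+) z2 ` boundaries CC n"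
      using c by (auto simp: HC_def homology_def)
    have "z2 - z \<in> boundaries CCk n"
    proof -
      have "to_reduced_HC scA n c = to_reduced_HC scA n ?c" using c by simp
      then show ?thesis
        unfolding z2(2) to_reduced_HC_coset fa.coset_eq_iff[OF subspace_bd_CCk] .
    qed
    then have "tr z2 - tr z \<in> boundaries Rk n"
      using tr_reduced_boundaries[OF n] by (simp add: linear_diff[OF linear_tr, symmetric])
    then show ?thesis
      unfolding z2(2) cyclic_to_nat_eq[OF n z2(1)] by (simp add: coset_eq_iff[OF subspace_bd_Rk])
  qed
  moreover have "?c \<in> ?C" using z by (auto simp: HC_def homology_def)
  ultimately show ?thesis unfolding feigin_tsygan_def by blast
qed


section \<open>The trace map in positive degrees\<close>

lemma RV_boundaries_RVk: "x \<in> boundaries RV n \<Longrightarrow> x \<in> boundaries RVk n"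
proof -
  assume "x \<in> boundaries RV n"
  then obtain y where y: "y \<in> centralizer scV R (n + 1)" "x - rdiff y \<in> rep_rel \<inter> centralizer scV R n"
    unfolding mem_boundaries by auto
  have "x - rdiff y \<in> fa.span (insert 1 (rep_relations scV R))"
    by (rule subsetD[OF fa.span_mono, of "rep_relations scV R"]) (use y in \<open>auto simp: rep_rel_def\<close>)
  then show ?thesis unfolding mem_boundaries using y by auto
qed

lemma induced_RVk_id: "induced RVk id n ((+) u ` boundaries RV n) = (+) u ` boundaries RVk n"
  by (subst fa.induced_coset[OF subspace_bd_RVk fa.subspace_0[OF subspace_bd_RV]])
    (simp_all add: RV_boundaries_RVk)

text \<open>A multiple of \<open>1\<close> has degree zero and cannot help to make an element of positive degree a boundary.\<close>

lemma RVk_inj: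
  assumes n: "n \<ge> 1"
  shows "inj_on (induced RVk id n) (homology RV n)"
proof (rule inj_onI)
  fix X Y assume X: "X \<in> homology RV n" and Y: "Y \<in> homology RV n"
    and eq: "induced RVk id n X = induced RVk id n Y"
  obtain u v where u: "X = (+) u ` boundaries RV n" and v: "Y = (+) v ` boundaries RV n"
    using X Y by (auto simp: homology_def)
  have "u - v \<in> boundaries RVk n"
    using eq unfolding u v induced_RVk_id by (simp add: fa.coset_eq_iff[OF subspace_bd_RVk])
  then obtain y where y: "y \<in> centralizer scV R (n + 1)"
    "u - v - rdiff y \<in> fa.span (insert 1 (rep_relations scV R))" "u - v - rdiff y \<in> centralizer scV R n"
    unfolding mem_boundaries by auto
  have "fp_proj 0 n (u - v - rdiff y) = u - v - rdiff y"
    using fp_proj_part[OF centralizer_part[OF y(3)], of n] by simp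
  then have "u - v - rdiff y \<in> rep_rel" using fp_proj_rep_rel[OF y(2) n] by simp
  then have "u - v \<in> boundaries RV n" unfolding mem_boundaries using y by auto
  then show "X = Y" unfolding u v by (simp add: fa.coset_eq_iff[OF subspace_bd_RV])
qed

lemma rep_rel_unit: "x \<in> rep_rel \<Longrightarrow> x \<in> fa.span (insert 1 (rep_relations scV R))"
  unfolding rep_rel_def by (rule subsetD[OF fa.span_mono]) auto

lemma rep_rel_boundaries:
  "x \<in> rep_rel \<Longrightarrow> x \<in> centralizer scV R n \<Longrightarrow> x \<in> boundaries RVk n"
  unfolding mem_boundaries
  by (rule bexI[of _ 0]) (auto simp: linear_0[OF linear_lin_smul] rep_rel_unit fa.subspace_0)

lemma boundaries_Rk_part: "x \<in> boundaries Rk n \<Longrightarrow> x \<in> dg_part R n"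
  unfolding mem_boundaries
proof (elim bexE)
  fix y assume y: "y \<in> cx_part Rk (n + 1)" "x - cx_diff Rk y \<in> cx_rel Rk n"
  then have "(x - dg_diff R y) + dg_diff R y \<in> dg_part R n"
    by (intro subspace_add[OF subspace_part]) (auto simp: diff_part)
  then show "x \<in> dg_part R n" by simp
qed

lemma mat_trace_boundaries:
  assumes n: "n \<ge> 1" and b: "b \<in> boundaries Rk n"
  shows "mtr n b \<in> boundaries RVk n"
proof -
  have I: "fa.subspace rel_ideal" by simp
  have B: "fa.subspace (boundaries RVk n)" by (rule subspace_bd_RVk)
  obtain y where y: "y \<in> dg_part R (Suc n)" "b - dg_diff R y \<in> dg_part R n"
    "b - dg_diff R y \<in> span (insert 1 (graded_commutators (dg_scale R) (dg_part R)))"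
    using b unfolding mem_boundaries by auto
  let ?u = "b - dg_diff R y"
  have dy: "dg_diff R y \<in> dg_part R n" by (rule diff_part[OF y(1)])
  have "mtr n ?u \<in> boundaries RVk n"
    by (rule rep_rel_boundaries[OF mat_trace_nat_rel_unit[OF y(3) n y(2)] mat_trace_centralizer[OF y(2)]])
  moreover have "mtr n (dg_diff R y) \<in> boundaries RVk n"
    unfolding mem_boundaries
    by (rule bexI[of _ "mtr (Suc n) y"])
      (auto simp: rdiff_mat_trace mat_trace_centralizer[OF y(1)] fa.span_zero fa.subspace_0)
  moreover have "mtr n (?u + dg_diff R y) - (mtr n ?u + mtr n (dg_diff R y)) \<in> boundaries RVk n"
    by (rule rep_rel_boundaries[OF rel_ideal_rep_rel[OF mat_trace_add[OF y(2) dy]]])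
      (intro fa.subspace_diff fa.subspace_add subspace_centralizer mat_trace_centralizer
        subspace_add[OF subspace_part] y(2) dy)
  ultimately show ?thesis
    using fa.cong_mem[OF B] fa.subspace_add[OF B] by (metis diff_add_cancel)
qed

text \<open>Both sides have the same image in the homology of \<open>R\<^sub>V/k\<close>.\<close>

lemma trace_map_pos:
  assumes n: "n \<ge> 1" and c: "c \<in> HC scA n"
  shows "induced RV (T n) n c = trace_map R scA \<pi> scV bs n c"
proof -
  obtain z where z: "z \<in> cycles CC n" "c = (+) z ` boundaries CC n"
    using c by (auto simp: HC_def homology_def)
  have zp: "z \<in> connes_part n" using z by (simp add: cycles_def)
  have Th: "(+) (T n z) ` boundaries RV n \<in> homology RV n" by (rule T_homology[OF z(1)])
  have T: "induced RV (T n) n c = (+) (T n z) ` boundaries RV n" by (simp add: z(2) induced_T)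
  show ?thesis
  proof (cases "acyclic_cplx RV")
    case True
    then have "(+) (T n z) ` boundaries RV n = boundaries RV n"
      using Th unfolding acyclic_cplx_def by blast
    then show ?thesis using True n T by (simp add: trace_map_def)
  next
    case False
    have trp: "tr z \<in> dg_part R n" by (rule CycF_elt(1)[OF zp])
    have "induced RVk (mtr n) n (feigin_tsygan R scA \<pi> n (to_reduced_HC scA n c))
        = induced RVk (mtr n) n ((+) (tr z) ` boundaries Rk n)"
      by (simp only: z(2) feigin_tsygan_eq[OF n z(1)])
    also have "\<dots> = (+) (mtr n (tr z)) ` boundaries RVk n"
    proof (rule fa.induced_coset[OF subspace_bd_RVk subspace_0[OF subspace_bd_Rk]])
      fix b assume b: "b \<in> boundaries Rk n"
      have bp: "b \<in> dg_part R n" by (rule boundaries_Rk_part[OF b])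
      have "mtr n (tr z + b) - (mtr n (tr z) + mtr n b) \<in> boundaries RVk n"
        by (rule rep_rel_boundaries[OF rel_ideal_rep_rel[OF mat_trace_add[OF trp bp]]])
          (intro fa.subspace_diff fa.subspace_add subspace_centralizer mat_trace_centralizer
            subspace_add[OF subspace_part] trp bp)
      from fa.subspace_add[OF subspace_bd_RVk this mat_trace_boundaries[OF n b]]
      show "mtr n (tr z + b) - mtr n (tr z) \<in> boundaries RVk n" by (simp add: algebra_simps)
    qed
    also have "\<dots> = (+) (T n z) ` boundaries RVk n"
    proof -
      have "T n z - mtr n (tr z) \<in> boundaries RVk n"
        by (rule rep_rel_boundaries[OF rel_ideal_rep_rel[OF T_mat_trace[OF zp]]])
          (intro fa.subspace_diff subspace_centralizer mat_trace_centralizer T_centralizer zp trp)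
      then show ?thesis
        using fa.cong_sym[OF subspace_bd_RVk] by (simp add: fa.coset_eq_iff[OF subspace_bd_RVk])
    qed
    also have "\<dots> = induced RVk id n ((+) (T n z) ` boundaries RV n)"
      by (simp only: induced_RVk_id)
    finally have "trace_map R scA \<pi> scV bs n c = inv_into (homology RV n) (induced RVk id n)
        (induced RVk id n ((+) (T n z) ` boundaries RV n))"
      using False n by (simp add: trace_map_def)
    also have "\<dots> = (+) (T n z) ` boundaries RV n"
      by (rule inv_into_f_f[OF RVk_inj[OF n] Th])
    finally show ?thesis by (simp add: T)
  qed
qed

theorem trace_map_T: "c \<in> HC scA n \<Longrightarrow> induced RV (T n) n c = trace_map R scA \<pi> scV bs n c"
  using trace_map_0 trace_map_pos by (cases n) auto

end


theorem theorem4p2: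
  fixes scA :: "'k::field_char_0 \<Rightarrow> 'a::{ring, monoid_mult} \<Rightarrow> 'a"
    and scV :: "'k \<Rightarrow> 'v::ab_group_add \<Rightarrow> 'v"
    and bs :: "'v list"
    and d :: nat
    and R :: "('k, 'r::{ring, monoid_mult}) dga"
    and \<pi> :: "'r \<Rightarrow> 'a"
    and f :: "'a list \<Rightarrow> 'r"
  assumes "k_algebra scA"
    and "vector_space scV" and "is_basis_list scV bs" and "length bs = d" and "d \<ge> 1"
    and "almost_free_resolution R scA \<pi>"
    and "multilinear_family R scA f"
    and "\<And>a. \<pi> (f [a]) = a"
    and "f [1] = 1"
    and "\<And>w. length w \<ge> 2 \<Longrightarrow> 1 \<in> set w \<Longrightarrow> f w = 0"
    and "\<And>n w. n \<ge> 2 \<Longrightarrow> length w = n \<Longrightarrow>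
      dg_diff R (f w) =
        (\<Sum>i=1..n-1. dg_scale R ((-1) ^ (i - 1)) (f (contract (i - 1) w))) +
        (\<Sum>i=1..n-1. dg_scale R ((-1) ^ i) (f (take i w) * f (drop i w)))"
  shows "cplx_morphism (connes_cplx scA) (rep_cplx scV R) (T_map scV bs f) \<and>
    (\<forall>n. \<forall>c \<in> HC scA n.
       induced (rep_cplx scV R) (T_map scV bs f n) n c = trace_map R scA \<pi> scV bs n c)"
proof -
  interpret dga R
    by unfold_locales (use assms(6) in \<open>simp add: almost_free_resolution_def\<close>)
  interpret resolved R scA f scV bs \<pi>
  proof (intro resolved.intro twisting.intro twisting_axioms.intro rep.intro rep_axioms.intro
      resolved_axioms.intro dga_axioms)
    show "dg_diff R (f w) =
        (\<Sum>i=1..length w-1. dg_scale R ((-1) ^ (i - 1)) (f (contract (i - 1) w))) +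
        (\<Sum>i=1..length w-1. dg_scale R ((-1) ^ i) (f (take i w) * f (drop i w)))" if "length w \<ge> 2" for w
      by (rule assms(11)[OF that refl])
    show "f w = 0" if "length w \<ge> 2" "1 \<in> set w" for w
      by (rule assms(10)[OF that])
    show "length bs \<ge> 1" using assms(4,5) by simp
  qed (fact assms)+
  show ?thesis using T_morphism trace_map_T by blast
qed


end
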